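(* Let $(G,\alpha)$ and $(H,\beta)$ be locally compact contraction groups and let $q\colon G\to H$ be a surjective, continuous homomorphism such that $\beta\circ q=q\circ\alpha$. Then there exists a continuous map $\sigma\colon H\to G$ such that $\sigma(e)=e$, $q\circ\sigma=\mathrm{id}_H$ and $\alpha\circ\sigma=\sigma\circ\beta$.
   Context: A locally compact contraction group is a pair $(G,\alpha)$ where $G$ is a (Hausdorff) locally compact group and $\alpha\colon G\to G$ is a bicontinuous automorphism with $\alpha^n(x)\to e$ as $n\to\infty$ for each $x\in G$. *)

theory Defs
  imports "HOL-Algebra.Group" "HOL-Analysis.Analysis"
begin

locale topological_group = group G for G (structure) +
  fixes T :: "'a topology"
  assumes topspace_eq_carrier: "topspace T = carrier G"
    and continuous_mult: "continuous_map (prod_topology T T) T (\<lambda>(x, y). x \<otimes> y)"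
    and continuous_inv: "continuous_map T T (\<lambda>x. inv x)"

locale locally_compact_group = topological_group +
  assumes Hausdorff: "Hausdorff_space T"
    and locally_compact: "locally_compact_space T"

text \<open>
  The map \<open>\<alpha>\<close> is a total function on the ambient type, but only its values on the carrier matter.
\<close>

locale locally_compact_contraction_group = locally_compact_group +
  fixes \<alpha> :: "'a \<Rightarrow> 'a"
  assumes automorphism: "\<alpha> \<in> iso G G"
    and bicontinuous: "homeomorphic_map T T \<alpha>"
    and contractive: "\<And>x. x \<in> carrier G \<Longrightarrow> limitin T (\<lambda>n. (\<alpha> ^^ n) x) \<one> sequentially"

end

theory Submission
 imports Defs "HOL-Algebra.Coset" "HOL-Algebra.Generated_Groups" "HOL-Analysis.Analysis"
begin

text \<open>
 By Baire's theorem \<open>\<alpha>\<close> contracts compact sets uniformly, so Frink's chain construction yields a norm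
 \<open>\<rho>\<close> defining the topology with \<open>\<rho> (\<alpha> x) = \<theta> * \<rho> x\<close>. By scaling, closed \<open>\<alpha>\<close>-invariant subgroups satisfy
 the minimal condition. Modulo identity components a section is a product of digits
 \<open>g d\<^sub>0 \<otimes> \<alpha> (g d\<^sub>1) \<otimes> \<alpha>\<^sup>2 (g d\<^sub>2) \<otimes> \<dots>\<close>. For connected groups, averaging maximal functions of word lengths over
 a Haar functional produces nonzero characters \<open>G \<rightarrow> \<real>\<close>. A section modulo a connected normal
 subgroup \<open>A\<close> of the kernel is then corrected to one modulo the common kernel of the characters of \<open>A\<close>, by
 extending these characters to an equivariant vector-valued cocycle on \<open>G\<close> and moving along \<open>A\<close> to its
 zero set. The common kernel is again connected and strictly smaller, so a minimal \<open>A\<close> is trivial.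
\<close>

text \<open>The norm turns \<alpha> into an exact dilation with compact balls, so a fact that
  compactness gives on one annulus holds at all scales; this replaces Lie theory throughout. The two
  halves of the construction need opposite features. Small open subgroups allow locally constant
  choices, digit by digit, and such choices are impossible in a connected direction. There the
  target R^n of the characters is convex, so local solutions can be averaged, and averaging over the
  powers of \<alpha> gives equivariance as well. A mere set-theoretic section suffices as a start,
  because it is already continuous and equivariant modulo the kernel; each correction shrinks the
  subgroup modulo which this is so. The obstacle is to keep that subgroup connected, since nonzero
  characters are guaranteed only then. This rests on a rigidity of contractions: a totally
  disconnected common kernel of characters is trivial, hence a connected group has no nontrivial
  bounded subgroup and its closed invariant normal subgroups are connected. The minimal condition
  stands in for induction on dimension.\<close>

lemma scale_into_interval:
 fixes u t :: real
 assumes "0 < u" "0 < t" "t < 1"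
 shows "\<exists>k::int. t < t powi k * u \<and> t powi k * u \<le> 1"
proof -
 define s where "s = log t u"
 define k where "k = - \<lfloor>s\<rfloor>"
 have u: "u = t powr s" using assms by (simp add: s_def)
 have pk: "t powi k * u = t powr (of_int k + s)"
  using assms by (simp add: u powr_add powr_real_of_int')
 have a: "0 \<le> of_int k + s" "of_int k + s < 1" by (simp_all add: k_def; linarith)+
 have "t powr (of_int k + s) \<le> t powr 0"
  using assms a by (intro powr_mono') auto
 moreover have "t powr 1 < t powr (of_int k + s)"
  using assms a by (intro powr_less_mono') auto
 ultimately show ?thesis using pk assms by (intro exI[of _ k]) auto
qed

section \<open>Groups with a homogeneous norm\<close>

text \<open>The topology is carried by \<rho> alone, through the left-invariant distance \<rho> (inv
  x \<otimes> y). \<open>rho_conj\<close> is continuity of conjugations at \<one>;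
  \<open>rho_compact\<close> is sequential compactness of closed balls. In this form the structure
  passes to closed invariant subgroups and to quotients without handling topologies.\<close>

locale homogeneous_group = group G for G (structure) +
 fixes \<alpha> :: "'a => 'a" and \<rho> :: "'a => real" and \<theta> :: real
 assumes theta: "0 < \<theta>" "\<theta> < 1"
  and alpha_iso: "\<alpha> \<in> iso G G"
  and rho_zero_iff: "!!x. x \<in> carrier G ==> \<rho> x = 0 \<longleftrightarrow> x = \<one>"
  and rho_inv: "!!x. x \<in> carrier G ==> \<rho> (inv x) = \<rho> x"
  and rho_mult: "!!x y. x \<in> carrier G ==> y \<in> carrier G ==> \<rho> (x \<otimes> y) \<le> \<rho> x + \<rho> y"
  and rho_alpha: "!!x. x \<in> carrier G ==> \<rho> (\<alpha> x) = \<theta> * \<rho> x"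
  and rho_conj: "!!x e. x \<in> carrier G ==> 0 < e ==>
      \<exists>d>0. \<forall>z\<in>carrier G. \<rho> z < d --> \<rho> (x \<otimes> z \<otimes> inv x) < e"
  and rho_compact: "!!(u::nat => 'a) R. (!!n. u n \<in> carrier G) ==> (!!n. \<rho> (u n) \<le> R) ==>
      \<exists>l\<in>carrier G. \<exists>r::nat => nat. strict_mono r \<and> (\<lambda>n. \<rho> (inv l \<otimes> u (r n))) \<longlonglongrightarrow> 0"
begin

lemma cancel_left [simp]:
 "x \<in> carrier G ==> y \<in> carrier G ==> inv x \<otimes> (x \<otimes> y) = y"
 "x \<in> carrier G ==> y \<in> carrier G ==> x \<otimes> (inv x \<otimes> y) = y"
 by (simp_all add: m_assoc[symmetric])

lemmas gsimps = m_assoc inv_mult_group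

lemma rho_one [simp]: "\<rho> \<one> = 0"
 by (simp add: rho_zero_iff)

lemma rho_nonneg: "x \<in> carrier G ==> 0 \<le> \<rho> x"
 using rho_mult[of x "inv x"] rho_inv[of x] by simp

lemma rho_pos: "x \<in> carrier G ==> x \<noteq> \<one> ==> 0 < \<rho> x"
 using rho_nonneg[of x] rho_zero_iff[of x] by force

abbreviation (input) "\<G> \<equiv> carrier G"
abbreviation (input) dst :: "'a => 'a => real" where "dst x y \<equiv> \<rho> (inv x \<otimes> y)"

lemma rho_mult_inv1: "x \<in> \<G> ==> y \<in> \<G> ==> dst x y \<le> \<rho> x + \<rho> y"
 using rho_mult[of "inv x" y] by (simp add: rho_inv)

lemma rho_diff: "x \<in> \<G> ==> y \<in> \<G> ==> \<rho> y \<le> \<rho> x + dst x y"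
 using rho_mult[of x "inv x \<otimes> y"] by simp

lemma dist_sym: "x \<in> \<G> ==> y \<in> \<G> ==> dst x y = dst y x"
 using rho_inv[of "inv x \<otimes> y"] by (simp add: gsimps)

lemma dist_tri: "x \<in> \<G> ==> y \<in> \<G> ==> z \<in> \<G> ==>
  dst x z \<le> dst x y + dst y z"
 using rho_mult[of "inv x \<otimes> y" "inv y \<otimes> z"] by (simp add: gsimps)

lemma alpha_hom: "\<alpha> \<in> hom G G" and alpha_bij: "bij_betw \<alpha> (\<G>) (\<G>)"
 using alpha_iso by (auto simp: iso_def)

lemma alpha_closed [simp]: "x \<in> \<G> ==> \<alpha> x \<in> \<G>"
 using alpha_hom by (auto simp: hom_def)

lemma alpha_mult [simp]: "x \<in> \<G> ==> y \<in> \<G> ==> \<alpha> (x \<otimes> y) = \<alpha> x \<otimes> \<alpha> y"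
 using alpha_hom by (auto simp: hom_def)

lemma alpha_group_hom: "group_hom G G \<alpha>"
 by (unfold_locales) (rule alpha_hom)

lemma alpha_one [simp]: "\<alpha> \<one> = \<one>"
 using group_hom.hom_one[OF alpha_group_hom] .

lemma alpha_inv [simp]: "x \<in> \<G> ==> \<alpha> (inv x) = inv (\<alpha> x)"
 using group_hom.hom_inv[OF alpha_group_hom] .

definition alpha' :: "'a => 'a" where "alpha' = inv_into (\<G>) \<alpha>"

lemma alpha'_closed [simp]: "x \<in> \<G> ==> alpha' x \<in> \<G>"
 unfolding alpha'_def using alpha_bij by (metis bij_betw_imp_surj_on inv_into_into)

lemma alpha_alpha' [simp]: "x \<in> \<G> ==> \<alpha> (alpha' x) = x"
 unfolding alpha'_def using alpha_bij by (simp add: bij_betw_inv_into_right)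

lemma alpha'_alpha [simp]: "x \<in> \<G> ==> alpha' (\<alpha> x) = x"
 unfolding alpha'_def using alpha_bij by (simp add: bij_betw_inv_into_left)

lemma alpha_inj: "x \<in> \<G> ==> y \<in> \<G> ==> \<alpha> x = \<alpha> y ==> x = y"
 by (metis alpha'_alpha)

lemma alpha'_mult [simp]: "x \<in> \<G> ==> y \<in> \<G> ==> alpha' (x \<otimes> y) = alpha' x \<otimes> alpha' y"
 by (rule alpha_inj) auto

lemma alpha'_one [simp]: "alpha' \<one> = \<one>"
 by (rule alpha_inj) auto

lemma rho_alpha': "x \<in> \<G> ==> \<rho> (alpha' x) = \<rho> x / \<theta>"
 using rho_alpha[of "alpha' x"] theta by (simp add: field_simps)

definition ap :: "int => 'a => 'a" where
 "ap k = (if 0 \<le> k then \<alpha> ^^ nat k else alpha' ^^ nat (- k))"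

lemma ap_0 [simp]: "ap 0 x = x"
 by (simp add: ap_def)

lemma ap_of_nat: "ap (int n) = \<alpha> ^^ n"
 by (simp add: ap_def)

lemma funpow_alpha_closed [simp]: "x \<in> \<G> ==> (\<alpha> ^^ n) x \<in> \<G>"
 by (induction n) auto

lemma funpow_alpha'_closed [simp]: "x \<in> \<G> ==> (alpha' ^^ n) x \<in> \<G>"
 by (induction n) auto

lemma ap_closed [simp]: "x \<in> \<G> ==> ap k x \<in> \<G>"
 by (simp add: ap_def)

lemma ap_Suc: "x \<in> \<G> ==> ap (k + 1) x = \<alpha> (ap k x)"
proof (cases "0 \<le> k")
 case True
 then have "nat (k + 1) = Suc (nat k)" by simp
 then show ?thesis using True by (simp add: ap_def)
next
 case False
 assume x: "x \<in> \<G>"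
 have "nat (- k) = Suc (nat (- (k + 1)))" using False by linarith
 moreover have "ap (k + 1) x = (alpha' ^^ nat (- (k + 1))) x"
  using False by (auto simp: ap_def)
 ultimately show ?thesis using False x by (simp add: ap_def)
qed

lemma ap_minus: "x \<in> \<G> ==> ap (k - 1) x = alpha' (ap k x)"
 using ap_Suc[of x "k - 1"] by simp

lemma ap_add: "x \<in> \<G> ==> ap (k + l) x = ap k (ap l x)"
proof (induction k rule: int_induct[where k = 0])
 case (step1 i)
 then show ?case using ap_Suc[of x "i + l"] ap_Suc[of "ap l x" i] by (simp add: algebra_simps)
next
 case (step2 i)
 then show ?case using ap_minus[of x "i + l"] ap_minus[of "ap l x" i] by (simp add: algebra_simps)
qed simp

lemma ap_1 [simp]: "ap 1 x = \<alpha> x"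
 by (simp add: ap_def)

lemma ap_cancel [simp]: "x \<in> \<G> ==> ap k (ap (- k) x) = x" "x \<in> \<G> ==> ap (- k) (ap k x) = x"
 using ap_add[of x k "- k"] ap_add[of x "- k" k] by auto

lemma ap_mult [simp]: "x \<in> \<G> ==> y \<in> \<G> ==> ap k (x \<otimes> y) = ap k x \<otimes> ap k y"
proof (induction k rule: int_induct[where k = 0])
 case (step1 i)
 then show ?case using ap_Suc[of _ i] by simp
next
 case (step2 i)
 then show ?case using ap_minus[of _ i] by simp
qed simp

lemma ap_hom: "ap k \<in> hom G G"
 by (auto simp: hom_def)

lemma ap_inv [simp]: "x \<in> \<G> ==> ap k (inv x) = inv (ap k x)"
 using group_hom.hom_inv[of G G "ap k" x] ap_hom by (simp add: group_hom_def group_hom_axioms_def)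

lemma ap_one [simp]: "ap k \<one> = \<one>"
 using group_hom.hom_one[of G G "ap k"] ap_hom by (simp add: group_hom_def group_hom_axioms_def)

lemma rho_ap: "x \<in> \<G> ==> \<rho> (ap k x) = \<theta> powi k * \<rho> x"
proof (induction k rule: int_induct[where k = 0])
 case (step1 i)
 then show ?case using ap_Suc[of x i] theta by (simp add: rho_alpha power_int_add)
next
 case (step2 i)
 then show ?case using ap_minus[of x i] theta by (simp add: rho_alpha' power_int_diff)
qed simp

lemma rho_funpow: "x \<in> \<G> ==> \<rho> ((\<alpha> ^^ n) x) = \<theta> ^ n * \<rho> x"
 using rho_ap[of x "int n"] by (simp add: ap_of_nat)

lemma funpow_alpha_mult [simp]: "x \<in> \<G> ==> y \<in> \<G> ==>
  (\<alpha> ^^ n) (x \<otimes> y) = (\<alpha> ^^ n) x \<otimes> (\<alpha> ^^ n) y"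
 using ap_mult[of x y "int n"] by (simp add: ap_of_nat)

lemma funpow_alpha_inv [simp]: "x \<in> \<G> ==> (\<alpha> ^^ n) (inv x) = inv ((\<alpha> ^^ n) x)"
 using ap_inv[of x "int n"] by (simp add: ap_of_nat)

lemma theta_pow_small: "0 < e ==> \<exists>n. \<theta> ^ n * R < e"
proof -
 assume "0 < e"
 have "(\<lambda>n. \<theta> ^ n * R) \<longlonglongrightarrow> 0"
  using theta by (intro tendsto_mult_left_zero LIMSEQ_power_zero) auto
 then have "eventually (\<lambda>n. \<theta> ^ n * R < e) sequentially"
  using \<open>0 < e\<close> by (auto dest: order_tendstoD(2))
 then show ?thesis by (auto simp: eventually_sequentially)
qed

text \<open>Compactness of balls upgrades pointwise continuity of conjugation: along a subsequence x
  = l \<otimes> y with y short, conjugation by y keeps z short by the triangle inequality, and only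
  the fixed limit l remains to conjugate.\<close>

lemma rho_conj_uniform:
 assumes "0 < e"
 shows "\<exists>d>0. \<forall>x\<in>\<G>. \<forall>z\<in>\<G>. \<rho> x \<le> R --> \<rho> z < d --> \<rho> (x \<otimes> z \<otimes> inv x) < e"
proof (rule ccontr)
 assume neg: "\<not> ?thesis"
 have "\<exists>p. \<forall>n::nat. fst (p n) \<in> \<G> \<and> snd (p n) \<in> \<G> \<and> \<rho> (fst (p n)) \<le> R
   \<and> \<rho> (snd (p n)) < 1 / Suc n \<and> e \<le> \<rho> (fst (p n) \<otimes> snd (p n) \<otimes> inv (fst (p n)))"
 proof (rule choice, rule allI)
  fix n :: nat
  have "0 < 1 / real (Suc n)" by simp
  then obtain x z where "x \<in> \<G>" "z \<in> \<G>" "\<rho> x \<le> R" "\<rho> z < 1 / Suc n"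
   "\<not> \<rho> (x \<otimes> z \<otimes> inv x) < e" using neg by blast
  then show "\<exists>p. fst p \<in> \<G> \<and> snd p \<in> \<G> \<and> \<rho> (fst p) \<le> R
   \<and> \<rho> (snd p) < 1 / Suc n \<and> e \<le> \<rho> (fst p \<otimes> snd p \<otimes> inv (fst p))"
   by (intro exI[of _ "(x, z)"]) auto
 qed
 then obtain p where p: "!!n::nat. fst (p n) \<in> \<G>" "!!n. snd (p n) \<in> \<G>" "!!n. \<rho> (fst (p n)) \<le> R"
   "!!n. \<rho> (snd (p n)) < 1 / Suc n" "!!n. e \<le> \<rho> (fst (p n) \<otimes> snd (p n) \<otimes> inv (fst (p n)))" by metis
 obtain l r where l: "l \<in> \<G>" and r: "strict_mono (r::nat=>nat)"
  and lim: "(\<lambda>n. dst l (fst (p (r n)))) \<longlonglongrightarrow> 0"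
  using rho_compact[of "\<lambda>n. fst (p n)" R] p by blast
 obtain d where d: "0 < d" "!!z. z \<in> \<G> ==> \<rho> z < d ==> \<rho> (l \<otimes> z \<otimes> inv l) < e"
  using rho_conj[OF l assms] by blast
 have lim2: "(\<lambda>n. \<rho> (snd (p n))) \<longlonglongrightarrow> 0"
 proof (rule tendsto_sandwich[OF _ _ tendsto_const LIMSEQ_Suc[OF lim_1_over_n]])
  show "\<forall>\<^sub>F n in sequentially. 0 \<le> \<rho> (snd (p n))" using p rho_nonneg by simp
  show "\<forall>\<^sub>F n in sequentially. \<rho> (snd (p n)) \<le> 1 / real (Suc n)"
   using p(4) by (intro always_eventually allI less_imp_le)
 qed
 have "(\<lambda>n. 2 * dst l (fst (p (r n))) + \<rho> (snd (p (r n)))) \<longlonglongrightarrow> 2 * 0 + 0"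
  by (intro tendsto_intros lim LIMSEQ_subseq_LIMSEQ[OF lim2 r, unfolded o_def])
 then have "eventually (\<lambda>n. 2 * dst l (fst (p (r n))) + \<rho> (snd (p (r n))) < d) sequentially"
  using d(1) by (intro order_tendstoD(2)[of _ "2*0+0"]) auto
 then obtain n where n: "2 * dst l (fst (p (r n))) + \<rho> (snd (p (r n))) < d"
  by (auto simp: eventually_sequentially)
 define x z y where "x = fst (p (r n))" and "z = snd (p (r n))" and "y = inv l \<otimes> x"
 have c: "x \<in> \<G>" "z \<in> \<G>" "y \<in> \<G>" using p l by (auto simp: x_def z_def y_def)
 have "\<rho> (y \<otimes> z \<otimes> inv y) \<le> \<rho> y + \<rho> z + \<rho> y"
  using c rho_mult[of "y \<otimes> z" "inv y"] rho_mult[of y z] rho_inv[of y] by force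
 then have "\<rho> (l \<otimes> (y \<otimes> z \<otimes> inv y) \<otimes> inv l) < e"
  using n c by (intro d(2)) (auto simp: x_def z_def y_def)
 also have "l \<otimes> (y \<otimes> z \<otimes> inv y) \<otimes> inv l = x \<otimes> z \<otimes> inv x"
  using c l by (simp add: y_def gsimps)
 finally show False using p(5)[of "r n"] by (simp add: x_def z_def)
qed

lemma rho_conj_uniform':
 assumes "0 < e"
 obtains d where "d > 0" "!!x z. x \<in> \<G> ==> z \<in> \<G> ==> \<rho> x \<le> R ==> \<rho> z < d ==>
   \<rho> (x \<otimes> z \<otimes> inv x) < e \<and> \<rho> (inv x \<otimes> z \<otimes> x) < e"
proof -
 obtain d where d: "d > 0" "!!x z. x \<in> \<G> ==> z \<in> \<G> ==> \<rho> x \<le> R ==> \<rho> z < d ==>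
   \<rho> (x \<otimes> z \<otimes> inv x) < e" using rho_conj_uniform[OF assms, of R] by blast
 have "\<rho> (inv x \<otimes> z \<otimes> x) < e" if "x \<in> \<G>" "z \<in> \<G>" "\<rho> x \<le> R" "\<rho> z < d" for x z
  using d(2)[of "inv x" z] that by (simp add: rho_inv)
 then show ?thesis using that[of d] d by blast
qed

text \<open>Sequential compactness gives finite subcovers by balls of variable radius w. The
  covering hypothesis is asked at the points adherent to S, so S itself may fail to be
  closed.\<close>

lemma finite_cover:
 assumes S: "S \<subseteq> \<G>" "!!x. x \<in> S ==> \<rho> x \<le> R"
  and w: "!!x. x \<in> \<G> ==> (!!e. 0 < e ==> \<exists>y\<in>S. dst x y < e) ==>
     \<exists>y\<in>P. y \<in> \<G> \<and> dst y x < w y"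
 shows "\<exists>F. finite F \<and> F \<subseteq> P \<and> (\<forall>x\<in>S. \<exists>y\<in>F. y \<in> \<G> \<and> dst y x < w y)"
proof (rule ccontr)
 assume neg: "\<not> ?thesis"
 \<comment> \<open>A Lebesgue number e for the cover: otherwise ever smaller balls that fit into no
   member have centres accumulating at a point which some member does cover.\<close>
 have leb: "\<exists>e>0. \<forall>x\<in>S. \<exists>y\<in>P. y \<in> \<G> \<and> (\<forall>z\<in>\<G>. dst x z < e --> dst y z < w y)"
 proof (rule ccontr)
  assume neg: "\<not> ?thesis"
  have neg': "\<exists>x. x \<in> S \<and> (\<forall>y\<in>P. y \<in> \<G> --> (\<exists>z\<in>\<G>. dst x z < e \<and> \<not> dst y z < w y))"
   if "0 < e" for e using neg that by meson
  have "\<exists>u. \<forall>n::nat. u n \<in> S \<and> (\<forall>y\<in>P. y \<in> \<G> --> (\<exists>z\<in>\<G>. dst (u n) z < 1 / Suc n \<and> \<not> dst y z < w y))"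
  proof (rule choice, rule allI)
   fix n :: nat
   have "0 < 1 / real (Suc n)" by simp
   then show "\<exists>x. x \<in> S \<and> (\<forall>y\<in>P. y \<in> \<G> --> (\<exists>z\<in>\<G>. dst x z < 1 / Suc n \<and> \<not> dst y z < w y))"
    by (rule neg')
  qed
  then obtain u where u: "!!n::nat. u n \<in> S" and u2: "!!n y. y \<in> P ==> y \<in> \<G> ==> \<exists>z\<in>\<G>. dst (u n) z < 1 / Suc n \<and> \<not> dst y z < w y"
   by metis
  obtain l r where l: "l \<in> \<G>" and r: "strict_mono (r::nat=>nat)"
   and lim: "(\<lambda>n. dst l (u (r n))) \<longlonglongrightarrow> 0"
   using rho_compact[of u R] u S by blast
  have "\<exists>y\<in>P. y \<in> \<G> \<and> dst y l < w y"
  proof (rule w[OF l])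
   fix e :: real assume "0 < e"
   then have "eventually (\<lambda>n. dst l (u (r n)) < e) sequentially"
    using lim by (auto dest: order_tendstoD(2))
   then show "\<exists>y\<in>S. dst l y < e" using u by (auto simp: eventually_sequentially)
  qed
  then obtain y where y: "y \<in> P" "y \<in> \<G>" "dst y l < w y" by blast
  have "(\<lambda>n. dst l (u (r n)) + 1 / Suc (r n)) \<longlonglongrightarrow> 0 + 0"
   by (intro tendsto_intros lim LIMSEQ_subseq_LIMSEQ[OF LIMSEQ_Suc[OF lim_1_over_n] r, unfolded o_def])
  then have "eventually (\<lambda>n. dst l (u (r n)) + 1 / Suc (r n) < w y - dst y l) sequentially"
   using y by (intro order_tendstoD(2)[of _ "0+0"]) auto
  then obtain n where n: "dst l (u (r n)) + 1 / Suc (r n) < w y - dst y l"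
   by (auto simp: eventually_sequentially)
  obtain z where z: "z \<in> \<G>" "dst (u (r n)) z < 1 / Suc (r n)" "\<not> dst y z < w y"
   using u2[OF y(1,2), of "r n"] by blast
  have uc: "u (r n) \<in> \<G>" using u S by blast
  show False
   using dist_tri[OF y(2) l z(1)] dist_tri[OF l uc z(1)] z n by linarith
 qed
 then obtain e where e: "0 < e" "!!x. x \<in> S ==> \<exists>y\<in>P. y \<in> \<G> \<and> (\<forall>z\<in>\<G>. dst x z < e --> dst y z < w y)"
  by blast
 then obtain g where g: "!!x. x \<in> S ==> g x \<in> P \<and> g x \<in> \<G> \<and> (\<forall>z\<in>\<G>. dst x z < e --> dst (g x) z < w (g x))"
  by metis
 have ex: "\<exists>x\<in>S. \<forall>z\<in>F. e \<le> dst z x" if "finite F" "F \<subseteq> S" for F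
 proof (rule ccontr)
  assume "\<not> ?thesis"
  then have "\<forall>x\<in>S. \<exists>z\<in>F. dst z x < e" by (meson not_le)
  then obtain h where h: "!!x. x \<in> S ==> h x \<in> F \<and> dst (h x) x < e" by metis
  have "\<forall>x\<in>S. \<exists>y\<in>g ` F. y \<in> \<G> \<and> dst y x < w y"
  proof
   fix x assume x: "x \<in> S"
   have "h x \<in> S" using h[OF x] that(2) by auto
   then have "dst (g (h x)) x < w (g (h x))" "g (h x) \<in> \<G>" using g[of "h x"] h[OF x] x S(1) by auto
   then show "\<exists>y\<in>g ` F. y \<in> \<G> \<and> dst y x < w y" using h[OF x] by (intro bexI[of _ "g (h x)"]) auto
  qed
  moreover have "finite (g ` F)" using that(1) by (rule finite_imageI)
  moreover have "g ` F \<subseteq> P"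
  proof
   fix y assume "y \<in> g ` F"
   then obtain x where "x \<in> F" "y = g x" by (rule imageE)
   then show "y \<in> P" using g[of x] that(2) by auto
  qed
  ultimately have "finite (g ` F) \<and> g ` F \<subseteq> P \<and> (\<forall>x\<in>S. \<exists>y\<in>g ` F. y \<in> \<G> \<and> dst y x < w y)"
   by (intro conjI)
  then show False by (rule notE[OF neg, OF exI])
 qed
 \<comment> \<open>If no finite set of members sufficed, points of S with pairwise distances at
   least e could be picked forever, against sequential compactness.\<close>
 define pick where "pick F = (SOME x. x \<in> S \<and> (\<forall>z\<in>F. e \<le> dst z x))" for F
 have pick: "pick F \<in> S \<and> (\<forall>z\<in>F. e \<le> dst z (pick F))" if F: "finite F" "F \<subseteq> S" for F
 proof -
  have "\<exists>x. x \<in> S \<and> (\<forall>z\<in>F. e \<le> dst z x)" using ex[OF F] by (simp only: Bex_def)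
  then show ?thesis unfolding pick_def by (rule someI_ex)
 qed
 define A where "A = rec_nat {} (\<lambda>_ F. insert (pick F) F)"
 have A0: "A 0 = {}" and AS: "A (Suc n) = insert (pick (A n)) (A n)" for n by (simp_all add: A_def)
 have fin: "finite (A n) \<and> A n \<subseteq> S" for n
 proof (induction n)
  case (Suc n)
  then show ?case using pick[of "A n"] by (simp add: AS)
 qed (simp add: A0)
 define u where "u n = pick (A n)" for n
 have mono: "A m \<subseteq> A n" if "m \<le> n" for m n using that by (induction rule: dec_induct) (auto simp: AS)
 have sep: "e \<le> dst (u m) (u n)" if "m < n" for m n
  using mono[of "Suc m" n] that pick[of "A n"] fin by (auto simp: AS u_def)
 have uS: "u n \<in> S" for n using pick[of "A n"] fin by (auto simp: u_def)
 obtain l r where l: "l \<in> \<G>" and r: "strict_mono (r::nat=>nat)"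
   and lim: "(\<lambda>n. dst l (u (r n))) \<longlonglongrightarrow> 0"
   using rho_compact[of u R] uS S by blast
 have "eventually (\<lambda>n. dst l (u (r n)) < e / 2) sequentially"
  by (rule order_tendstoD(2)[OF lim]) (use e(1) in simp)
 then obtain n where n': "\<forall>m\<ge>n. dst l (u (r m)) < e / 2"
  by (auto simp only: eventually_sequentially)
 then have n: "dst l (u (r n)) < e / 2" "dst l (u (r (Suc n))) < e / 2"
  by simp_all
 have c: "u (r n) \<in> \<G>" "u (r (Suc n)) \<in> \<G>" using uS S by auto
 show False using sep[of "r n" "r (Suc n)"] r dist_tri[OF c(1) l c(2)] dist_sym[OF c(1) l] n
  by (simp add: strict_mono_def)
qed

lemma totally_bounded:
 assumes "0 < e"
 shows "\<exists>F. finite F \<and> F \<subseteq> \<G> \<and> (\<forall>x\<in>\<G>. \<rho> x \<le> R --> (\<exists>y\<in>F. dst y x < e))"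
proof -
 have "\<exists>F. finite F \<and> F \<subseteq> \<G> \<and> (\<forall>x\<in>{x \<in> \<G>. \<rho> x \<le> R}. \<exists>y\<in>F. y \<in> \<G> \<and> dst y x < e)"
 proof (rule finite_cover[where R = R])
  fix x assume "x \<in> \<G>"
  then show "\<exists>y\<in>\<G>. y \<in> \<G> \<and> dst y x < e"
   using assms by (intro bexI[of _ x]) auto
 qed auto
 then show ?thesis by (elim exE) (rule exI, blast)
qed

section \<open>Closed invariant subgroups and the minimal condition\<close>

definition seqclosed :: "'a set => bool" where
 "seqclosed A \<longleftrightarrow> A \<subseteq> \<G> \<and> (\<forall>x\<in>\<G>. (\<forall>e>0. \<exists>a\<in>A. dst x a < e) --> x \<in> A)"

definition invsub :: "'a set => bool" where
 "invsub A \<longleftrightarrow> subgroup A G \<and> \<alpha> ` A = A \<and> seqclosed A"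

definition opensub :: "'a set => bool" where
 "opensub U \<longleftrightarrow> subgroup U G \<and> (\<exists>r>0. \<forall>x\<in>\<G>. \<rho> x < r --> x \<in> U)"

text \<open>Absence of proper open subgroups; for locally compact groups this is equivalent to
  connectedness.\<close>

definition conn :: bool where
 "conn \<longleftrightarrow> (\<forall>U. opensub U --> U = \<G>)"

lemma seqclosedD: "seqclosed A ==> x \<in> \<G> ==> (!!e. 0 < e ==> \<exists>a\<in>A. dst x a < e) ==> x \<in> A"
 by (auto simp: seqclosed_def)

lemma seqclosed_limit:
 assumes "seqclosed A" "l \<in> \<G>" "(\<lambda>n. dst l (u n)) \<longlonglongrightarrow> 0" "!!n::nat. N \<le> n ==> u n \<in> A"
 shows "l \<in> A"
proof (rule seqclosedD[OF assms(1,2)])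
 fix e :: real assume "0 < e"
 then have "eventually (\<lambda>n. dst l (u n) < e) sequentially"
  using assms(3) by (auto dest: order_tendstoD(2))
 then obtain M where "!!n. n \<ge> M ==> dst l (u n) < e" by (auto simp: eventually_sequentially)
 then show "\<exists>a\<in>A. dst l a < e" using assms(4)[of "max M N"] by (metis max.cobounded1 max.cobounded2)
qed

lemma invsub_subgroup: "invsub A ==> subgroup A G"
 and invsub_image: "invsub A ==> \<alpha> ` A = A"
 and invsub_closed: "invsub A ==> seqclosed A"
 by (simp_all add: invsub_def)

lemma invsub_subset: "invsub A ==> A \<subseteq> \<G>"
 by (simp add: invsub_subgroup subgroup.subset)

lemma invsub_mem: "invsub A ==> x \<in> A ==> x \<in> \<G>"
 using invsub_subset by blast

lemma invsub_mult: "invsub A ==> x \<in> A ==> y \<in> A ==> x \<otimes> y \<in> A"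
 by (simp add: invsub_subgroup subgroup.m_closed)

lemma invsub_minv: "invsub A ==> x \<in> A ==> inv x \<in> A"
 by (simp add: invsub_subgroup subgroup.m_inv_closed)

lemma invsub_one_mem: "invsub A ==> \<one> \<in> A"
 by (simp add: invsub_subgroup subgroup.one_closed)

lemma invsub_carrier: "invsub (\<G>)"
 using alpha_bij by (auto simp: invsub_def seqclosed_def subgroup_self bij_betw_def)

lemma invsub_ap: "invsub A ==> x \<in> A ==> ap k x \<in> A"
proof (induction k rule: int_induct[where k = 0])
 case (step1 i)
 then have "ap i x \<in> A" by simp
 then have "\<alpha> (ap i x) \<in> \<alpha> ` A" by (rule imageI)
 then show ?case using ap_Suc[of x i] invsub_mem[OF step1(3,4)] by (simp only: invsub_image[OF step1(3)])
next
 case (step2 i)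
 have s: "A \<subseteq> \<G>" "\<alpha> ` A = A" using invsub_subset invsub_image step2(3) by auto
 have "alpha' y \<in> A" if "y \<in> A" for y
 proof -
  have "y \<in> \<alpha> ` A" using that by (simp only: s(2))
  then obtain z where "z \<in> A" "y = \<alpha> z" by blast
  then show ?thesis using s(1) by auto
 qed
 then show ?case using ap_minus[of x i] s(1) step2 by auto
qed simp

lemma invsubI:
 assumes "subgroup A G" "seqclosed A" "!!x. x \<in> A ==> \<alpha> x \<in> A" "!!x. x \<in> A ==> alpha' x \<in> A"
 shows "invsub A"
proof -
 have "A \<subseteq> \<G>" using assms(1) subgroup.subset by blast
 then have "x \<in> \<alpha> ` A" if "x \<in> A" for x using assms(4)[OF that] that by (metis alpha_alpha' imageI subsetD)
 then show ?thesis using assms by (auto simp: invsub_def)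
qed

text \<open>A closed invariant subgroup that meets every coset in a bounded set is everything, by rescaling.\<close>
lemma invsub_cobounded:
 assumes A: "invsub A" and B: "invsub B" and AB: "A \<subseteq> B"
  and R: "!!x. x \<in> B ==> \<exists>a\<in>A. dst x a \<le> R"
 shows "A = B"
proof
 show "B \<subseteq> A"
 proof
  fix x assume x: "x \<in> B"
  then have xc: "x \<in> \<G>" by (rule invsub_mem[OF B])
  show "x \<in> A"
  proof (rule seqclosedD[OF invsub_closed[OF A] xc])
   fix e :: real assume "0 < e"
   then obtain n where n: "\<theta> ^ n * R < e" using theta_pow_small by blast
   obtain a where a: "a \<in> A" "dst (ap (- int n) x) a \<le> R" using R[OF invsub_ap[OF B x, of "- int n"]] by blast
   have ac: "a \<in> \<G>" by (rule invsub_mem[OF A a(1)])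
   have "\<rho> (ap (int n) (inv (ap (- int n) x) \<otimes> a)) \<le> \<theta> ^ n * R"
    using a(2) theta xc ac by (subst rho_ap) auto
   then have "dst x (ap (int n) a) < e"
    using n xc ac by simp
   then show "\<exists>a\<in>A. dst x a < e" using invsub_ap[OF A a(1)] by blast
  qed
 qed
qed (rule AB)

lemma invsub_one: "invsub {\<one>}"
proof (rule invsubI)
 show "seqclosed {\<one>}"
  unfolding seqclosed_def
 proof (intro conjI ballI impI)
  fix x assume x: "x \<in> \<G>" and h: "\<forall>e>0. \<exists>a\<in>{\<one>}. dst x a < e"
  have "\<not> 0 < \<rho> x"
  proof
   assume "0 < \<rho> x"
   then show False using h x by (auto simp: rho_inv)
  qed
  then show "x \<in> {\<one>}" using rho_pos[OF x] by auto
 qed simp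
qed (auto simp: triv_subgroup)

lemma invsub_bounded:
 assumes "invsub A" "!!x. x \<in> A ==> \<rho> x \<le> R"
 shows "A = {\<one>}"
proof -
 have "{\<one>} = A"
  using invsub_mem[OF assms(1)] assms(2) invsub_one_mem[OF assms(1)]
  by (intro invsub_cobounded[OF invsub_one assms(1), of R]) (auto simp: rho_inv)
 then show ?thesis by simp
qed

text \<open>The minimal condition. In a strictly descending chain some member lies within distance one,
 on the unit ball, of the intersection, and then rescaling shows equality.\<close>
lemma invsub_minimal:
 assumes "A0 \<in> \<F>" "!!A. A \<in> \<F> ==> invsub A"
 shows "\<exists>A\<in>\<F>. \<forall>B\<in>\<F>. \<not> B \<subset> A"
proof (rule ccontr)
 assume "\<not> ?thesis"
 then have "\<forall>A\<in>\<F>. \<exists>B\<in>\<F>. B \<subset> A" by blast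
 then obtain f where f: "!!A. A \<in> \<F> ==> f A \<in> \<F> \<and> f A \<subset> A" by metis
 define A where "A n = (f ^^ n) A0" for n
 have AF: "A n \<in> \<F>" for n by (induction n) (use assms f in \<open>auto simp: A_def\<close>)
 have As: "A (Suc n) \<subset> A n" for n using f[OF AF[of n]] by (simp add: A_def)
 have mono: "A n \<subseteq> A m" if "m \<le> n" for m n using that by (induction rule: dec_induct) (use As in auto)
 have inv: "invsub (A n)" for n using AF assms by blast
 define I where "I = (\<Inter>n. A n)"
 have I: "invsub I"
 proof (rule invsubI)
  show "subgroup I G" unfolding I_def using invsub_subgroup[OF inv] by (intro subgroups_Inter) auto
  show "seqclosed I"
   unfolding seqclosed_def
  proof (intro conjI ballI impI)
   show "I \<subseteq> \<G>" using invsub_subset[OF inv, of 0] by (auto simp: I_def)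
   fix x assume x: "x \<in> \<G>" and h: "\<forall>e>0. \<exists>a\<in>I. dst x a < e"
   have "x \<in> A n" for n
    using h by (intro seqclosedD[OF invsub_closed[OF inv] x]) (auto simp: I_def)
   then show "x \<in> I" by (auto simp: I_def)
  qed
  fix x assume "x \<in> I"
  then show "\<alpha> x \<in> I" "alpha' x \<in> I"
   using invsub_ap[OF inv, of x _ 1] invsub_ap[OF inv, of x _ "-1"] ap_minus[of x 0] invsub_mem[OF inv, of x 0]
   by (auto simp: I_def)
 qed
 have "\<exists>n. \<forall>x\<in>A n. \<rho> x \<le> 1 --> (\<exists>a\<in>I. dst a x < \<theta>)"
 proof (rule ccontr)
  assume "\<not> ?thesis"
  then have "\<forall>n. \<exists>x. x \<in> A n \<and> \<rho> x \<le> 1 \<and> (\<forall>a\<in>I. \<not> dst a x < \<theta>)" by blast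
  then obtain u where u: "!!n. u n \<in> A n" "!!n. \<rho> (u n) \<le> 1" "!!n a. a \<in> I ==> \<not> dst a (u n) < \<theta>"
   by metis
  have uc: "u n \<in> \<G>" for n using invsub_mem[OF inv u(1)] .
  obtain l r where l: "l \<in> \<G>" and r: "strict_mono (r::nat=>nat)"
   and lim: "(\<lambda>n. dst l (u (r n))) \<longlonglongrightarrow> 0"
   using rho_compact[of u 1] uc u by blast
  have "l \<in> A n" for n
  proof (rule seqclosed_limit[OF invsub_closed[OF inv] l lim, of n])
   fix k assume "n \<le> k"
   then have "n \<le> r k" using seq_suble[OF r, of k] by linarith
   then show "u (r k) \<in> A n" using u(1)[of "r k"] mono by blast
  qed
  then have "l \<in> I" by (simp add: I_def)
  moreover have "eventually (\<lambda>n. dst l (u (r n)) < \<theta>) sequentially"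
   using lim theta by (auto dest: order_tendstoD(2))
  ultimately show False using u(3) by (auto simp: eventually_sequentially)
 qed
 then obtain n where n: "!!x. x \<in> A n ==> \<rho> x \<le> 1 ==> \<exists>a\<in>I. dst a x < \<theta>" by blast
 have Ac: "A n \<subseteq> \<G>" and Ic: "I \<subseteq> \<G>" using invsub_subset[OF inv] invsub_subset[OF I] by auto
 have IA: "I \<subseteq> A n" by (auto simp: I_def)
 \<comment> \<open>The estimate on the unit ball, transported by a power of \<alpha>, gains one
   factor \<theta> at every scale. Since the quotient inv a \<otimes> x stays in \<open>A n\<close>,
   the step can be iterated.\<close>
 have step: "\<exists>a\<in>I. dst a x \<le> \<theta> powi (k + 1)" if x: "x \<in> A n" "\<rho> x \<le> \<theta> powi k" for x k
 proof -
  have "\<rho> (ap (- k) x) \<le> 1" using x theta Ac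
   by (subst rho_ap) (auto simp: power_int_minus field_simps)
  then obtain a where a: "a \<in> I" "dst a (ap (- k) x) < \<theta>"
   using n[OF invsub_ap[OF inv x(1), of "- k"]] by blast
  have c: "a \<in> \<G>" "x \<in> \<G>" using a x Ac Ic by auto
  have "dst (ap k a) x = \<rho> (ap k (inv a \<otimes> ap (- k) x))" using c by simp
  also have "\<dots> \<le> \<theta> powi k * \<theta>" using c a theta by (subst rho_ap) (auto intro!: mult_left_mono)
  finally show ?thesis using invsub_ap[OF I a(1), of k] theta by (auto simp: power_int_add)
 qed
 have "I = A n"
 proof (rule invsub_cobounded[OF I inv IA, of 1])
  fix x assume x: "x \<in> A n"
  have it: "\<exists>a\<in>I. dst a x \<le> \<theta> powi (k + int m)" if "\<rho> x \<le> \<theta> powi k" for k m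
  proof (induction m)
   case 0
   have "\<one> \<in> I" by (rule invsub_one_mem[OF I])
   then show ?case using that x Ac by (intro bexI[of _ \<one>]) auto
  next
   case (Suc m)
   then obtain a where a: "a \<in> I" "dst a x \<le> \<theta> powi (k + int m)" by blast
   have aA: "inv a \<otimes> x \<in> A n" using a IA x invsub_mult[OF inv] invsub_minv[OF inv]
    by blast
   obtain b where b: "b \<in> I" "dst b (inv a \<otimes> x) \<le> \<theta> powi (k + int m + 1)"
    using step[OF aA a(2)] by blast
   have "a \<otimes> b \<in> I" using a b invsub_mult[OF I] by blast
   moreover have "inv (a \<otimes> b) \<otimes> x = inv b \<otimes> (inv a \<otimes> x)" using a b x Ac Ic by (simp add: gsimps subset_iff)
   ultimately show ?case using b by (intro bexI[of _ "a \<otimes> b"]) (auto simp: algebra_simps)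
  qed
  have "\<exists>k. \<rho> x \<le> \<theta> powi k"
  proof (cases "\<rho> x = 0")
   case True then show ?thesis using theta by (intro exI[of _ 0]) auto
  next
   case False
   then have "0 < \<rho> x" using rho_nonneg[of x] x Ac by force
   then obtain k where "\<theta> powi k * \<rho> x \<le> 1" using scale_into_interval theta by blast
   then show ?thesis using theta by (intro exI[of _ "- k"]) (auto simp: power_int_minus field_simps)
  qed
  then obtain k where k: "\<rho> x \<le> \<theta> powi k" by blast
  \<comment> \<open>With nat (- k) iterations the exponent becomes nonnegative, so the remaining
    distance is at most 1, whatever the size of x.\<close>
  obtain a where a: "a \<in> I" "dst a x \<le> \<theta> powi (k + int (nat (- k)))" using it[OF k] by blast
  have "\<theta> powi (k + int (nat (- k))) \<le> 1" using theta
   by (cases "0 \<le> k") (auto intro: power_int_le_one)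
  then show "\<exists>a\<in>I. dst x a \<le> 1" using a(2) dist_sym[of a x] invsub_mem[OF I a(1)] invsub_mem[OF inv x] by (intro bexI[OF _ a(1)]) linarith
 qed
 then show False using As[of n] by (auto simp: I_def)
qed

end

section \<open>Limits along an ultrafilter\<close>

text \<open>Zorn's lemma on the proper filters below \<open>sequentially\<close>. A finer filter is
  smaller in the filter order, hence the reversal in \<open>Q\<close>. Limits along U exist for all
  bounded sequences at once and respect sums and inequalities, so no subsequences have to be
  chosen.\<close>

lemma ex_ultrafilter:
 "\<exists>U::nat filter. U \<le> sequentially \<and> U \<noteq> bot \<and> (\<forall>P. eventually P U \<or> eventually (\<lambda>x. \<not> P x) U)"
proof -
 define A where "A = {F::nat filter. F \<le> sequentially \<and> F \<noteq> bot}"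
 define Q where "Q = (\<lambda>F G :: nat filter. G \<le> F)"
 have "\<exists>m\<in>A. \<forall>a\<in>A. Q m a --> a = m"
 proof (rule predicate_Zorn)
  show "partial_order_on A (relation_of Q A)"
   by (rule partial_order_on_relation_ofI) (auto simp: Q_def)
  fix C assume C: "C \<in> Chains (relation_of Q A)"
  then have CA: "C \<subseteq> A" and tot: "!!F G. F \<in> C ==> G \<in> C ==> F \<le> G \<or> G \<le> F"
   by (auto simp: Chains_def relation_of_def Q_def)
  show "\<exists>u\<in>A. \<forall>a\<in>C. Q a u"
  proof (cases "C = {}")
   case True
   then show ?thesis by (intro bexI[of _ sequentially]) (auto simp: A_def)
  next
   case False
   have fin: "X \<noteq> {} --> (\<exists>F\<in>C. \<forall>G\<in>X. F \<le> G)" if "finite X" "X \<subseteq> C" for X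
    using that
   proof (induction X rule: finite_induct)
    case (insert x X)
    show ?case
    proof (cases "X = {}")
     case False
     then obtain F where F: "F \<in> C" "\<forall>G\<in>X. F \<le> G" using insert by auto
     show ?thesis using tot[OF F(1), of x] F insert by (auto intro: order_trans)
    qed (use insert in auto)
   qed simp
   have "Inf C \<noteq> bot"
   proof (rule Inf_filter_not_bot)
    fix X assume X: "X \<subseteq> C" "finite X"
    show "Inf X \<noteq> bot"
    proof (cases "X = {}")
     case False
     then obtain F where F: "F \<in> C" "\<forall>G\<in>X. F \<le> G" using fin X by blast
     then have "F \<le> Inf X" by (intro Inf_greatest) auto
     then show ?thesis using F CA by (auto simp: A_def bot_unique)
    next
     case True
     have "\<not> eventually (\<lambda>_. False) (Inf {} :: nat filter)" by (simp add: eventually_top)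
     then show ?thesis using True by (metis eventually_bot)
    qed
   qed
   moreover obtain F where "F \<in> C" using False by blast
   ultimately show ?thesis using CA
    by (intro bexI[of _ "Inf C"]) (auto simp: A_def Q_def intro: Inf_lower Inf_lower2)
  qed
 qed
 then obtain U where U: "U \<in> A" "!!F. F \<in> A ==> F \<le> U ==> F = U" by (auto simp: Q_def)
 have "eventually P U \<or> eventually (\<lambda>x. \<not> P x) U" for P
 proof (cases "inf U (principal {x. P x}) = bot")
  case True
  then have "eventually (\<lambda>x. False) (inf U (principal {x. P x}))" by simp
  then show ?thesis by (simp add: eventually_inf_principal)
 next
  case False
  then have "inf U (principal {x. P x}) = U" using U by (intro U(2)) (auto simp: A_def intro: le_infI1)
  moreover have "eventually P (inf U (principal {x. P x}))" by (simp add: eventually_inf_principal)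
  ultimately show ?thesis by simp
 qed
 then show ?thesis using U by (auto simp: A_def)
qed

lemma ultrafilter_limit:
 fixes x :: "nat => real"
 assumes U: "U \<noteq> bot" "!!P. eventually P U \<or> eventually (\<lambda>x. \<not> P x) U"
  and b: "!!n. \<bar>x n\<bar> \<le> B"
 shows "\<exists>l. (x \<longlongrightarrow> l) U"
proof -
 have cpt: "compact {-B..B}" by simp
 have le: "filtermap x U \<le> principal {-B..B}"
  using b by (auto simp: le_principal eventually_filtermap abs_le_iff minus_le_iff)
 have nb: "filtermap x U \<noteq> bot" using U by (simp add: filtermap_bot_iff)
 have "\<exists>l\<in>{-B..B}. inf (nhds l) (filtermap x U) \<noteq> bot"
  by (rule cpt[unfolded compact_filter, rule_format, OF nb]) (use le in \<open>simp add: le_principal\<close>)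
 then obtain l where l: "inf (nhds l) (filtermap x U) \<noteq> bot" ..
 have "eventually P (filtermap x U)" if P: "eventually P (nhds l)" for P
 proof (rule ccontr)
  assume "\<not> eventually P (filtermap x U)"
  then have "eventually (\<lambda>y. \<not> P y) (filtermap x U)" using U(2)[of "\<lambda>n. P (x n)"] by (simp add: eventually_filtermap)
  then have "eventually (\<lambda>y. False) (inf (nhds l) (filtermap x U))"
   using P by (auto simp: eventually_inf)
  then show False using l by (simp add: eventually_False)
 qed
 then show ?thesis by (intro exI[of _ l]) (auto simp: filterlim_def le_filter_def)
qed

section \<open>Haar's covering functional\<close>

context homogeneous_group
begin

text \<open>The test functions: nonnegative, Lipschitz for the left-invariant distance, with bounded
  support. The Lipschitz bound gives uniform continuity directly and survives sums, products and
  left translations.\<close>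

definition bumps :: "('a => real) set" where
 "bumps = {f. (\<forall>x\<in>\<G>. 0 \<le> f x) \<and>
   (\<exists>L\<ge>0. \<forall>x\<in>\<G>. \<forall>y\<in>\<G>. \<bar>f x - f y\<bar> \<le> L * dst x y) \<and>
   (\<exists>R. \<forall>x\<in>\<G>. f x \<noteq> 0 --> \<rho> x \<le> R)}"

lemma bumpsE:
 assumes "f \<in> bumps"
 obtains L R M where "0 \<le> L" "0 \<le> R" "0 \<le> M" "!!x. x \<in> \<G> ==> 0 \<le> f x"
  "!!x. x \<in> \<G> ==> f x \<le> M"
  "!!x y. x \<in> \<G> ==> y \<in> \<G> ==> \<bar>f x - f y\<bar> \<le> L * dst x y"
  "!!x. x \<in> \<G> ==> f x \<noteq> 0 ==> \<rho> x \<le> R"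
proof -
 obtain L R where L: "0 \<le> L" "!!x y. x \<in> \<G> ==> y \<in> \<G> ==> \<bar>f x - f y\<bar> \<le> L * dst x y"
  and R: "!!x. x \<in> \<G> ==> f x \<noteq> 0 ==> \<rho> x \<le> R"
  and pos: "!!x. x \<in> \<G> ==> 0 \<le> f x"
  using assms unfolding bumps_def by blast
 have "f x \<le> f \<one> + L * \<bar>R\<bar>" if x: "x \<in> \<G>" for x
 proof (cases "f x = 0")
  case True then show ?thesis using pos[of \<one>] L by simp
 next
  case False
  have "L * \<rho> x \<le> L * \<bar>R\<bar>" using R[OF x False] L by (intro mult_left_mono) auto
  then show ?thesis using L(2)[of \<one> x] x by simp
 qed
 moreover have "0 \<le> f \<one> + L * \<bar>R\<bar>" using pos[of \<one>] L by simp
 ultimately show ?thesis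
 proof (intro that[of L "\<bar>R\<bar>" "f \<one> + L * \<bar>R\<bar>"])
  show "\<rho> x \<le> \<bar>R\<bar>" if "x \<in> \<G>" "f x \<noteq> 0" for x using R[OF that] by linarith
 qed (use L pos in auto)
qed

lemma bumpsI:
 assumes "!!x. x \<in> \<G> ==> 0 \<le> f x" "0 \<le> L"
  "!!x y. x \<in> \<G> ==> y \<in> \<G> ==> \<bar>f x - f y\<bar> \<le> L * dst x y"
  "!!x. x \<in> \<G> ==> f x \<noteq> 0 ==> \<rho> x \<le> R"
 shows "f \<in> bumps"
 using assms unfolding bumps_def by blast

lemma bumps_add:
 assumes "f \<in> bumps" "g \<in> bumps"
 shows "(\<lambda>x. f x + g x) \<in> bumps"
proof -
 obtain L R M where f: "0 \<le> L" "0 \<le> R" "0 \<le> M" "!!x. x \<in> \<G> ==> 0 \<le> f x"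
  "!!x. x \<in> \<G> ==> f x \<le> M"
  "!!x y. x \<in> \<G> ==> y \<in> \<G> ==> \<bar>f x - f y\<bar> \<le> L * dst x y"
  "!!x. x \<in> \<G> ==> f x \<noteq> 0 ==> \<rho> x \<le> R" by (rule bumpsE[OF assms(1)], rule that)
 obtain L' R' M' where g: "0 \<le> L'" "0 \<le> R'" "0 \<le> M'" "!!x. x \<in> \<G> ==> 0 \<le> g x"
  "!!x. x \<in> \<G> ==> g x \<le> M'"
  "!!x y. x \<in> \<G> ==> y \<in> \<G> ==> \<bar>g x - g y\<bar> \<le> L' * dst x y"
  "!!x. x \<in> \<G> ==> g x \<noteq> 0 ==> \<rho> x \<le> R'" by (rule bumpsE[OF assms(2)], rule that)
 show ?thesis
 proof (rule bumpsI[of _ "L + L'" "R + R'"])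
  fix x y assume x: "x \<in> \<G>" "y \<in> \<G>"
  show "\<bar>f x + g x - (f y + g y)\<bar> \<le> (L + L') * dst x y"
   using f(6)[OF x] g(6)[OF x] by (simp add: distrib_right)
 next
  fix x assume x: "x \<in> \<G>" "f x + g x \<noteq> 0"
  then have "f x \<noteq> 0 \<or> g x \<noteq> 0" by auto
  then show "\<rho> x \<le> R + R'" using f(7)[OF x(1)] g(7)[OF x(1)] f(2) g(2) by auto
 qed (use f g in auto)
qed

lemma bumps_scale:
 assumes "f \<in> bumps" "0 \<le> c"
 shows "(\<lambda>x. c * f x) \<in> bumps"
proof -
 obtain L R M where f: "0 \<le> L" "0 \<le> R" "0 \<le> M" "!!x. x \<in> \<G> ==> 0 \<le> f x"
  "!!x. x \<in> \<G> ==> f x \<le> M"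
  "!!x y. x \<in> \<G> ==> y \<in> \<G> ==> \<bar>f x - f y\<bar> \<le> L * dst x y"
  "!!x. x \<in> \<G> ==> f x \<noteq> 0 ==> \<rho> x \<le> R" by (rule bumpsE[OF assms(1)], rule that)
 show ?thesis
 proof (rule bumpsI[of _ "c * L" R])
  fix x y assume x: "x \<in> \<G>" "y \<in> \<G>"
  have "\<bar>c * f x - c * f y\<bar> = c * \<bar>f x - f y\<bar>" using assms(2) by (simp add: abs_mult flip: right_diff_distrib)
  then show "\<bar>c * f x - c * f y\<bar> \<le> c * L * dst x y"
   using mult_left_mono[OF f(6)[OF x] assms(2)] by (simp add: mult.assoc)
 qed (use f assms in auto)
qed

lemma bumps_mult:
 assumes "f \<in> bumps" "g \<in> bumps"
 shows "(\<lambda>x. f x * g x) \<in> bumps"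
proof -
 obtain L R M where f: "0 \<le> L" "0 \<le> R" "0 \<le> M" "!!x. x \<in> \<G> ==> 0 \<le> f x"
  "!!x. x \<in> \<G> ==> f x \<le> M"
  "!!x y. x \<in> \<G> ==> y \<in> \<G> ==> \<bar>f x - f y\<bar> \<le> L * dst x y"
  "!!x. x \<in> \<G> ==> f x \<noteq> 0 ==> \<rho> x \<le> R" by (rule bumpsE[OF assms(1)], rule that)
 obtain L' R' M' where g: "0 \<le> L'" "0 \<le> R'" "0 \<le> M'" "!!x. x \<in> \<G> ==> 0 \<le> g x"
  "!!x. x \<in> \<G> ==> g x \<le> M'"
  "!!x y. x \<in> \<G> ==> y \<in> \<G> ==> \<bar>g x - g y\<bar> \<le> L' * dst x y"
  "!!x. x \<in> \<G> ==> g x \<noteq> 0 ==> \<rho> x \<le> R'" by (rule bumpsE[OF assms(2)], rule that)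
 show ?thesis
 proof (rule bumpsI[of _ "M * L' + M' * L" R])
  fix x y assume x: "x \<in> \<G>" "y \<in> \<G>"
  have "f x * g x - f y * g y = f x * (g x - g y) + g y * (f x - f y)" by (simp add: algebra_simps)
  then have "\<bar>f x * g x - f y * g y\<bar> \<le> \<bar>f x * (g x - g y)\<bar> + \<bar>g y * (f x - f y)\<bar>" by linarith
  also have "\<dots> = f x * \<bar>g x - g y\<bar> + g y * \<bar>f x - f y\<bar>" using f(4) g(4) x by (simp add: abs_mult)
  also have "\<dots> \<le> M * (L' * dst x y) + M' * (L * dst x y)"
   using f g x by (intro add_mono mult_mono) auto
  finally show "\<bar>f x * g x - f y * g y\<bar> \<le> (M * L' + M' * L) * dst x y" by (simp add: algebra_simps)
 qed (use f g in auto)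
qed

lemma bumps_translate:
 assumes "f \<in> bumps" "s \<in> \<G>"
 shows "(\<lambda>x. f (s \<otimes> x)) \<in> bumps"
proof -
 obtain L R M where f: "0 \<le> L" "0 \<le> R" "0 \<le> M" "!!x. x \<in> \<G> ==> 0 \<le> f x"
  "!!x. x \<in> \<G> ==> f x \<le> M"
  "!!x y. x \<in> \<G> ==> y \<in> \<G> ==> \<bar>f x - f y\<bar> \<le> L * dst x y"
  "!!x. x \<in> \<G> ==> f x \<noteq> 0 ==> \<rho> x \<le> R" by (rule bumpsE[OF assms(1)], rule that)
 show ?thesis
 proof (rule bumpsI[of _ L "\<rho> s + R"])
  fix x y assume x: "x \<in> \<G>" "y \<in> \<G>"
  then show "\<bar>f (s \<otimes> x) - f (s \<otimes> y)\<bar> \<le> L * dst x y"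
   using f(6)[of "s \<otimes> x" "s \<otimes> y"] assms by (simp add: gsimps)
 next
  fix x assume x: "x \<in> \<G>" "f (s \<otimes> x) \<noteq> 0"
  then have "\<rho> (s \<otimes> x) \<le> R" using f assms by auto
  then show "\<rho> x \<le> \<rho> s + R" using rho_mult_inv1[of s "s \<otimes> x"] assms x by simp
 qed (use f assms in auto)
qed

lemma rho_lipschitz: "x \<in> \<G> ==> y \<in> \<G> ==> \<bar>\<rho> x - \<rho> y\<bar> \<le> dst x y"
 using rho_diff[of x y] rho_diff[of y x] dist_sym[of x y] by linarith

lemma bumps_cone:
 assumes c: "0 < c"
 shows "(\<lambda>x. max 0 (r - c * \<rho> x)) \<in> bumps"
proof (rule bumpsI[of _ c "r / c"])
 fix x y assume x: "x \<in> \<G>" "y \<in> \<G>"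
 have "\<bar>max 0 (r - c * \<rho> x) - max 0 (r - c * \<rho> y)\<bar> \<le> \<bar>c * \<rho> x - c * \<rho> y\<bar>" by linarith
 also have "\<dots> = c * \<bar>\<rho> x - \<rho> y\<bar>" using c by (simp add: abs_mult flip: right_diff_distrib)
 also have "\<dots> \<le> c * dst x y" using c rho_lipschitz[OF x] by simp
 finally show "\<bar>max 0 (r - c * \<rho> x) - max 0 (r - c * \<rho> y)\<bar> \<le> c * dst x y" .
qed (use c in \<open>auto simp: field_simps max_def split: if_splits\<close>)

text \<open>A list of weighted left translates of g that dominates F. The infimum \<open>cn\<close>
  of the total weights is Haar's covering number (F : g).\<close>

definition covers :: "('a => real) => ('a => real) => (real \<times> 'a) list => bool" where
 "covers F g cs \<longleftrightarrow> (\<forall>(c, s)\<in>set cs. 0 \<le> c \<and> s \<in> \<G>) \<and>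
   (\<forall>x\<in>\<G>. F x \<le> (\<Sum>(c, s)\<leftarrow>cs. c * g (s \<otimes> x)))"

definition cn :: "('a => real) => ('a => real) => real" where
 "cn F g = (INF cs\<in>Collect (covers F g). \<Sum>(c, s)\<leftarrow>cs. c)"

lemma covers_sum_nonneg: "covers F g cs ==> 0 \<le> (\<Sum>(c, s)\<leftarrow>cs. c)"
 unfolding covers_def by (intro sum_list_nonneg) auto

lemma cn_bdd: "bdd_below ((\<lambda>cs. \<Sum>(c, s)\<leftarrow>cs. c) ` Collect (covers F g))"
 using covers_sum_nonneg by (intro bdd_belowI[of _ 0]) auto

lemma cn_le: "covers F g cs ==> cn F g \<le> (\<Sum>(c, s)\<leftarrow>cs. c)"
 unfolding cn_def by (intro cINF_lower cn_bdd) auto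

lemma covers_exists:
 assumes F: "F \<in> bumps" and g: "g \<in> bumps" "0 < g \<one>"
 shows "\<exists>cs. covers F g cs"
proof -
 obtain L R M where f: "0 \<le> L" "0 \<le> R" "0 \<le> M" "!!x. x \<in> \<G> ==> 0 \<le> F x"
  "!!x. x \<in> \<G> ==> F x \<le> M"
  "!!x y. x \<in> \<G> ==> y \<in> \<G> ==> \<bar>F x - F y\<bar> \<le> L * dst x y"
  "!!x. x \<in> \<G> ==> F x \<noteq> 0 ==> \<rho> x \<le> R" by (rule bumpsE[OF F], rule that)
 obtain L' R' M' where g': "0 \<le> L'" "0 \<le> R'" "0 \<le> M'" "!!x. x \<in> \<G> ==> 0 \<le> g x"
  "!!x. x \<in> \<G> ==> g x \<le> M'"
  "!!x y. x \<in> \<G> ==> y \<in> \<G> ==> \<bar>g x - g y\<bar> \<le> L' * dst x y"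
  "!!x. x \<in> \<G> ==> g x \<noteq> 0 ==> \<rho> x \<le> R'" by (rule bumpsE[OF g(1)], rule that)
 \<comment> \<open>On the ball of this radius the Lipschitz bound keeps g above half of its value at
   \<one>; the summand 1 only keeps the denominator positive.\<close>
 define r where "r = g \<one> / (2 * (L' + 1))"
 have r: "0 < r" using g g' by (simp add: r_def)
 have gr: "g \<one> / 2 \<le> g x" if "x \<in> \<G>" "\<rho> x < r" for x
 proof -
  have "L' * \<rho> x \<le> (L' + 1) * r" using that g' rho_nonneg by (intro mult_mono) auto
  also have "\<dots> = g \<one> / 2" using g'(1) by (simp add: r_def field_simps)
  finally show ?thesis using g'(6)[of \<one> x] that by simp
 qed
 obtain P where P: "finite P" "P \<subseteq> \<G>" "!!x. x \<in> \<G> ==> \<rho> x \<le> R ==> \<exists>y\<in>P. dst y x < r"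
  using totally_bounded[OF r, of R] by blast
 define C where "C = 2 * M / g \<one>"
 have C: "0 \<le> C" using f g by (simp add: C_def)
 obtain ys where ys: "set ys = P" using P(1) finite_list by blast
 define cs where "cs = map (\<lambda>y. (C, inv y)) ys"
 have "covers F g cs"
  unfolding covers_def
 proof (intro conjI ballI)
  fix x assume x: "x \<in> \<G>"
  have eq: "(\<Sum>(c, s)\<leftarrow>cs. c * g (s \<otimes> x)) = (\<Sum>y\<leftarrow>ys. C * g (inv y \<otimes> x))"
   by (simp add: cs_def o_def)
  have nn: "0 \<le> C * g (inv y \<otimes> x)" if "y \<in> set ys" for y
   using that ys P C g' x by (auto intro!: mult_nonneg_nonneg)
  show "F x \<le> (\<Sum>(c, s)\<leftarrow>cs. c * g (s \<otimes> x))"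
  proof (cases "F x = 0")
   case True
   show ?thesis unfolding eq True using nn by (intro sum_list_nonneg) auto
  next
   case False
   then obtain y where y: "y \<in> P" "dst y x < r" using P(3) f(7) x by blast
   have "F x \<le> C * (g \<one> / 2)" using f(5)[OF x] g by (simp add: C_def)
   also have "\<dots> \<le> C * g (inv y \<otimes> x)" using C gr[of "inv y \<otimes> x"] y P x by (intro mult_left_mono) auto
   also have "\<dots> \<le> (\<Sum>y\<leftarrow>ys. C * g (inv y \<otimes> x))"
    using y ys nn by (intro member_le_sum_list) auto
   finally show ?thesis by (simp add: eq)
  qed
 qed (use P ys C in \<open>auto simp: cs_def\<close>)
 then show ?thesis ..
qed

lemma cn_greatest:
 assumes "F \<in> bumps" "g \<in> bumps" "0 < g \<one>" "!!cs. covers F g cs ==> B \<le> (\<Sum>(c, s)\<leftarrow>cs. c)"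
 shows "B \<le> cn F g"
 unfolding cn_def using covers_exists[OF assms(1-3)] assms(4) by (intro cINF_greatest) auto

lemma cn_nonneg: "F \<in> bumps ==> g \<in> bumps ==> 0 < g \<one> ==> 0 \<le> cn F g"
 by (rule cn_greatest) (auto intro: covers_sum_nonneg)

lemma cn_approx:
 assumes "F \<in> bumps" "g \<in> bumps" "0 < g \<one>" "0 < e"
 shows "\<exists>cs. covers F g cs \<and> (\<Sum>(c, s)\<leftarrow>cs. c) < cn F g + e"
proof (rule ccontr)
 assume "\<not> ?thesis"
 then have "cn F g + e \<le> cn F g" using assms by (intro cn_greatest) (auto simp: not_less)
 then show False using assms by simp
qed

lemma cn_mono:
 assumes "F' \<in> bumps" "g \<in> bumps" "0 < g \<one>" "!!x. x \<in> \<G> ==> F x \<le> F' x"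
 shows "cn F g \<le> cn F' g"
proof (rule cn_greatest[OF assms(1-3)])
 fix cs assume "covers F' g cs"
 then have "covers F g cs" using assms(4) unfolding covers_def by (meson order_trans)
 then show "cn F g \<le> (\<Sum>(c, s)\<leftarrow>cs. c)" by (rule cn_le)
qed

lemma cn_add:
 assumes "F \<in> bumps" "F' \<in> bumps" "g \<in> bumps" "0 < g \<one>"
 shows "cn (\<lambda>x. F x + F' x) g \<le> cn F g + cn F' g"
proof (rule field_le_epsilon)
 fix e :: real assume "0 < e"
 then obtain cs cs' where c: "covers F g cs" "(\<Sum>(c, s)\<leftarrow>cs. c) < cn F g + e / 2"
  "covers F' g cs'" "(\<Sum>(c, s)\<leftarrow>cs'. c) < cn F' g + e / 2"
  using cn_approx assms by (metis half_gt_zero)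
 have "covers (\<lambda>x. F x + F' x) g (cs @ cs')" using c(1,3) by (auto simp: covers_def intro: add_mono)
 from cn_le[OF this] show "cn (\<lambda>x. F x + F' x) g \<le> cn F g + cn F' g + e" using c by simp
qed

lemma sum_list_scale: "(\<Sum>(c, s)\<leftarrow>map (\<lambda>(c, s). ((k::real) * c, t s)) cs. c * h s) = k * (\<Sum>(c, s)\<leftarrow>cs. c * h (t s) :: real)"
 by (induction cs) (auto simp: algebra_simps)

lemma sum_list_scale': "(\<Sum>(c, s)\<leftarrow>map (\<lambda>(c, s). ((k::real) * c, t s)) cs. c) = k * (\<Sum>(c, s)\<leftarrow>cs. c :: real)"
 using sum_list_scale[where k = k and t = t and h = "\<lambda>_. 1" and cs = cs] by simp

lemma cn_scale:
 assumes "F \<in> bumps" "g \<in> bumps" "0 < g \<one>" "0 \<le> k"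
 shows "cn (\<lambda>x. k * F x) g \<le> k * cn F g"
proof (rule field_le_epsilon)
 fix e :: real assume e: "0 < e"
 then obtain cs where c: "covers F g cs" "(\<Sum>(c, s)\<leftarrow>cs. c) < cn F g + e / (k + 1)"
  using cn_approx[OF assms(1-3), of "e / (k + 1)"] assms(4) by auto
 have "covers (\<lambda>x. k * F x) g (map (\<lambda>(c, s). (k * c, s)) cs)"
  using c(1) assms(4) unfolding covers_def sum_list_scale[where k = k and t = "\<lambda>s. s"]
  by (auto intro!: mult_left_mono)
 from cn_le[OF this] have "cn (\<lambda>x. k * F x) g \<le> k * (\<Sum>(c, s)\<leftarrow>cs. c)" unfolding sum_list_scale' .
 also have "\<dots> \<le> k * (cn F g + e / (k + 1))" using c assms by (intro mult_left_mono) auto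
 also have "\<dots> \<le> k * cn F g + e" using e assms(4) by (simp add: field_simps)
 finally show "cn (\<lambda>x. k * F x) g \<le> k * cn F g + e" .
qed

lemma cn_translate:
 assumes "F \<in> bumps" "g \<in> bumps" "0 < g \<one>" "t \<in> \<G>"
 shows "cn (\<lambda>x. F (t \<otimes> x)) g \<le> cn F g"
proof (rule cn_greatest[OF assms(1-3)])
 fix cs assume c: "covers F g cs"
 have "covers (\<lambda>x. F (t \<otimes> x)) g (map (\<lambda>(c, s). (1 * c, s \<otimes> t)) cs)"
  unfolding covers_def sum_list_scale[where t = "\<lambda>s. s \<otimes> t"]
 proof (intro conjI ballI)
  fix x assume x: "x \<in> \<G>"
  have "F (t \<otimes> x) \<le> (\<Sum>(c, s)\<leftarrow>cs. c * g (s \<otimes> (t \<otimes> x)))" using c x assms by (auto simp: covers_def)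
  also have "\<dots> = (\<Sum>(c, s)\<leftarrow>cs. c * g (s \<otimes> t \<otimes> x))"
   using c x assms by (intro arg_cong[where f = sum_list] map_cong) (auto simp: covers_def m_assoc)
  finally show "F (t \<otimes> x) \<le> 1 * (\<Sum>(c, s)\<leftarrow>cs. c * g (s \<otimes> t \<otimes> x))" by simp
 qed (use c assms in \<open>auto simp: covers_def\<close>)
 from cn_le[OF this] show "cn (\<lambda>x. F (t \<otimes> x)) g \<le> (\<Sum>(c, s)\<leftarrow>cs. c)" unfolding sum_list_scale' by simp
qed

lemma cn_cover_le:
 assumes "h \<in> bumps" "g \<in> bumps" "0 < g \<one>" "F \<in> bumps"
  and "\<forall>(c, s)\<in>set cs. 0 \<le> c \<and> s \<in> \<G>" "!!x. x \<in> \<G> ==> F x \<le> (\<Sum>(c, s)\<leftarrow>cs. c * h (s \<otimes> x))"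
 shows "cn F g \<le> (\<Sum>(c, s)\<leftarrow>cs. c) * cn h g"
proof -
 have "(\<lambda>x. \<Sum>(c, s)\<leftarrow>cs. c * h (s \<otimes> x)) \<in> bumps \<and> cn (\<lambda>x. \<Sum>(c, s)\<leftarrow>cs. c * h (s \<otimes> x)) g \<le> (\<Sum>(c, s)\<leftarrow>cs. c) * cn h g"
  using assms(5)
 proof (induction cs)
  case Nil
  have z: "(\<lambda>x. 0) \<in> bumps" using bumps_scale[OF assms(1), of 0] by simp
  have "cn (\<lambda>x. 0) g \<le> 0" using cn_scale[OF assms(1-3), of 0] by simp
  then show ?case using z by simp
 next
  case (Cons p cs)
  obtain c s where p: "p = (c, s)" by fastforce
  have c: "0 \<le> c" "s \<in> \<G>" using Cons by (auto simp: p)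
  have IH: "(\<lambda>x. \<Sum>(c, s)\<leftarrow>cs. c * h (s \<otimes> x)) \<in> bumps" "cn (\<lambda>x. \<Sum>(c, s)\<leftarrow>cs. c * h (s \<otimes> x)) g \<le> (\<Sum>(c, s)\<leftarrow>cs. c) * cn h g"
   using Cons by auto
  have t: "(\<lambda>x. h (s \<otimes> x)) \<in> bumps" using bumps_translate[OF assms(1) c(2)] .
  have t2: "(\<lambda>x. c * h (s \<otimes> x)) \<in> bumps" using bumps_scale[OF t c(1)] .
  have "cn (\<lambda>x. c * h (s \<otimes> x)) g \<le> c * cn h g"
   using cn_scale[OF t assms(2,3) c(1)] mult_left_mono[OF cn_translate[OF assms(1-3) c(2)] c(1)] by linarith
  then show ?case using bumps_add[OF t2 IH(1)] cn_add[OF t2 IH(1) assms(2,3)] IH(2)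
   by (simp add: p distrib_right)
 qed
 then show ?thesis using cn_mono[of "\<lambda>x. \<Sum>(c, s)\<leftarrow>cs. c * h (s \<otimes> x)" g F] assms by force
qed

text \<open>Substituting a cover of h by g into a cover of F by h. This inequality bounds the
  normalized covering numbers above and below, independently of g.\<close>

lemma cn_compose:
 assumes "F \<in> bumps" "h \<in> bumps" "0 < h \<one>" "g \<in> bumps" "0 < g \<one>"
 shows "cn F g \<le> cn F h * cn h g"
proof (rule field_le_epsilon)
 fix e :: real assume e: "0 < e"
 define k where "k = cn h g"
 have k: "0 \<le> k" using cn_nonneg[OF assms(2,4,5)] by (simp add: k_def)
 obtain cs where c: "covers F h cs" "(\<Sum>(c, s)\<leftarrow>cs. c) < cn F h + e / (k + 1)"
  using cn_approx[OF assms(1-3), of "e / (k + 1)"] e k by auto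
 have "cn F g \<le> (\<Sum>(c, s)\<leftarrow>cs. c) * k"
  using c(1) cn_cover_le[OF assms(2,4,5,1), of cs] by (auto simp: covers_def k_def)
 also have "\<dots> \<le> (cn F h + e / (k + 1)) * k" using c k by (intro mult_right_mono) auto
 also have "\<dots> \<le> cn F h * k + e" using e k by (simp add: field_simps)
 finally show "cn F g \<le> cn F h * cn h g + e" by (simp add: k_def)
qed

lemma cn_pos:
 assumes "F \<in> bumps" "g \<in> bumps" "0 < g \<one>" "0 < F \<one>"
 shows "0 < cn F g"
proof -
 obtain M where M: "!!x. x \<in> \<G> ==> g x \<le> M" by (rule bumpsE[OF assms(2)], rule that)
 have M0: "0 < M" using M[of \<one>] assms by simp
 have "F \<one> / M \<le> cn F g"
 proof (rule cn_greatest[OF assms(1-3)])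
  fix cs assume c: "covers F g cs"
  have "F \<one> \<le> (\<Sum>(c, s)\<leftarrow>cs. c * g (s \<otimes> \<one>))" using c by (auto simp: covers_def)
  also have "\<dots> \<le> (\<Sum>(c, s)\<leftarrow>cs. M * c)"
   using c M by (intro sum_list_mono) (auto simp: covers_def mult.commute[of M] intro!: mult_left_mono)
  also have "\<dots> = M * (\<Sum>(c, s)\<leftarrow>cs. c)" by (induction cs) (auto simp: algebra_simps)
  finally show "F \<one> / M \<le> (\<Sum>(c, s)\<leftarrow>cs. c)" using M0 by (simp add: field_simps)
 qed
 then show ?thesis using M0 assms by (smt (verit) divide_pos_pos)
qed

text \<open>If g has small support, F1 / F and F2 / F hardly vary on the support of a translate of
  g, so a cover of F splits into covers of F1 and F2 whose weights add up to almost the original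
  ones. The term e * k added to the sum keeps the denominator F at least e near the supports, and
  the margin R + 1 allows for neighbouring points.\<close>

lemma cn_additive:
 assumes F: "F1 \<in> bumps" "F2 \<in> bumps" and e: "0 < e"
  and k: "k \<in> bumps" "!!x. x \<in> \<G> ==> \<rho> x \<le> R + 1 ==> k x = 1"
  and R: "!!x. x \<in> \<G> ==> F1 x \<noteq> 0 \<or> F2 x \<noteq> 0 ==> \<rho> x \<le> R"
 shows "\<exists>r>0. \<forall>g\<in>bumps. 0 < g \<one> --> (\<forall>x\<in>\<G>. g x \<noteq> 0 --> \<rho> x < r) -->
   cn F1 g + cn F2 g \<le> (1 + 2 * e) * (cn (\<lambda>x. F1 x + F2 x) g + e * cn k g)"
proof -
 define F where "F = (\<lambda>x. (F1 x + F2 x) + e * k x)"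
 have ek: "(\<lambda>x. e * k x) \<in> bumps" using bumps_scale[OF k(1)] e by simp
 have F12: "(\<lambda>x. F1 x + F2 x) \<in> bumps" using bumps_add[OF F] .
 have Fb: "F \<in> bumps" unfolding F_def using bumps_add[OF F12 ek] .
 obtain L1 R1 M1 where f1: "0 \<le> L1" "0 \<le> R1" "0 \<le> M1" "!!x. x \<in> \<G> ==> 0 \<le> F1 x"
  "!!x. x \<in> \<G> ==> F1 x \<le> M1"
  "!!x y. x \<in> \<G> ==> y \<in> \<G> ==> \<bar>F1 x - F1 y\<bar> \<le> L1 * dst x y"
  "!!x. x \<in> \<G> ==> F1 x \<noteq> 0 ==> \<rho> x \<le> R1" by (rule bumpsE[OF F(1)], rule that)
 obtain L2 R2 M2 where f2: "0 \<le> L2" "0 \<le> R2" "0 \<le> M2" "!!x. x \<in> \<G> ==> 0 \<le> F2 x"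
  "!!x. x \<in> \<G> ==> F2 x \<le> M2"
  "!!x y. x \<in> \<G> ==> y \<in> \<G> ==> \<bar>F2 x - F2 y\<bar> \<le> L2 * dst x y"
  "!!x. x \<in> \<G> ==> F2 x \<noteq> 0 ==> \<rho> x \<le> R2" by (rule bumpsE[OF F(2)], rule that)
 obtain L3 R3 M3 where f3: "0 \<le> L3" "0 \<le> R3" "0 \<le> M3" "!!x. x \<in> \<G> ==> 0 \<le> F x"
  "!!x. x \<in> \<G> ==> F x \<le> M3"
  "!!x y. x \<in> \<G> ==> y \<in> \<G> ==> \<bar>F x - F y\<bar> \<le> L3 * dst x y"
  "!!x. x \<in> \<G> ==> F x \<noteq> 0 ==> \<rho> x \<le> R3" by (rule bumpsE[OF Fb], rule that)
 have k0: "0 \<le> k x" if "x \<in> \<G>" for x using k(1) that by (auto simp: bumps_def)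
 define L where "L = L1 + L2 + L3 + 1"
 have L: "0 < L" "L1 \<le> L" "L2 \<le> L" "L3 \<le> L" using f1 f2 f3 by (auto simp: L_def)
 \<comment> \<open>Within distance r numerator and denominator each change by at most e * e / 2. As
   F is at least e, the quotient then changes by at most e; the bound 1 keeps the neighbour inside
   the ball of radius R + 1.\<close>
 define r where "r = min 1 (e * e / (2 * L))"
 have r: "0 < r" "r \<le> 1" using e L by (auto simp: r_def)
 have Fe: "e \<le> F x" if "x \<in> \<G>" "\<rho> x \<le> R + 1" for x
  using k(2)[OF that] f1(4) f2(4) that by (simp add: F_def)
 have osc: "h x / F x \<le> h y / F y + e"
  if h: "!!x. x \<in> \<G> ==> 0 \<le> h x" "!!x. x \<in> \<G> ==> h x \<le> F x"
   "!!x. x \<in> \<G> ==> h x \<noteq> 0 ==> \<rho> x \<le> R"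
   "!!x y. x \<in> \<G> ==> y \<in> \<G> ==> \<bar>h x - h y\<bar> \<le> L * dst x y"
   and xy: "x \<in> \<G>" "y \<in> \<G>" "dst y x < r" for h x y
 proof (cases "h x = 0")
  case True
  then show ?thesis using h(1)[OF xy(2)] f3(4)[OF xy(2)] e by simp
 next
  case False
  have Rx: "\<rho> x \<le> R" using h(3)[OF xy(1) False] .
  have "\<rho> y \<le> \<rho> x + dst x y" using rho_diff xy by blast
  then have Ry: "\<rho> y \<le> R + 1" using Rx xy r dist_sym[of x y] by auto
  have Fx: "e \<le> F x" and Fy: "e \<le> F y" using Fe xy Rx Ry by auto
  have d: "dst x y \<le> r" using xy dist_sym[of x y] by simp
  have "L * dst x y \<le> L * (e * e / (2 * L))"
   using d L by (intro mult_left_mono) (auto simp: r_def)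
  then have Lr: "L * dst x y \<le> e * e / 2" using L by simp
  have a: "h x \<le> h y + e * e / 2" using h(4)[OF xy(1,2)] Lr by linarith
  have "\<bar>F x - F y\<bar> \<le> L * dst x y"
   using f3(6)[OF xy(1,2)] mult_right_mono[OF L(4) rho_nonneg[of "inv x \<otimes> y"]] xy by force
  then have b: "F y \<le> F x + e * e / 2" using Lr by linarith
  have "h x * F y \<le> (h y + e * e / 2) * F y" using a Fy e by (intro mult_right_mono) auto
  also have "\<dots> \<le> h y * (F x + e * e / 2) + e * e / 2 * F y"
   using mult_left_mono[OF b h(1)[OF xy(2)]] by (simp add: algebra_simps)
  also have "\<dots> \<le> h y * F x + F y * (e * e / 2) + e * e / 2 * F y"
  proof -
   have "h y * (e * e / 2) \<le> F y * (e * e / 2)" using h(2)[OF xy(2)] e by (intro mult_right_mono) auto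
   then show ?thesis unfolding distrib_left by linarith
  qed
  also have "\<dots> = h y * F x + e * e * F y" by simp
  also have "\<dots> \<le> h y * F x + e * F x * F y"
   using Fx Fy e by (intro add_left_mono mult_right_mono mult_left_mono) auto
  finally have "h x * F y \<le> (h y + e * F y) * F x" by (simp add: algebra_simps)
  then have "h x / F x \<le> (h y + e * F y) / F y" using Fx Fy e by (simp add: divide_le_eq le_divide_eq field_simps)
  also have "\<dots> = h y / F y + e" using Fy e by (simp add: field_simps)
  finally show ?thesis .
 qed
 have main: "cn F1 g + cn F2 g \<le> (1 + 2 * e) * cn F g"
  if g: "g \<in> bumps" "0 < g \<one>" "!!x. x \<in> \<G> ==> g x \<noteq> 0 ==> \<rho> x < r" for g
 proof -
  have g0: "0 \<le> g x" if "x \<in> \<G>" for x using g(1) that by (auto simp: bumps_def)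
  have sumle: "cn h g \<le> (\<Sum>(c, s)\<leftarrow>cs. c * (h (inv s) / F (inv s) + e))"
   if cs: "covers F g cs" and h: "!!x. x \<in> \<G> ==> 0 \<le> h x" "!!x. x \<in> \<G> ==> h x \<le> F x"
   "!!x. x \<in> \<G> ==> h x \<noteq> 0 ==> \<rho> x \<le> R"
   "!!x y. x \<in> \<G> ==> y \<in> \<G> ==> \<bar>h x - h y\<bar> \<le> L * dst x y" for cs h
  proof -
   have c0: "0 \<le> c" "s \<in> \<G>" if "(c, s) \<in> set cs" for c s
    using cs that by (auto simp: covers_def)
   \<comment> \<open>Each translate keeps its place, and its weight is multiplied by h / F at its
     centre inv s, plus the oscillation error e.\<close>
   have "covers h g (map (\<lambda>(c, s). (c * (h (inv s) / F (inv s) + e), s)) cs)"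
    unfolding covers_def
   proof (intro conjI ballI)
    fix x assume x: "x \<in> \<G>"
    have q0: "0 \<le> h x / F x" using h(1)[OF x] f3(4)[OF x] by simp
    have "h x = F x * (h x / F x)" using h(1)[OF x] h(2)[OF x] by (cases "F x = 0") auto
    also have "\<dots> \<le> (\<Sum>(c, s)\<leftarrow>cs. c * g (s \<otimes> x)) * (h x / F x)"
     using cs x q0 by (intro mult_right_mono) (auto simp: covers_def)
    also have "\<dots> = (\<Sum>(c, s)\<leftarrow>cs. c * g (s \<otimes> x) * (h x / F x))"
     by (induction cs) (auto simp: algebra_simps)
    also have "\<dots> \<le> (\<Sum>(c, s)\<leftarrow>cs. c * (h (inv s) / F (inv s) + e) * g (s \<otimes> x))"
    proof (rule sum_list_mono, clarify)
     fix c s assume p: "(c, s) \<in> set cs"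
     note cc = c0[OF p]
     show "c * g (s \<otimes> x) * (h x / F x) \<le> c * (h (inv s) / F (inv s) + e) * g (s \<otimes> x)"
     proof (cases "g (s \<otimes> x) = 0")
      case False
      then have "dst (inv s) x < r" using g(3)[of "s \<otimes> x"] cc x by simp
      then have "h x / F x \<le> h (inv s) / F (inv s) + e" using osc[of h x "inv s"] h x cc by auto
      then have "(c * g (s \<otimes> x)) * (h x / F x) \<le> (c * g (s \<otimes> x)) * (h (inv s) / F (inv s) + e)"
       using cc g0[of "s \<otimes> x"] x by (intro mult_left_mono) auto
      then show ?thesis by (simp add: mult_ac)
     qed simp
    qed
    finally show "h x \<le> (\<Sum>(c, s)\<leftarrow>map (\<lambda>(c, s). (c * (h (inv s) / F (inv s) + e), s)) cs. c * g (s \<otimes> x))"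
     by (simp add: o_def case_prod_unfold)
   next
    fix p assume "p \<in> set (map (\<lambda>(c, s). (c * (h (inv s) / F (inv s) + e), s)) cs)"
    then obtain c s where p: "(c, s) \<in> set cs" "p = (c * (h (inv s) / F (inv s) + e), s)" by auto
    have "0 \<le> h (inv s) / F (inv s)" using h(1)[of "inv s"] f3(4)[of "inv s"] c0[OF p(1)] by simp
    then show "case p of (c, s) => 0 \<le> c \<and> s \<in> \<G>" using c0[OF p(1)] p(2) e by simp
   qed
   from cn_le[OF this] show ?thesis by (simp add: o_def case_prod_unfold)
  qed
  have F1F: "F1 x \<le> F x" "F2 x \<le> F x" "F1 x + F2 x \<le> F x" if "x \<in> \<G>" for x
   using f1(4)[OF that] f2(4)[OF that] k0[OF that] e by (auto simp: F_def)
  have "(cn F1 g + cn F2 g) / (1 + 2 * e) \<le> cn F g"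
  proof (rule cn_greatest[OF Fb g(1,2)])
   fix cs assume cs: "covers F g cs"
   have lip: "\<bar>F1 x - F1 y\<bar> \<le> L * dst x y" "\<bar>F2 x - F2 y\<bar> \<le> L * dst x y"
    if "x \<in> \<G>" "y \<in> \<G>" for x y
    using f1(6)[OF that] f2(6)[OF that] mult_right_mono[OF L(2) rho_nonneg[of "inv x \<otimes> y"]]
     mult_right_mono[OF L(3) rho_nonneg[of "inv x \<otimes> y"]] that by force+
   have "cn F1 g \<le> (\<Sum>(c, s)\<leftarrow>cs. c * (F1 (inv s) / F (inv s) + e))"
    using f1(4) F1F R lip by (intro sumle[OF cs]) auto
   moreover have "cn F2 g \<le> (\<Sum>(c, s)\<leftarrow>cs. c * (F2 (inv s) / F (inv s) + e))"
    using f2(4) F1F R lip by (intro sumle[OF cs]) auto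
   ultimately have "cn F1 g + cn F2 g \<le> (\<Sum>(c, s)\<leftarrow>cs. c * (F1 (inv s) / F (inv s) + e) + c * (F2 (inv s) / F (inv s) + e))"
    by (simp add: sum_list_addf case_prod_unfold)
   also have "\<dots> \<le> (\<Sum>(c, s)\<leftarrow>cs. (1 + 2 * e) * c)"
   proof (rule sum_list_mono, clarify)
    fix c s assume p: "(c, s) \<in> set cs"
    have cc: "0 \<le> c" "s \<in> \<G>" using cs p by (auto simp: covers_def)
    have "F1 (inv s) / F (inv s) + F2 (inv s) / F (inv s) \<le> 1"
     using F1F(3)[of "inv s"] f3(4)[of "inv s"] cc by (cases "F (inv s) = 0") (auto simp: divide_le_eq simp flip: add_divide_distrib)
    then have "c * (F1 (inv s) / F (inv s) + F2 (inv s) / F (inv s) + 2 * e) \<le> c * (1 + 2 * e)"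
     using cc by (intro mult_left_mono) auto
    then show "c * (F1 (inv s) / F (inv s) + e) + c * (F2 (inv s) / F (inv s) + e) \<le> (1 + 2 * e) * c"
     by (simp add: algebra_simps)
   qed
   also have "\<dots> = (1 + 2 * e) * (\<Sum>(c, s)\<leftarrow>cs. c)" by (induction cs) (auto simp: algebra_simps)
   finally show "(cn F1 g + cn F2 g) / (1 + 2 * e) \<le> (\<Sum>(c, s)\<leftarrow>cs. c)" using e by (simp add: field_simps)
  qed
  then show ?thesis using e by (simp add: field_simps)
 qed
 show ?thesis
 proof (intro exI[of _ r] conjI ballI impI)
  fix g assume g: "g \<in> bumps" "0 < g \<one>" "\<forall>x\<in>\<G>. g x \<noteq> 0 --> \<rho> x < r"
  have "cn F g \<le> cn (\<lambda>x. F1 x + F2 x) g + cn (\<lambda>x. e * k x) g"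
   unfolding F_def using cn_add[OF F12 ek g(1,2)] .
  also have "cn (\<lambda>x. e * k x) g \<le> e * cn k g" using cn_scale[OF k(1) g(1,2)] e by simp
  finally have "(1 + 2 * e) * cn F g \<le> (1 + 2 * e) * (cn (\<lambda>x. F1 x + F2 x) g + e * cn k g)"
   using e by (intro mult_left_mono) auto
  then show "cn F1 g + cn F2 g \<le> (1 + 2 * e) * (cn (\<lambda>x. F1 x + F2 x) g + e * cn k g)"
   using main[of g] g by force
 qed (rule r)
qed

lemma bumps_cutoff: "\<exists>k\<in>bumps. \<forall>x\<in>\<G>. \<rho> x \<le> R + 1 --> k x = 1"
proof (intro bexI ballI impI)
 show "(\<lambda>x. min 1 (max 0 (R + 2 - 1 * \<rho> x))) \<in> bumps"
 proof (rule bumpsI[of _ 1 "R + 2"])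
  fix x y assume x: "x \<in> \<G>" "y \<in> \<G>"
  show "\<bar>min 1 (max 0 (R + 2 - 1 * \<rho> x)) - min 1 (max 0 (R + 2 - 1 * \<rho> y))\<bar> \<le> 1 * dst x y"
   using rho_lipschitz[OF x] by linarith
 qed (auto simp: min_def max_def split: if_splits)
qed auto

text \<open>The functional is the limit along an ultrafilter of covering numbers by the cones g n,
  normalized so that g 0 has value 1. \<open>cn_compose\<close> places the normalized numbers
  between 1 / cn (g 0) F and cn F (g 0), so limits exist and are positive where required. Scaling
  and translation are stated as inequalities; equality under translation follows by applying them to
  the inverse.\<close>

theorem left_invariant_functional:
 "\<exists>I. (\<forall>F\<in>bumps. 0 \<le> I F \<and> (0 < F \<one> --> 0 < I F)) \<and>
   (\<forall>F\<in>bumps. \<forall>F'\<in>bumps. (\<forall>x\<in>\<G>. F x \<le> F' x) --> I F \<le> I F') \<and>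
   (\<forall>F\<in>bumps. \<forall>F'\<in>bumps. I (\<lambda>x. F x + F' x) = I F + I F') \<and>
   (\<forall>F\<in>bumps. \<forall>c\<ge>0. I (\<lambda>x. c * F x) \<le> c * I F) \<and>
   (\<forall>F\<in>bumps. \<forall>s\<in>\<G>. I (\<lambda>x. F (s \<otimes> x)) \<le> (I F :: real))"
proof -
 obtain U :: "nat filter" where U: "U \<le> sequentially" "U \<noteq> bot" "!!P. eventually P U \<or> eventually (\<lambda>x. \<not> P x) U"
  using ex_ultrafilter by blast
 define g where "g n = (\<lambda>x. max 0 (1 - real (Suc n) * \<rho> x))" for n
 have g: "g n \<in> bumps" "0 < g n \<one>" for n using bumps_cone[of "real (Suc n)" 1] by (auto simp: g_def)
 have gs: "\<rho> x < r" if "g n x \<noteq> 0" "1 / Suc n < r" for n x r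
 proof -
  have "real (Suc n) * \<rho> x < 1" using that(1) by (auto simp: g_def max_def split: if_splits)
  then have "\<rho> x < 1 / Suc n" by (simp add: field_simps)
  then show ?thesis using that(2) by linarith
 qed
 define J where "J n F = cn F (g n) / cn (g 0) (g n)" for n F
 have p0: "0 < cn (g 0) (g n)" for n using cn_pos g by blast
 have J0: "0 \<le> J n F" if "F \<in> bumps" for n F using cn_nonneg[OF that g] p0[of n] by (simp add: J_def)
 have JB: "J n F \<le> cn F (g 0)" if "F \<in> bumps" for n F
  using cn_compose[OF that g(1)[of 0] g(2)[of 0] g(1)[of n] g(2)[of n]] p0[of n] by (simp add: J_def divide_le_eq)
 have JP: "1 / cn (g 0) F \<le> J n F" if "F \<in> bumps" "0 < F \<one>" for n F
 proof -
  have "cn (g 0) (g n) \<le> cn (g 0) F * cn F (g n)" using cn_compose[OF g(1) that g] .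
  moreover have "0 < cn (g 0) F" using cn_pos[OF g(1) that g(2)] .
  ultimately show ?thesis using p0[of n] by (simp add: J_def field_simps)
 qed
 define I where "I F = Lim U (\<lambda>n. J n F)" for F
 have lim: "((\<lambda>n. J n F) \<longlongrightarrow> I F) U" if "F \<in> bumps" for F
 proof -
  have "\<exists>l. ((\<lambda>n. J n F) \<longlongrightarrow> l) U"
   using J0[OF that] JB[OF that] by (intro ultrafilter_limit[OF U(2,3), of _ "cn F (g 0)"]) auto
  then show ?thesis unfolding I_def using U(2) by (metis tendsto_Lim)
 qed
 have mono: "I F \<le> I F'" if "F \<in> bumps" "F' \<in> bumps" "!!x. x \<in> \<G> ==> F x \<le> F' x" for F F'
  using cn_mono[OF that(2) g that(3)] p0
  by (intro tendsto_le[OF U(2) lim[OF that(2)] lim[OF that(1)]] always_eventually allI)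
   (auto simp: J_def intro!: divide_right_mono less_imp_le[OF p0])
 have add1: "I (\<lambda>x. F x + F' x) \<le> I F + I F'" if F: "F \<in> bumps" "F' \<in> bumps" for F F'
 proof (rule tendsto_le[OF U(2) tendsto_add[OF lim[OF F(1)] lim[OF F(2)]] lim[OF bumps_add[OF F]]])
  show "\<forall>\<^sub>F n in U. J n (\<lambda>x. F x + F' x) \<le> J n F + J n F'"
   using cn_add[OF F g] p0 by (intro always_eventually allI) (auto simp: J_def simp flip: add_divide_distrib intro!: divide_right_mono less_imp_le[OF p0])
 qed
 have add2: "I F + I F' \<le> I (\<lambda>x. F x + F' x)" if F: "F \<in> bumps" "F' \<in> bumps" for F F'
 proof -
  obtain L R M where f: "0 \<le> L" "0 \<le> R" "0 \<le> M" "!!x. x \<in> \<G> ==> 0 \<le> F x"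
   "!!x. x \<in> \<G> ==> F x \<le> M"
   "!!x y. x \<in> \<G> ==> y \<in> \<G> ==> \<bar>F x - F y\<bar> \<le> L * dst x y"
   "!!x. x \<in> \<G> ==> F x \<noteq> 0 ==> \<rho> x \<le> R" by (rule bumpsE[OF F(1)], rule that)
  obtain L' R' M' where f': "0 \<le> L'" "0 \<le> R'" "0 \<le> M'" "!!x. x \<in> \<G> ==> 0 \<le> F' x"
   "!!x. x \<in> \<G> ==> F' x \<le> M'"
   "!!x y. x \<in> \<G> ==> y \<in> \<G> ==> \<bar>F' x - F' y\<bar> \<le> L' * dst x y"
   "!!x. x \<in> \<G> ==> F' x \<noteq> 0 ==> \<rho> x \<le> R'" by (rule bumpsE[OF F(2)], rule that)
  obtain k where k: "k \<in> bumps" "!!x. x \<in> \<G> ==> \<rho> x \<le> (R + R') + 1 ==> k x = 1"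
   using bumps_cutoff[of "R + R'"] by blast
  have FR: "\<rho> x \<le> R + R'" if "x \<in> \<G>" "F x \<noteq> 0 \<or> F' x \<noteq> 0" for x
   using f(7)[OF that(1)] f'(7)[OF that(1)] that(2) f(2) f'(2) by auto
  have le: "I F + I F' \<le> (1 + 2 * e) * (I (\<lambda>x. F x + F' x) + e * I k)" if e: "0 < e" for e
  proof -
   obtain r where r: "0 < r" "!!g. g \<in> bumps ==> 0 < g \<one> ==> (\<forall>x\<in>\<G>. g x \<noteq> 0 --> \<rho> x < r) ==>
    cn F g + cn F' g \<le> (1 + 2 * e) * (cn (\<lambda>x. F x + F' x) g + e * cn k g)"
    using cn_additive[OF F e k FR] by blast
   have "eventually (\<lambda>n. 1 / real (Suc n) < r) sequentially"
    by (rule order_tendstoD(2)[OF LIMSEQ_Suc[OF lim_1_over_n] r(1)])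
   then have "eventually (\<lambda>n. 1 / real (Suc n) < r) U" using U(1) by (simp add: filter_leD)
   then have ev: "eventually (\<lambda>n. J n F + J n F' \<le> (1 + 2 * e) * (J n (\<lambda>x. F x + F' x) + e * J n k)) U"
   proof (rule eventually_mono)
    fix n assume "1 / real (Suc n) < r"
    then have "cn F (g n) + cn F' (g n) \<le> (1 + 2 * e) * (cn (\<lambda>x. F x + F' x) (g n) + e * cn k (g n))"
     using gs by (intro r(2) g) blast
    from divide_right_mono[OF this less_imp_le[OF p0[of n]]]
    show "J n F + J n F' \<le> (1 + 2 * e) * (J n (\<lambda>x. F x + F' x) + e * J n k)"
     by (simp add: J_def add_divide_distrib algebra_simps)
   qed
   show ?thesis
    by (rule tendsto_le[OF U(2) _ _ ev]) (intro tendsto_intros lim F k bumps_add)+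
  qed
  \<comment> \<open>For each fixed e the ultrafilter limit has already been taken; now e tends to 0
    and both errors vanish.\<close>
  have "((\<lambda>e. (1 + 2 * e) * (I (\<lambda>x. F x + F' x) + e * I k)) \<longlongrightarrow> (1 + 2 * 0) * (I (\<lambda>x. F x + F' x) + 0 * I k)) (at_right 0)"
   by (intro tendsto_intros)
  moreover have "eventually (\<lambda>e. I F + I F' \<le> (1 + 2 * e) * (I (\<lambda>x. F x + F' x) + e * I k)) (at_right 0)"
   using le by (intro eventually_at_rightI[of 0 1]) auto
  ultimately have "I F + I F' \<le> (1 + 2 * 0) * (I (\<lambda>x. F x + F' x) + 0 * I k)"
   by (intro tendsto_lowerbound) auto
  then show ?thesis by simp
 qed
 have scale: "I (\<lambda>x. c * F x) \<le> c * I F" if F: "F \<in> bumps" "0 \<le> c" for F c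
 proof (rule tendsto_le[OF U(2) tendsto_mult_left[OF lim[OF F(1)]] lim[OF bumps_scale[OF F]]])
  show "\<forall>\<^sub>F n in U. J n (\<lambda>x. c * F x) \<le> c * J n F"
   using cn_scale[OF F(1) g F(2)] p0 by (intro always_eventually allI) (auto simp: J_def intro!: divide_right_mono less_imp_le[OF p0])
 qed
 have trans: "I (\<lambda>x. F (s \<otimes> x)) \<le> I F" if F: "F \<in> bumps" "s \<in> \<G>" for F s
 proof (rule tendsto_le[OF U(2) lim[OF F(1)] lim[OF bumps_translate[OF F]]])
  show "\<forall>\<^sub>F n in U. J n (\<lambda>x. F (s \<otimes> x)) \<le> J n F"
   using cn_translate[OF F(1) g F(2)] p0 by (intro always_eventually allI) (auto simp: J_def intro!: divide_right_mono less_imp_le[OF p0])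
 qed
 have nn: "0 \<le> I F" if F: "F \<in> bumps" for F
  by (rule tendsto_lowerbound[OF lim[OF F] _ U(2)]) (use J0[OF F] in simp)
 have pos: "0 < I F" if F: "F \<in> bumps" "0 < F \<one>" for F
 proof -
  have "1 / cn (g 0) F \<le> I F"
   by (rule tendsto_lowerbound[OF lim[OF F(1)] _ U(2)]) (use JP[OF F] in simp)
  moreover have "0 < cn (g 0) F" using cn_pos[OF g(1) F g(2)] .
  ultimately show ?thesis by (smt (verit) zero_less_divide_1_iff)
 qed
 show ?thesis
  by (rule exI[of _ I]) (intro conjI ballI allI impI nn pos mono scale trans antisym add1 add2; simp)
qed

end

section \<open>Word lengths and the existence of characters\<close>

context homogeneous_group
begin

text \<open>Words of k letters from the closed ball of radius r. As \<one> is a letter for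
  nonnegative r, these sets increase with k.\<close>

primrec pw :: "real => nat => 'a set" where
 "pw r 0 = {\<one>}"
| "pw r (Suc k) = {x \<otimes> y |x y. x \<in> \<G> \<and> \<rho> x \<le> r \<and> y \<in> pw r k}"

lemma pw_closed: "x \<in> pw r k ==> x \<in> \<G>"
 by (induction k arbitrary: x) auto

lemma pw_Suc: "x \<in> \<G> ==> \<rho> x \<le> r ==> y \<in> pw r k ==> x \<otimes> y \<in> pw r (Suc k)"
 by auto

lemma pw_1: "x \<in> \<G> ==> \<rho> x \<le> r ==> x \<in> pw r 1"
 using pw_Suc[of x r \<one> 0] by simp

lemma pw_step: "0 \<le> r ==> x \<in> pw r k ==> x \<in> pw r (Suc k)"
 using pw_Suc[of \<one> r x k] pw_closed[of x r k] by simp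

lemma pw_mono:
 assumes "0 \<le> r" "k \<le> l" "x \<in> pw r k"
 shows "x \<in> pw r l"
 using assms(2) by (induction l rule: dec_induct) (use assms pw_step in blast)+

lemma pw_add: "x \<in> pw r k ==> y \<in> pw r l ==> x \<otimes> y \<in> pw r (k + l)"
proof (induction k arbitrary: x)
 case 0
 then show ?case using pw_closed[of y] by simp
next
 case (Suc k)
 then obtain u v where uv: "x = u \<otimes> v" "u \<in> \<G>" "\<rho> u \<le> r" "v \<in> pw r k" by auto
 then have "u \<otimes> (v \<otimes> y) \<in> pw r (Suc (k + l))" using Suc by (intro pw_Suc) auto
 then show ?case using uv pw_closed[of v] pw_closed[of y] Suc(3) by (simp add: m_assoc)
qed

lemma pw_inv: "x \<in> pw r k ==> inv x \<in> pw r k"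
proof (induction k arbitrary: x)
 case (Suc k)
 then obtain u v where uv: "x = u \<otimes> v" "u \<in> \<G>" "\<rho> u \<le> r" "v \<in> pw r k" by auto
 then have "inv v \<otimes> inv u \<in> pw r (k + 1)" using Suc by (intro pw_add pw_1) (auto simp: rho_inv)
 then show ?case using uv pw_closed[of v] by (simp add: inv_mult_group)
qed simp

lemma pw_funpow: "x \<in> pw r k ==> (\<alpha> ^^ n) x \<in> pw (\<theta> ^ n * r) k"
proof (induction k arbitrary: x)
 case 0
 then show ?case using ap_one[of "int n"] by (simp add: ap_of_nat)
next
 case (Suc k)
 then obtain u v where uv: "x = u \<otimes> v" "u \<in> \<G>" "\<rho> u \<le> r" "v \<in> pw r k" by auto
 have "(\<alpha> ^^ n) u \<otimes> (\<alpha> ^^ n) v \<in> pw (\<theta> ^ n * r) (Suc k)"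
  using uv Suc theta by (intro pw_Suc) (auto simp: rho_funpow)
 then show ?case using uv pw_closed[of v] by simp
qed

lemma pw_unfunpow: "x \<in> pw (\<theta> ^ n * r) k ==> ap (- int n) x \<in> pw r k"
proof (induction k arbitrary: x)
 case (Suc k)
 then obtain u v where uv: "x = u \<otimes> v" "u \<in> \<G>" "\<rho> u \<le> \<theta> ^ n * r" "v \<in> pw (\<theta> ^ n * r) k" by auto
 have "\<rho> (ap (- int n) u) \<le> r" using uv theta by (simp add: rho_ap power_int_minus field_simps)
 then have "ap (- int n) u \<otimes> ap (- int n) v \<in> pw r (Suc k)"
  using uv Suc by (intro pw_Suc) auto
 then show ?case using uv pw_closed[of v] by simp
qed simp

lemma conn_pw:
 assumes "conn" "0 < r" "x \<in> \<G>"
 shows "\<exists>k. x \<in> pw r k"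
proof -
 define U where "U = {x. \<exists>k. x \<in> pw r k}"
 have "subgroup U G"
 proof (rule subgroupI)
  have "\<one> \<in> pw r 0" by simp
  then show "U \<noteq> {}" unfolding U_def by blast
  show "U \<subseteq> \<G>" using pw_closed by (auto simp: U_def)
  show "inv a \<in> U" if "a \<in> U" for a using that pw_inv by (auto simp: U_def)
  show "a \<otimes> b \<in> U" if "a \<in> U" "b \<in> U" for a b using that pw_add unfolding U_def by blast
 qed
 moreover have "\<forall>x\<in>\<G>. \<rho> x < r --> x \<in> U"
 proof (intro ballI impI)
  fix x assume "x \<in> \<G>" "\<rho> x < r"
  then have "x \<in> pw r 1" by (intro pw_1) auto
  then show "x \<in> U" unfolding U_def by blast
 qed
 ultimately have "U = \<G>" using assms(1,2) unfolding conn_def opensub_def by blast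
 then show ?thesis using assms(3) by (auto simp: U_def)
qed

text \<open>Word length for the ball of radius r as alphabet. For a connected group and positive r
  the minimum exists by \<open>conn_pw\<close>.\<close>

definition wl :: "real => 'a => nat" where
 "wl r g = (LEAST k. g \<in> pw r k)"

lemma wl_pw: "conn ==> 0 < r ==> g \<in> \<G> ==> g \<in> pw r (wl r g)"
 unfolding wl_def by (rule LeastI_ex) (rule conn_pw)

lemma wl_le: "g \<in> pw r k ==> wl r g \<le> k"
 unfolding wl_def by (rule Least_le)

lemma wl_mult: "conn ==> 0 < r ==> g \<in> \<G> ==> h \<in> \<G> ==> wl r (g \<otimes> h) \<le> wl r g + wl r h"
 by (intro wl_le pw_add wl_pw)

lemma wl_ball: "g \<in> \<G> ==> \<rho> g \<le> r ==> wl r g \<le> 1"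
 by (intro wl_le pw_1)

lemma wl_funpow:
 assumes "conn" "v \<in> \<G>"
 shows "wl (\<theta> ^ n) ((\<alpha> ^^ n) v) \<le> wl 1 v"
 using pw_funpow[OF wl_pw[OF assms(1) _ assms(2), of 1], of n] by (intro wl_le) simp

text \<open>A finite \<theta>-net of the unit ball leaves one more letter to append, so the word
  lengths of the net points bound all lengths.\<close>

lemma unit_ball_words:
 assumes conn
 shows "\<exists>M. \<forall>x\<in>\<G>. \<rho> x \<le> 1 --> x \<in> pw \<theta> M"
proof -
 obtain F where F: "finite F" "F \<subseteq> \<G>" "!!x. x \<in> \<G> ==> \<rho> x \<le> 1 ==> \<exists>y\<in>F. dst y x < \<theta>"
  using totally_bounded[OF theta(1), of 1] by blast
 define M where "M = Suc (\<Sum>y\<in>F. wl \<theta> y)"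
 have "x \<in> pw \<theta> M" if x: "x \<in> \<G>" "\<rho> x \<le> 1" for x
 proof -
  obtain y where y: "y \<in> F" "dst y x < \<theta>" using F(3)[OF x] by blast
  have yc: "y \<in> \<G>" using y F by blast
  have "y \<otimes> (inv y \<otimes> x) \<in> pw \<theta> (wl \<theta> y + 1)"
   using y x yc by (intro pw_add pw_1 wl_pw assms theta) auto
  moreover have "wl \<theta> y \<le> (\<Sum>y\<in>F. wl \<theta> y)" using F y by (intro member_le_sum) auto
  ultimately show ?thesis using x yc theta pw_mono[of \<theta> "wl \<theta> y + 1" M x] by (simp add: M_def)
 qed
 then show ?thesis by blast
qed

text \<open>Self-similarity: the constant M for passing from letters of size 1 to letters of size
  \<theta> serves at every scale after applying \<alpha>, so a refinements cost the factor M ^ a,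
  independently of m.\<close>

lemma pw_refine:
 assumes M: "\<forall>x\<in>\<G>. \<rho> x \<le> 1 --> x \<in> pw \<theta> M"
 shows "x \<in> pw (\<theta> ^ m) k ==> x \<in> pw (\<theta> ^ (m + a)) (M ^ a * k)"
proof (induction a)
 case (Suc a)
 have ball: "u \<in> pw (\<theta> ^ Suc n) M" if u: "u \<in> \<G>" "\<rho> u \<le> \<theta> ^ n" for u n
 proof -
  have "ap (- int n) u \<in> pw \<theta> M"
   using M u theta by (simp add: rho_ap power_int_minus field_simps)
  from pw_funpow[OF this, of n] show ?thesis
   using u ap_cancel(1)[of u "int n"] by (simp add: ap_of_nat mult.commute)
 qed
 have ref: "y \<in> pw (\<theta> ^ Suc n) (M * k)" if "y \<in> pw (\<theta> ^ n) k" for y n k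
  using that
 proof (induction k arbitrary: y)
  case (Suc k)
  then obtain u v where uv: "y = u \<otimes> v" "u \<in> \<G>" "\<rho> u \<le> \<theta> ^ n" "v \<in> pw (\<theta> ^ n) k" by auto
  then show ?case using pw_add[OF ball[OF uv(2,3)] Suc.IH[OF uv(4)]] by simp
 qed simp
 show ?case using ref[OF Suc.IH[OF Suc.prems]] by (simp add: algebra_simps)
qed simp

text \<open>Continuous homomorphisms into the reals. Continuity is encoded as boundedness on the
  unit ball, which is equivalent for homomorphisms and easier to check for limits; see
  \<open>chr_small\<close>.\<close>

definition chr :: "('a => real) => bool" where
 "chr \<xi> \<longleftrightarrow> (\<forall>x\<in>\<G>. \<forall>y\<in>\<G>. \<xi> (x \<otimes> y) = \<xi> x + \<xi> y) \<and>
   (\<exists>K. \<forall>x\<in>\<G>. \<rho> x \<le> 1 --> \<bar>\<xi> x\<bar> \<le> K)"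

definition f0 :: "'a => real" where "f0 x = max 0 (1 - 4 * \<rho> x)"

text \<open>A Gleason function: the sup-convolution of the cone \<open>f0\<close> with word length
  at slope 1 / \<tau>. A left translation by h changes it by at most wl r h / \<tau>, while it stays
  Lipschitz with the constant 4 of \<open>f0\<close>, whatever r and \<tau> are.\<close>

definition phi :: "real => real => 'a => real" where
 "phi r \<tau> x = (SUP g\<in>\<G>. max 0 (f0 (inv g \<otimes> x) - wl r g / \<tau>))"

lemma f0_bumps: "f0 \<in> bumps"
 unfolding f0_def[abs_def] by (rule bumps_cone) simp

lemma f0_range: "x \<in> \<G> ==> 0 \<le> f0 x \<and> f0 x \<le> 1"
 using rho_nonneg by (simp add: f0_def)

lemma f0_lip: "x \<in> \<G> ==> y \<in> \<G> ==> f0 x \<le> f0 y + 4 * dst x y"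
 using rho_lipschitz[of x y] rho_nonneg[of "inv x \<otimes> y"] by (simp add: f0_def max_def abs_le_iff)

lemma phi_bdd: "0 < \<tau> ==> x \<in> \<G> ==> bdd_above ((\<lambda>g. max 0 (f0 (inv g \<otimes> x) - wl r g / \<tau>)) ` \<G>)"
proof (rule bdd_aboveI2[of _ _ 1])
 fix g assume "0 < \<tau>" "x \<in> \<G>" "g \<in> \<G>"
 then have "f0 (inv g \<otimes> x) \<le> 1" "0 \<le> wl r g / \<tau>" using f0_range[of "inv g \<otimes> x"] by auto
 then show "max 0 (f0 (inv g \<otimes> x) - wl r g / \<tau>) \<le> 1" by linarith
qed

lemma phi_ge: "0 < \<tau> ==> x \<in> \<G> ==> g \<in> \<G> ==> max 0 (f0 (inv g \<otimes> x) - wl r g / \<tau>) \<le> phi r \<tau> x"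
 unfolding phi_def by (rule cSUP_upper[OF _ phi_bdd])

lemma phi_le: "(!!g. g \<in> \<G> ==> f0 (inv g \<otimes> x) - wl r g / \<tau> \<le> c) ==> 0 \<le> c ==> phi r \<tau> x \<le> c"
 unfolding phi_def by (rule cSUP_least) auto

lemma phi_nonneg: "0 < \<tau> ==> x \<in> \<G> ==> 0 \<le> phi r \<tau> x"
 using phi_ge[of \<tau> x \<one> r] by simp

lemma phi_f0: "0 < \<tau> ==> x \<in> \<G> ==> f0 x \<le> phi r \<tau> x"
proof -
 assume a: "0 < \<tau>" "x \<in> \<G>"
 have "wl r \<one> = 0" using wl_le[of \<one> r 0] by simp
 then show ?thesis using phi_ge[OF a, of \<one> r] a by simp
qed

lemma phi_left:
 assumes "conn" "0 < r" "0 < \<tau>" "x \<in> \<G>" "h \<in> \<G>"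
 shows "phi r \<tau> (h \<otimes> x) \<le> phi r \<tau> x + wl r h / \<tau>"
proof (rule phi_le)
 fix g assume g: "g \<in> \<G>"
 have "wl r (inv h \<otimes> g) \<le> wl r (inv h) + wl r g" using wl_mult assms g by simp
 also have "wl r (inv h) \<le> wl r h" using pw_inv[OF wl_pw] assms by (intro wl_le) auto
 finally have "wl r (inv h \<otimes> g) / \<tau> \<le> (wl r h + wl r g) / \<tau>" using assms by (intro divide_right_mono) auto
 moreover have "f0 (inv (inv h \<otimes> g) \<otimes> x) - wl r (inv h \<otimes> g) / \<tau> \<le> phi r \<tau> x"
  using phi_ge[OF assms(3,4), of "inv h \<otimes> g" r] assms g by simp
 moreover have "inv (inv h \<otimes> g) \<otimes> x = inv g \<otimes> (h \<otimes> x)" using assms g by (simp add: gsimps)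
 ultimately show "f0 (inv g \<otimes> (h \<otimes> x)) - wl r g / \<tau> \<le> phi r \<tau> x + wl r h / \<tau>"
  by (simp add: add_divide_distrib)
qed (use phi_nonneg assms in auto)

lemma phi_left_abs:
 assumes "conn" "0 < r" "0 < \<tau>" "x \<in> \<G>" "h \<in> \<G>"
 shows "\<bar>phi r \<tau> (h \<otimes> x) - phi r \<tau> x\<bar> \<le> wl r h / \<tau>"
proof -
 have "wl r (inv h) \<le> wl r h" using pw_inv[OF wl_pw] assms by (intro wl_le) auto
 then have "wl r (inv h) / \<tau> \<le> wl r h / \<tau>" using assms by (intro divide_right_mono) auto
 then show ?thesis using phi_left[OF assms] phi_left[OF assms(1-3), of "h \<otimes> x" "inv h"] assms by simp
qed

text \<open>As \<open>f0\<close> is at most 1, only g with fewer than \<tau> letters contribute.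
  These lie in the ball of radius 1/4 by hypothesis, and \<open>f0\<close> adds another 1/4 to the
  support.\<close>

lemma phi_bumps:
 fixes \<tau> :: real
 assumes "conn" "0 < r" "0 < \<tau>" "!!g. g \<in> \<G> ==> wl r g < \<tau> ==> \<rho> g \<le> 1/4"
 shows "phi r \<tau> \<in> bumps" "!!x. x \<in> \<G> ==> phi r \<tau> x \<noteq> 0 ==> \<rho> x \<le> 1/2"
proof -
 show supp: "\<rho> x \<le> 1/2" if x: "x \<in> \<G>" "phi r \<tau> x \<noteq> 0" for x
 proof (rule ccontr)
  assume neg: "\<not> \<rho> x \<le> 1/2"
  have "phi r \<tau> x \<le> 0"
  proof (rule phi_le)
   fix g assume g: "g \<in> \<G>"
   show "f0 (inv g \<otimes> x) - wl r g / \<tau> \<le> 0"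
   proof (cases "wl r g < \<tau>")
    case True
    then have "\<rho> g \<le> 1/4" using assms(4) g by blast
    then have "1/4 < dst g x" using neg rho_diff[OF g x(1)] by linarith
    then show ?thesis using assms(3) by (simp add: f0_def)
   next
    case False
    then have "1 \<le> wl r g / \<tau>" using assms(3) by (simp add: field_simps)
    then show ?thesis using f0_range[of "inv g \<otimes> x"] x g by simp
   qed
  qed simp
  then show False using phi_nonneg[OF assms(3) x(1), of r] x(2) by simp
 qed
 have lip: "phi r \<tau> x \<le> phi r \<tau> y + 4 * dst x y" if xy: "x \<in> \<G>" "y \<in> \<G>" for x y
 proof (rule phi_le)
  fix g assume g: "g \<in> \<G>"
  have "f0 (inv g \<otimes> x) \<le> f0 (inv g \<otimes> y) + 4 * dst x y"
   using f0_lip[of "inv g \<otimes> x" "inv g \<otimes> y"] g xy by (simp add: gsimps)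
  then show "f0 (inv g \<otimes> x) - wl r g / \<tau> \<le> phi r \<tau> y + 4 * dst x y"
   using phi_ge[OF assms(3) xy(2) g, of r] by simp
 qed (use phi_nonneg[OF assms(3) xy(2), of r] rho_nonneg[of "inv x \<otimes> y"] xy in auto)
 show "phi r \<tau> \<in> bumps"
 proof (rule bumpsI[of _ 4 "1/2"])
  fix x y assume xy: "x \<in> \<G>" "y \<in> \<G>"
  show "\<bar>phi r \<tau> x - phi r \<tau> y\<bar> \<le> 4 * dst x y"
   using lip[OF xy] lip[OF xy(2,1)] dist_sym[OF xy] by simp
 qed (use supp phi_nonneg[OF assms(3)] in auto)
qed

text \<open>The cone is Lipschitz under right displacements, so the left translation by u is
  rewritten as right displacement by the conjugate inv y \<otimes> u \<otimes> y, small uniformly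
  for \<rho> y \<le> 2. Farther out both values vanish; the majorant e * k makes the bound
  integrable.\<close>

lemma f0_translate_small:
 assumes "0 < e" "k \<in> bumps" "!!x. x \<in> \<G> ==> \<rho> x \<le> 2 ==> k x = 1"
 shows "\<exists>d>0. \<forall>u\<in>\<G>. \<rho> u < d --> (\<forall>y\<in>\<G>. \<bar>f0 (inv u \<otimes> y) - f0 y\<bar> \<le> e * k y)"
proof -
 obtain d where d: "0 < d" "!!x z. x \<in> \<G> ==> z \<in> \<G> ==> \<rho> x \<le> 2 ==> \<rho> z < d ==>
   \<rho> (x \<otimes> z \<otimes> inv x) < e / 4 \<and> \<rho> (inv x \<otimes> z \<otimes> x) < e / 4"
  using rho_conj_uniform'[of "e / 4" 2] assms(1) by auto
 show ?thesis
 proof (intro exI[of _ "min d 1"] conjI ballI impI)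
  fix u y assume u: "u \<in> \<G>" "\<rho> u < min d 1" and y: "y \<in> \<G>"
  show "\<bar>f0 (inv u \<otimes> y) - f0 y\<bar> \<le> e * k y"
  proof (cases "\<rho> y \<le> 2")
   case True
   have "\<rho> (inv y \<otimes> u \<otimes> y) < e / 4" using d(2)[OF y u(1) True] u by auto
   moreover have "inv (inv u \<otimes> y) \<otimes> y = inv y \<otimes> u \<otimes> y" using u y by (simp add: gsimps)
   moreover have "dst y (inv u \<otimes> y) = \<rho> (inv y \<otimes> u \<otimes> y)"
    using rho_inv[of "inv y \<otimes> u \<otimes> y"] u y by (simp add: gsimps)
   ultimately show ?thesis
    using f0_lip[of "inv u \<otimes> y" y] f0_lip[of y "inv u \<otimes> y"] u y assms(3)[OF y True] by simp
  next
   case False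
   have "1 < dst u y" using rho_diff[of u y] u y False by simp
   then have "f0 (inv u \<otimes> y) = 0" "f0 y = 0" using False by (auto simp: f0_def)
   moreover have "0 \<le> k y" using assms(2) y by (auto simp: bumps_def)
   ultimately show ?thesis using assms(1) by simp
  qed
 qed (use d in auto)
qed

text \<open>\<xi> is a limit of rescaled difference quotients. The word-length slope makes first
  differences of the Gleason functions \<phi> of order 1 / \<tau>; smoothing \<phi> against
  \<open>f0\<close> with the invariant functional makes second differences of smaller order, so the
  limit is additive. It is not zero, because the smoothed function \<psi> must fall from a fixed
  positive value to 0 within the number of steps needed to leave the unit ball.\<close>

theorem exists_character:
 assumes conn: conn and nt: "\<G> \<noteq> {\<one>}"
 shows "\<exists>\<xi>. chr \<xi> \<and> (\<exists>x\<in>\<G>. \<xi> x \<noteq> 0)"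
proof -
 obtain I where I: "\<forall>F\<in>bumps. (0::real) \<le> I F \<and> (0 < F \<one> --> 0 < I F)"
   "\<forall>F\<in>bumps. \<forall>F'\<in>bumps. (\<forall>x\<in>\<G>. F x \<le> F' x) --> I F \<le> I F'"
   "\<forall>F\<in>bumps. \<forall>F'\<in>bumps. I (\<lambda>x. F x + F' x) = I F + I F'"
   "\<forall>F\<in>bumps. \<forall>c\<ge>0. I (\<lambda>x. c * F x) \<le> c * I F"
   "\<forall>F\<in>bumps. \<forall>s\<in>\<G>. I (\<lambda>x. F (s \<otimes> x)) \<le> I F"
  using left_invariant_functional by (elim exE conjE) (rule that)
 note I0 = I(1)[rule_format, THEN conjunct1] and Ipos = I(1)[rule_format, THEN conjunct2, rule_format]
  and Imono = I(2)[rule_format] and Iadd = I(3)[rule_format] and Iscale = I(4)[rule_format] and Itr = I(5)[rule_format]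
 have Icong: "I F = I F'" if "F \<in> bumps" "F' \<in> bumps" "!!x. x \<in> \<G> ==> F x = F' x" for F F'
  using Imono[OF that(1,2)] Imono[OF that(2,1)] that(3) by (simp add: antisym)
 have Iinv: "I (\<lambda>x. F (s \<otimes> x)) = I F" if F: "F \<in> bumps" and s: "s \<in> \<G>" for F s
 proof -
  note t = bumps_translate[OF F s]
  have ic: "inv s \<in> \<G>" using s by simp
  have "I F = I (\<lambda>x. F (s \<otimes> (inv s \<otimes> x)))"
   using s by (intro Icong F bumps_translate[OF t ic]) simp
  also have "\<dots> \<le> I (\<lambda>x. F (s \<otimes> x))" by (rule Itr[OF t ic])
  finally show ?thesis using Itr[OF F s] by simp
 qed
 have Iabs: "\<bar>I A - I B\<bar> \<le> I C" if b: "A \<in> bumps" "B \<in> bumps" "C \<in> bumps"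
  and le: "!!x. x \<in> \<G> ==> \<bar>A x - B x\<bar> \<le> C x" for A B C
 proof -
  have "I A \<le> I (\<lambda>x. B x + C x)" using le by (intro Imono b bumps_add) (auto simp: abs_le_iff algebra_simps)
  moreover have "I B \<le> I (\<lambda>x. A x + C x)" using le by (intro Imono b bumps_add) (auto simp: abs_le_iff algebra_simps)
  ultimately show ?thesis using Iadd[OF b(2,3)] Iadd[OF b(1,3)] by simp
 qed
 obtain k2 where k2: "k2 \<in> bumps" "!!x. x \<in> \<G> ==> \<rho> x \<le> 2 ==> k2 x = 1"
  using bumps_cutoff[of 1] by auto
 obtain M where M: "\<forall>x\<in>\<G>. \<rho> x \<le> 1 --> x \<in> pw \<theta> M" using unit_ball_words[OF conn] by blast
 \<comment> \<open>Shrinking the letters by \<theta> ^ a turns words that stay in the unit ball into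
   words that stay in the ball of radius 1/4, as \<open>phi_bumps\<close> requires.\<close>
 obtain a where a: "\<theta> ^ a < 1 / 4" using theta_pow_small[of "1/4" 1] by auto
 obtain x0 where x0: "x0 \<in> \<G>" "x0 \<noteq> \<one>" using nt by fastforce
 obtain x1 where x1: "x1 \<in> \<G>" "1 < \<rho> x1"
 proof -
  have "0 < \<rho> x0" using rho_pos x0 by blast
  then obtain n where n: "\<theta> ^ n * 1 < \<rho> x0" using theta_pow_small by blast
  have "1 < \<rho> (ap (- int n) x0)" using n x0 theta by (simp add: rho_ap power_int_minus field_simps)
  then show ?thesis using that[of "ap (- int n) x0"] x0 by simp
 qed
 \<comment> \<open>The escape time from the unit ball with steps of size \<theta> ^ m. It will be
   the slope parameter \<tau> m.\<close>
 define t where "t m = (LEAST k. \<exists>x\<in>pw (\<theta> ^ m) k. 1 < \<rho> x)" for m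
 have thp: "0 < \<theta> ^ m" "\<theta> ^ m \<le> 1" for m using theta by (auto intro: power_le_one)
 have tex: "\<exists>x\<in>pw (\<theta> ^ m) (t m). 1 < \<rho> x" for m
 proof -
  have "\<exists>k. \<exists>x\<in>pw (\<theta> ^ m) k. 1 < \<rho> x" using wl_pw[OF conn thp(1) x1(1), of m] x1(2) by blast
  then show ?thesis unfolding t_def by (rule LeastI_ex)
 qed
 have tlt: "\<rho> x \<le> 1" if "k < t m" "x \<in> pw (\<theta> ^ m) k" for k m x
  using not_less_Least[of k "\<lambda>k. \<exists>x\<in>pw (\<theta> ^ m) k. 1 < \<rho> x"] that unfolding t_def by force
 have t0: "0 < t m" for m
 proof (rule ccontr)
  assume "\<not> 0 < t m"
  then show False using tex[of m] by simp
 qed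
 have tgrow: "t (m + a) \<le> M ^ a * t m" for m
 proof -
  obtain x where x: "x \<in> pw (\<theta> ^ m) (t m)" "1 < \<rho> x" using tex by blast
  show ?thesis unfolding t_def[of "m + a"]
   by (rule Least_le) (use pw_refine[OF M x(1), of a] x(2) in blast)
 qed
 define r where "r m = \<theta> ^ (m + a)" for m
 define \<tau> where "\<tau> m = real (t m)" for m
 have rpos: "0 < r m" "r m \<le> 1" for m using thp by (auto simp: r_def)
 have \<tau>pos: "0 < \<tau> m" for m using t0 by (simp add: \<tau>_def)
 have small: "\<rho> g \<le> 1/4" if g: "g \<in> \<G>" "wl (r m) g < \<tau> m" for g m
 proof -
  have "g \<in> pw (\<theta> ^ a * \<theta> ^ m) (wl (r m) g)" using wl_pw[OF conn rpos(1) g(1), of m] by (simp add: r_def power_add mult.commute)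
  then have "ap (- int a) g \<in> pw (\<theta> ^ m) (wl (r m) g)" by (rule pw_unfunpow)
  then have "\<rho> (ap (- int a) g) \<le> 1" using g tlt by (simp add: \<tau>_def)
  then have "\<rho> g \<le> \<theta> ^ a" using g theta by (simp add: rho_ap power_int_minus field_simps)
  then show ?thesis using a by linarith
 qed
 define \<phi> where "\<phi> m = phi (r m) (\<tau> m)" for m
 have \<phi>b: "\<phi> m \<in> bumps" and \<phi>s: "!!x. x \<in> \<G> ==> \<phi> m x \<noteq> 0 ==> \<rho> x \<le> 1/2" for m
  unfolding \<phi>_def using phi_bumps[OF conn rpos(1)[of m] \<tau>pos[of m] small[of _ m]] by blast+
 have \<phi>l: "\<bar>\<phi> m (h \<otimes> x) - \<phi> m x\<bar> \<le> wl (r m) h / \<tau> m" if "x \<in> \<G>" "h \<in> \<G>" for x h m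
  unfolding \<phi>_def using phi_left_abs[OF conn rpos(1) \<tau>pos that] .
 \<comment> \<open>Pairing translates of \<phi> with \<open>f0\<close> is the smoothing: a
   translation acting on \<phi> can be moved over to the fixed Lipschitz function
   \<open>f0\<close>.\<close>
 define \<psi> where "\<psi> m x = I (\<lambda>y. \<phi> m (x \<otimes> y) * f0 y)" for m x
 have pb: "(\<lambda>y. \<phi> m (x \<otimes> y) * f0 y) \<in> bumps" if "x \<in> \<G>" for m x
  by (rule bumps_mult[OF bumps_translate[OF \<phi>b that] f0_bumps])
 define If where "If = I f0"
 have If: "0 \<le> If" using I0 f0_bumps by (simp add: If_def)
 have d1: "\<bar>\<psi> m (g \<otimes> x) - \<psi> m x\<bar> \<le> wl (r m) g / \<tau> m * If" if gx: "g \<in> \<G>" "x \<in> \<G>" for g x m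
 proof -
  have w: "0 \<le> wl (r m) g / \<tau> m" using \<tau>pos[of m] by simp
  have "\<bar>\<psi> m (g \<otimes> x) - \<psi> m x\<bar> \<le> I (\<lambda>y. wl (r m) g / \<tau> m * f0 y)"
   unfolding \<psi>_def
  proof (rule Iabs[OF pb pb bumps_scale[OF f0_bumps w]])
   fix y assume y: "y \<in> \<G>"
   have "\<bar>\<phi> m (g \<otimes> x \<otimes> y) - \<phi> m (x \<otimes> y)\<bar> * f0 y \<le> wl (r m) g / \<tau> m * f0 y"
    using \<phi>l[of "x \<otimes> y" g m] gx y f0_range[OF y] by (intro mult_right_mono) (auto simp: m_assoc)
   then show "\<bar>\<phi> m (g \<otimes> x \<otimes> y) * f0 y - \<phi> m (x \<otimes> y) * f0 y\<bar> \<le> wl (r m) g / \<tau> m * f0 y"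
    using f0_range[OF y] by (simp add: abs_mult flip: left_diff_distrib)
  qed (use gx in auto)
  also have "\<dots> \<le> wl (r m) g / \<tau> m * If" unfolding If_def by (rule Iscale[OF f0_bumps w])
  finally show ?thesis .
 qed
 define c0 where "c0 = I (\<lambda>y. f0 y * f0 y)"
 have ff: "(\<lambda>y. f0 y * f0 y) \<in> bumps" by (rule bumps_mult[OF f0_bumps f0_bumps])
 have c0: "0 < c0" unfolding c0_def by (rule Ipos[OF ff]) (simp add: f0_def)
 have \<psi>1: "c0 \<le> \<psi> m \<one>" for m
  unfolding c0_def \<psi>_def
 proof (rule Imono[OF ff pb])
  fix y assume y: "y \<in> \<G>"
  show "f0 y * f0 y \<le> \<phi> m (\<one> \<otimes> y) * f0 y"
   using phi_f0[OF \<tau>pos[of m] y, of "r m"] f0_range[OF y] y by (intro mult_right_mono) (auto simp: \<phi>_def)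
 qed simp
 have \<psi>0: "\<psi> m x = 0" if x: "x \<in> \<G>" "3/4 < \<rho> x" for x m
 proof -
  have "\<psi> m x \<le> I (\<lambda>y. 0 * f0 y)"
   unfolding \<psi>_def
  proof (rule Imono[OF pb[OF x(1)] bumps_scale[OF f0_bumps]])
   fix y assume y: "y \<in> \<G>"
   show "\<phi> m (x \<otimes> y) * f0 y \<le> 0 * f0 y"
   proof (cases "\<rho> y < 1/4")
    case True
    then have "1/2 < \<rho> (x \<otimes> y)" using rho_mult[of "x \<otimes> y" "inv y"] x y by (simp add: rho_inv m_assoc)
    then have "\<phi> m (x \<otimes> y) = 0" using \<phi>s[of "x \<otimes> y" m] x y by force
    then show ?thesis by simp
   qed (simp add: f0_def)
  qed simp
  also have "\<dots> \<le> 0" using Iscale[OF f0_bumps, of 0] by simp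
  finally show ?thesis using I0[OF pb[OF x(1)], of m] by (simp add: \<psi>_def)
 qed
 \<comment> \<open>Substituting inv u \<otimes> y for y, with u = inv x \<otimes> h \<otimes> x,
   moves the displacement h onto \<open>f0\<close>. The second difference then becomes the integral
   of a first difference of \<phi>, of order 1 / \<tau>, times a small difference of
   \<open>f0\<close>.\<close>
 have d2: "\<exists>d>0. \<forall>m. \<forall>g\<in>\<G>. \<forall>h\<in>\<G>. \<forall>x\<in>\<G>. \<rho> x \<le> 2 --> \<rho> h < d -->
   \<bar>\<psi> m (g \<otimes> h \<otimes> x) - \<psi> m (h \<otimes> x) - \<psi> m (g \<otimes> x) + \<psi> m x\<bar> \<le> wl (r m) g / \<tau> m * e" if e: "0 < e" for e
 proof -
  define Ik where "Ik = I k2"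
  have Ik: "0 \<le> Ik" using I0 k2 by (simp add: Ik_def)
  define e' where "e' = e / (Ik + 1)"
  have e': "0 < e'" using e Ik by (simp add: e'_def)
  obtain d where d: "0 < d" "!!u y. u \<in> \<G> ==> \<rho> u < d ==> y \<in> \<G> ==> \<bar>f0 (inv u \<otimes> y) - f0 y\<bar> \<le> e' * k2 y"
   using f0_translate_small[OF e' k2] by blast
  obtain d' where d': "0 < d'" "!!x z. x \<in> \<G> ==> z \<in> \<G> ==> \<rho> x \<le> 2 ==> \<rho> z < d' ==>
   \<rho> (x \<otimes> z \<otimes> inv x) < d \<and> \<rho> (inv x \<otimes> z \<otimes> x) < d"
   using rho_conj_uniform'[OF d(1), of 2] by auto
  show ?thesis
  proof (intro exI[of _ d'] conjI allI ballI impI)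
   fix m g h x assume c: "g \<in> \<G>" "h \<in> \<G>" "x \<in> \<G>" and xh: "\<rho> x \<le> 2" "\<rho> h < d'"
   define u where "u = inv x \<otimes> h \<otimes> x"
   have uc: "u \<in> \<G>" using c by (simp add: u_def)
   have ud: "\<rho> u < d" using d'(2)[OF c(3,2) xh] by (simp add: u_def)
   have w: "0 \<le> wl (r m) g / \<tau> m" using \<tau>pos[of m] by simp
   have tw: "\<psi> m (z \<otimes> h \<otimes> x) = I (\<lambda>y. \<phi> m (z \<otimes> x \<otimes> y) * f0 (inv u \<otimes> y))" if z: "z \<in> \<G>" for z
   proof -
    have zc: "z \<otimes> h \<otimes> x \<in> \<G>" using z c by simp
    have "\<psi> m (z \<otimes> h \<otimes> x) = I (\<lambda>y. \<phi> m (z \<otimes> h \<otimes> x \<otimes> (inv u \<otimes> y)) * f0 (inv u \<otimes> y))"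
     unfolding \<psi>_def using Iinv[OF pb[OF zc], of "inv u" m] uc by simp
    also have "\<dots> = I (\<lambda>y. \<phi> m (z \<otimes> x \<otimes> y) * f0 (inv u \<otimes> y))"
    proof (rule Icong)
     show "(\<lambda>y. \<phi> m (z \<otimes> h \<otimes> x \<otimes> (inv u \<otimes> y)) * f0 (inv u \<otimes> y)) \<in> bumps"
      using bumps_translate[OF pb[OF zc], of "inv u" m] uc by simp
     show "(\<lambda>y. \<phi> m (z \<otimes> x \<otimes> y) * f0 (inv u \<otimes> y)) \<in> bumps"
      using z c uc by (intro bumps_mult bumps_translate \<phi>b f0_bumps) auto
    qed (use z c in \<open>simp add: u_def gsimps\<close>)
    finally show ?thesis .
   qed
   define A1 where "A1 = (\<lambda>y. \<phi> m (g \<otimes> x \<otimes> y) * f0 (inv u \<otimes> y))"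
   define A2 where "A2 = (\<lambda>y. \<phi> m (x \<otimes> y) * f0 (inv u \<otimes> y))"
   define A3 where "A3 = (\<lambda>y. \<phi> m (g \<otimes> x \<otimes> y) * f0 y)"
   define A4 where "A4 = (\<lambda>y. \<phi> m (x \<otimes> y) * f0 y)"
   have Ab: "A1 \<in> bumps" "A2 \<in> bumps" "A3 \<in> bumps" "A4 \<in> bumps"
    unfolding A1_def A2_def A3_def A4_def using c uc by (auto intro!: bumps_mult bumps_translate \<phi>b f0_bumps)
   have e1: "\<psi> m (g \<otimes> h \<otimes> x) = I A1" unfolding A1_def by (rule tw[OF c(1)])
   have e2: "\<psi> m (h \<otimes> x) = I A2"
   proof -
    have "\<psi> m (h \<otimes> x) = \<psi> m (\<one> \<otimes> h \<otimes> x)" using c by simp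
    also have "\<dots> = I (\<lambda>y. \<phi> m (\<one> \<otimes> x \<otimes> y) * f0 (inv u \<otimes> y))" by (rule tw) simp
    finally show ?thesis using c by (simp add: A2_def)
   qed
   have e3: "\<psi> m (g \<otimes> x) = I A3" and e4: "\<psi> m x = I A4" by (simp_all add: A3_def A4_def \<psi>_def)
   have we: "0 \<le> wl (r m) g / \<tau> m * e'" using w e' by (intro mult_nonneg_nonneg) auto
   have kb: "(\<lambda>y. wl (r m) g / \<tau> m * e' * k2 y) \<in> bumps" by (rule bumps_scale[OF k2(1) we])
   have "\<bar>I (\<lambda>y. A1 y + A4 y) - I (\<lambda>y. A2 y + A3 y)\<bar> \<le> I (\<lambda>y. wl (r m) g / \<tau> m * e' * k2 y)"
   proof (rule Iabs[OF bumps_add[OF Ab(1,4)] bumps_add[OF Ab(2,3)] kb])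
    fix y assume y: "y \<in> \<G>"
    have "\<bar>(A1 y + A4 y) - (A2 y + A3 y)\<bar> = \<bar>(\<phi> m (g \<otimes> x \<otimes> y) - \<phi> m (x \<otimes> y)) * (f0 (inv u \<otimes> y) - f0 y)\<bar>"
     by (simp add: A1_def A2_def A3_def A4_def algebra_simps)
    also have "\<dots> \<le> wl (r m) g / \<tau> m * (e' * k2 y)"
     unfolding abs_mult using \<phi>l[of "x \<otimes> y" g m] d(2)[OF uc ud y] c y w
     by (intro mult_mono) (auto simp: m_assoc)
    finally show "\<bar>(A1 y + A4 y) - (A2 y + A3 y)\<bar> \<le> wl (r m) g / \<tau> m * e' * k2 y" by (simp add: mult.assoc)
   qed
   also have "\<dots> \<le> wl (r m) g / \<tau> m * e' * Ik" unfolding Ik_def by (rule Iscale[OF k2(1) we])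
   also have "\<dots> \<le> wl (r m) g / \<tau> m * e"
   proof -
    have "e' * Ik \<le> e" using e Ik by (simp add: e'_def field_simps)
    then show ?thesis using mult_left_mono[OF _ w] by (simp add: mult.assoc)
   qed
   finally show "\<bar>\<psi> m (g \<otimes> h \<otimes> x) - \<psi> m (h \<otimes> x) - \<psi> m (g \<otimes> x) + \<psi> m x\<bar> \<le> wl (r m) g / \<tau> m * e"
    using Iadd[OF Ab(1,4)] Iadd[OF Ab(2,3)] by (simp add: e1 e2 e3 e4)
  qed (rule d')
 qed
 \<comment> \<open>If all steps changed \<psi> by at most c1 / \<tau> m, the t (m + a) \<le> M ^ a *
   t m steps that lead out of the unit ball would change it by at most M ^ a * c1, which is less
   than c0.\<close>
 define c1 where "c1 = c0 / (2 * real (M ^ a) + 1)"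
 have c1: "0 < c1" using c0 by (simp add: c1_def add_nonneg_pos)
 have "\<exists>x v. x \<in> \<G> \<and> \<rho> x \<le> 2 \<and> v \<in> \<G> \<and> \<rho> v \<le> 1 \<and>
   c1 < \<bar>\<tau> m * (\<psi> m ((\<alpha> ^^ (m + a)) v \<otimes> x) - \<psi> m x)\<bar>" for m
 proof (rule ccontr)
  assume neg: "\<not> ?thesis"
  define e where "e = c1 / \<tau> m"
  have e0: "0 \<le> e" using c1 \<tau>pos[of m] by (simp add: e_def)
  have step: "\<bar>\<psi> m (g \<otimes> y) - \<psi> m y\<bar> \<le> e" if g: "g \<in> \<G>" "\<rho> g \<le> r m" and y: "y \<in> \<G>" for g y
  proof (cases "\<rho> y \<le> 2")
   case True
   define v where "v = ap (- int (m + a)) g"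
   have v: "v \<in> \<G>" "(\<alpha> ^^ (m + a)) v = g"
    using g ap_cancel(1)[of g "int (m + a)"] unfolding v_def ap_of_nat by auto
   have "\<rho> v \<le> 1" using g(2) rho_funpow[OF v(1), of "m + a"] v thp(1)[of "m + a"] by (simp add: r_def)
   then have "\<bar>\<tau> m * (\<psi> m (g \<otimes> y) - \<psi> m y)\<bar> \<le> c1" using neg v y True by (metis not_le)
   then have "\<bar>\<psi> m (g \<otimes> y) - \<psi> m y\<bar> * \<tau> m \<le> c1"
    unfolding abs_mult using \<tau>pos[of m] by (simp add: mult.commute)
   then show ?thesis using \<tau>pos[of m] by (simp add: e_def pos_le_divide_eq)
  next
   case False
   have "\<rho> g \<le> 1" using g rpos(2)[of m] by linarith
   then have "3/4 < \<rho> (g \<otimes> y)" using rho_mult_inv1[of g "g \<otimes> y"] g y False by simp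
   then show ?thesis using \<psi>0[of y m] \<psi>0[of "g \<otimes> y" m] g y False e0 by simp
  qed
  have path: "\<bar>\<psi> m x - \<psi> m \<one>\<bar> \<le> k * e" if "x \<in> pw (r m) k" for x k
   using that
  proof (induction k arbitrary: x)
   case (Suc k)
   then obtain g y where gy: "x = g \<otimes> y" "g \<in> \<G>" "\<rho> g \<le> r m" "y \<in> pw (r m) k" by auto
   have "\<bar>\<psi> m x - \<psi> m \<one>\<bar> \<le> \<bar>\<psi> m (g \<otimes> y) - \<psi> m y\<bar> + \<bar>\<psi> m y - \<psi> m \<one>\<bar>" unfolding gy(1) by linarith
   also have "\<dots> \<le> e + k * e" using step[OF gy(2,3) pw_closed[OF gy(4)]] Suc.IH[OF gy(4)] by linarith
   finally show ?case by (simp add: algebra_simps)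
  qed simp
  obtain x where x: "x \<in> pw (\<theta> ^ (m + a)) (t (m + a))" "1 < \<rho> x" using tex by blast
  have "\<psi> m x = 0" using \<psi>0[OF pw_closed[OF x(1)], of m] x(2) by simp
  then have "c0 \<le> t (m + a) * e" using path[of x "t (m + a)"] x(1) \<psi>1[of m] by (simp add: r_def)
  also have "\<dots> \<le> real (M ^ a * t m) * e"
   using tgrow[of m] by (intro mult_right_mono e0) (simp only: of_nat_le_iff)
  also have "\<dots> = real (M ^ a) * c1" using \<tau>pos[of m] by (simp add: e_def \<tau>_def)
  also have "\<dots> < c0"
  proof -
   define P where "P = real (M ^ a)"
   have P: "0 \<le> P" by (simp add: P_def)
   have "0 \<le> P * c0" using P c0 by simp
   then have "P * c0 < c0 * (2 * P + 1)" using c0 by (simp add: algebra_simps)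
   then show ?thesis using P unfolding c1_def P_def[symmetric] by (simp add: pos_divide_less_eq)
  qed
  finally show False by simp
 qed
 then obtain xx vv where xv: "!!m. xx m \<in> \<G>" "!!m. \<rho> (xx m) \<le> 2" "!!m. vv m \<in> \<G>" "!!m. \<rho> (vv m) \<le> 1"
   "!!m. c1 < \<bar>\<tau> m * (\<psi> m ((\<alpha> ^^ (m + a)) (vv m) \<otimes> xx m) - \<psi> m (xx m))\<bar>" by metis
 \<comment> \<open>The difference quotients: v is contracted to the scale of the letters, and the
   change of \<psi> at the chosen base point is multiplied by \<tau> m.\<close>
 define c where "c m v = \<tau> m * (\<psi> m ((\<alpha> ^^ (m + a)) v \<otimes> xx m) - \<psi> m (xx m))" for m v
 have wlv: "wl (r m) ((\<alpha> ^^ (m + a)) v) \<le> wl 1 v" if "v \<in> \<G>" for m v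
  unfolding r_def by (rule wl_funpow[OF conn that])
 have cb: "\<bar>c m v\<bar> \<le> wl 1 v * If" if v: "v \<in> \<G>" for m v
 proof -
  have "\<bar>c m v\<bar> = \<tau> m * \<bar>\<psi> m ((\<alpha> ^^ (m + a)) v \<otimes> xx m) - \<psi> m (xx m)\<bar>"
   using \<tau>pos[of m] by (simp add: c_def abs_mult)
  also have "\<dots> \<le> \<tau> m * (wl (r m) ((\<alpha> ^^ (m + a)) v) / \<tau> m * If)"
   using d1[of "(\<alpha> ^^ (m + a)) v" "xx m" m] v xv \<tau>pos[of m] by (intro mult_left_mono) auto
  also have "\<dots> = wl (r m) ((\<alpha> ^^ (m + a)) v) * If" using \<tau>pos[of m] by simp
  also have "\<dots> \<le> wl 1 v * If" using wlv[OF v] If by (intro mult_right_mono) auto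
  finally show ?thesis .
 qed
 \<comment> \<open>This is d2 multiplied by \<tau> m. For bounded w the contracted element is
   eventually short enough, and the word length of v controls the error uniformly in m.\<close>
 have ca: "\<exists>N. \<forall>m\<ge>N. \<forall>v\<in>\<G>. \<forall>w\<in>\<G>. \<rho> w \<le> R --> \<bar>c m (v \<otimes> w) - c m v - c m w\<bar> \<le> wl 1 v * e"
  if e: "0 < e" for e R :: real
 proof -
  obtain d where d: "0 < d" "!!m g h x. g \<in> \<G> ==> h \<in> \<G> ==> x \<in> \<G> ==> \<rho> x \<le> 2 ==> \<rho> h < d ==>
   \<bar>\<psi> m (g \<otimes> h \<otimes> x) - \<psi> m (h \<otimes> x) - \<psi> m (g \<otimes> x) + \<psi> m x\<bar> \<le> wl (r m) g / \<tau> m * e"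
   using d2[OF e] by blast
  obtain N where N: "\<theta> ^ N * \<bar>R\<bar> < d" using theta_pow_small[OF d(1)] by blast
  show ?thesis
  proof (intro exI[of _ N] allI ballI impI)
   fix m v w assume m: "N \<le> m" and v: "v \<in> \<G>" and w: "w \<in> \<G>" "\<rho> w \<le> R"
   define g h where "g = (\<alpha> ^^ (m + a)) v" and "h = (\<alpha> ^^ (m + a)) w"
   have gh: "g \<in> \<G>" "h \<in> \<G>" "(\<alpha> ^^ (m + a)) (v \<otimes> w) = g \<otimes> h" using v w unfolding g_def h_def by auto
   have "\<rho> h \<le> \<theta> ^ N * \<bar>R\<bar>"
    unfolding h_def rho_funpow[OF w(1)] using m theta w rho_nonneg[OF w(1)]
    by (intro mult_mono power_decreasing) auto
   then have hd: "\<rho> h < d" using N by linarith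
   have "\<bar>c m (v \<otimes> w) - c m v - c m w\<bar> = \<tau> m * \<bar>\<psi> m (g \<otimes> h \<otimes> xx m) - \<psi> m (h \<otimes> xx m) - \<psi> m (g \<otimes> xx m) + \<psi> m (xx m)\<bar>"
   proof -
    have "c m (v \<otimes> w) - c m v - c m w = \<tau> m * (\<psi> m (g \<otimes> h \<otimes> xx m) - \<psi> m (h \<otimes> xx m) - \<psi> m (g \<otimes> xx m) + \<psi> m (xx m))"
     unfolding c_def gh(3) g_def[symmetric] h_def[symmetric] by (simp add: algebra_simps)
    then show ?thesis using \<tau>pos[of m] by (simp add: abs_mult)
   qed
   also have "\<dots> \<le> \<tau> m * (wl (r m) g / \<tau> m * e)"
    using d(2)[OF gh(1,2) xv(1,2) hd, of m] \<tau>pos[of m] by (intro mult_left_mono) auto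
   also have "\<dots> = wl (r m) g * e" using \<tau>pos[of m] by simp
   also have "\<dots> \<le> wl 1 v * e" unfolding g_def using wlv[OF v] e by (intro mult_right_mono) auto
   finally show "\<bar>c m (v \<otimes> w) - c m v - c m w\<bar> \<le> wl 1 v * e" .
  qed
 qed
 obtain U :: "nat filter" where U: "U \<le> sequentially" "U \<noteq> bot" "!!P. eventually P U \<or> eventually (\<lambda>x. \<not> P x) U"
  using ex_ultrafilter by blast
 define \<xi> where "\<xi> v = Lim U (\<lambda>m. c m v)" for v
 have lim: "((\<lambda>m. c m v) \<longlongrightarrow> \<xi> v) U" if "v \<in> \<G>" for v
 proof -
  have "\<exists>l. ((\<lambda>m. c m v) \<longlongrightarrow> l) U" using cb[OF that] by (intro ultrafilter_limit[OF U(2,3)])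
  then show ?thesis unfolding \<xi>_def using U(2) by (metis tendsto_Lim)
 qed
 have hom: "\<xi> (v \<otimes> w) = \<xi> v + \<xi> w" if v: "v \<in> \<G>" and w: "w \<in> \<G>" for v w
 proof -
  have l: "((\<lambda>m. \<bar>c m (v \<otimes> w) - c m v - c m w\<bar>) \<longlongrightarrow> \<bar>\<xi> (v \<otimes> w) - \<xi> v - \<xi> w\<bar>) U"
   using v w by (intro tendsto_intros lim) auto
  have "\<bar>\<xi> (v \<otimes> w) - \<xi> v - \<xi> w\<bar> \<le> 0 + e" if e: "0 < e" for e
  proof -
   define e' where "e' = e / (real (wl 1 v) + 1)"
   have e': "0 < e'" using e by (simp add: e'_def add_nonneg_pos)
   obtain N where "!!m. N \<le> m ==> \<bar>c m (v \<otimes> w) - c m v - c m w\<bar> \<le> wl 1 v * e'"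
    using ca[OF e', of "\<rho> w"] v w by blast
   then have "eventually (\<lambda>m. \<bar>c m (v \<otimes> w) - c m v - c m w\<bar> \<le> wl 1 v * e') sequentially"
    by (auto simp: eventually_sequentially)
   then have "eventually (\<lambda>m. \<bar>c m (v \<otimes> w) - c m v - c m w\<bar> \<le> wl 1 v * e') U" using U(1) by (simp add: filter_leD)
   then have "\<bar>\<xi> (v \<otimes> w) - \<xi> v - \<xi> w\<bar> \<le> wl 1 v * e'" using U(2) by (intro tendsto_upperbound[OF l])
   also have "\<dots> \<le> e" using e by (simp add: e'_def field_simps)
   finally show ?thesis by simp
  qed
  then have "\<bar>\<xi> (v \<otimes> w) - \<xi> v - \<xi> w\<bar> \<le> 0" by (rule field_le_epsilon)
  then show ?thesis by simp
 qed
 have chr: "chr \<xi>"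
  unfolding chr_def
 proof (intro conjI ballI exI[of _ If] impI hom)
  fix v assume v: "v \<in> \<G>" "\<rho> v \<le> 1"
  have "real (wl 1 v) * If \<le> 1 * If" using wl_ball[OF v] If by (intro mult_right_mono) auto
  then have "\<bar>c m v\<bar> \<le> If" for m using cb[OF v(1), of m] by linarith
  then show "\<bar>\<xi> v\<bar> \<le> If" using U(2) by (intro tendsto_upperbound[OF tendsto_rabs[OF lim[OF v(1)]]]) auto
 qed
 obtain K0 where "4 * If / c1 < real K0" using reals_Archimedean2 by blast
 then obtain K :: nat where K: "4 * If / c1 < K" "0 < K" by (intro that[of "Suc K0"]) auto
 \<comment> \<open>The K-th power of z still lies in the unit ball, where |c m| is at most If.
   Approximate additivity gives K * |c m z| \<le> If + K * c1 / 8, and K was chosen so that If \<le>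
   K * c1 / 4.\<close>
 have zs: "\<exists>N. \<forall>m\<ge>N. \<forall>z\<in>\<G>. \<rho> z \<le> 1 / K --> \<bar>c m z\<bar> \<le> 3 * c1 / 8"
 proof -
  obtain N where N: "!!m v w. m \<ge> N ==> v \<in> \<G> ==> w \<in> \<G> ==> \<rho> w \<le> 1 ==>
    \<bar>c m (v \<otimes> w) - c m v - c m w\<bar> \<le> wl 1 v * (c1 / 8)"
   using ca[of "c1 / 8" 1] c1 by auto
  have "\<bar>c m z\<bar> \<le> 3 * c1 / 8" if m: "m \<ge> N" and z: "z \<in> \<G>" "\<rho> z \<le> 1 / K" for m z
  proof -
   have zi: "\<rho> (z [^] i) \<le> real i / K" for i :: nat
   proof (induction i)
    case (Suc i)
    then show ?case using rho_mult[of "z [^] i" z] z by (simp add: add_divide_distrib)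
   qed simp
   have K1: "1 / real K \<le> 1" using K by simp
   have w1: "wl 1 z * (c1 / 8) \<le> 1 * (c1 / 8)"
    using wl_ball[of z 1] z K1 c1 by (intro mult_right_mono) auto
   have it: "\<bar>c m (z [^] i) - i * c m z\<bar> \<le> i * (c1 / 8)" if "0 < i" "i \<le> K" for i :: nat
    using that
   proof (induction i rule: nat_induct_non_zero)
    case 1
    then show ?case using z c1 by simp
   next
    case (Suc i)
    have "\<rho> (z [^] i) \<le> 1" using zi[of i] Suc K by (simp add: divide_le_eq order_trans[OF zi])
    then have "\<bar>c m (z \<otimes> z [^] i) - c m z - c m (z [^] i)\<bar> \<le> c1 / 8"
     using N[OF m z(1), of "z [^] i"] z w1 by simp
    moreover have "z [^] Suc i = z \<otimes> z [^] i" using z by (simp only: nat_pow_Suc2)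
    moreover have "\<bar>c m (z [^] i) - i * c m z\<bar> \<le> i * (c1 / 8)" using Suc by simp
    ultimately show ?case by (simp only: of_nat_Suc distrib_right mult_1)
   qed
   have zK: "\<rho> (z [^] K) \<le> 1" using zi[of K] K by simp
   have "real (wl 1 (z [^] K)) * If \<le> 1 * If" using wl_ball[OF _ zK] z If by (intro mult_right_mono) auto
   then have "\<bar>c m (z [^] K)\<bar> \<le> If" using cb[of "z [^] K" m] z by simp
   then have "\<bar>K * c m z\<bar> \<le> If + K * (c1 / 8)" using it[of K] K by linarith
   moreover have "\<bar>K * c m z\<bar> = K * \<bar>c m z\<bar>" by (simp add: abs_mult)
   moreover have "If \<le> K * (c1 / 4)" using K(1) c1 by (simp add: pos_divide_less_eq)
   ultimately have "K * \<bar>c m z\<bar> \<le> K * (3 * c1 / 8)" by simp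
   then have "\<bar>c m z\<bar> \<le> 3 * c1 / 8" using K(2) by (subst (asm) mult_le_cancel_left_pos) auto
   then show ?thesis .
  qed
  then show ?thesis by blast
 qed
 obtain N1 where N1: "!!m z. m \<ge> N1 ==> z \<in> \<G> ==> \<rho> z \<le> 1 / K ==> \<bar>c m z\<bar> \<le> 3 * c1 / 8"
  using zs by blast
 obtain F where F: "finite F" "F \<subseteq> \<G>" "!!x. x \<in> \<G> ==> \<rho> x \<le> 1 ==> \<exists>y\<in>F. dst y x < 1 / K"
  using totally_bounded[of "1 / K" 1] K by auto
 define Q where "Q = real (\<Sum>y\<in>F. wl 1 y)"
 have Q: "0 \<le> Q" "!!y. y \<in> F ==> wl 1 y \<le> Q"
  unfolding Q_def using F member_le_sum[of _ F "wl 1"] by (auto simp del: of_nat_sum)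
 obtain N2 where N2: "!!m v w. m \<ge> N2 ==> v \<in> \<G> ==> w \<in> \<G> ==> \<rho> w \<le> 1 ==>
    \<bar>c m (v \<otimes> w) - c m v - c m w\<bar> \<le> wl 1 v * (c1 / (8 * (Q + 1)))"
  using ca[of "c1 / (8 * (Q + 1))" 1] c1 Q(1) by auto
 \<comment> \<open>The elements vv m at which the quotients are large vary with m. Replacing them by
   points of a finite 1 / K-net loses at most half of c1, so that a fixed net point can be kept in
   the limit.\<close>
 have big: "\<exists>u\<in>F. c1 / 2 \<le> \<bar>c m u\<bar>" if m: "m \<ge> max N1 N2" for m
 proof -
  obtain u where u: "u \<in> F" "dst u (vv m) < 1 / K" using F(3)[OF xv(3,4)] by blast
  have uc: "u \<in> \<G>" using u F by blast
  define z where "z = inv u \<otimes> vv m"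
  have zc: "z \<in> \<G>" "u \<otimes> z = vv m" using uc xv(3)[of m] by (auto simp: z_def)
  have z1: "\<rho> z \<le> 1 / K" using u by (simp add: z_def)
  moreover have "1 / real K \<le> 1" using K by simp
  ultimately have "\<bar>c m (u \<otimes> z) - c m u - c m z\<bar> \<le> wl 1 u * (c1 / (8 * (Q + 1)))"
   using m uc zc by (intro N2) auto
  also have "\<dots> \<le> Q * (c1 / (8 * (Q + 1)))" using Q(2)[OF u(1)] Q(1) c1 by (intro mult_right_mono) auto
  also have "\<dots> \<le> c1 / 8" using Q(1) c1 by (simp add: field_simps)
  finally have "\<bar>c m (vv m) - c m u - c m z\<bar> \<le> c1 / 8" by (simp add: zc)
  moreover have "\<bar>c m z\<bar> \<le> 3 * c1 / 8" using m zc z1 by (intro N1) auto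
  moreover have "c1 < \<bar>c m (vv m)\<bar>" using xv(5)[of m] by (simp add: c_def)
  ultimately have "c1 / 2 \<le> \<bar>c m u\<bar>" by linarith
  then show ?thesis using u by blast
 qed
 have "\<exists>u\<in>F. \<xi> u \<noteq> 0"
 proof (rule ccontr)
  assume "\<not> ?thesis"
  then have z: "!!u. u \<in> F ==> \<xi> u = 0" by blast
  have "eventually (\<lambda>m. \<bar>c m u\<bar> < c1 / 2) U" if "u \<in> F" for u
   using tendsto_rabs[OF lim[of u]] F that z[OF that] c1 by (intro order_tendstoD(2)) auto
  then have "eventually (\<lambda>m. \<forall>u\<in>F. \<bar>c m u\<bar> < c1 / 2) U" using F(1) by (simp add: eventually_ball_finite)
  moreover have "eventually (\<lambda>m. m \<ge> max N1 N2) U" using U(1) eventually_ge_at_top by (rule filter_leD)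
  ultimately have "eventually (\<lambda>m. False) U"
  proof eventually_elim
   case (elim m)
   then show ?case using big[of m] by force
  qed
  then show False using U(2) by simp
 qed
 then show ?thesis using chr F by blast
qed

end

section \<open>Subgroups as homogeneous groups and the identity component\<close>

text \<open>The induction rule of \<open>generate\<close> multiplies two arbitrary generated
  elements. Generalizing to the claim that P y implies P (y \<otimes> x) for all y reduces it to
  appending single generators.\<close>

lemma (in group) generate_right_induct:
 assumes x: "x \<in> generate G S" and S: "S \<subseteq> carrier G" "!!s. s \<in> S ==> inv s \<in> S"
  and P1: "P \<one>" and Ps: "!!x s. x \<in> generate G S ==> P x ==> s \<in> S ==> P (x \<otimes> s)"
 shows "P x"
proof -
 have gc: "generate G S \<subseteq> carrier G" using generate_in_carrier[OF S(1)] by blast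
 have "\<forall>y\<in>generate G S. P y --> P (y \<otimes> x)"
  using x
 proof (induction x rule: generate.induct)
  case one
  then show ?case using gc by auto
 next
  case (incl h)
  then show ?case using Ps by blast
 next
  case (inv h)
  then show ?case using Ps S(2) by blast
 next
  case (eng h1 h2)
  show ?case
  proof (intro ballI impI)
   fix y assume y: "y \<in> generate G S" "P y"
   have "P (y \<otimes> h1)" using eng.IH(1) y by simp
   then have "P (y \<otimes> h1 \<otimes> h2)" using eng.IH(2) generate.eng[OF y(1) eng.hyps(1)] by simp
   then show "P (y \<otimes> (h1 \<otimes> h2))" using y(1) eng.hyps gc by (simp add: m_assoc subset_iff)
  qed
 qed
 then have "P (\<one> \<otimes> x)" using P1 generate.one by blast
 then show ?thesis using x gc by auto
qed

context homogeneous_group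
begin

text \<open>Only the carrier changes, so all results for homogeneous groups can be used inside A;
  the equivalences below translate them back to the ambient group.\<close>

lemma sub_hg:
 assumes A: "invsub A"
 shows "homogeneous_group (G\<lparr>carrier := A\<rparr>) \<alpha> \<rho> \<theta>"
proof -
 let ?S = "G\<lparr>carrier := A\<rparr>"
 note sub = invsub_subgroup[OF A]
 have grp: "group ?S" by (rule subgroup_imp_group[OF sub])
 note inv_eq = m_inv_consistent[OF sub]
 note Ac = invsub_mem[OF A]
 show ?thesis
 proof (intro homogeneous_group.intro[OF grp] homogeneous_group_axioms.intro)
  show "\<alpha> \<in> iso ?S ?S"
  proof (rule isoI)
   have "\<alpha> x \<in> A" if "x \<in> A" for x using invsub_ap[OF A that, of 1] by simp
   then show "\<alpha> \<in> hom ?S ?S" using Ac by (auto simp: hom_def)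
   show "bij_betw \<alpha> (carrier ?S) (carrier ?S)"
    using invsub_image[OF A] alpha_bij invsub_subset[OF A] by (auto simp: bij_betw_def intro: inj_on_subset)
  qed
  fix x y assume x: "x \<in> carrier ?S" and y: "y \<in> carrier ?S"
  show "\<rho> (x \<otimes>\<^bsub>?S\<^esub> y) \<le> \<rho> x + \<rho> y" using x y Ac rho_mult by simp
 next
  fix x assume "x \<in> carrier ?S"
  then have x: "x \<in> A" "x \<in> \<G>" using Ac by auto
  show "(\<rho> x = 0) = (x = \<one>\<^bsub>?S\<^esub>)" using rho_zero_iff[OF x(2)] by simp
  show "\<rho> (inv\<^bsub>?S\<^esub> x) = \<rho> x" using inv_eq[OF x(1)] rho_inv[OF x(2)] by simp
  show "\<rho> (\<alpha> x) = \<theta> * \<rho> x" using rho_alpha[OF x(2)] .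
  fix e :: real assume "0 < e"
  then obtain d where "d > 0" "\<forall>z\<in>\<G>. \<rho> z < d --> \<rho> (x \<otimes> z \<otimes> inv x) < e" using rho_conj[OF x(2)] by blast
  then show "\<exists>d>0. \<forall>z\<in>carrier ?S. \<rho> z < d --> \<rho> (x \<otimes>\<^bsub>?S\<^esub> z \<otimes>\<^bsub>?S\<^esub> inv\<^bsub>?S\<^esub> x) < e"
   using inv_eq[OF x(1)] Ac by (intro exI[of _ d]) simp
 next
  fix u :: "nat => 'a" and R assume u: "!!n. u n \<in> carrier ?S" "!!n. \<rho> (u n) \<le> R"
  then have uA: "!!n. u n \<in> A" by simp
  obtain l r where l: "l \<in> \<G>" and r: "strict_mono (r::nat=>nat)"
   and lim: "(\<lambda>n. dst l (u (r n))) \<longlonglongrightarrow> 0"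
   using rho_compact[of u R] u Ac by auto
  have lA: "l \<in> A" by (rule seqclosed_limit[OF invsub_closed[OF A] l lim]) (rule uA)
  show "\<exists>l\<in>carrier ?S. \<exists>r::nat=>nat. strict_mono r \<and> (\<lambda>n. \<rho> (inv\<^bsub>?S\<^esub> l \<otimes>\<^bsub>?S\<^esub> u (r n))) \<longlonglongrightarrow> 0"
   using r lim lA inv_eq[OF lA] by (intro bexI[of _ l] exI[of _ r]) auto
 qed (use theta in auto)
qed

text \<open>Connectedness of A in terms of the ambient group operations, so that it does not depend
  on the group in which A is viewed.\<close>

definition connsub :: "'a set => bool" where
 "connsub A \<longleftrightarrow> (\<forall>U. subgroup U G \<and> U \<subseteq> A \<and> (\<exists>r>0. \<forall>x\<in>A. \<rho> x < r --> x \<in> U) --> U = A)"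

lemma connsub_carrier: "connsub (\<G>) \<longleftrightarrow> conn"
proof -
 have "U \<subseteq> \<G>" if "subgroup U G" for U using subgroup.subset[OF that] .
 then show ?thesis unfolding connsub_def conn_def opensub_def by blast
qed

lemma sub_subgroup_iff:
 assumes A: "subgroup A G"
 shows "subgroup U (G\<lparr>carrier := A\<rparr>) \<longleftrightarrow> subgroup U G \<and> U \<subseteq> A"
proof
 assume U: "subgroup U (G\<lparr>carrier := A\<rparr>)"
 then show "subgroup U G \<and> U \<subseteq> A" using incl_subgroup[OF A U] subgroup.subset[OF U] by simp
next
 assume "subgroup U G \<and> U \<subseteq> A"
 then show "subgroup U (G\<lparr>carrier := A\<rparr>)" using subgroup_incl[OF _ A] by blast
qed

lemma sub_conn_iff:
 assumes A: "invsub A"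
 shows "homogeneous_group.conn (G\<lparr>carrier := A\<rparr>) \<rho> \<longleftrightarrow> connsub A"
proof -
 interpret S: homogeneous_group "G\<lparr>carrier := A\<rparr>" \<alpha> \<rho> \<theta> by (rule sub_hg[OF A])
 show ?thesis
  unfolding S.conn_def S.opensub_def sub_subgroup_iff[OF invsub_subgroup[OF A]] connsub_def by auto
qed

lemma sub_seqclosed_iff:
 assumes A: "invsub A"
 shows "homogeneous_group.seqclosed (G\<lparr>carrier := A\<rparr>) \<rho> B \<longleftrightarrow> seqclosed B \<and> B \<subseteq> A"
proof -
 interpret S: homogeneous_group "G\<lparr>carrier := A\<rparr>" \<alpha> \<rho> \<theta> by (rule sub_hg[OF A])
 have S: "S.seqclosed B \<longleftrightarrow> B \<subseteq> A \<and> (\<forall>x\<in>A. (\<forall>e>0. \<exists>a\<in>B. dst x a < e) --> x \<in> B)"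
  unfolding S.seqclosed_def using m_inv_consistent[OF invsub_subgroup[OF A]] by simp
 have xA: "x \<in> A" if "x \<in> \<G>" "B \<subseteq> A" "\<forall>e>0. \<exists>a\<in>B. dst x a < e" for x
  by (rule seqclosedD[OF invsub_closed[OF A] that(1)]) (use that in blast)
 show ?thesis
 proof
  assume "S.seqclosed B"
  then have h: "B \<subseteq> A" "!!x. x \<in> A ==> \<forall>e>0. \<exists>a\<in>B. dst x a < e ==> x \<in> B" by (simp_all add: S)
  have "B \<subseteq> \<G>" using h(1) invsub_subset[OF A] by (rule order_trans)
  then show "seqclosed B \<and> B \<subseteq> A" unfolding seqclosed_def using h xA by simp
 next
  assume h: "seqclosed B \<and> B \<subseteq> A"
  then show "S.seqclosed B" unfolding S using invsub_mem[OF A] by (simp add: seqclosed_def)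
 qed
qed

lemma sub_invsub_iff:
 assumes A: "invsub A"
 shows "homogeneous_group.invsub (G\<lparr>carrier := A\<rparr>) \<alpha> \<rho> B \<longleftrightarrow> invsub B \<and> B \<subseteq> A"
proof -
 interpret S: homogeneous_group "G\<lparr>carrier := A\<rparr>" \<alpha> \<rho> \<theta> by (rule sub_hg[OF A])
 show ?thesis
  unfolding S.invsub_def invsub_def sub_subgroup_iff[OF invsub_subgroup[OF A]] sub_seqclosed_iff[OF A] by blast
qed

text \<open>A sequence of open subgroups that is cofinal by \<open>On_least\<close> and shifted by
  \<alpha>. It need not shrink to \<one>.\<close>

definition On :: "nat => 'a set" where
 "On n = generate G {x \<in> \<G>. \<rho> x < \<theta> ^ n}"

text \<open>By \<open>On_least\<close> this is the intersection of all open subgroups, which in a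
  locally compact group is the identity component.\<close>

definition Comp :: "'a set" where
 "Comp = (\<Inter>n. On n)"

lemma On_opensub: "opensub (On n)"
 unfolding opensub_def On_def using theta
 by (intro conjI generate_is_subgroup exI[of _ "\<theta> ^ n"]) (auto intro: generate.incl)

lemma On_subgroup: "subgroup (On n) G"
 using On_opensub by (simp add: opensub_def)

lemma On_closed: "x \<in> On n ==> x \<in> \<G>"
 using subgroup.subset[OF On_subgroup] by blast

lemma On_least: "opensub U ==> \<exists>n. On n \<subseteq> U"
proof -
 assume U: "opensub U"
 then obtain r where r: "0 < r" "!!x. x \<in> \<G> ==> \<rho> x < r ==> x \<in> U" by (auto simp: opensub_def)
 obtain n where n: "\<theta> ^ n * 1 < r" using theta_pow_small[OF r(1)] by blast
 have "{x \<in> \<G>. \<rho> x < \<theta> ^ n} \<subseteq> U" using r n by auto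
 then show ?thesis unfolding On_def using U by (intro exI[of _ n] generate_subgroup_incl) (auto simp: opensub_def)
qed

lemma On_antimono: "m \<le> n ==> On n \<subseteq> On m"
proof -
 assume "m \<le> n"
 then have "\<theta> ^ n \<le> \<theta> ^ m" using theta by (intro power_decreasing) auto
 then show ?thesis unfolding On_def by (intro mono_generate) auto
qed

lemma On_alpha: "\<alpha> ` On n = On (Suc n)"
proof -
 have "\<alpha> ` {x \<in> \<G>. \<rho> x < \<theta> ^ n} = {x \<in> \<G>. \<rho> x < \<theta> ^ Suc n}"
 proof (intro equalityI subsetI)
  fix x assume x: "x \<in> {x \<in> \<G>. \<rho> x < \<theta> ^ Suc n}"
  then have "alpha' x \<in> {x \<in> \<G>. \<rho> x < \<theta> ^ n}" using theta by (simp add: rho_alpha' field_simps)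
  then show "x \<in> \<alpha> ` {x \<in> \<G>. \<rho> x < \<theta> ^ n}" using x by (intro image_eqI[of _ _ "alpha' x"]) auto
 qed (use theta in \<open>auto simp: rho_alpha\<close>)
 then show ?thesis
  unfolding On_def using group_hom.generate_img[OF alpha_group_hom, of "{x \<in> \<G>. \<rho> x < \<theta> ^ n}"] by auto
qed

lemma opensub_closed: "opensub U ==> seqclosed U"
 unfolding seqclosed_def
proof (intro conjI ballI impI)
 assume U: "opensub U"
 then show "U \<subseteq> \<G>" by (simp add: opensub_def subgroup.subset)
 fix x assume x: "x \<in> \<G>" and h: "\<forall>e>0. \<exists>a\<in>U. dst x a < e"
 obtain r where r: "0 < r" "!!x. x \<in> \<G> ==> \<rho> x < r ==> x \<in> U" using U by (auto simp: opensub_def)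
 obtain a where a: "a \<in> U" "dst x a < r" using h r by blast
 have sub: "subgroup U G" using U by (simp add: opensub_def)
 have ac: "a \<in> \<G>" using subgroup.mem_carrier[OF sub a(1)] .
 have "inv x \<otimes> a \<in> U" using r a x ac by simp
 then have "a \<otimes> inv (inv x \<otimes> a) \<in> U" using a sub by (simp add: subgroup.m_closed subgroup.m_inv_closed)
 then show "x \<in> U" using x ac by (simp add: gsimps)
qed

lemma Comp_On: "x \<in> Comp ==> x \<in> On n"
 by (simp add: Comp_def)

lemma Comp_invsub: "invsub Comp"
proof (rule invsubI)
 show "subgroup Comp G" unfolding Comp_def using On_subgroup by (intro subgroups_Inter) auto
 have "On n \<subseteq> \<G>" for n using On_closed by blast
 then show "seqclosed Comp"
  unfolding seqclosed_def Comp_def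
 proof (intro conjI ballI impI)
  fix x assume x: "x \<in> \<G>" and h: "\<forall>e>0. \<exists>a\<in>\<Inter>n. On n. dst x a < e"
  have "x \<in> On n" for n using h by (intro seqclosedD[OF opensub_closed[OF On_opensub] x]) auto
  then show "x \<in> (\<Inter>n. On n)" by blast
 qed blast
 fix x assume x: "x \<in> Comp"
 have xc: "x \<in> \<G>" using Comp_On[OF x, of 0] On_closed by blast
 have "\<alpha> x \<in> On (Suc n)" for n using Comp_On[OF x, of n] On_alpha[of n] by blast
 then show "\<alpha> x \<in> Comp" unfolding Comp_def using On_antimono[of n "Suc n" for n] by auto
 have "alpha' x \<in> On n" for n
 proof -
  have "x \<in> \<alpha> ` On n" using Comp_On[OF x, of "Suc n"] On_alpha[of n] by simp
  then show ?thesis using On_closed by auto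
 qed
 then show "alpha' x \<in> Comp" by (simp add: Comp_def)
qed

text \<open>Products of short elements of a sufficiently small open subgroup cannot leave the neighbourhood
 of the subgroup generated by the short elements of the component: by compactness the annulus is avoided.\<close>
lemma On_close_aux:
 assumes e: "0 < e"
 shows "\<exists>n. \<forall>x\<in>On n. \<exists>l\<in>generate G {c \<in> Comp. \<rho> c \<le> 3 * e}. dst l x < e"
proof -
 \<comment> \<open>The radius 3 * e is forced by the annulus argument: a component element within e
   of an element of norm at most 2 * e has norm at most 3 * e.\<close>
 define S where "S = {c \<in> Comp. \<rho> c \<le> 3 * e}"
 have "\<exists>n. \<forall>x\<in>On n. \<rho> x \<le> 2 * e --> (\<exists>c\<in>S. dst c x < e)"
 proof (rule ccontr)
  assume "\<not> ?thesis"
  then have "\<forall>n. \<exists>x. x \<in> On n \<and> \<rho> x \<le> 2 * e \<and> (\<forall>c\<in>S. \<not> dst c x < e)" by blast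
  then obtain u where u: "!!n. u n \<in> On n" "!!n. \<rho> (u n) \<le> 2 * e" "!!n c. c \<in> S ==> \<not> dst c (u n) < e"
   by metis
  obtain l r where l: "l \<in> \<G>" and r: "strict_mono (r::nat=>nat)"
   and lim: "(\<lambda>n. dst l (u (r n))) \<longlonglongrightarrow> 0"
   using rho_compact[of u "2 * e"] On_closed[OF u(1)] u(2) by blast
  have "l \<in> On n" for n
  proof (rule seqclosed_limit[OF opensub_closed[OF On_opensub] l lim, of n])
   fix k assume "n \<le> k"
   then have "n \<le> r k" using seq_suble[OF r, of k] by linarith
   then show "u (r k) \<in> On n" using u(1)[of "r k"] On_antimono by blast
  qed
  then have lC: "l \<in> Comp" by (simp add: Comp_def)
  have "eventually (\<lambda>n. dst l (u (r n)) < e) sequentially" by (rule order_tendstoD(2)[OF lim e])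
  then obtain n where n: "dst l (u (r n)) < e" by (auto simp: eventually_sequentially)
  have uc: "u (r n) \<in> \<G>" using On_closed[OF u(1)] .
  have "\<rho> l \<le> 3 * e" using rho_diff[OF uc l] dist_sym[OF uc l] u(2)[of "r n"] n by linarith
  then have "l \<in> S" using lC by (simp add: S_def)
  then show False using u(3)[of l "r n"] n by blast
 qed
 then obtain n0 where n0: "!!x. x \<in> On n0 ==> \<rho> x \<le> 2 * e ==> \<exists>c\<in>S. dst c x < e" by blast
 obtain n1 where n1: "\<theta> ^ n1 * 1 < e" using theta_pow_small[OF e] by blast
 define n where "n = max n0 n1"
 have "\<theta> ^ n \<le> \<theta> ^ n1" using theta by (intro power_decreasing) (auto simp: n_def)
 then have n: "\<theta> ^ n < e" using n1 by simp
 have nn: "On n \<subseteq> On n0" by (rule On_antimono) (simp add: n_def)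
 let ?L = "generate G S"
 have Sc: "S \<subseteq> \<G>" using invsub_mem[OF Comp_invsub] by (auto simp: S_def)
 have LC: "?L \<subseteq> Comp" by (rule generate_subgroup_incl[OF _ invsub_subgroup[OF Comp_invsub]]) (auto simp: S_def)
 have "\<exists>l\<in>?L. dst l x < e" if x: "x \<in> On n" for x
  using x[unfolded On_def]
 proof (rule generate_right_induct[where P = "\<lambda>x. \<exists>l\<in>?L. dst l x < e"])
  show "\<exists>l\<in>?L. \<rho> (inv l \<otimes> \<one>) < e" using e by (intro bexI[of _ \<one>]) (auto intro: generate.one)
  fix x s assume x: "x \<in> generate G {x \<in> \<G>. \<rho> x < \<theta> ^ n}" and ex: "\<exists>l\<in>?L. dst l x < e"
   and s: "s \<in> {x \<in> \<G>. \<rho> x < \<theta> ^ n}"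
  obtain l where l: "l \<in> ?L" "dst l x < e" using ex by blast
  have xO: "x \<in> On n" using x by (simp add: On_def)
  have sO: "s \<in> On n" using s by (simp add: On_def generate.incl)
  have lO: "l \<in> On n" using l LC Comp_On by blast
  have c: "x \<in> \<G>" "s \<in> \<G>" "l \<in> \<G>" using xO sO lO On_closed by blast+
  define y where "y = inv l \<otimes> x \<otimes> s"
  have yO: "y \<in> On n" unfolding y_def
   using xO sO lO On_subgroup by (simp add: subgroup.m_closed subgroup.m_inv_closed)
  have "\<rho> y \<le> dst l x + \<rho> s" using rho_mult c by (simp add: y_def)
  \<comment> \<open>The deviation from l was below e and the new generator is below e, so y has not
    left the range in which elements of the open subgroup are close to S.\<close>
  then have "\<rho> y \<le> 2 * e" using l s n by auto
  then obtain k where k: "k \<in> S" "dst k y < e" using n0[of y] yO nn by blast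
  have kc: "k \<in> \<G>" using k Sc by blast
  have "l \<otimes> k \<in> ?L" using l k by (simp add: generate.eng generate.incl)
  moreover have "inv (l \<otimes> k) \<otimes> (x \<otimes> s) = inv k \<otimes> y" using c kc by (simp add: y_def gsimps)
  ultimately show "\<exists>l\<in>?L. dst l (x \<otimes> s) < e" using k by (metis (no_types))
 qed (auto simp: rho_inv)
 then show ?thesis unfolding S_def by blast
qed

text \<open>An element x of the component is within e of a product l of short component elements,
  and then inv l \<otimes> x is itself a short component element. Generation by arbitrarily short
  elements is what makes the component connected.\<close>

lemma generate_Comp:
 assumes e: "0 < e"
 shows "generate G {c \<in> Comp. \<rho> c \<le> 3 * e} = Comp"
proof
 show LC: "generate G {c \<in> Comp. \<rho> c \<le> 3 * e} \<subseteq> Comp"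
  by (rule generate_subgroup_incl[OF _ invsub_subgroup[OF Comp_invsub]]) blast
 obtain n where n: "!!x. x \<in> On n ==> \<exists>l\<in>generate G {c \<in> Comp. \<rho> c \<le> 3 * e}. dst l x < e"
  using On_close_aux[OF e] by blast
 show "Comp \<subseteq> generate G {c \<in> Comp. \<rho> c \<le> 3 * e}"
 proof
  fix x assume x: "x \<in> Comp"
  obtain l where l: "l \<in> generate G {c \<in> Comp. \<rho> c \<le> 3 * e}" "dst l x < e" using n[OF Comp_On[OF x]] by blast
  have lC: "l \<in> Comp" using l LC by blast
  have "inv l \<otimes> x \<in> Comp" using invsub_mult[OF Comp_invsub invsub_minv[OF Comp_invsub lC] x] .
  then have "inv l \<otimes> x \<in> generate G {c \<in> Comp. \<rho> c \<le> 3 * e}" using l e by (intro generate.incl) auto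
  from generate.eng[OF l(1) this] show "x \<in> generate G {c \<in> Comp. \<rho> c \<le> 3 * e}"
   using invsub_mem[OF Comp_invsub] lC x by simp
 qed
qed

lemma On_close_Comp:
 assumes "0 < e"
 shows "\<exists>n. \<forall>x\<in>On n. \<exists>c\<in>Comp. dst c x < e"
 using On_close_aux[OF assms] by (simp add: generate_Comp[OF assms])

lemma Comp_conn: "connsub Comp"
 unfolding connsub_def
proof (intro allI impI, elim conjE exE)
 fix U r assume U: "subgroup U G" "U \<subseteq> Comp" and r: "0 < r" "\<forall>x\<in>Comp. \<rho> x < r --> x \<in> U"
 have "generate G {c \<in> Comp. \<rho> c \<le> 3 * (r / 4)} \<subseteq> U"
  by (rule generate_subgroup_incl[OF _ U(1)]) (use r in auto)
 then show "U = Comp" using generate_Comp[of "r / 4"] r U by simp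
qed

text \<open>The preimage of an open subgroup under a continuous endomorphism is an open subgroup,
  hence contains the component. Applied to conjugations it gives normality.\<close>

lemma Comp_endo:
 assumes h: "h \<in> hom G G" and c: "!!e. 0 < e ==> \<exists>d>0. \<forall>x\<in>\<G>. \<rho> x < d --> \<rho> (h x) < e"
  and x: "x \<in> Comp"
 shows "h x \<in> Comp"
proof -
 have "h x \<in> On n" for n
 proof -
  define U where "U = {y \<in> \<G>. h y \<in> On n}"
  interpret h: group_hom G G h by unfold_locales (rule h)
  have "subgroup U G"
   using On_subgroup[of n] by (intro subgroupI)
    (auto simp: U_def subgroup.one_closed subgroup.m_closed subgroup.m_inv_closed intro: exI[of _ \<one>])
  moreover obtain r where r: "0 < r" "!!x. x \<in> \<G> ==> \<rho> x < r ==> x \<in> On n"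
   using On_opensub[of n] by (auto simp: opensub_def)
  moreover obtain d where "d > 0" "\<forall>x\<in>\<G>. \<rho> x < d --> \<rho> (h x) < r" using c[OF r(1)] by blast
  ultimately have "opensub U" unfolding opensub_def U_def by (auto intro!: exI[of _ d])
  then obtain m where "On m \<subseteq> U" using On_least by blast
  then show ?thesis using Comp_On[OF x, of m] by (auto simp: U_def)
 qed
 then show ?thesis by (simp add: Comp_def)
qed

text \<open>Distance to a subgroup; left multiplication matches the right cosets used by \<open>G Mod N\<close>.\<close>
definition dd :: "'a set => 'a => real" where
 "dd N x = (INF n\<in>N. \<rho> (n \<otimes> x))"

lemma dd_bdd: "N \<subseteq> \<G> ==> x \<in> \<G> ==> bdd_below ((\<lambda>n. \<rho> (n \<otimes> x)) ` N)"
 by (rule bdd_belowI2[of _ 0]) (auto intro!: rho_nonneg)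

lemma dd_le: "subgroup N G ==> x \<in> \<G> ==> n \<in> N ==> dd N x \<le> \<rho> (n \<otimes> x)"
 unfolding dd_def by (rule cINF_lower[OF dd_bdd]) (auto simp: subgroup.subset)

lemma dd_greatest: "subgroup N G ==> (!!n. n \<in> N ==> c \<le> \<rho> (n \<otimes> x)) ==> c \<le> dd N x"
 unfolding dd_def by (rule cINF_greatest) (auto dest: subgroup.one_closed)

lemma dd_le_rho: "subgroup N G ==> x \<in> \<G> ==> dd N x \<le> \<rho> x"
 using dd_le[of N x \<one>] by (simp add: subgroup.one_closed)

lemma dd_nonneg: "subgroup N G ==> x \<in> \<G> ==> 0 \<le> dd N x"
 by (rule dd_greatest) (auto intro!: rho_nonneg dest: subgroup.mem_carrier)

lemma dd_approx:
 assumes "subgroup N G" "x \<in> \<G>" "dd N x < c"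
 shows "\<exists>n\<in>N. \<rho> (n \<otimes> x) < c"
proof (rule ccontr)
 assume "\<not> ?thesis"
 then have "c \<le> dd N x" using assms(1) by (intro dd_greatest) (auto simp: not_less)
 then show False using assms by simp
qed

lemma dd_left:
 assumes N: "subgroup N G" and x: "x \<in> \<G>" and m: "m \<in> N"
 shows "dd N (m \<otimes> x) = dd N x"
proof -
 have mc: "m \<in> \<G>" using subgroup.mem_carrier[OF N m] .
 have "dd N x \<le> dd N (m \<otimes> x)"
 proof (rule dd_greatest[OF N])
  fix n assume n: "n \<in> N"
  show "dd N x \<le> \<rho> (n \<otimes> (m \<otimes> x))"
   using dd_le[OF N x subgroup.m_closed[OF N n m]] subgroup.mem_carrier[OF N n] mc x by (simp add: m_assoc)
 qed
 moreover have "dd N (m \<otimes> x) \<le> dd N x"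
 proof (rule dd_greatest[OF N])
  fix n assume n: "n \<in> N"
  show "dd N (m \<otimes> x) \<le> \<rho> (n \<otimes> x)"
   using dd_le[OF N _ subgroup.m_closed[OF N n subgroup.m_inv_closed[OF N m]], of "m \<otimes> x"]
    subgroup.mem_carrier[OF N n] mc x by (simp add: m_assoc)
 qed
 ultimately show ?thesis by simp
qed

lemma dd_zero_iff:
 assumes N: "invsub N" and x: "x \<in> \<G>"
 shows "dd N x = 0 \<longleftrightarrow> x \<in> N"
proof
 note sub = invsub_subgroup[OF N]
 show "dd N x = 0" if "x \<in> N"
  using dd_le[OF sub x invsub_minv[OF N that]] dd_nonneg[OF sub x] x by simp
 assume z: "dd N x = 0"
 show "x \<in> N"
 proof (rule ccontr)
  assume xn: "x \<notin> N"
  then obtain e where e: "0 < e" "!!a. a \<in> N ==> \<not> dst x a < e"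
   using seqclosedD[OF invsub_closed[OF N] x] by metis
  obtain n where n: "n \<in> N" "\<rho> (n \<otimes> x) < e" using dd_approx[OF sub x, of e] z e by auto
  have nc: "n \<in> \<G>" using invsub_mem[OF N n(1)] .
  have "dst x (inv n) = \<rho> (n \<otimes> x)" using rho_inv[of "n \<otimes> x"] nc x by (simp add: gsimps)
  then show False using e(2)[OF invsub_minv[OF N n(1)]] n by simp
 qed
qed

lemma dd_alpha:
 assumes N: "invsub N" and x: "x \<in> \<G>"
 shows "dd N (\<alpha> x) = \<theta> * dd N x"
proof -
 note sub = invsub_subgroup[OF N] and Nc = invsub_mem[OF N]
 have le: "\<theta> * dd N x \<le> dd N (\<alpha> x)"
 proof (rule dd_greatest[OF sub])
  fix n assume n: "n \<in> N"
  have n': "ap (-1) n \<in> N" by (rule invsub_ap[OF N n])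
  have "n \<otimes> \<alpha> x = \<alpha> (ap (-1) n \<otimes> x)" using ap_cancel(1)[of n 1] Nc[OF n] x by simp
  then have "\<rho> (n \<otimes> \<alpha> x) = \<theta> * \<rho> (ap (-1) n \<otimes> x)" using Nc[OF n] x by (simp only: rho_alpha ap_closed m_closed)
  then show "\<theta> * dd N x \<le> \<rho> (n \<otimes> \<alpha> x)" using dd_le[OF sub x n'] theta by simp
 qed
 have "dd N (\<alpha> x) / \<theta> \<le> dd N x"
 proof (rule dd_greatest[OF sub])
  fix n assume n: "n \<in> N"
  have "dd N (\<alpha> x) \<le> \<rho> (\<alpha> n \<otimes> \<alpha> x)" using dd_le[OF sub _ invsub_ap[OF N n, of 1], of "\<alpha> x"] x by simp
  also have "\<dots> = \<theta> * \<rho> (n \<otimes> x)" using rho_alpha[of "n \<otimes> x"] Nc[OF n] x by simp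
  finally show "dd N (\<alpha> x) / \<theta> \<le> \<rho> (n \<otimes> x)" using theta by (simp add: field_simps)
 qed
 then show ?thesis using le theta by (simp add: field_simps)
qed

lemma dd_ap:
 assumes N: "invsub N" and x: "x \<in> \<G>"
 shows "dd N (ap k x) = \<theta> powi k * dd N x"
proof (induction k rule: int_induct[where k = 0])
 case (step1 i)
 then show ?case using ap_Suc[OF x, of i] dd_alpha[OF N, of "ap i x"] x theta by (simp add: power_int_add)
next
 case (step2 i)
 have "dd N (ap i x) = \<theta> * dd N (ap (i - 1) x)"
  using ap_Suc[OF x, of "i - 1"] dd_alpha[OF N, of "ap (i - 1) x"] x by simp
 then show ?case using step2 theta by (simp add: power_int_diff field_simps)
qed simp

lemma dd_mult:
 assumes N: "N \<lhd> G" and x: "x \<in> \<G>" "y \<in> \<G>"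
 shows "dd N (x \<otimes> y) \<le> dd N x + dd N y"
proof (rule field_le_epsilon)
 fix e :: real assume e: "0 < e"
 have sub: "subgroup N G" using N by (simp add: normal_def)
 note Nc = subgroup.mem_carrier[OF sub]
 obtain n where n: "n \<in> N" "\<rho> (n \<otimes> x) < dd N x + e / 2" using dd_approx[OF sub x(1), of "dd N x + e / 2"] e by auto
 obtain m where m: "m \<in> N" "\<rho> (m \<otimes> y) < dd N y + e / 2" using dd_approx[OF sub x(2), of "dd N y + e / 2"] e by auto
 have "n \<otimes> (x \<otimes> m \<otimes> inv x) \<in> N"
  using n m normal.inv_op_closed2[OF N x(1)] subgroup.m_closed[OF sub] by blast
 then have "dd N (x \<otimes> y) \<le> \<rho> (n \<otimes> (x \<otimes> m \<otimes> inv x) \<otimes> (x \<otimes> y))" using dd_le[OF sub] x by simp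
 also have "n \<otimes> (x \<otimes> m \<otimes> inv x) \<otimes> (x \<otimes> y) = (n \<otimes> x) \<otimes> (m \<otimes> y)" using n m Nc x by (simp add: gsimps)
 also have "\<rho> \<dots> \<le> \<rho> (n \<otimes> x) + \<rho> (m \<otimes> y)" using n m Nc x by (intro rho_mult) auto
 finally show "dd N (x \<otimes> y) \<le> dd N x + dd N y + e" using n m by simp
qed

lemma dd_inv:
 assumes N: "N \<lhd> G" and x: "x \<in> \<G>"
 shows "dd N (inv x) = dd N x"
proof -
 have sub: "subgroup N G" using N by (simp add: normal_def)
 note Nc = subgroup.mem_carrier[OF sub]
 have le: "dd N (inv x) \<le> dd N x" if x: "x \<in> \<G>" for x
 proof (rule dd_greatest[OF sub])
  fix n assume n: "n \<in> N"
  have "inv x \<otimes> inv n \<otimes> x \<in> N" using normal.inv_op_closed1[OF N x subgroup.m_inv_closed[OF sub n]] .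
  then have "dd N (inv x) \<le> \<rho> (inv x \<otimes> inv n \<otimes> x \<otimes> inv x)" using dd_le[OF sub] x by simp
  also have "inv x \<otimes> inv n \<otimes> x \<otimes> inv x = inv (n \<otimes> x)" using x Nc[OF n] by (simp add: gsimps)
  finally show "dd N (inv x) \<le> \<rho> (n \<otimes> x)" using rho_inv x Nc[OF n] by simp
 qed
 show ?thesis using le[OF x] le[of "inv x"] x by simp
qed

section \<open>Quotients by closed invariant normal subgroups\<close>

definition rq :: "'a set => real" where "rq X = Inf (\<rho> ` X)"

lemma rq_coset: "rq (N #> x) = dd N x"
 unfolding rq_def dd_def r_coset_def by (intro arg_cong[where f = Inf]) auto

lemma quotient_hg:
 assumes N: "invsub N" and nor: "N \<lhd> G"
 shows "homogeneous_group (G Mod N) (image \<alpha>) rq \<theta>"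
proof -
 let ?Q = "G Mod N"
 interpret nN: normal N G by (rule nor)
 note sub = invsub_subgroup[OF N] and Nc = invsub_mem[OF N]
 have grp: "group ?Q" by (rule nN.factorgroup_is_group)
 have ca: "carrier ?Q = {N #> x |x. x \<in> \<G>}" by (auto simp: FactGroup_def RCOSETS_def)
 have cin: "N #> x \<in> carrier ?Q" if "x \<in> \<G>" for x using that by (auto simp: ca)
 have cex: "\<exists>x\<in>\<G>. X = N #> x" if "X \<in> carrier ?Q" for X using that by (auto simp: ca)
 have mu: "(N #> x) \<otimes>\<^bsub>?Q\<^esub> (N #> y) = N #> (x \<otimes> y)" if "x \<in> \<G>" "y \<in> \<G>" for x y
  using nN.rcos_sum[OF that] by (simp add: FactGroup_def)
 have one: "\<one>\<^bsub>?Q\<^esub> = N" by (simp add: FactGroup_def)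
 have iv: "inv\<^bsub>?Q\<^esub> (N #> x) = N #> inv x" if "x \<in> \<G>" for x
  using nN.inv_FactGroup[of "N #> x"] nN.rcos_inv[OF that] that by (auto simp: ca)
 have al: "\<alpha> ` (N #> x) = N #> \<alpha> x" if x: "x \<in> \<G>" for x
 proof -
  have "\<alpha> ` (N #> x) = (\<lambda>n. n \<otimes> \<alpha> x) ` (\<alpha> ` N)" unfolding r_coset_def using Nc x by (auto simp: image_iff)
  also have "\<dots> = N #> \<alpha> x" using invsub_image[OF N] by (auto simp: r_coset_def)
  finally show ?thesis .
 qed
 have rep: "\<exists>x\<in>\<G>. X = N #> x \<and> \<rho> x < c" if X: "X \<in> carrier ?Q" "rq X < c" for X c
 proof -
  obtain x where x: "x \<in> \<G>" "X = N #> x" using X by (auto simp: ca)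
  obtain n where n: "n \<in> N" "\<rho> (n \<otimes> x) < c" using dd_approx[OF sub x(1)] X x by (auto simp: rq_coset)
  have "N #> (n \<otimes> x) = N #> n #> x" using coset_mult_assoc[OF invsub_subset[OF N] Nc[OF n(1)] x(1)] by simp
  also have "\<dots> = X" using coset_join2[OF Nc[OF n(1)] sub n(1)] x by simp
  finally show ?thesis using n Nc x by (intro bexI[of _ "n \<otimes> x"]) auto
 qed
 show ?thesis
 proof (intro homogeneous_group.intro[OF grp] homogeneous_group_axioms.intro)
  show "image \<alpha> \<in> iso ?Q ?Q"
  proof (rule isoI)
   show "image \<alpha> \<in> hom ?Q ?Q"
   proof (rule homI)
    fix X assume "X \<in> carrier ?Q"
    then obtain x where x: "x \<in> \<G>" "X = N #> x" using cex by blast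
    show "\<alpha> ` X \<in> carrier ?Q" unfolding x(2) al[OF x(1)] by (rule cin[OF alpha_closed[OF x(1)]])
    fix Y assume "Y \<in> carrier ?Q"
    then obtain y where y: "y \<in> \<G>" "Y = N #> y" using cex by blast
    show "\<alpha> ` (X \<otimes>\<^bsub>?Q\<^esub> Y) = \<alpha> ` X \<otimes>\<^bsub>?Q\<^esub> \<alpha> ` Y"
     by (simp only: x(2) y(2) mu[OF x(1) y(1)] al[OF x(1)] al[OF y(1)] al[OF m_closed[OF x(1) y(1)]]
       alpha_mult[OF x(1) y(1)] mu[OF alpha_closed[OF x(1)] alpha_closed[OF y(1)]])
   qed
   show "bij_betw (image \<alpha>) (carrier ?Q) (carrier ?Q)"
   proof (rule bij_betwI[where g = "image alpha'"])
    have bck: "alpha' ` (\<alpha> ` X) = X" "\<alpha> ` (alpha' ` X) = X" if "X \<subseteq> \<G>" for X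
     using that by (force simp: image_image)+
    have Xc: "X \<subseteq> \<G>" if "X \<in> carrier ?Q" for X using that r_coset_subset_G[OF invsub_subset[OF N]] by (auto simp: ca)
    show "image \<alpha> \<in> carrier ?Q \<rightarrow> carrier ?Q"
    proof (rule funcsetI)
     fix X assume "X \<in> carrier ?Q"
     then obtain x where x: "x \<in> \<G>" "X = N #> x" using cex by blast
     show "\<alpha> ` X \<in> carrier ?Q" unfolding x(2) al[OF x(1)] by (rule cin[OF alpha_closed[OF x(1)]])
    qed
    have al': "alpha' ` (N #> x) = N #> alpha' x" if x: "x \<in> \<G>" for x
    proof -
     have "N #> x = \<alpha> ` (N #> alpha' x)" using al[of "alpha' x"] x by simp
     then show ?thesis using bck(1)[of "N #> alpha' x"] r_coset_subset_G[OF invsub_subset[OF N], of "alpha' x"] x by simp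
    qed
    show "image alpha' \<in> carrier ?Q \<rightarrow> carrier ?Q"
    proof (rule funcsetI)
     fix X assume "X \<in> carrier ?Q"
     then obtain x where x: "x \<in> \<G>" "X = N #> x" using cex by blast
     show "alpha' ` X \<in> carrier ?Q" unfolding x(2) al'[OF x(1)] by (rule cin[OF alpha'_closed[OF x(1)]])
    qed
    show "alpha' ` (\<alpha> ` X) = X" if "X \<in> carrier ?Q" for X using bck(1)[OF Xc[OF that]] .
    show "\<alpha> ` (alpha' ` X) = X" if "X \<in> carrier ?Q" for X using bck(2)[OF Xc[OF that]] .
   qed
  qed
 next
  fix X Y assume "X \<in> carrier ?Q" "Y \<in> carrier ?Q"
  then obtain x y where "x \<in> \<G>" "y \<in> \<G>" "X = N #> x" "Y = N #> y" by (auto simp: ca)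
  then show "rq (X \<otimes>\<^bsub>?Q\<^esub> Y) \<le> rq X + rq Y" using dd_mult[OF nor] by (simp add: nN.rcos_sum rq_coset)
 next
  fix X assume X: "X \<in> carrier ?Q"
  then obtain x where x: "x \<in> \<G>" "X = N #> x" by (auto simp: ca)
  show "(rq X = 0) = (X = \<one>\<^bsub>?Q\<^esub>)"
   using dd_zero_iff[OF N x(1)] x coset_join1[OF _ x(1) sub] coset_join2[OF x(1) sub] invsub_subset[OF N] by (auto simp: rq_coset one)
  show "rq (inv\<^bsub>?Q\<^esub> X) = rq X" using x dd_inv[OF nor x(1)] by (simp add: iv rq_coset)
  show "rq (\<alpha> ` X) = \<theta> * rq X" using x dd_alpha[OF N x(1)] by (simp add: al rq_coset)
  fix e :: real assume "0 < e"
  then obtain d where d: "d > 0" "\<forall>z\<in>\<G>. \<rho> z < d --> \<rho> (x \<otimes> z \<otimes> inv x) < e" using rho_conj[OF x(1)] by blast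
  show "\<exists>d>0. \<forall>Z\<in>carrier ?Q. rq Z < d --> rq (X \<otimes>\<^bsub>?Q\<^esub> Z \<otimes>\<^bsub>?Q\<^esub> inv\<^bsub>?Q\<^esub> X) < e"
  proof (intro exI[of _ d] conjI ballI impI d(1))
   fix Z assume Z: "Z \<in> carrier ?Q" "rq Z < d"
   obtain z where z: "z \<in> \<G>" "Z = N #> z" "\<rho> z < d" using rep[OF Z] by blast
   have "rq (X \<otimes>\<^bsub>?Q\<^esub> Z \<otimes>\<^bsub>?Q\<^esub> inv\<^bsub>?Q\<^esub> X) = dd N (x \<otimes> z \<otimes> inv x)" using x z by (simp add: nN.rcos_sum iv rq_coset)
   also have "\<dots> \<le> \<rho> (x \<otimes> z \<otimes> inv x)" using x z by (intro dd_le_rho sub) auto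
   finally show "rq (X \<otimes>\<^bsub>?Q\<^esub> Z \<otimes>\<^bsub>?Q\<^esub> inv\<^bsub>?Q\<^esub> X) < e" using d z by fastforce
  qed
 next
  fix u :: "nat => 'a set" and R assume u: "!!n. u n \<in> carrier ?Q" "!!n. rq (u n) \<le> R"
  \<comment> \<open>The quotient norm is an infimum, so representatives are taken with norm below R
    + 1; compactness in G then descends.\<close>
  have "\<forall>n. \<exists>x. x \<in> \<G> \<and> u n = N #> x \<and> \<rho> x < R + 1" using rep[OF u(1)] u(2) by (meson le_less_trans less_add_one)
  then obtain x where x: "!!n. x n \<in> \<G>" "!!n. u n = N #> x n" "!!n. \<rho> (x n) < R + 1" by metis
  obtain l r where l: "l \<in> \<G>" and r: "strict_mono (r::nat=>nat)"
   and lim: "(\<lambda>n. dst l (x (r n))) \<longlonglongrightarrow> 0"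
   using rho_compact[of x "R + 1"] x less_imp_le by metis
  have "(\<lambda>n. dd N (inv l \<otimes> x (r n))) \<longlonglongrightarrow> 0"
   by (rule tendsto_sandwich[OF _ _ tendsto_const lim]) (use dd_nonneg[OF sub] dd_le_rho[OF sub] l x in auto)
  then show "\<exists>L\<in>carrier ?Q. \<exists>r::nat=>nat. strict_mono r \<and> (\<lambda>n. rq (inv\<^bsub>?Q\<^esub> L \<otimes>\<^bsub>?Q\<^esub> u (r n))) \<longlonglongrightarrow> 0"
   using l r x by (intro bexI[of _ "N #> l"] exI[of _ r]) (auto simp: iv nN.rcos_sum rq_coset ca)
 qed (use theta in auto)
qed

end

section \<open>Equivariant homomorphisms\<close>

text \<open>Continuity at \<one> gives continuity everywhere for a homomorphism, so only the former
  is recorded. The contraction factors of the two norms are independent.\<close>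

locale homogeneous_hom = homogeneous_group G \<alpha> \<rho> \<theta> + H: homogeneous_group H \<beta> \<rho>' \<theta>'
 for G (structure) and \<alpha> :: "'a => 'a" and \<rho> \<theta> and H (structure) and \<beta> :: "'b => 'b" and \<rho>' \<theta>' +
 fixes q :: "'a => 'b"
 assumes q_hom: "q \<in> hom G H"
  and q_equiv: "!!x. x \<in> \<G> ==> \<beta> (q x) = q (\<alpha> x)"
  and q_cont: "!!e. 0 < e ==> \<exists>d>0. \<forall>x\<in>\<G>. \<rho> x < d --> \<rho>' (q x) < e"
begin

abbreviation (input) multH (infixl "\<star>" 70) where "x \<star> y \<equiv> x \<otimes>\<^bsub>H\<^esub> y"
abbreviation (input) ivH ("ivH _" [81] 80) where "ivH x \<equiv> inv\<^bsub>H\<^esub> x"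

sublocale qh: group_hom G H q
 by unfold_locales (rule q_hom)

definition qker :: "'a set" where "qker = {x \<in> \<G>. q x = \<one>\<^bsub>H\<^esub>}"

lemma q_limit:
 assumes "l \<in> \<G>" "!!n. u n \<in> \<G>" "(\<lambda>n. dst l (u n)) \<longlonglongrightarrow> 0"
 shows "(\<lambda>n. H.dst (q l) (q (u n))) \<longlonglongrightarrow> 0"
proof (rule LIMSEQ_I)
 fix e :: real assume "0 < e"
 then obtain d where d: "0 < d" "!!x. x \<in> \<G> ==> \<rho> x < d ==> \<rho>' (q x) < e" using q_cont by blast
 obtain N where N: "!!n. n \<ge> N ==> norm (dst l (u n) - 0) < d" using LIMSEQ_D[OF assms(3) d(1)] by blast
 have "H.dst (q l) (q (u n)) < e" if "n \<ge> N" for n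
  using d(2)[of "inv l \<otimes> u n"] N[OF that] assms by simp
 then show "\<exists>N. \<forall>n\<ge>N. norm (H.dst (q l) (q (u n)) - 0) < e"
  using H.rho_nonneg assms by (intro exI[of _ N]) auto
qed

lemma q_funpow: "x \<in> \<G> ==> q ((\<alpha> ^^ n) x) = (\<beta> ^^ n) (q x)"
 by (induction n) (auto simp: q_equiv[symmetric])

lemma qker_subgroup: "subgroup qker G"
 unfolding qker_def by (rule subgroupI) auto

lemma qker_normal: "qker \<lhd> G"
 unfolding normal_inv_iff using qker_subgroup by (auto simp: qker_def)

lemma qker_invsub: "invsub qker"
proof (rule invsubI[OF qker_subgroup])
 show "seqclosed qker"
  unfolding seqclosed_def
 proof (intro conjI ballI impI)
  fix x assume x: "x \<in> \<G>" and h: "\<forall>e>0. \<exists>a\<in>qker. dst x a < e"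
  have "\<not> 0 < \<rho>' (q x)"
  proof
   assume "0 < \<rho>' (q x)"
   then obtain d where d: "0 < d" "!!z. z \<in> \<G> ==> \<rho> z < d ==> \<rho>' (q z) < \<rho>' (q x)" using q_cont by blast
   obtain a where a: "a \<in> qker" "dst x a < d" using h d(1) by blast
   have "\<rho>' (q (inv x \<otimes> a)) < \<rho>' (q x)" using a x by (intro d(2)) (auto simp: qker_def)
   then show False using a x by (auto simp: qker_def H.rho_inv)
  qed
  then show "x \<in> qker" using H.rho_pos[of "q x"] x by (auto simp: qker_def)
 qed (auto simp: qker_def)
 fix x assume "x \<in> qker"
 then have x: "x \<in> \<G>" "q x = \<one>\<^bsub>H\<^esub>" by (auto simp: qker_def)
 show "\<alpha> x \<in> qker" using x q_equiv[of x] by (simp add: qker_def)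
 have "\<beta> (q (alpha' x)) = \<beta> \<one>\<^bsub>H\<^esub>" using q_equiv[of "alpha' x"] x by simp
 then have "q (alpha' x) = \<one>\<^bsub>H\<^esub>" by (rule H.alpha_inj[rotated 2]) (use x in simp_all)
 then show "alpha' x \<in> qker" using x by (simp add: qker_def)
qed

text \<open>Homogeneity replaces the open mapping theorem: an element far from the kernel with image near the
 identity can be rescaled into a fixed annulus, which is compact modulo the kernel.\<close>
lemma q_open:
 assumes e: "0 < e"
 shows "\<exists>d>0. \<forall>x\<in>\<G>. \<rho>' (q x) < d --> (\<exists>k\<in>qker. \<rho> (k \<otimes> x) < e)"
proof (rule ccontr)
 assume neg: "\<not> ?thesis"
 have "\<exists>x. x \<in> \<G> \<and> \<rho>' (q x) < d \<and> e \<le> dd qker x" if "0 < d" for d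
 proof -
  have "\<not> (\<forall>x\<in>\<G>. \<rho>' (q x) < d --> (\<exists>k\<in>qker. \<rho> (k \<otimes> x) < e))"
  proof
   assume "\<forall>x\<in>\<G>. \<rho>' (q x) < d --> (\<exists>k\<in>qker. \<rho> (k \<otimes> x) < e)"
   with that have "\<exists>d>0. \<forall>x\<in>\<G>. \<rho>' (q x) < d --> (\<exists>k\<in>qker. \<rho> (k \<otimes> x) < e)" by (intro exI[of _ d] conjI)
   with neg show False by (rule notE)
  qed
  then obtain x where x: "x \<in> \<G>" "\<rho>' (q x) < d" "\<not> (\<exists>k\<in>qker. \<rho> (k \<otimes> x) < e)" by auto
  have "e \<le> dd qker x" using x(3) by (intro dd_greatest[OF qker_subgroup]) (auto simp: not_less)
  then show ?thesis using x by blast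
 qed
 then have "\<exists>x. x \<in> \<G> \<and> \<rho>' (q x) < 1 / real (Suc n) \<and> e \<le> dd qker x" for n by simp
 then obtain x where x: "!!n. x n \<in> \<G>" "!!n. \<rho>' (q (x n)) < 1 / real (Suc n)" "!!n. e \<le> dd qker (x n)"
  by metis
 have "\<exists>z. z \<in> \<G> \<and> \<rho>' (q z) < 1 / real (Suc n) \<and> \<theta> * e < dd qker z \<and> \<rho> z < e + 1" for n
 proof -
  have d0: "0 < dd qker (x n)" using x(3)[of n] e by linarith
  obtain k where k: "\<theta> < \<theta> powi k * (dd qker (x n) / e)" "\<theta> powi k * (dd qker (x n) / e) \<le> 1"
   using scale_into_interval[of "dd qker (x n) / e" \<theta>] d0 e theta by auto
  \<comment> \<open>The distance to the kernel is at least e, so bringing it into the annulus is a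
    contraction. This matters because the image in H must not grow under the same power.\<close>
  have k0: "0 \<le> k"
  proof (rule ccontr)
   assume "\<not> 0 \<le> k"
   then have "1 < \<theta> powi k" using theta by (simp add: power_int_def one_less_inverse power_less_one_iff)
   moreover have "1 \<le> dd qker (x n) / e" using x(3)[of n] e by simp
   ultimately have "1 < \<theta> powi k * (dd qker (x n) / e)" by (metis less_le_trans mult_cancel_left2 mult_le_cancel_left_pos mult_zero_left not_one_less_zero linorder_not_less less_trans zero_less_one)
   then show False using k(2) by simp
  qed
  define z0 where "z0 = (\<alpha> ^^ nat k) (x n)"
  have z0: "z0 = ap k (x n)" "z0 \<in> \<G>" using k0 x(1)[of n] by (auto simp: z0_def ap_def)
  have ddz: "dd qker z0 = \<theta> powi k * dd qker (x n)" unfolding z0(1) by (rule dd_ap[OF qker_invsub x(1)])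
  have dz: "\<theta> * e < dd qker z0" "dd qker z0 < e + 1" using k e unfolding ddz by (simp_all add: field_simps)
  have "\<rho>' (q z0) = \<theta>' ^ nat k * \<rho>' (q (x n))" unfolding z0_def using x(1)[of n] by (simp add: q_funpow H.rho_funpow)
  also have "\<dots> \<le> 1 * \<rho>' (q (x n))" using H.theta x(1)[of n] H.rho_nonneg[of "q (x n)"] by (intro mult_right_mono power_le_one) auto
  finally have qz: "\<rho>' (q z0) < 1 / real (Suc n)" using x(2)[of n] by simp
  \<comment> \<open>Multiplying by a kernel element changes neither the image nor the distance to
    the kernel, and makes the sequence bounded. Its limit lies in the kernel, although its members
    keep a distance above \<theta> * e from it.\<close>
  obtain m where m: "m \<in> qker" "\<rho> (m \<otimes> z0) < e + 1" using dd_approx[OF qker_subgroup z0(2) dz(2)] by blast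
  show ?thesis
   using m z0(2) qz dz(1) dd_left[OF qker_subgroup z0(2) m(1)] by (intro exI[of _ "m \<otimes> z0"]) (auto simp: qker_def)
 qed
 then obtain z where z: "!!n. z n \<in> \<G>" "!!n. \<rho>' (q (z n)) < 1 / real (Suc n)" "!!n. \<theta> * e < dd qker (z n)" "!!n. \<rho> (z n) < e + 1"
  by metis
 obtain l r where l: "l \<in> \<G>" and r: "strict_mono (r::nat=>nat)"
  and lim: "(\<lambda>n. dst l (z (r n))) \<longlonglongrightarrow> 0"
  using rho_compact[of z "e + 1"] z(1,4) less_imp_le by metis
 have ql: "\<rho>' (q l) \<le> 0"
 proof (rule LIMSEQ_le_const)
  show "(\<lambda>n. 1 / real (Suc (r n)) + H.dst (q l) (q (z (r n)))) \<longlonglongrightarrow> 0"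
   using tendsto_add[OF LIMSEQ_subseq_LIMSEQ[OF LIMSEQ_Suc[OF lim_1_over_n] r] q_limit[OF l z(1) lim]]
   by (simp add: o_def)
  have "\<rho>' (q l) \<le> 1 / real (Suc (r n)) + H.dst (q l) (q (z (r n)))" for n
   using H.rho_diff[of "q (z (r n))" "q l"] H.dist_sym[of "q (z (r n))" "q l"] z(1)[of "r n"] z(2)[of "r n"] l by simp
  then show "\<exists>N. \<forall>n\<ge>N. \<rho>' (q l) \<le> 1 / real (Suc (r n)) + H.dst (q l) (q (z (r n)))" by blast
 qed
 then have lK: "l \<in> qker" using H.rho_pos[of "q l"] l by (force simp: qker_def)
 have "eventually (\<lambda>n. dst l (z (r n)) < \<theta> * e) sequentially"
  by (rule order_tendstoD(2)[OF lim]) (use theta e in simp)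
 then obtain n where "dst l (z (r n)) < \<theta> * e" by (auto simp: eventually_sequentially)
 then show False using z(3)[of "r n"] dd_le[OF qker_subgroup z(1) subgroup.m_inv_closed[OF qker_subgroup lK], of "r n"] by simp
qed

lemma q_lift:
 assumes "q ` \<G> = carrier H" "0 < e"
 shows "\<exists>d>0. \<forall>y\<in>carrier H. \<rho>' y < d --> (\<exists>x\<in>\<G>. q x = y \<and> \<rho> x < e)"
proof -
 obtain d where d: "0 < d" "!!x. x \<in> \<G> ==> \<rho>' (q x) < d ==> \<exists>k\<in>qker. \<rho> (k \<otimes> x) < e" using q_open[OF assms(2)] by blast
 show ?thesis
 proof (intro exI[of _ d] conjI ballI impI d(1))
  fix y assume y: "y \<in> carrier H" "\<rho>' y < d"
  then obtain x where x: "x \<in> \<G>" "y = q x" using assms(1) by blast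
  then obtain k where k: "k \<in> qker" "\<rho> (k \<otimes> x) < e" using d(2) y by blast
  then show "\<exists>x\<in>\<G>. q x = y \<and> \<rho> x < e" using x by (intro bexI[of _ "k \<otimes> x"]) (auto simp: qker_def)
 qed
qed

text \<open>For closedness, preimages of approximants of y are compared with one fixed x0: by
  \<open>q_open\<close> they can be corrected by kernel elements to x0 \<otimes> w with w in the
  unit ball, where a subsequence converges.\<close>

lemma q_image_invsub: "H.invsub (q ` \<G>)"
proof (rule H.invsubI)
 show sub: "subgroup (q ` \<G>) H" by (rule qh.img_is_subgroup)
 show "\<beta> y \<in> q ` \<G>" if "y \<in> q ` \<G>" for y using that by (auto simp: q_equiv)
 show "H.alpha' y \<in> q ` \<G>" if y: "y \<in> q ` \<G>" for y
 proof -
  obtain x where x: "y = q x" "x \<in> \<G>" by (rule imageE[OF y])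
  have "\<beta> (q (alpha' x)) = y" using q_equiv[of "alpha' x"] x by simp
  then have "H.alpha' y = q (alpha' x)" using H.alpha'_alpha[of "q (alpha' x)"] x by auto
  then show ?thesis using x by auto
 qed
 show "H.seqclosed (q ` \<G>)"
  unfolding H.seqclosed_def
 proof (intro conjI ballI impI)
  fix y assume y: "y \<in> carrier H" and h: "\<forall>e>0. \<exists>a\<in>q ` \<G>. H.dst y a < e"
  have h': "\<exists>x\<in>\<G>. H.dst y (q x) < e" if "0 < e" for e using h that by simp
  obtain d where d: "0 < d" "!!x. x \<in> \<G> ==> \<rho>' (q x) < d ==> \<exists>k\<in>qker. \<rho> (k \<otimes> x) < 1" using q_open[of 1] by auto
  obtain x0 where x0: "x0 \<in> \<G>" "H.dst y (q x0) < d / 2" using h'[of "d / 2"] d by auto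
  have "\<exists>w. w \<in> \<G> \<and> \<rho> w \<le> 1 \<and> H.dst y (q (x0 \<otimes> w)) < 1 / real (Suc n)" for n
  proof -
   obtain x where x: "x \<in> \<G>" "H.dst y (q x) < min (d / 2) (1 / real (Suc n))"
    using h'[of "min (d / 2) (1 / real (Suc n))"] d by auto
   have "\<rho>' (q (inv x0 \<otimes> x)) < d"
    using H.dist_tri[of "q x0" y "q x"] H.dist_sym[of y "q x0"] x x0 y by simp
   then obtain k where k: "k \<in> qker" "\<rho> (k \<otimes> (inv x0 \<otimes> x)) < 1" using d(2)[of "inv x0 \<otimes> x"] x x0 by auto
   have kc: "k \<in> \<G>" "q k = \<one>\<^bsub>H\<^esub>" using k by (auto simp: qker_def)
   have "q (x0 \<otimes> (k \<otimes> (inv x0 \<otimes> x))) = q x" using kc x x0 by simp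
   then show ?thesis using k x x0 kc by (intro exI[of _ "k \<otimes> (inv x0 \<otimes> x)"]) simp
  qed
  then obtain w where w: "!!n. w n \<in> \<G>" "!!n. \<rho> (w n) \<le> 1" "!!n. H.dst y (q (x0 \<otimes> w n)) < 1 / real (Suc n)"
   by metis
  obtain l r where l: "l \<in> \<G>" and r: "strict_mono (r::nat=>nat)"
   and lim: "(\<lambda>n. dst l (w (r n))) \<longlonglongrightarrow> 0"
   using rho_compact[of w 1] w by blast
  have "H.dst y (q (x0 \<otimes> l)) \<le> 0"
  proof (rule LIMSEQ_le_const)
   have "(\<lambda>n. dst (x0 \<otimes> l) (x0 \<otimes> w (r n))) \<longlonglongrightarrow> 0" using lim x0 l w by (simp add: gsimps)
   from q_limit[OF _ _ this] have "(\<lambda>n. H.dst (q (x0 \<otimes> l)) (q (x0 \<otimes> w (r n)))) \<longlonglongrightarrow> 0" using x0 l w by simp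
   then show "(\<lambda>n. 1 / real (Suc (r n)) + H.dst (q (x0 \<otimes> l)) (q (x0 \<otimes> w (r n)))) \<longlonglongrightarrow> 0"
    using tendsto_add[OF LIMSEQ_subseq_LIMSEQ[OF LIMSEQ_Suc[OF lim_1_over_n] r]] by (force simp: o_def)
   have "H.dst y (q (x0 \<otimes> l)) \<le> 1 / real (Suc (r n)) + H.dst (q (x0 \<otimes> l)) (q (x0 \<otimes> w (r n)))" for n
    using H.dist_tri[of y "q (x0 \<otimes> w (r n))" "q (x0 \<otimes> l)"] H.dist_sym[of "q (x0 \<otimes> w (r n))" "q (x0 \<otimes> l)"]
     w(1)[of "r n"] w(3)[of "r n"] l x0 y by (simp del: qh.hom_mult)
   then show "\<exists>N. \<forall>n\<ge>N. H.dst y (q (x0 \<otimes> l)) \<le> 1 / real (Suc (r n)) + H.dst (q (x0 \<otimes> l)) (q (x0 \<otimes> w (r n)))" by blast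
  qed
  then have "ivH y \<star> q (x0 \<otimes> l) = \<one>\<^bsub>H\<^esub>"
   using H.rho_pos[of "ivH y \<star> q (x0 \<otimes> l)"] x0 l y by force
  then have "q (x0 \<otimes> l) = y" using x0 l y H.inv_solve_left'[of "\<one>\<^bsub>H\<^esub>" y "q (x0 \<otimes> l)"] by (metis H.cancel_left(2) H.r_one m_closed qh.hom_closed)
  then show "y \<in> q ` \<G>" using x0 l by blast
 qed auto
qed

end

section \<open>Properties of characters and square roots in abelian groups\<close>

context homogeneous_group
begin

lemma conn_right_induct:
 assumes conn "0 < r" "x \<in> \<G>" "P \<one>"
  and "!!x z. x \<in> \<G> ==> P x ==> z \<in> \<G> ==> \<rho> z < r ==> P (x \<otimes> z)"
 shows "P x"
proof -
 let ?B = "{x \<in> \<G>. \<rho> x < r}"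
 have "subgroup (generate G ?B) G" by (rule generate_is_subgroup) auto
 moreover have "\<forall>x\<in>\<G>. \<rho> x < r --> x \<in> generate G ?B" by (simp add: generate.incl)
 ultimately have "opensub (generate G ?B)"
  unfolding opensub_def by (intro conjI exI[of _ r] assms(2))
 then have "generate G ?B = \<G>" by (rule assms(1)[unfolded conn_def, rule_format])
 then have "x \<in> generate G ?B" using assms(3) by (simp only:)
 then show ?thesis
 proof (rule generate_right_induct)
  fix x s assume "x \<in> generate G ?B" "P x" "s \<in> ?B"
  then show "P (x \<otimes> s)" using assms(5) generate_in_carrier[of ?B x] by blast
 qed (use assms(4) in \<open>auto simp: rho_inv\<close>)
qed

lemma chr_mult: "chr \<xi> ==> x \<in> \<G> ==> y \<in> \<G> ==> \<xi> (x \<otimes> y) = \<xi> x + \<xi> y"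
 by (simp add: chr_def)

lemma chr_one: "chr \<xi> ==> \<xi> \<one> = 0"
 using chr_mult[of \<xi> \<one> \<one>] by simp

lemma chr_inv: "chr \<xi> ==> x \<in> \<G> ==> \<xi> (inv x) = - \<xi> x"
 using chr_mult[of \<xi> x "inv x"] chr_one[of \<xi>] by simp

lemma chr_pow: "chr \<xi> ==> x \<in> \<G> ==> \<xi> (x [^] (n::nat)) = n * \<xi> x"
 by (induction n) (auto simp: chr_one chr_mult distrib_right)

lemma chr_int_pow: "chr \<xi> ==> x \<in> \<G> ==> \<xi> (x [^] (n::int)) = n * \<xi> x"
 by (cases n rule: int_cases2) (auto simp: int_pow_int int_pow_neg_int chr_pow chr_inv)

text \<open>If \<rho> x < 1 / n, the n-th power of x is still in the unit ball, so n * |\<xi> x| is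
  at most the bound K there.\<close>

lemma chr_small:
 assumes \<xi>: "chr \<xi>" and e: "0 < e"
 shows "\<exists>d>0. \<forall>x\<in>\<G>. \<rho> x < d --> \<bar>\<xi> x\<bar> < e"
proof -
 obtain K where K: "!!x. x \<in> \<G> ==> \<rho> x \<le> 1 ==> \<bar>\<xi> x\<bar> \<le> K" using \<xi> by (auto simp: chr_def)
 have K0: "0 \<le> K" using K[of \<one>] by simp
 obtain n :: nat where n: "K / e < n" using reals_Archimedean2 by blast
 have n0: "0 < n" using n K0 e by (smt (verit) divide_nonneg_pos of_nat_0_less_iff)
 show ?thesis
 proof (intro exI[of _ "1 / n"] conjI ballI impI)
  fix x assume x: "x \<in> \<G>" "\<rho> x < 1 / n"
  have "\<rho> (x [^] k) \<le> k * \<rho> x" for k :: nat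
  proof (induction k)
   case (Suc k)
   then show ?case using rho_mult[of "x [^] k" x] x by (simp add: distrib_right)
  qed simp
  then have "\<rho> (x [^] n) \<le> n * \<rho> x" .
  also have "\<dots> \<le> 1" using x n0 by (simp add: field_simps)
  finally have "\<bar>\<xi> (x [^] n)\<bar> \<le> K" using x by (intro K) auto
  then have "n * \<bar>\<xi> x\<bar> \<le> K" using \<xi> x by (simp add: chr_pow abs_mult)
  also have "K < n * e" using n e by (simp add: field_simps)
  finally show "\<bar>\<xi> x\<bar> < e" using n0 by simp
 qed (use n0 in simp)
qed

lemma chr_bdd:
 assumes \<xi>: "chr \<xi>"
 shows "\<exists>K. \<forall>x\<in>\<G>. \<rho> x \<le> R --> \<bar>\<xi> x\<bar> \<le> K"
proof -
 obtain K where K: "!!x. x \<in> \<G> ==> \<rho> x \<le> 1 ==> \<bar>\<xi> x\<bar> \<le> K" using \<xi> by (auto simp: chr_def)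
 obtain F where F: "finite F" "F \<subseteq> \<G>" "!!x. x \<in> \<G> ==> \<rho> x \<le> R ==> \<exists>y\<in>F. dst y x < 1"
  using totally_bounded[of 1 R] by auto
 have "\<bar>\<xi> x\<bar> \<le> (\<Sum>y\<in>F. \<bar>\<xi> y\<bar>) + K" if x: "x \<in> \<G>" "\<rho> x \<le> R" for x
 proof -
  obtain y where y: "y \<in> F" "dst y x < 1" using F(3)[OF x] by blast
  have yc: "y \<in> \<G>" using y F by blast
  have "\<bar>\<xi> (inv y \<otimes> x)\<bar> \<le> K" using y x yc by (intro K) auto
  moreover have "\<bar>\<xi> y\<bar> \<le> (\<Sum>y\<in>F. \<bar>\<xi> y\<bar>)" using F y by (intro member_le_sum) auto
  moreover have "\<xi> x = \<xi> y + \<xi> (inv y \<otimes> x)" using chr_mult[OF \<xi> yc, of "inv y \<otimes> x"] x yc by simp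
  ultimately show ?thesis by linarith
 qed
 then show ?thesis by blast
qed

lemma chr_hom_comp:
 assumes \<xi>: "chr \<xi>" and h: "h \<in> hom G G" and b: "!!x. x \<in> \<G> ==> \<rho> x \<le> 1 ==> \<rho> (h x) \<le> R"
 shows "chr (\<lambda>x. \<xi> (h x))"
proof -
 have hc: "h x \<in> \<G>" if "x \<in> \<G>" for x using h that by (auto simp: hom_def)
 obtain K where "!!x. x \<in> \<G> ==> \<rho> x \<le> R ==> \<bar>\<xi> x\<bar> \<le> K" using chr_bdd[OF \<xi>] by blast
 then show ?thesis unfolding chr_def using \<xi> h hc b
  by (intro conjI ballI exI[of _ K] impI) (auto simp: hom_def chr_mult)
qed

lemma chr_ap: "chr \<xi> ==> chr (\<lambda>x. \<xi> (ap k x))"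
proof (rule chr_hom_comp[OF _ ap_hom])
 show "\<rho> (ap k x) \<le> \<theta> powi k * 1" if "x \<in> \<G>" "\<rho> x \<le> 1" for x
  using that theta rho_ap[OF that(1), of k] by simp
qed

lemma chr_scale: "chr \<xi> ==> chr (\<lambda>x. c * \<xi> x)"
proof -
 assume \<xi>: "chr \<xi>"
 obtain K where K: "!!x. x \<in> \<G> ==> \<rho> x \<le> 1 ==> \<bar>\<xi> x\<bar> \<le> K" using \<xi> by (auto simp: chr_def)
 then have "\<bar>c * \<xi> x\<bar> \<le> \<bar>c\<bar> * K" if "x \<in> \<G>" "\<rho> x \<le> 1" for x
  using that by (auto simp: abs_mult intro: mult_left_mono)
 then show ?thesis unfolding chr_def using chr_mult[OF \<xi>] by (auto simp: distrib_left)
qed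

lemma chr_limit:
 assumes \<xi>: "chr \<xi>" and l: "l \<in> \<G>" "!!n. u n \<in> \<G>" "(\<lambda>n. dst l (u n)) \<longlonglongrightarrow> 0"
 shows "(\<lambda>n. \<xi> (u n)) \<longlonglongrightarrow> \<xi> l"
proof (rule LIMSEQ_I)
 fix e :: real assume "0 < e"
 then obtain d where d: "0 < d" "!!x. x \<in> \<G> ==> \<rho> x < d ==> \<bar>\<xi> x\<bar> < e" using chr_small[OF \<xi>] by blast
 obtain N where N: "!!n. n \<ge> N ==> norm (dst l (u n) - 0) < d" using LIMSEQ_D[OF l(3) d(1)] by blast
 have "norm (\<xi> (u n) - \<xi> l) < e" if "n \<ge> N" for n
  using d(2)[of "inv l \<otimes> u n"] N[OF that] l chr_mult[OF \<xi>, of "inv l" "u n"] chr_inv[OF \<xi> l(1)] by simp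
 then show "\<exists>N. \<forall>n\<ge>N. norm (\<xi> (u n) - \<xi> l) < e" by blast
qed

definition chrker :: "'a set" where
 "chrker = {x \<in> \<G>. \<forall>\<xi>. chr \<xi> --> \<xi> x = 0}"

text \<open>Each point other than \<one> has a character bounded away from 0 on a neighbourhood, and
  the annulus is compact. The lower bound u on the norm keeps accumulation points away from
  \<one>.\<close>

lemma annulus_finite:
 assumes \<Psi>: "!!\<xi>. \<xi> \<in> \<Psi> ==> chr \<xi>" and sep: "!!x. x \<in> \<G> ==> x \<noteq> \<one> ==> \<exists>\<xi>\<in>\<Psi>. \<xi> x \<noteq> 0" and u: "0 < u"
 shows "\<exists>\<Phi> c. finite \<Phi> \<and> \<Phi> \<subseteq> \<Psi> \<and> 0 < c \<and> (\<forall>x\<in>\<G>. u \<le> \<rho> x --> \<rho> x \<le> 1 --> (\<exists>\<xi>\<in>\<Phi>. c \<le> \<bar>\<xi> x\<bar>))"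
proof -
 have "\<exists>\<xi> d. \<xi> \<in> \<Psi> \<and> \<xi> y \<noteq> 0 \<and> 0 < d \<and> (\<forall>z\<in>\<G>. dst y z < d --> \<bar>\<xi> y\<bar> / 2 \<le> \<bar>\<xi> z\<bar>)"
  if y: "y \<in> \<G> - {\<one>}" for y
 proof -
  obtain \<xi> where \<xi>: "\<xi> \<in> \<Psi>" "\<xi> y \<noteq> 0" using sep y by blast
  obtain d where d: "0 < d" "!!x. x \<in> \<G> ==> \<rho> x < d ==> \<bar>\<xi> x\<bar> < \<bar>\<xi> y\<bar> / 2"
   using chr_small[OF \<Psi>[OF \<xi>(1)], of "\<bar>\<xi> y\<bar> / 2"] \<xi>(2) by auto
  have "\<bar>\<xi> y\<bar> / 2 \<le> \<bar>\<xi> z\<bar>" if z: "z \<in> \<G>" "dst y z < d" for z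
   using d(2)[of "inv y \<otimes> z"] z y chr_mult[OF \<Psi>[OF \<xi>(1)], of "inv y" z] chr_inv[OF \<Psi>[OF \<xi>(1)], of y]
   by simp (smt (verit))
  then show ?thesis using \<xi> d by blast
 qed
 then obtain f w where fw: "!!y. y \<in> \<G> - {\<one>} ==> f y \<in> \<Psi> \<and> f y y \<noteq> 0 \<and> 0 < w y \<and>
   (\<forall>z\<in>\<G>. dst y z < w y --> \<bar>f y y\<bar> / 2 \<le> \<bar>f y z\<bar>)" by metis
 have "\<exists>F. finite F \<and> F \<subseteq> \<G> - {\<one>} \<and> (\<forall>x\<in>{x \<in> \<G>. u \<le> \<rho> x \<and> \<rho> x \<le> 1}. \<exists>y\<in>F. y \<in> \<G> \<and> dst y x < w y)"
 proof (rule finite_cover[where R = 1])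
  fix x assume x: "x \<in> \<G>" and h: "!!e. 0 < e ==> \<exists>y\<in>{x \<in> \<G>. u \<le> \<rho> x \<and> \<rho> x \<le> 1}. dst x y < e"
  obtain y where "y \<in> \<G>" "u \<le> \<rho> y" "dst x y < u" using h[OF u] by blast
  then have "x \<noteq> \<one>" by auto
  then show "\<exists>y\<in>\<G> - {\<one>}. y \<in> \<G> \<and> dst y x < w y" using x fw[of x] by (intro bexI[of _ x]) auto
 qed auto
 then obtain F where F: "finite F" "F \<subseteq> \<G> - {\<one>}"
   "!!x. x \<in> \<G> ==> u \<le> \<rho> x ==> \<rho> x \<le> 1 ==> \<exists>y\<in>F. y \<in> \<G> \<and> dst y x < w y" by blast
 define c where "c = Min (insert 1 ((\<lambda>y. \<bar>f y y\<bar> / 2) ` F))"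
 have c0: "0 < c" using F(1,2) fw by (auto simp: c_def subset_iff)
 have c1: "c \<le> \<bar>f y y\<bar> / 2" if "y \<in> F" for y unfolding c_def using F(1) that by (intro Min_le) auto
 note c = c0 c1
 have "\<exists>\<xi>\<in>f ` F. c \<le> \<bar>\<xi> x\<bar>" if x: "x \<in> \<G>" "u \<le> \<rho> x" "\<rho> x \<le> 1" for x
 proof -
  obtain y where y: "y \<in> F" "dst y x < w y" using F(3)[OF x] by blast
  have "\<bar>f y y\<bar> / 2 \<le> \<bar>f y x\<bar>" using fw[of y] F(2) y x by blast
  then show ?thesis using c(2)[OF y(1)] y(1) by (intro bexI[of _ "f y"]) auto
 qed
 moreover have "f ` F \<subseteq> \<Psi>" using fw F(2) by blast
 ultimately show ?thesis using F(1) c(1) by (intro exI[of _ "f ` F"] exI[of _ c]) auto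
qed

lemma unit_chr_bound:
 assumes conn "chr \<xi>" "!!x. x \<in> \<G> ==> \<rho> x \<le> 1 ==> \<bar>\<xi> x\<bar> \<le> 1" "x \<in> \<G>"
 shows "\<bar>\<xi> x\<bar> \<le> wl 1 x"
proof -
 have "\<bar>\<xi> x\<bar> \<le> k" if "x \<in> pw 1 k" for x k
  using that
 proof (induction k arbitrary: x)
  case 0
  then show ?case using chr_one[OF assms(2)] by simp
 next
  case (Suc k)
  then obtain u v where uv: "x = u \<otimes> v" "u \<in> \<G>" "\<rho> u \<le> 1" "v \<in> pw 1 k" by auto
  then show ?case using Suc.IH[OF uv(4)] assms(3)[OF uv(2,3)] chr_mult[OF assms(2) uv(2) pw_closed[OF uv(4)]] by simp
 qed
 then show ?thesis using wl_pw[OF assms(1) _ assms(4), of 1] by simp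
qed

text \<open>Modulo Q every element has order at most two, so the finite set F generates a finite
  subgroup there. E represents it, and each new f doubles E.\<close>

lemma finite_square_closed_set:
 assumes comm: "!!x y. x \<in> \<G> ==> y \<in> \<G> ==> x \<otimes> y = y \<otimes> x"
  and F: "finite F" "F \<subseteq> \<G>" and Q: "subgroup Q G" "!!x. x \<in> \<G> ==> x \<otimes> x \<in> Q"
 shows "\<exists>E. finite E \<and> E \<subseteq> \<G> \<and> \<one> \<in> E \<and> (\<forall>x\<in>E. \<forall>f\<in>F. \<exists>e\<in>E. \<exists>q\<in>Q. x \<otimes> f = e \<otimes> q)"
 using F
proof (induction F rule: finite_induct)
 case empty
 then show ?case by (intro exI[of _ "{\<one>}"]) auto
next
 case (insert f F)
 have "F \<subseteq> \<G>" using insert by simp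
 from insert.IH[OF this] obtain E where E': "finite E \<and> E \<subseteq> \<G> \<and> \<one> \<in> E \<and> (\<forall>x\<in>E. \<forall>g\<in>F. \<exists>e\<in>E. \<exists>q\<in>Q. x \<otimes> g = e \<otimes> q)" ..
 note E = E'[THEN conjunct1] E'[THEN conjunct2, THEN conjunct1] E'[THEN conjunct2, THEN conjunct2, THEN conjunct1]
  E'[THEN conjunct2, THEN conjunct2, THEN conjunct2, rule_format]
 have f: "f \<in> \<G>" and Fc: "F \<subseteq> \<G>" using insert by auto
 note Qc = subgroup.mem_carrier[OF Q(1)]
 let ?E = "E \<union> (\<lambda>x. x \<otimes> f) ` E"
 have "\<exists>e\<in>?E. \<exists>q\<in>Q. x \<otimes> g = e \<otimes> q" if x: "x \<in> ?E" and g: "g \<in> insert f F" for x g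
 proof -
  have gc: "g \<in> \<G>" using g f Fc by blast
  consider (a) "x \<in> E" "g = f" | (b) "x \<in> E" "g \<in> F" | (c) y where "y \<in> E" "x = y \<otimes> f" "g = f" | (d) y where "y \<in> E" "x = y \<otimes> f" "g \<in> F"
   using x g by blast
  then show ?thesis
  proof cases
   case a
   then show ?thesis using E f subgroup.one_closed[OF Q(1)] by (intro bexI[of _ "x \<otimes> f"] bexI[of _ \<one>]) auto
  next
   case b
   then show ?thesis using E(4)[of x g] by blast
  next
   case c
   then show ?thesis using E(2) f Q(2)[OF f] by (intro bexI[of _ y] bexI[of _ "f \<otimes> f"]) (auto simp: m_assoc)
  next
   case d
   obtain e q where eq: "e \<in> E" "q \<in> Q" "y \<otimes> g = e \<otimes> q" using E(4) d by blast
   have c: "y \<in> \<G>" "e \<in> \<G>" "q \<in> \<G>" using d E(2) eq Qc by auto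
   have "x \<otimes> g = (y \<otimes> g) \<otimes> f" using c d f gc comm[of f g] by (simp add: m_assoc)
   also have "\<dots> = (e \<otimes> f) \<otimes> q" using c f comm[of q f] by (simp add: eq m_assoc)
   finally show ?thesis using eq by (intro bexI[of _ "e \<otimes> f"] bexI[of _ q]) auto
  qed
 qed
 then show ?case using E f by (intro exI[of _ ?E]) auto
qed

text \<open>The set Q of squares is a closed invariant subgroup. Modulo Q, right multiplication by
  short elements never leaves a finite set E up to an error of norm below 1, so Q is cobounded by
  connectedness and therefore everything.\<close>

lemma square_surj:
 assumes conn: conn and comm: "!!x y. x \<in> \<G> ==> y \<in> \<G> ==> x \<otimes> y = y \<otimes> x"
  and x: "x \<in> \<G>"
 shows "\<exists>y\<in>\<G>. y \<otimes> y = x"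
proof -
 interpret D: homogeneous_hom G \<alpha> \<rho> \<theta> G \<alpha> \<rho> \<theta> "\<lambda>x. x \<otimes> x"
 proof
  show "(\<lambda>x. x \<otimes> x) \<in> hom G G"
  proof (rule homI)
   fix x y assume xy: "x \<in> \<G>" "y \<in> \<G>"
   have "x \<otimes> y \<otimes> (x \<otimes> y) = x \<otimes> (y \<otimes> x) \<otimes> y" using xy by (simp add: m_assoc)
   also have "\<dots> = x \<otimes> x \<otimes> (y \<otimes> y)" using xy comm[of y x] by (simp add: m_assoc)
   finally show "x \<otimes> y \<otimes> (x \<otimes> y) = x \<otimes> x \<otimes> (y \<otimes> y)" .
  qed simp
  fix e :: real assume e: "0 < e"
  show "\<exists>d>0. \<forall>x\<in>\<G>. \<rho> x < d --> \<rho> (x \<otimes> x) < e"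
   using e by (intro exI[of _ "e / 2"]) (auto intro: le_less_trans[OF rho_mult])
 qed simp
 define Q where "Q = (\<lambda>x. x \<otimes> x) ` \<G>"
 have Q: "invsub Q" using D.q_image_invsub by (simp add: Q_def)
 note Qs = invsub_subgroup[OF Q] and Qc = invsub_mem[OF Q]
 \<comment> \<open>Radius 2, because F has to absorb w \<otimes> z with both factors of norm below 1
   and return an error of norm below 1.\<close>
 obtain F where F: "finite F" "F \<subseteq> \<G>" "!!x. x \<in> \<G> ==> \<rho> x \<le> 2 ==> \<exists>y\<in>F. dst y x < 1"
  using totally_bounded[of 1 2] by auto
 have sq: "x \<otimes> x \<in> Q" if "x \<in> \<G>" for x unfolding Q_def using that by (rule imageI)
 have "\<exists>E. finite E \<and> E \<subseteq> \<G> \<and> \<one> \<in> E \<and> (\<forall>x\<in>E. \<forall>f\<in>F. \<exists>e\<in>E. \<exists>q\<in>Q. x \<otimes> f = e \<otimes> q)"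
  by (rule finite_square_closed_set[OF _ F(1,2) Qs sq]) (rule comm)
 then obtain E where E': "finite E \<and> E \<subseteq> \<G> \<and> \<one> \<in> E \<and> (\<forall>x\<in>E. \<forall>f\<in>F. \<exists>e\<in>E. \<exists>q\<in>Q. x \<otimes> f = e \<otimes> q)" ..
 note E = E'[THEN conjunct1] E'[THEN conjunct2, THEN conjunct1] E'[THEN conjunct2, THEN conjunct2, THEN conjunct1]
  E'[THEN conjunct2, THEN conjunct2, THEN conjunct2, rule_format]
 have ex: "\<exists>e\<in>E. \<exists>q\<in>Q. \<exists>w\<in>\<G>. \<rho> w < 1 \<and> x = q \<otimes> (e \<otimes> w)" if "x \<in> \<G>" for x
  using that
 proof (rule conn_right_induct[OF conn, of 1, rotated])
  show "\<exists>e\<in>E. \<exists>q\<in>Q. \<exists>w\<in>\<G>. \<rho> w < 1 \<and> \<one> = q \<otimes> (e \<otimes> w)"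
   using E(3) subgroup.one_closed[OF Qs] by (intro bexI[of _ \<one>]) auto
  fix x z assume xz: "x \<in> \<G>" "z \<in> \<G>" "\<rho> z < 1"
   and "\<exists>e\<in>E. \<exists>q\<in>Q. \<exists>w\<in>\<G>. \<rho> w < 1 \<and> x = q \<otimes> (e \<otimes> w)"
  then obtain e q w where h: "e \<in> E" "q \<in> Q" "w \<in> \<G>" "\<rho> w < 1" "x = q \<otimes> (e \<otimes> w)" by blast
  have "\<rho> (w \<otimes> z) \<le> 2" using rho_mult[of w z] h xz by simp
  then obtain f where f: "f \<in> F" "dst f (w \<otimes> z) < 1" using F(3)[of "w \<otimes> z"] h xz by auto
  obtain e' q' where e': "e' \<in> E" "q' \<in> Q" "e \<otimes> f = e' \<otimes> q'" using E(4)[OF h(1) f(1)] by blast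
  have c: "e \<in> \<G>" "q \<in> \<G>" "e' \<in> \<G>" "q' \<in> \<G>" "f \<in> \<G>"
   using h e' f E(2) F(2) Qc by auto
  have "x \<otimes> z = q \<otimes> ((e \<otimes> f) \<otimes> (inv f \<otimes> (w \<otimes> z)))" using h c xz by (simp add: m_assoc)
  also have "\<dots> = (q \<otimes> q') \<otimes> (e' \<otimes> (inv f \<otimes> (w \<otimes> z)))"
   using c h xz comm[of e' q'] by (simp add: e'(3) m_assoc)
  finally show "\<exists>e\<in>E. \<exists>q\<in>Q. \<exists>w\<in>\<G>. \<rho> w < 1 \<and> x \<otimes> z = q \<otimes> (e \<otimes> w)"
   using e' f c h xz subgroup.m_closed[OF Qs h(2) e'(2)]
   by (intro bexI[of _ e'] bexI[of _ "q \<otimes> q'"] bexI[of _ "inv f \<otimes> (w \<otimes> z)"]) auto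
 qed simp
 define R where "R = (\<Sum>e\<in>E. \<rho> e) + 1"
 have "Q = \<G>"
 proof (rule invsub_cobounded[OF Q invsub_carrier, of R])
  fix x assume x: "x \<in> \<G>"
  obtain e q w where h: "e \<in> E" "q \<in> Q" "w \<in> \<G>" "\<rho> w < 1" "x = q \<otimes> (e \<otimes> w)" using ex[OF x] by blast
  have c: "e \<in> \<G>" "q \<in> \<G>" using h E(2) Qc by auto
  have "\<rho> e \<le> (\<Sum>e\<in>E. \<rho> e)" using E h rho_nonneg by (intro member_le_sum) auto
  then have "dst x q \<le> R"
   using dist_sym[of x q] h c rho_mult[of e w] by (simp add: R_def)
  then show "\<exists>a\<in>Q. dst x a \<le> R" using h by blast
 qed (use Qc in auto)
 then have "x \<in> (\<lambda>x. x \<otimes> x) ` \<G>" using x by (simp only: Q_def)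
 then show ?thesis by (elim imageE) (rule bexI, simp_all)
qed

end

section \<open>The quotient homomorphism and characters of quotients\<close>

locale homogeneous_quotient = homogeneous_group +
 fixes N :: "'a set"
 assumes N_invsub: "invsub N" and N_normal: "N \<lhd> G"
begin

sublocale Q: homogeneous_group "G Mod N" "image \<alpha>" rq \<theta>
 by (rule quotient_hg[OF N_invsub N_normal])

sublocale nN: normal N G
 by (rule N_normal)

lemma pi_closed: "x \<in> \<G> ==> N #> x \<in> carrier (G Mod N)"
 by (auto simp: FactGroup_def RCOSETS_def)

lemma pi_surj: "X \<in> carrier (G Mod N) ==> \<exists>x\<in>\<G>. X = N #> x"
 by (auto simp: FactGroup_def RCOSETS_def)

lemma pi_mult: "x \<in> \<G> ==> y \<in> \<G> ==> (N #> x) \<otimes>\<^bsub>G Mod N\<^esub> (N #> y) = N #> (x \<otimes> y)"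
 using nN.rcos_sum by (simp add: FactGroup_def)

lemma pi_one: "\<one>\<^bsub>G Mod N\<^esub> = N"
 by (simp add: FactGroup_def)

lemma pi_inv: "x \<in> \<G> ==> inv\<^bsub>G Mod N\<^esub> (N #> x) = N #> inv x"
 using nN.inv_FactGroup[OF pi_closed] nN.rcos_inv by simp

lemma pi_eq_N: "x \<in> \<G> ==> N #> x = N \<longleftrightarrow> x \<in> N"
 using coset_join1[OF _ _ nN.is_subgroup] coset_join2[OF _ nN.is_subgroup] nN.subset by blast

lemma pi_eq: "x \<in> \<G> ==> y \<in> \<G> ==> x \<otimes> inv y \<in> N ==> N #> x = N #> y"
proof -
 assume c: "x \<in> \<G>" "y \<in> \<G>" and n: "x \<otimes> inv y \<in> N"
 have "N #> (x \<otimes> inv y) = N" using n c by (simp add: pi_eq_N)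
 then have "N #> (x \<otimes> inv y) #> y = N #> y" by simp
 then show ?thesis using c nN.subset by (simp add: coset_mult_assoc m_assoc)
qed

lemma rq_pi_le: "x \<in> \<G> ==> rq (N #> x) \<le> \<rho> x"
 by (simp add: rq_coset dd_le_rho nN.is_subgroup)

lemma rq_rep:
 assumes "X \<in> carrier (G Mod N)" "rq X < c"
 shows "\<exists>x\<in>\<G>. X = N #> x \<and> \<rho> x < c"
proof -
 obtain x where x: "x \<in> \<G>" "X = N #> x" using pi_surj[OF assms(1)] by blast
 obtain n where n: "n \<in> N" "\<rho> (n \<otimes> x) < c" using dd_approx[OF nN.is_subgroup x(1)] assms x by (auto simp: rq_coset)
 have nc: "n \<in> \<G>" using n nN.subset by blast
 have "N #> (n \<otimes> x) = X" unfolding x(2) using n nc x by (intro pi_eq) (auto simp: m_assoc)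
 then show ?thesis using n nc x by (intro bexI[of _ "n \<otimes> x"]) auto
qed

lemma pi_hom: "(\<lambda>x. N #> x) \<in> hom G (G Mod N)"
 by (rule homI) (auto simp: pi_closed pi_mult[symmetric] simp del: mult_FactGroup)

lemma quotient_conn:
 assumes conn
 shows "Q.conn"
 unfolding Q.conn_def
proof (intro allI impI)
 fix U assume U: "Q.opensub U"
 interpret ph: group_hom G "G Mod N" "\<lambda>x. N #> x" by unfold_locales (rule pi_hom)
 have sub: "subgroup U (G Mod N)" using U by (simp add: Q.opensub_def)
 obtain r where r: "0 < r" "!!X. X \<in> carrier (G Mod N) ==> rq X < r ==> X \<in> U" using U by (auto simp: Q.opensub_def)
 let ?V = "{x \<in> \<G>. N #> x \<in> U}"
 have "subgroup ?V G"
 proof (rule subgroupI)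
  have "N #> \<one> \<in> U" using subgroup.one_closed[OF sub] nN.subset by (simp add: pi_one)
  then show "?V \<noteq> {}" by blast
  show "inv a \<in> ?V" if "a \<in> ?V" for a
  proof -
   have a: "a \<in> \<G>" "N #> a \<in> U" using that by simp_all
   show ?thesis using subgroup.m_inv_closed[OF sub a(2)] a(1) unfolding pi_inv[OF a(1)] by simp
  qed
  show "a \<otimes> b \<in> ?V" if "a \<in> ?V" "b \<in> ?V" for a b
  proof -
   have a: "a \<in> \<G>" "N #> a \<in> U" and b: "b \<in> \<G>" "N #> b \<in> U" using that by simp_all
   show ?thesis using subgroup.m_closed[OF sub a(2) b(2)] a(1) b(1) unfolding pi_mult[OF a(1) b(1)] by simp
  qed
 qed auto
 moreover have "\<forall>x\<in>\<G>. \<rho> x < r --> x \<in> ?V"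
 proof (intro ballI impI)
  fix x assume x: "x \<in> \<G>" "\<rho> x < r"
  have "N #> x \<in> U" using rq_pi_le[OF x(1)] x by (intro r(2) pi_closed) auto
  then show "x \<in> ?V" using x by simp
 qed
 ultimately have "opensub ?V" unfolding opensub_def using r(1) by (intro conjI exI[of _ r])
 then have V: "?V = \<G>" by (rule assms[unfolded conn_def, rule_format])
 show "U = carrier (G Mod N)"
 proof
  show "U \<subseteq> carrier (G Mod N)" by (rule subgroup.subset[OF sub])
  show "carrier (G Mod N) \<subseteq> U"
  proof
   fix X assume "X \<in> carrier (G Mod N)"
   then obtain x where x: "x \<in> \<G>" "X = N #> x" using pi_surj by blast
   have "x \<in> ?V" unfolding V by (rule x(1))
   then show "X \<in> U" using x by simp
  qed
 qed
qed

lemma chr_pull: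
 assumes "Q.chr \<zeta>"
 shows "chr (\<lambda>x. \<zeta> (N #> x))"
proof -
 obtain K where K: "!!X. X \<in> carrier (G Mod N) ==> rq X \<le> 1 ==> \<bar>\<zeta> X\<bar> \<le> K" using assms by (auto simp: Q.chr_def)
 show ?thesis
  unfolding chr_def
 proof (intro conjI ballI exI[of _ K] impI)
  fix x y assume "x \<in> \<G>" "y \<in> \<G>"
  then show "\<zeta> (N #> (x \<otimes> y)) = \<zeta> (N #> x) + \<zeta> (N #> y)"
   using Q.chr_mult[OF assms pi_closed pi_closed, of x y] by (simp add: pi_mult del: mult_FactGroup)
 next
  fix x assume x: "x \<in> \<G>" "\<rho> x \<le> 1"
  then show "\<bar>\<zeta> (N #> x)\<bar> \<le> K" using rq_pi_le[OF x(1)] by (intro K pi_closed) auto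
 qed
qed

lemma chr_push:
 assumes \<eta>: "chr \<eta>" and z: "!!n. n \<in> N ==> \<eta> n = 0"
 shows "\<exists>\<zeta>. Q.chr \<zeta> \<and> (\<forall>x\<in>\<G>. \<zeta> (N #> x) = \<eta> x)"
proof -
 define \<zeta> where "\<zeta> X = \<eta> (SOME x. x \<in> \<G> \<and> X = N #> x)" for X
 have eq: "\<eta> y = \<eta> x" if x: "x \<in> \<G>" "y \<in> \<G>" "N #> x = N #> y" for x y
 proof -
  have "y \<in> N #> x" using rcos_self[OF x(2) nN.is_subgroup] that by simp
  then obtain n where n: "n \<in> N" "y = n \<otimes> x" by (auto simp: r_coset_def)
  then show ?thesis using chr_mult[OF \<eta>, of n x] z nN.subset x by auto
 qed
 have \<zeta>: "\<zeta> (N #> x) = \<eta> x" if x: "x \<in> \<G>" for x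
 proof -
  have "(SOME y. y \<in> \<G> \<and> N #> x = N #> y) \<in> \<G> \<and> N #> x = N #> (SOME y. y \<in> \<G> \<and> N #> x = N #> y)"
   by (rule someI[of _ x]) (simp add: x)
  then show ?thesis unfolding \<zeta>_def using eq[OF x] by blast
 qed
 obtain K where K: "!!x. x \<in> \<G> ==> \<rho> x \<le> 2 ==> \<bar>\<eta> x\<bar> \<le> K" using chr_bdd[OF \<eta>] by blast
 have "Q.chr \<zeta>"
  unfolding Q.chr_def
 proof (intro conjI ballI exI[of _ K] impI)
  fix X Y assume "X \<in> carrier (G Mod N)" "Y \<in> carrier (G Mod N)"
  then obtain x y where xy: "x \<in> \<G>" "X = N #> x" "y \<in> \<G>" "Y = N #> y" using pi_surj by metis
  have "\<zeta> (X \<otimes>\<^bsub>G Mod N\<^esub> Y) = \<zeta> (N #> (x \<otimes> y))" unfolding xy(2,4) pi_mult[OF xy(1,3)] ..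
  then show "\<zeta> (X \<otimes>\<^bsub>G Mod N\<^esub> Y) = \<zeta> X + \<zeta> Y" using xy \<zeta> chr_mult[OF \<eta>] by simp
 next
  fix X assume X: "X \<in> carrier (G Mod N)" "rq X \<le> 1"
  obtain x where "x \<in> \<G>" "X = N #> x" "\<rho> x < 2" using rq_rep[OF X(1), of 2] X(2) by auto
  then show "\<bar>\<zeta> X\<bar> \<le> K" using \<zeta> K by simp
 qed
 then show ?thesis using \<zeta> by blast
qed

end

section \<open>The common kernel of the characters and bases of characters\<close>

context homogeneous_group
begin

lemma chrker_mem: "x \<in> chrker ==> chr \<xi> ==> \<xi> x = 0"
 by (simp add: chrker_def)

lemma chrker_subgroup: "subgroup chrker G"
 by (rule subgroupI) (auto simp: chrker_def chr_mult chr_inv chr_one intro!: exI[of _ \<one>])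

lemma chrker_invsub: "invsub chrker"
proof (rule invsubI[OF chrker_subgroup])
 show "seqclosed chrker"
  unfolding seqclosed_def
 proof (intro conjI ballI impI)
  fix x assume x: "x \<in> \<G>" and h: "\<forall>e>0. \<exists>a\<in>chrker. dst x a < e"
  have "\<xi> x = 0" if \<xi>: "chr \<xi>" for \<xi>
  proof (rule ccontr)
   assume "\<xi> x \<noteq> 0"
   then have "0 < \<bar>\<xi> x\<bar>" by simp
   then obtain d where d: "0 < d" "!!z. z \<in> \<G> ==> \<rho> z < d ==> \<bar>\<xi> z\<bar> < \<bar>\<xi> x\<bar>" using chr_small[OF \<xi>] by blast
   obtain a where a: "a \<in> chrker" "dst x a < d" using h d(1) by blast
   have ac: "a \<in> \<G>" using a by (simp add: chrker_def)
   show False using d(2)[of "inv x \<otimes> a"] a ac x chr_mult[OF \<xi>, of "inv x" a] chr_inv[OF \<xi> x] chrker_mem[OF a(1) \<xi>] by simp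
  qed
  then show "x \<in> chrker" using x by (simp add: chrker_def)
 qed (auto simp: chrker_def)
 fix x assume x: "x \<in> chrker"
 then have xc: "x \<in> \<G>" by (simp add: chrker_def)
 show "\<alpha> x \<in> chrker" using chrker_mem[OF x chr_ap[where k = 1]] xc by (simp add: chrker_def)
 show "alpha' x \<in> chrker" using chrker_mem[OF x chr_ap[where k = "-1"]] ap_minus[OF xc, of 0] xc by (simp add: chrker_def)
qed

lemma chrker_normal: "chrker \<lhd> G"
 unfolding normal_inv_iff using chrker_subgroup by (auto simp: chrker_def chr_mult chr_inv)

lemma chrker_commutator: "x \<in> \<G> ==> y \<in> \<G> ==> x \<otimes> y \<otimes> inv x \<otimes> inv y \<in> chrker"
 by (simp add: chrker_def chr_mult chr_inv)

lemma chrker_quotient: "homogeneous_quotient G \<alpha> \<rho> \<theta> chrker"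
 by (intro homogeneous_quotient.intro homogeneous_quotient_axioms.intro chrker_invsub chrker_normal homogeneous_group_axioms)

text \<open>Together the clauses say that the \<xi> i identify G modulo \<open>chrker\<close> with
  R^n. The e i are a dual family; the fourth clause realizes every real coefficient vector, and the
  last one is continuity of the inverse identification at 0.\<close>

definition chr_basis :: "nat => (nat => 'a => real) => (nat => 'a) => bool" where
 "chr_basis n \<xi> e \<longleftrightarrow> (\<forall>i<n. chr (\<xi> i) \<and> e i \<in> \<G>) \<and>
   (\<forall>i<n. \<forall>j<n. \<xi> i (e j) = (if i = j then 1 else 0)) \<and>
   (\<forall>\<eta>. chr \<eta> --> (\<forall>x\<in>\<G>. \<eta> x = (\<Sum>i<n. \<xi> i x * \<eta> (e i)))) \<and>
   (\<forall>s::nat => real. \<exists>a\<in>\<G>. \<forall>\<eta>. chr \<eta> --> \<eta> a = (\<Sum>i<n. s i * \<eta> (e i))) \<and>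
   (\<forall>w>0. \<exists>c>0. \<forall>y\<in>\<G>. (\<forall>i<n. \<bar>\<xi> i y\<bar> < c) --> (\<exists>b\<in>chrker. \<rho> (b \<otimes> y) < w))"

text \<open>Square roots and compactness give multiplication by real scalars, visible through the
  characters. Compactness of an annulus gives finitely many separating characters, and a separating
  family of least cardinality has a dual family, as for a basis of a vector space.\<close>

lemma chr_basis_separating:
 assumes conn: conn and comm: "!!x y. x \<in> \<G> ==> y \<in> \<G> ==> x \<otimes> y = y \<otimes> x"
  and sep: "chrker = {\<one>}"
 shows "\<exists>n \<xi> e. chr_basis n \<xi> e"
proof -
 have sep': "\<exists>\<xi>. chr \<xi> \<and> \<xi> x \<noteq> 0" if "x \<in> \<G>" "x \<noteq> \<one>" for x
  using sep that by (auto simp: chrker_def)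
 have eqI: "x = y" if x: "x \<in> \<G>" "y \<in> \<G>" and h: "!!\<xi>. \<xi> \<in> \<Psi> ==> \<xi> x = \<xi> y"
  and \<Psi>: "!!\<xi>. \<xi> \<in> \<Psi> ==> chr \<xi>" "!!x. x \<in> \<G> ==> x \<noteq> \<one> ==> \<exists>\<xi>\<in>\<Psi>. \<xi> x \<noteq> 0" for x y \<Psi>
 proof (rule ccontr)
  assume ne: "x \<noteq> y"
  have "inv y \<otimes> x \<noteq> \<one>" using ne x by (metis cancel_left(2) r_one inv_closed)
  then obtain \<xi> where \<xi>: "\<xi> \<in> \<Psi>" "\<xi> (inv y \<otimes> x) \<noteq> 0" using \<Psi>(2) x by (metis inv_closed m_closed)
  then show False using h[OF \<xi>(1)] \<Psi>(1)[OF \<xi>(1)] x by (simp add: chr_mult chr_inv)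
 qed
 \<comment> \<open>Normalizing on the unit ball makes the family stable under precomposition with
   contracting powers of \<alpha> and bounds it by the word length \<open>wl 1\<close>,
   uniformly.\<close>
 define X1 where "X1 = {\<xi>. chr \<xi> \<and> (\<forall>x\<in>\<G>. \<rho> x \<le> 1 --> \<bar>\<xi> x\<bar> \<le> 1)}"
 have X1c: "chr \<xi>" if "\<xi> \<in> X1" for \<xi> using that by (simp add: X1_def)
 have X1sep: "\<exists>\<xi>\<in>X1. \<xi> x \<noteq> 0" if x: "x \<in> \<G>" "x \<noteq> \<one>" for x
 proof -
  obtain \<xi> where \<xi>: "chr \<xi>" "\<xi> x \<noteq> 0" using sep'[OF x] by blast
  obtain K where K: "!!x. x \<in> \<G> ==> \<rho> x \<le> 1 ==> \<bar>\<xi> x\<bar> \<le> K" using \<xi>(1) by (auto simp: chr_def)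
  have K0: "0 \<le> K" using K[of \<one>] by simp
  have "(\<lambda>x. 1 / (K + 1) * \<xi> x) \<in> X1"
   unfolding X1_def
  proof (intro CollectI conjI chr_scale[OF \<xi>(1)] ballI impI)
   fix x assume x: "x \<in> \<G>" "\<rho> x \<le> 1"
   then have "\<bar>\<xi> x\<bar> \<le> K + 1" using K[OF x] by linarith
   then show "\<bar>1 / (K + 1) * \<xi> x\<bar> \<le> 1" using K0 by (simp add: abs_mult divide_le_eq)
  qed
  then show ?thesis using \<xi>(2) K0 by (intro bexI[of _ "\<lambda>x. 1 / (K + 1) * \<xi> x"]) auto
 qed
 define hf where "hf x = (SOME y. y \<in> \<G> \<and> y \<otimes> y = x)" for x
 have hf: "hf x \<in> \<G>" "hf x \<otimes> hf x = x" if "x \<in> \<G>" for x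
 proof -
  have "\<exists>y. y \<in> \<G> \<and> y \<otimes> y = x" using square_surj[OF conn comm that] by blast
  from someI_ex[OF this] show "hf x \<in> \<G>" "hf x \<otimes> hf x = x" by (simp_all add: hf_def)
 qed
 have hfc: "(hf ^^ k) x \<in> \<G>" if "x \<in> \<G>" for x k
  by (induction k) (use that hf in auto)
 have hf\<xi>: "\<xi> ((hf ^^ k) x) = \<xi> x / 2 ^ k" if \<xi>: "chr \<xi>" and x: "x \<in> \<G>" for \<xi> x k
 proof (induction k)
  case (Suc k)
  have "\<xi> (hf ((hf ^^ k) x)) + \<xi> (hf ((hf ^^ k) x)) = \<xi> ((hf ^^ k) x)"
   using chr_mult[OF \<xi> hf(1)[OF hfc[OF x]] hf(1)[OF hfc[OF x]]] hf(2)[OF hfc[OF x]] by metis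
  then show ?case using Suc by simp
 qed simp
 \<comment> \<open>Every element of norm at least u has a value of modulus at least c under some
   member of \<open>X1\<close>, by rescaling into the annulus. For the k-th iterated root of x all
   these values are at most wl 1 x / 2 ^ k.\<close>
 have halving: "\<exists>k. \<rho> ((hf ^^ k) x) < u" if x: "x \<in> \<G>" and u: "0 < u" "u \<le> \<theta>" for x u
 proof -
  obtain \<Phi> c where \<Phi>: "finite \<Phi>" "\<Phi> \<subseteq> X1" "0 < c"
   "!!x. x \<in> \<G> ==> u \<le> \<rho> x ==> \<rho> x \<le> 1 ==> \<exists>\<xi>\<in>\<Phi>. c \<le> \<bar>\<xi> x\<bar>"
   using annulus_finite[OF X1c X1sep u(1)] by blast
  have far: "\<exists>\<xi>\<in>X1. c \<le> \<bar>\<xi> y\<bar>" if y: "y \<in> \<G>" "u \<le> \<rho> y" for y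
  proof (cases "\<rho> y \<le> 1")
   case True
   then show ?thesis using \<Phi>(4)[OF y True] \<Phi>(2) by blast
  next
   case False
   then obtain k where k: "\<theta> < \<theta> powi k * \<rho> y" "\<theta> powi k * \<rho> y \<le> 1"
    using scale_into_interval[of "\<rho> y" \<theta>] theta by auto
   obtain \<xi> where \<xi>: "\<xi> \<in> \<Phi>" "c \<le> \<bar>\<xi> (ap k y)\<bar>" using \<Phi>(4)[of "ap k y"] k u y by (auto simp: rho_ap)
   have k0: "\<theta> powi k \<le> 1"
   proof (rule ccontr)
    assume "\<not> \<theta> powi k \<le> 1"
    then have "1 * \<rho> y < \<theta> powi k * \<rho> y" using False by (intro mult_strict_right_mono) auto
    then show False using False k(2) by linarith
   qed
   have "(\<lambda>x. \<xi> (ap k x)) \<in> X1"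
    unfolding X1_def
   proof (intro CollectI conjI chr_ap ballI impI)
    show "chr \<xi>" using \<xi> \<Phi>(2) X1c by blast
    fix x assume x: "x \<in> \<G>" "\<rho> x \<le> 1"
    have "\<rho> (ap k x) \<le> 1 * 1" unfolding rho_ap[OF x(1)] using x k0 rho_nonneg theta by (intro mult_mono) auto
    then show "\<bar>\<xi> (ap k x)\<bar> \<le> 1" using \<xi> \<Phi>(2) x by (auto simp: X1_def)
   qed
   then show ?thesis using \<xi> by (intro bexI[of _ "\<lambda>x. \<xi> (ap k x)"])
  qed
  obtain k :: nat where k: "wl 1 x / c < k" using reals_Archimedean2 by blast
  have "real k < 2 ^ k" by (rule of_nat_less_two_power)
  then have "wl 1 x / c < 2 ^ k" using k by linarith
  then have k2: "wl 1 x / 2 ^ k < c" using \<Phi>(3) by (simp add: field_simps)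
  have "\<not> u \<le> \<rho> ((hf ^^ k) x)"
  proof
   assume "u \<le> \<rho> ((hf ^^ k) x)"
   then obtain \<xi> where \<xi>: "\<xi> \<in> X1" "c \<le> \<bar>\<xi> ((hf ^^ k) x)\<bar>" using far hfc x by blast
   have "\<bar>\<xi> x\<bar> \<le> wl 1 x" using \<xi>(1) x by (intro unit_chr_bound[OF conn]) (auto simp: X1_def)
   then have "\<bar>\<xi> x\<bar> / 2 ^ k \<le> wl 1 x / 2 ^ k" by (intro divide_right_mono) auto
   then show False using \<xi>(2) hf\<xi>[OF X1c[OF \<xi>(1)] x, of k] k2 by simp
  qed
  then show ?thesis by (intro exI[of _ k]) simp
 qed
 \<comment> \<open>The last iterated root before the norm drops below u has norm at most 2 * u \<le>
   1, hence lies in the annulus. Passing back to y multiplies character values by a power of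
   two.\<close>
 have outer: "\<exists>\<xi>\<in>\<Phi>. c \<le> \<bar>\<xi> y\<bar>"
  if \<Phi>: "!!\<xi>. \<xi> \<in> \<Phi> ==> chr \<xi>" "!!x. x \<in> \<G> ==> u \<le> \<rho> x ==> \<rho> x \<le> 1 ==> \<exists>\<xi>\<in>\<Phi>. c \<le> \<bar>\<xi> x\<bar>"
   and u: "0 < u" "u \<le> \<theta>" "u \<le> 1/2" and y: "y \<in> \<G>" "u \<le> \<rho> y" and c: "0 < c" for \<Phi> c u y
 proof -
  define k where "k = (LEAST k. \<rho> ((hf ^^ k) y) < u)"
  have k: "\<rho> ((hf ^^ k) y) < u" unfolding k_def by (rule LeastI_ex) (rule halving[OF y(1) u(1,2)])
  have "k \<noteq> 0" using k y(2) by (cases k) auto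
  then obtain m where m: "k = Suc m" by (cases k) auto
  let ?z = "(hf ^^ m) y"
  have "\<not> \<rho> ?z < u" using not_less_Least[of m "\<lambda>k. \<rho> ((hf ^^ k) y) < u"] m by (simp add: k_def)
  moreover have "\<rho> ?z \<le> \<rho> (hf ?z) + \<rho> (hf ?z)"
   using rho_mult[OF hf(1)[OF hfc[OF y(1)]] hf(1)[OF hfc[OF y(1)]], of m m] hf(2)[OF hfc[OF y(1), of m]] by simp
  moreover have "\<rho> (hf ?z) < u" using k m by simp
  ultimately obtain \<xi> where \<xi>: "\<xi> \<in> \<Phi>" "c \<le> \<bar>\<xi> ?z\<bar>" using \<Phi>(2)[OF hfc[OF y(1), of m]] u by auto
  have "\<bar>\<xi> y\<bar> / 2 ^ m \<le> \<bar>\<xi> y\<bar> / 1" by (intro divide_left_mono) auto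
  then show ?thesis using \<xi> hf\<xi>[OF \<Phi>(1)[OF \<xi>(1)] y(1), of m] by (intro bexI[OF _ \<xi>(1)]) simp
 qed
 define u0 where "u0 = min \<theta> (1/2)"
 have u0: "0 < u0" "u0 \<le> \<theta>" "u0 \<le> 1/2" using theta by (auto simp: u0_def)
 obtain \<Phi>0 c0 where \<Phi>0: "finite \<Phi>0" "\<Phi>0 \<subseteq> X1" "0 < c0"
   "!!x. x \<in> \<G> ==> u0 \<le> \<rho> x ==> \<rho> x \<le> 1 ==> \<exists>\<xi>\<in>\<Phi>0. c0 \<le> \<bar>\<xi> x\<bar>"
  using annulus_finite[OF X1c X1sep u0(1)] by blast
 have \<Phi>0c: "\<xi> \<in> \<Phi>0 ==> chr \<xi>" for \<xi> using \<Phi>0(2) X1c by blast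
 have out0: "\<exists>\<xi>\<in>\<Phi>0. c0 \<le> \<bar>\<xi> y\<bar>" if "y \<in> \<G>" "u0 \<le> \<rho> y" for y
  by (rule outer[OF \<Phi>0c \<Phi>0(4) u0 that \<Phi>0(3)])
 \<comment> \<open>Some character is nonzero at y, so a power of y leaves the unit ball. There the
   finite family detects it, and therefore it detects y.\<close>
 have sep0: "\<exists>\<xi>\<in>\<Phi>0. \<xi> y \<noteq> 0" if y: "y \<in> \<G>" "y \<noteq> \<one>" for y
 proof -
  obtain \<xi> where \<xi>: "chr \<xi>" "\<xi> y \<noteq> 0" using sep'[OF y] by blast
  obtain K where K: "!!x. x \<in> \<G> ==> \<rho> x \<le> 1 ==> \<bar>\<xi> x\<bar> \<le> K" using \<xi>(1) by (auto simp: chr_def)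
  obtain k :: nat where k: "K / \<bar>\<xi> y\<bar> < k" using reals_Archimedean2 by blast
  have "K < \<bar>\<xi> (y [^] k)\<bar>" using k \<xi> y by (simp add: chr_pow abs_mult field_simps)
  then have "\<not> \<rho> (y [^] k) \<le> 1" using K[of "y [^] k"] y by auto
  then obtain \<zeta> where \<zeta>: "\<zeta> \<in> \<Phi>0" "c0 \<le> \<bar>\<zeta> (y [^] k)\<bar>" using out0[of "y [^] k"] y u0 by auto
  then have "\<zeta> y \<noteq> 0" using chr_pow[OF \<Phi>0c[OF \<zeta>(1)] y(1), of k] \<Phi>0(3) by auto
  then show ?thesis using \<zeta> by blast
 qed
 define P where "P \<Phi> \<longleftrightarrow> finite \<Phi> \<and> (\<forall>\<xi>\<in>\<Phi>. chr \<xi>) \<and> (\<forall>y\<in>\<G>. y \<noteq> \<one> --> (\<exists>\<xi>\<in>\<Phi>. \<xi> y \<noteq> 0))" for \<Phi>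
 have "P \<Phi>0" unfolding P_def using \<Phi>0(1) \<Phi>0c sep0 by blast
 from ex_has_least_nat[of P, OF this, of card] obtain \<Phi> where P\<Phi>': "P \<Phi> \<and> (\<forall>\<Psi>. P \<Psi> --> card \<Phi> \<le> card \<Psi>)" ..
 note P\<Phi> = P\<Phi>'[THEN conjunct1] and min = P\<Phi>'[THEN conjunct2, rule_format]
 have fin: "finite \<Phi>" and \<Phi>c: "!!\<xi>. \<xi> \<in> \<Phi> ==> chr \<xi>" and \<Phi>sep: "!!y. y \<in> \<G> ==> y \<noteq> \<one> ==> \<exists>\<xi>\<in>\<Phi>. \<xi> y \<noteq> 0"
  using P\<Phi> by (auto simp: P_def)
 \<comment> \<open>Scalar multiplication by r: the dyadic approximations of r act through integer
   powers and iterated roots, and a bounded sequence of such elements has a limit.\<close>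
 have scal: "\<exists>y\<in>\<G>. \<forall>\<xi>. chr \<xi> --> \<xi> y = r * \<xi> x" if x: "x \<in> \<G>" for r x
 proof -
  define rk where "rk k = real_of_int \<lfloor>r * 2 ^ k\<rfloor> / 2 ^ k" for k :: nat
  define y where "y k = (hf ^^ k) (x [^] \<lfloor>r * 2 ^ k\<rfloor>)" for k
  have yc: "y k \<in> \<G>" for k unfolding y_def using x by (intro hfc) auto
  have y\<xi>: "\<xi> (y k) = rk k * \<xi> x" if "chr \<xi>" for \<xi> k
   unfolding y_def rk_def using hf\<xi>[OF that, of "x [^] \<lfloor>r * 2 ^ k\<rfloor>" k] x by (simp add: chr_int_pow[OF that])
  have rk: "\<bar>rk k - r\<bar> \<le> (1 / 2) ^ k" for k
  proof -
   have "\<bar>real_of_int \<lfloor>r * 2 ^ k\<rfloor> - r * 2 ^ k\<bar> \<le> 1" by linarith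
   then have "\<bar>real_of_int \<lfloor>r * 2 ^ k\<rfloor> - r * 2 ^ k\<bar> / 2 ^ k \<le> 1 / 2 ^ k" by (intro divide_right_mono) auto
   moreover have "rk k - r = (real_of_int \<lfloor>r * 2 ^ k\<rfloor> - r * 2 ^ k) / 2 ^ k" by (simp add: rk_def diff_divide_distrib)
   ultimately show ?thesis by (simp add: abs_divide power_one_over)
  qed
  have lim: "rk \<longlonglongrightarrow> r"
  proof (rule LIM_zero_cancel)
   show "(\<lambda>k. rk k - r) \<longlonglongrightarrow> 0"
    by (rule Lim_null_comparison[of _ "\<lambda>k. (1 / 2) ^ k"]) (use rk in \<open>auto intro!: LIMSEQ_power_zero\<close>)
  qed
  define S where "S = (\<Sum>\<xi>\<in>\<Phi>0. \<bar>\<xi> x\<bar>)"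
  have S0: "0 \<le> S" by (simp add: S_def sum_nonneg)
  obtain K :: nat where K: "(\<bar>r\<bar> + 1) * S / c0 < K" using reals_Archimedean2 by blast
  have K2: "(\<bar>r\<bar> + 1) * S < c0 * 2 ^ K"
  proof -
   have "real K < 2 ^ K" by (rule of_nat_less_two_power)
   then have "(\<bar>r\<bar> + 1) * S / c0 < 2 ^ K" using K by linarith
   then show ?thesis using \<Phi>0(3) by (simp add: field_simps)
  qed
  \<comment> \<open>K is so large that the K-th iterated root of y k has character values below c0
    on the finite family, hence small norm. Undoing K roots at most doubles the norm each
    time.\<close>
  have bd: "\<rho> (y k) \<le> 2 ^ K" for k
  proof -
   have "\<not> u0 \<le> \<rho> ((hf ^^ K) (y k))"
   proof
    assume "u0 \<le> \<rho> ((hf ^^ K) (y k))"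
    then obtain \<xi> where \<xi>: "\<xi> \<in> \<Phi>0" "c0 \<le> \<bar>\<xi> ((hf ^^ K) (y k))\<bar>" using out0[OF hfc[OF yc]] by blast
    have e: "\<xi> ((hf ^^ K) (y k)) = rk k * \<xi> x / 2 ^ K" using hf\<xi>[OF \<Phi>0c[OF \<xi>(1)] yc] y\<xi>[OF \<Phi>0c[OF \<xi>(1)]] by simp
    have "(1 / 2) ^ k \<le> (1::real)" by (rule power_le_one) auto
    then have "\<bar>rk k\<bar> \<le> \<bar>r\<bar> + 1" using rk[of k] by linarith
    moreover have "\<bar>\<xi> x\<bar> \<le> S" unfolding S_def using \<Phi>0(1) \<xi>(1) by (intro member_le_sum) auto
    ultimately have "\<bar>rk k\<bar> * \<bar>\<xi> x\<bar> \<le> (\<bar>r\<bar> + 1) * S" by (intro mult_mono) auto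
    moreover have "c0 * 2 ^ K \<le> \<bar>rk k\<bar> * \<bar>\<xi> x\<bar>" using \<xi>(2) unfolding e by (simp add: abs_mult field_simps)
    ultimately show False using K2 by linarith
   qed
   moreover have "\<rho> z \<le> 2 ^ K * \<rho> ((hf ^^ K) z)" if "z \<in> \<G>" for z K
   proof (induction K)
    case (Suc K)
    have "\<rho> ((hf ^^ K) z) \<le> 2 * \<rho> (hf ((hf ^^ K) z))"
     using rho_mult[OF hf(1)[OF hfc[OF that]] hf(1)[OF hfc[OF that]], of K K] hf(2)[OF hfc[OF that], of K] by simp
    then have "2 ^ K * \<rho> ((hf ^^ K) z) \<le> 2 ^ K * (2 * \<rho> (hf ((hf ^^ K) z)))" by (intro mult_left_mono) auto
    then have "\<rho> z \<le> 2 ^ K * (2 * \<rho> (hf ((hf ^^ K) z)))" using Suc by linarith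
    then show ?case by (simp add: mult_ac)
   qed simp
   then have "\<rho> (y k) \<le> 2 ^ K * \<rho> ((hf ^^ K) (y k))" using yc by blast
   moreover have "\<rho> ((hf ^^ K) (y k)) \<le> 1" using calculation(1) u0(3) by linarith
   then have "2 ^ K * \<rho> ((hf ^^ K) (y k)) \<le> 2 ^ K * 1" by (intro mult_left_mono) auto
   ultimately show ?thesis by linarith
  qed
  obtain l r' where l: "l \<in> \<G>" and r': "strict_mono (r'::nat=>nat)"
   and lim': "(\<lambda>n. dst l (y (r' n))) \<longlonglongrightarrow> 0"
   using rho_compact[of y "2 ^ K"] yc bd by blast
  have "\<xi> l = r * \<xi> x" if \<xi>: "chr \<xi>" for \<xi>
  proof -
   have "(\<lambda>n. \<xi> (y (r' n))) \<longlonglongrightarrow> \<xi> l" by (rule chr_limit[OF \<xi> l yc lim'])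
   moreover have "(\<lambda>n. rk (r' n) * \<xi> x) \<longlonglongrightarrow> r * \<xi> x"
    using LIMSEQ_subseq_LIMSEQ[OF lim r'] by (intro tendsto_intros) (simp add: o_def)
   ultimately show ?thesis using y\<xi>[OF \<xi>] by (simp add: LIMSEQ_unique)
  qed
  then show ?thesis using l by blast
 qed
 \<comment> \<open>By minimality, dropping \<xi> destroys separation: some y other than \<one> is
   killed by all the other members but not by \<xi>. A scalar multiple of it is the dual
   element.\<close>
 have "\<exists>e. e \<in> \<G> \<and> \<xi> e = 1 \<and> (\<forall>\<xi>'\<in>\<Phi>. \<xi>' \<noteq> \<xi> --> \<xi>' e = 0)" if \<xi>: "\<xi> \<in> \<Phi>" for \<xi>
 proof -
  have "\<not> P (\<Phi> - {\<xi>})"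
  proof
   assume "P (\<Phi> - {\<xi>})"
   then have "card \<Phi> \<le> card (\<Phi> - {\<xi>})" by (rule min)
   then show False using card_Diff1_less[OF fin \<xi>] by simp
  qed
  then obtain y where y: "y \<in> \<G>" "y \<noteq> \<one>" "!!\<xi>'. \<xi>' \<in> \<Phi> - {\<xi>} ==> \<xi>' y = 0" using fin \<Phi>c unfolding P_def by blast
  then have ne: "\<xi> y \<noteq> 0" using \<Phi>sep[OF y(1,2)] by auto
  obtain e where e: "e \<in> \<G>" "!!\<zeta>. chr \<zeta> ==> \<zeta> e = 1 / \<xi> y * \<zeta> y" using scal[OF y(1), of "1 / \<xi> y"] by blast
  show ?thesis
  proof (intro exI[of _ e] conjI ballI impI e(1))
   show "\<xi> e = 1" using e(2)[OF \<Phi>c[OF \<xi>]] ne by simp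
   fix \<xi>' assume \<xi>': "\<xi>' \<in> \<Phi>" "\<xi>' \<noteq> \<xi>"
   then have "\<xi>' y = 0" by (intro y(3)) blast
   then show "\<xi>' e = 0" using e(2)[OF \<Phi>c[OF \<xi>'(1)]] by simp
  qed
 qed
 then obtain ee where ee: "!!\<xi>. \<xi> \<in> \<Phi> ==> ee \<xi> \<in> \<G> \<and> \<xi> (ee \<xi>) = 1 \<and> (\<forall>\<xi>'\<in>\<Phi>. \<xi>' \<noteq> \<xi> --> \<xi>' (ee \<xi>) = 0)" by metis
 obtain f where f: "bij_betw f {0..<card \<Phi>} \<Phi>" using ex_bij_betw_nat_finite[OF fin] by blast
 define n where "n = card \<Phi>"
 have fn: "f i \<in> \<Phi>" if "i < n" for i using f that by (auto simp: bij_betw_def n_def)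
 have fsurj: "\<exists>i<n. f i = \<xi>" if "\<xi> \<in> \<Phi>" for \<xi> using f that by (force simp: bij_betw_def n_def)
 have finj: "f i = f j \<longleftrightarrow> i = j" if "i < n" "j < n" for i j using f that by (auto simp: bij_betw_def n_def inj_on_def)
 define e where "e i = ee (f i)" for i
 have ec: "e i \<in> \<G>" if "i < n" for i using ee fn[OF that] by (simp add: e_def)
 have dual: "f i (e j) = (if i = j then 1 else 0)" if "i < n" "j < n" for i j
  using ee[OF fn[OF that(2)]] fn[OF that(1)] finj[OF that] by (auto simp: e_def)
 have comb: "\<exists>a\<in>\<G>. \<forall>\<eta>. chr \<eta> --> \<eta> a = (\<Sum>i<m. s i * \<eta> (e i))" if "m \<le> n" for s :: "nat => real" and m
  using that
 proof (induction m)
  case 0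
  then show ?case using chr_one by (intro bexI[of _ \<one>]) auto
 next
  case (Suc m)
  then obtain a where a: "a \<in> \<G>" "!!\<eta>. chr \<eta> ==> \<eta> a = (\<Sum>i<m. s i * \<eta> (e i))" by auto
  obtain b where b: "b \<in> \<G>" "!!\<eta>. chr \<eta> ==> \<eta> b = s m * \<eta> (e m)" using scal[OF ec, of m "s m"] Suc by auto
  show ?case
  proof (intro bexI[of _ "a \<otimes> b"] allI impI)
   fix \<eta> assume \<eta>: "chr \<eta>"
   show "\<eta> (a \<otimes> b) = (\<Sum>i<Suc m. s i * \<eta> (e i))"
    using a(2)[OF \<eta>] b(2)[OF \<eta>] chr_mult[OF \<eta> a(1) b(1)] by simp
  qed (use a b in simp)
 qed
 \<comment> \<open>The element a built from the coordinates of x agrees with x on the separating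
   family, hence equals x. So every character, inside the family or not, is determined by its values
   on the e i.\<close>
 have expand: "\<eta> x = (\<Sum>i<n. f i x * \<eta> (e i))" if \<eta>: "chr \<eta>" and x: "x \<in> \<G>" for \<eta> x
 proof -
  obtain a where a: "a \<in> \<G>" "!!\<eta>. chr \<eta> ==> \<eta> a = (\<Sum>i<n. f i x * \<eta> (e i))" using comb[of n "\<lambda>i. f i x"] by auto
  have "x = a"
  proof (rule eqI[OF x a(1) _ \<Phi>c \<Phi>sep])
   fix \<xi> assume \<xi>: "\<xi> \<in> \<Phi>"
   then obtain j where j: "j < n" "f j = \<xi>" using fsurj by blast
   have "\<xi> a = (\<Sum>i<n. f i x * (if i = j then 1 else 0))"
    unfolding a(2)[OF \<Phi>c[OF \<xi>]] using dual[OF j(1)] j(2) by (intro sum.cong) auto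
   also have "\<dots> = f j x" using j(1) by (simp add: if_distrib cong: if_cong)
   finally show "\<xi> x = \<xi> a" using j by simp
  qed
  then show ?thesis using a(2)[OF \<eta>] by simp
 qed
 have small: "\<exists>c>0. \<forall>y\<in>\<G>. (\<forall>i<n. \<bar>f i y\<bar> < c) --> (\<exists>b\<in>chrker. \<rho> (b \<otimes> y) < w)" if w: "0 < w" for w
 proof -
  define u where "u = min u0 w"
  have u: "0 < u" "u \<le> \<theta>" "u \<le> 1/2" "u \<le> w" using u0 w by (auto simp: u_def)
  obtain \<Psi> c where \<Psi>: "\<Psi> \<subseteq> \<Phi>" "0 < c"
   "!!x. x \<in> \<G> ==> u \<le> \<rho> x ==> \<rho> x \<le> 1 ==> \<exists>\<xi>\<in>\<Psi>. c \<le> \<bar>\<xi> x\<bar>"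
   using annulus_finite[OF \<Phi>c \<Phi>sep u(1)] by blast
  have \<Psi>c: "chr \<xi>" if "\<xi> \<in> \<Psi>" for \<xi> using that \<Psi>(1) \<Phi>c by blast
  have "\<rho> y < w" if y: "y \<in> \<G>" and s: "\<forall>i<n. \<bar>f i y\<bar> < c" for y
  proof (rule ccontr)
   assume "\<not> \<rho> y < w"
   then have "u \<le> \<rho> y" using u by linarith
   from outer[OF \<Psi>c \<Psi>(3) u(1-3) y this \<Psi>(2)] obtain \<xi> where \<xi>: "\<xi> \<in> \<Psi>" "c \<le> \<bar>\<xi> y\<bar>" by blast
   then obtain i where "i < n" "f i = \<xi>" using fsurj \<Psi>(1) by blast
   then show False using s \<xi> by auto
  qed
  then show ?thesis using \<Psi>(2) sep by (intro exI[of _ c]) auto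
 qed
 have "chr_basis n f e"
  unfolding chr_basis_def using fn \<Phi>c ec dual expand comb[of n] small by (intro conjI allI ballI impI) auto
 then show ?thesis by blast
qed

text \<open>Modulo the common kernel the group is abelian, because commutators are killed by all
  characters, and its characters separate points; it also stays connected. The basis found there is
  pulled back.\<close>

theorem ex_chr_basis:
 assumes conn: conn
 shows "\<exists>n \<xi> e. chr_basis n \<xi> e"
proof -
 interpret K: homogeneous_quotient G \<alpha> \<rho> \<theta> chrker by (rule chrker_quotient)
 have push: "\<exists>\<zeta>. K.Q.chr \<zeta> \<and> (\<forall>x\<in>\<G>. \<zeta> (chrker #> x) = \<eta> x)" if "chr \<eta>" for \<eta>
  by (rule K.chr_push[OF that]) (rule chrker_mem[OF _ that])
 have sep: "K.Q.chrker = {\<one>\<^bsub>G Mod chrker\<^esub>}"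
 proof (intro equalityI subsetI)
  fix X assume X: "X \<in> K.Q.chrker"
  then obtain x where x: "x \<in> \<G>" "X = chrker #> x" using K.pi_surj by (auto simp: K.Q.chrker_def)
  have "\<eta> x = 0" if \<eta>: "chr \<eta>" for \<eta>
  proof -
   obtain \<zeta> where \<zeta>: "K.Q.chr \<zeta>" "!!x. x \<in> \<G> ==> \<zeta> (chrker #> x) = \<eta> x" using push[OF \<eta>] by blast
   show ?thesis using K.Q.chrker_mem[OF X \<zeta>(1)] unfolding x(2) \<zeta>(2)[OF x(1)] .
  qed
  then have "x \<in> chrker" unfolding chrker_def using x(1) by blast
  then show "X \<in> {\<one>\<^bsub>G Mod chrker\<^esub>}" unfolding x(2) using K.pi_eq_N[OF x(1)] by (simp add: K.pi_one)
 next
  fix X assume "X \<in> {\<one>\<^bsub>G Mod chrker\<^esub>}"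
  then show "X \<in> K.Q.chrker" using subgroup.one_closed[OF K.Q.chrker_subgroup] by simp
 qed
 have comm: "X \<otimes>\<^bsub>G Mod chrker\<^esub> Y = Y \<otimes>\<^bsub>G Mod chrker\<^esub> X" if XY: "X \<in> carrier (G Mod chrker)" "Y \<in> carrier (G Mod chrker)" for X Y
 proof -
  obtain x where x: "x \<in> \<G>" "X = chrker #> x" using K.pi_surj[OF XY(1)] by blast
  obtain y where y: "y \<in> \<G>" "Y = chrker #> y" using K.pi_surj[OF XY(2)] by blast
  have "chrker #> (x \<otimes> y) = chrker #> (y \<otimes> x)"
   using chrker_commutator[OF x(1) y(1)] x y by (intro K.pi_eq) (auto simp: gsimps)
  then show ?thesis unfolding x(2) y(2) K.pi_mult[OF x(1) y(1)] K.pi_mult[OF y(1) x(1)] .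
 qed
 obtain n \<xi> e where B: "K.Q.chr_basis n \<xi> e"
  using K.Q.chr_basis_separating[OF K.quotient_conn[OF conn] comm sep] by blast
 note B' = B[unfolded K.Q.chr_basis_def]
 have b1: "K.Q.chr (\<xi> i)" "e i \<in> carrier (G Mod chrker)" if "i < n" for i using B' that by auto
 have b2: "\<xi> i (e j) = (if i = j then 1 else 0)" if "i < n" "j < n" for i j using B' that by blast
 have b3: "\<eta> X = (\<Sum>i<n. \<xi> i X * \<eta> (e i))" if "K.Q.chr \<eta>" "X \<in> carrier (G Mod chrker)" for \<eta> X using B' that by blast
 have b4: "\<exists>a\<in>carrier (G Mod chrker). \<forall>\<eta>. K.Q.chr \<eta> --> \<eta> a = (\<Sum>i<n. s i * \<eta> (e i))" for s :: "nat => real" using B' by blast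
 have b5: "\<exists>c>0. \<forall>Y\<in>carrier (G Mod chrker). (\<forall>i<n. \<bar>\<xi> i Y\<bar> < c) --> rq Y < w" if "0 < w" for w
 proof -
  have "\<exists>c>0. \<forall>Y\<in>carrier (G Mod chrker). (\<forall>i<n. \<bar>\<xi> i Y\<bar> < c) --> (\<exists>b\<in>{\<one>\<^bsub>G Mod chrker\<^esub>}. rq (b \<otimes>\<^bsub>G Mod chrker\<^esub> Y) < w)"
   using B'[THEN conjunct2, THEN conjunct2, THEN conjunct2, THEN conjunct2, rule_format, OF that] unfolding sep .
  then obtain c where c: "0 < c" "\<forall>Y\<in>carrier (G Mod chrker). (\<forall>i<n. \<bar>\<xi> i Y\<bar> < c) -->
    (\<exists>b\<in>{\<one>\<^bsub>G Mod chrker\<^esub>}. rq (b \<otimes>\<^bsub>G Mod chrker\<^esub> Y) < w)" by (elim exE conjE)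
  show ?thesis
  proof (intro exI[of _ c] conjI ballI impI c(1))
   fix Y assume Y: "Y \<in> carrier (G Mod chrker)" "\<forall>i<n. \<bar>\<xi> i Y\<bar> < c"
   have "rq (\<one>\<^bsub>G Mod chrker\<^esub> \<otimes>\<^bsub>G Mod chrker\<^esub> Y) < w" using c(2)[rule_format, OF Y(1)] Y(2) by simp
   then show "rq Y < w" unfolding K.Q.l_one[OF Y(1)] .
  qed
 qed
 have "\<forall>i. \<exists>x. i < n --> x \<in> \<G> \<and> e i = chrker #> x" using K.pi_surj b1(2) by blast
 then obtain e' where e': "!!i. i < n ==> e' i \<in> \<G> \<and> e i = chrker #> e' i" by metis
 define \<xi>' where "\<xi>' i x = \<xi> i (chrker #> x)" for i x
 have "chr_basis n \<xi>' e'"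
  unfolding chr_basis_def
 proof (intro conjI allI impI ballI)
  fix i assume i: "i < n"
  show "chr (\<xi>' i)" unfolding \<xi>'_def[abs_def] by (rule K.chr_pull[OF b1(1)[OF i]])
  show "e' i \<in> \<G>" using e'[OF i] by simp
  fix j assume j: "j < n"
  show "\<xi>' i (e' j) = (if i = j then 1 else 0)" using b2[OF i j] e'[OF j] by (simp add: \<xi>'_def)
 next
  fix \<eta> x assume \<eta>: "chr \<eta>" and x: "x \<in> \<G>"
  obtain \<zeta> where \<zeta>: "K.Q.chr \<zeta>" "!!x. x \<in> \<G> ==> \<zeta> (chrker #> x) = \<eta> x" using push[OF \<eta>] by blast
  show "\<eta> x = (\<Sum>i<n. \<xi>' i x * \<eta> (e' i))"
   using b3[OF \<zeta>(1) K.pi_closed[OF x]] \<zeta>(2) x e' by (simp add: \<xi>'_def)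
 next
  fix s :: "nat => real"
  obtain A where A: "A \<in> carrier (G Mod chrker)" "!!\<eta>. K.Q.chr \<eta> ==> \<eta> A = (\<Sum>i<n. s i * \<eta> (e i))" using b4[of s] by blast
  obtain a where a: "a \<in> \<G>" "A = chrker #> a" using K.pi_surj[OF A(1)] by blast
  show "\<exists>a\<in>\<G>. \<forall>\<eta>. chr \<eta> --> \<eta> a = (\<Sum>i<n. s i * \<eta> (e' i))"
  proof (intro bexI[OF _ a(1)] allI impI)
   fix \<eta> assume \<eta>: "chr \<eta>"
   obtain \<zeta> where \<zeta>: "K.Q.chr \<zeta>" "!!x. x \<in> \<G> ==> \<zeta> (chrker #> x) = \<eta> x" using push[OF \<eta>] by blast
   show "\<eta> a = (\<Sum>i<n. s i * \<eta> (e' i))" using A(2)[OF \<zeta>(1)] \<zeta>(2) a e' by simp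
  qed
 next
  fix w :: real assume "0 < w"
  from b5[OF this] obtain c where c: "0 < c" "\<forall>Y\<in>carrier (G Mod chrker). (\<forall>i<n. \<bar>\<xi> i Y\<bar> < c) --> rq Y < w" by (elim exE conjE)
  show "\<exists>c>0. \<forall>y\<in>\<G>. (\<forall>i<n. \<bar>\<xi>' i y\<bar> < c) --> (\<exists>b\<in>chrker. \<rho> (b \<otimes> y) < w)"
  proof (intro exI[of _ c] conjI ballI impI c(1))
   fix y assume y: "y \<in> \<G>" "\<forall>i<n. \<bar>\<xi>' i y\<bar> < c"
   then have "rq (chrker #> y) < w" by (intro c(2)[rule_format] K.pi_closed) (auto simp: \<xi>'_def)
   then show "\<exists>b\<in>chrker. \<rho> (b \<otimes> y) < w" unfolding rq_coset by (rule dd_approx[OF chrker_subgroup y(1)])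
  qed
 qed
 then show ?thesis by blast
qed

end

section \<open>Totally disconnected subgroups and connectedness of normal subgroups\<close>

context homogeneous_group
begin

lemma conn_opensub: "conn ==> opensub U ==> U = \<G>"
 by (simp only: conn_def)

lemma opensubI:
 assumes "U \<subseteq> \<G>" "\<one> \<in> U" "!!a. a \<in> U ==> inv a \<in> U" "!!a b. a \<in> U ==> b \<in> U ==> a \<otimes> b \<in> U"
  "0 < r" "!!x. x \<in> \<G> ==> \<rho> x < r ==> x \<in> U"
 shows "opensub U"
 unfolding opensub_def
proof (intro conjI exI[of _ r] ballI impI)
 show "subgroup U G" by (rule subgroupI) (use assms(1-4) in auto)
qed (use assms(5,6) in auto)

text \<open>Arbitrarily small relatively open subgroups, the van Dantzig form of total
  disconnectedness.\<close>

definition tdsub :: "'a set => bool" where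
 "tdsub Z \<longleftrightarrow> (\<forall>e>0. \<exists>U r. 0 < r \<and> subgroup U G \<and> U \<subseteq> Z \<and> (\<forall>x\<in>U. \<rho> x < e) \<and> (\<forall>x\<in>Z. \<rho> x < r --> x \<in> U))"

lemma tdsubE:
 assumes "tdsub Z" "0 < e"
 obtains U r where "0 < r" "subgroup U G" "U \<subseteq> Z" "!!x. x \<in> U ==> \<rho> x < e" "!!x. x \<in> Z ==> \<rho> x < r ==> x \<in> U"
proof -
 have "\<exists>U r. 0 < r \<and> subgroup U G \<and> U \<subseteq> Z \<and> (\<forall>x\<in>U. \<rho> x < e) \<and> (\<forall>x\<in>Z. \<rho> x < r --> x \<in> U)"
  by (rule assms(1)[unfolded tdsub_def, rule_format, OF assms(2)])
 then obtain U r where h: "0 < r" "subgroup U G" "U \<subseteq> Z" "\<forall>x\<in>U. \<rho> x < e" "\<forall>x\<in>Z. \<rho> x < r --> x \<in> U" by (elim exE conjE)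
 show thesis by (rule that[OF h(1-3)]) (use h(4,5) in auto)
qed

lemma small_eq_one: "x \<in> \<G> ==> (!!e. 0 < e ==> \<rho> x < e) ==> x = \<one>"
 using rho_pos[of x] by force

lemma commutator_one: "g \<in> \<G> ==> z \<in> \<G> ==> g \<otimes> z \<otimes> inv g \<otimes> inv z = \<one> ==> g \<otimes> z = z \<otimes> g"
proof -
 assume c: "g \<in> \<G>" "z \<in> \<G>" and h: "g \<otimes> z \<otimes> inv g \<otimes> inv z = \<one>"
 have "g \<otimes> z = (g \<otimes> z \<otimes> inv g \<otimes> inv z) \<otimes> (z \<otimes> g)" using c by (simp add: gsimps)
 then show ?thesis using h c by simp
qed

text \<open>For a small relatively open subgroup U of Z, the elements of G normalizing U form an
  open subgroup, hence all of G. Then the g whose commutator with z lies in U form an open subgroup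
  too, so all these commutators lie in arbitrarily small U.\<close>

lemma td_normal_central:
 assumes conn: conn and Z: "Z \<lhd> G" and td: "tdsub Z" and g: "g \<in> \<G>" and z: "z \<in> Z"
 shows "g \<otimes> z = z \<otimes> g"
proof -
 have subZ: "subgroup Z G" using Z by (simp add: normal_def)
 note Zc = subgroup.mem_carrier[OF subZ]
 have zc: "z \<in> \<G>" by (rule Zc[OF z])
 have "\<rho> (g \<otimes> z \<otimes> inv g \<otimes> inv z) < e" if e: "0 < e" for e
 proof -
  obtain U r where U: "0 < r" "subgroup U G" "U \<subseteq> Z" "!!x. x \<in> U ==> \<rho> x < e" "!!x. x \<in> Z ==> \<rho> x < r ==> x \<in> U"
   by (rule tdsubE[OF td e], rule that)
  note Uc = subgroup.mem_carrier[OF U(2)]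
  \<comment> \<open>Uniform continuity of conjugation by the bounded elements of U makes [inv u, h]
    shorter than r for short h and all u at once, hence an element of U.\<close>
  obtain d where d: "0 < d" "!!x w. x \<in> \<G> ==> w \<in> \<G> ==> \<rho> x \<le> e ==> \<rho> w < d ==>
    \<rho> (x \<otimes> w \<otimes> inv x) < r / 2 \<and> \<rho> (inv x \<otimes> w \<otimes> x) < r / 2"
   using rho_conj_uniform'[of "r / 2" e] U(1) by auto
  have small: "h \<otimes> u \<otimes> inv h \<in> U" if h: "h \<in> \<G>" "\<rho> h < min d (r / 2)" and u: "u \<in> U" for h u
  proof -
   have uc: "u \<in> \<G>" by (rule Uc[OF u])
   have "\<rho> (inv u \<otimes> h \<otimes> u \<otimes> inv h) \<le> \<rho> (inv u \<otimes> h \<otimes> u) + \<rho> h"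
    using rho_mult[of "inv u \<otimes> h \<otimes> u" "inv h"] h uc by (simp add: rho_inv)
   also have "\<dots> < r" using d(2)[OF uc h(1)] U(4)[OF u] h(2) by force
   finally have "dst u (h \<otimes> u \<otimes> inv h) < r" using h uc by (simp add: m_assoc)
   moreover have "inv u \<otimes> (h \<otimes> u \<otimes> inv h) \<in> Z"
    using normal.inv_op_closed2[OF Z h(1)] U(3) u subZ by (meson subgroup.m_closed subgroup.m_inv_closed subsetD)
   ultimately have "inv u \<otimes> (h \<otimes> u \<otimes> inv h) \<in> U" by (intro U(5))
   then have "u \<otimes> (inv u \<otimes> (h \<otimes> u \<otimes> inv h)) \<in> U" using u U(2) by (simp add: subgroup.m_closed)
   then show ?thesis using h uc by simp
  qed
  let ?V = "{h \<in> \<G>. \<forall>u\<in>U. h \<otimes> u \<otimes> inv h \<in> U \<and> inv h \<otimes> u \<otimes> h \<in> U}"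
  have "opensub ?V"
  proof (rule opensubI[where r = "min d (r / 2)"])
   show "\<one> \<in> ?V" using Uc by simp
   show "inv a \<in> ?V" if "a \<in> ?V" for a using that by simp
   show "a \<otimes> b \<in> ?V" if "a \<in> ?V" "b \<in> ?V" for a b
   proof -
    have a: "a \<in> \<G>" "!!u. u \<in> U ==> a \<otimes> u \<otimes> inv a \<in> U \<and> inv a \<otimes> u \<otimes> a \<in> U" using that(1) by auto
    have b: "b \<in> \<G>" "!!u. u \<in> U ==> b \<otimes> u \<otimes> inv b \<in> U \<and> inv b \<otimes> u \<otimes> b \<in> U" using that(2) by auto
    have "a \<otimes> b \<otimes> u \<otimes> inv (a \<otimes> b) \<in> U \<and> inv (a \<otimes> b) \<otimes> u \<otimes> (a \<otimes> b) \<in> U" if u: "u \<in> U" for u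
     using a(2)[of "b \<otimes> u \<otimes> inv b"] b(2)[of "inv a \<otimes> u \<otimes> a"] a(2)[OF u] b(2)[OF u] a(1) b(1) Uc[OF u]
     by (simp add: gsimps)
    then show ?thesis using a(1) b(1) by simp
   qed
   show "0 < min d (r / 2)" using d U by simp
   show "x \<in> ?V" if "x \<in> \<G>" "\<rho> x < min d (r / 2)" for x
    using small[of x] small[of "inv x"] that by (auto simp: rho_inv)
  qed auto
  then have V: "?V = \<G>" by (rule conn_opensub[OF conn])
  have cj: "h \<otimes> u \<otimes> inv h \<in> U" "inv h \<otimes> u \<otimes> h \<in> U" if "h \<in> \<G>" "u \<in> U" for h u
  proof -
   have "h \<in> ?V" unfolding V by (rule that(1))
   then show "h \<otimes> u \<otimes> inv h \<in> U" "inv h \<otimes> u \<otimes> h \<in> U" using that(2) by auto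
  qed
  obtain d' where d': "0 < d'" "!!w. w \<in> \<G> ==> \<rho> w < d' ==> \<rho> (z \<otimes> w \<otimes> inv z) < r / 2"
   using rho_conj[OF zc, of "r / 2"] U(1) by auto
  have inZ: "h \<otimes> z \<otimes> inv h \<otimes> inv z \<in> Z" if "h \<in> \<G>" for h
   using normal.inv_op_closed2[OF Z that z] z subZ by (simp add: subgroup.m_closed subgroup.m_inv_closed)
  let ?W = "{h \<in> \<G>. h \<otimes> z \<otimes> inv h \<otimes> inv z \<in> U}"
  have "opensub ?W"
  proof (rule opensubI[where r = "min d' (r / 2)"])
   show "\<one> \<in> ?W" using zc subgroup.one_closed[OF U(2)] by simp
   show "inv a \<in> ?W" if "a \<in> ?W" for a
   proof -
    have a: "a \<in> \<G>" "a \<otimes> z \<otimes> inv a \<otimes> inv z \<in> U" using that by auto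
    have "inv a \<otimes> inv (a \<otimes> z \<otimes> inv a \<otimes> inv z) \<otimes> a \<in> U"
     by (rule cj(2)[OF a(1) subgroup.m_inv_closed[OF U(2) a(2)]])
    then show ?thesis using a zc by (simp add: gsimps)
   qed
   show "a \<otimes> b \<in> ?W" if "a \<in> ?W" "b \<in> ?W" for a b
   proof -
    have a: "a \<in> \<G>" "a \<otimes> z \<otimes> inv a \<otimes> inv z \<in> U" using that(1) by auto
    have b: "b \<in> \<G>" "b \<otimes> z \<otimes> inv b \<otimes> inv z \<in> U" using that(2) by auto
    have "(a \<otimes> (b \<otimes> z \<otimes> inv b \<otimes> inv z) \<otimes> inv a) \<otimes> (a \<otimes> z \<otimes> inv a \<otimes> inv z) \<in> U"
     by (rule subgroup.m_closed[OF U(2) cj(1)[OF a(1) b(2)] a(2)])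
    then show ?thesis using a b zc by (simp add: gsimps)
   qed
   show "0 < min d' (r / 2)" using d' U by simp
   show "x \<in> ?W" if x: "x \<in> \<G>" "\<rho> x < min d' (r / 2)" for x
   proof -
    have "\<rho> (x \<otimes> (z \<otimes> inv x \<otimes> inv z)) \<le> \<rho> x + \<rho> (z \<otimes> inv x \<otimes> inv z)" using x zc by (intro rho_mult) auto
    also have "\<dots> < r" using d'(2)[of "inv x"] x by (force simp: rho_inv)
    finally have "x \<otimes> z \<otimes> inv x \<otimes> inv z \<in> U" using inZ[OF x(1)] x zc by (intro U(5)) (auto simp: m_assoc)
    then show ?thesis using x by simp
   qed
  qed auto
  then have W: "?W = \<G>" by (rule conn_opensub[OF conn])
  have "g \<in> ?W" unfolding W by (rule g)
  then show ?thesis using U(4) by blast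
 qed
 then have "g \<otimes> z \<otimes> inv g \<otimes> inv z = \<one>" using g zc by (intro small_eq_one) auto
 then show ?thesis by (rule commutator_one[OF g zc])
qed

text \<open>By centrality of the common kernel, taking commutators with x is a homomorphism modulo
  small subgroups, so connectedness makes G abelian. Then approximate square roots modulo a bounded
  subgroup U generate G, which shows that every element killed by all characters lies in U; a
  bounded closed invariant subgroup is trivial.\<close>

lemma td_chrker_trivial:
 assumes conn: conn and td: "tdsub chrker"
 shows "chrker = {\<one>}"
proof -
 note cen = td_normal_central[OF conn chrker_normal td]
 note Zc = subgroup.mem_carrier[OF chrker_subgroup]
 have comm: "x \<otimes> y = y \<otimes> x" if x: "x \<in> \<G>" and y: "y \<in> \<G>" for x y
 proof -
  have "\<rho> (x \<otimes> y \<otimes> inv x \<otimes> inv y) < e" if e: "0 < e" for e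
  proof -
   obtain U r where U: "0 < r" "subgroup U G" "U \<subseteq> chrker" "!!x. x \<in> U ==> \<rho> x < e" "!!x. x \<in> chrker ==> \<rho> x < r ==> x \<in> U"
    by (rule tdsubE[OF td e], rule that)
   obtain d' where d': "0 < d'" "!!w. w \<in> \<G> ==> \<rho> w < d' ==> \<rho> (x \<otimes> w \<otimes> inv x) < r / 2"
    using rho_conj[OF x, of "r / 2"] U(1) by auto
   let ?W = "{h \<in> \<G>. x \<otimes> h \<otimes> inv x \<otimes> inv h \<in> U}"
   have "opensub ?W"
   proof (rule opensubI[where r = "min d' (r / 2)"])
    show "\<one> \<in> ?W" using x subgroup.one_closed[OF U(2)] by simp
    show "inv a \<in> ?W" if "a \<in> ?W" for a
    proof -
     have a: "a \<in> \<G>" "x \<otimes> a \<otimes> inv x \<otimes> inv a \<in> U" using that by auto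
     define k where "k = inv (x \<otimes> a \<otimes> inv x \<otimes> inv a)"
     have k: "k \<in> U" unfolding k_def by (rule subgroup.m_inv_closed[OF U(2) a(2)])
     have kc: "k \<in> \<G>" using k U(3) Zc by blast
     have "x \<otimes> inv a \<otimes> inv x \<otimes> inv (inv a) = inv a \<otimes> k \<otimes> a" using a x by (simp add: k_def gsimps)
     also have "\<dots> = k" using cen[OF a(1), of k] k U(3) a kc by (simp add: m_assoc) (metis cancel_left(1) subsetD)
     finally show ?thesis using k a by simp
    qed
    show "a \<otimes> b \<in> ?W" if "a \<in> ?W" "b \<in> ?W" for a b
    proof -
     have a: "a \<in> \<G>" "x \<otimes> a \<otimes> inv x \<otimes> inv a \<in> U" using that(1) by auto
     have b: "b \<in> \<G>" "x \<otimes> b \<otimes> inv x \<otimes> inv b \<in> U" using that(2) by auto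
     define k where "k = x \<otimes> b \<otimes> inv x \<otimes> inv b"
     have k: "k \<in> U" using b by (simp add: k_def)
     have kc: "k \<in> \<G>" using k U(3) Zc by blast
     have "x \<otimes> (a \<otimes> b) \<otimes> inv x \<otimes> inv (a \<otimes> b) = (x \<otimes> a \<otimes> inv x \<otimes> inv a) \<otimes> (a \<otimes> k \<otimes> inv a)"
      using a b x by (simp add: k_def gsimps)
     also have "a \<otimes> k \<otimes> inv a = k"
     proof -
      have ak: "a \<otimes> k = k \<otimes> a" using cen[OF a(1)] k U(3) by blast
      show ?thesis unfolding ak using a kc by (simp add: m_assoc)
     qed
     finally show ?thesis using subgroup.m_closed[OF U(2) a(2) k] a b by simp
    qed
    show "0 < min d' (r / 2)" using d' U by simp
    show "w \<in> ?W" if w: "w \<in> \<G>" "\<rho> w < min d' (r / 2)" for w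
    proof -
     have "\<rho> (x \<otimes> w \<otimes> inv x \<otimes> inv w) \<le> \<rho> (x \<otimes> w \<otimes> inv x) + \<rho> w"
      using rho_mult[of "x \<otimes> w \<otimes> inv x" "inv w"] x w by (simp add: rho_inv)
     also have "\<dots> < r" using d'(2)[of w] w by force
     finally show ?thesis using chrker_commutator[OF x w(1)] w by (simp add: U(5))
    qed
   qed auto
   then have W: "?W = \<G>" by (rule conn_opensub[OF conn])
   have "y \<in> ?W" unfolding W by (rule y)
   then show ?thesis using U(4) by blast
  qed
  then have "x \<otimes> y \<otimes> inv x \<otimes> inv y = \<one>" using x y by (intro small_eq_one) auto
  then show ?thesis by (rule commutator_one[OF x y])
 qed
 obtain n \<xi> e where B: "chr_basis n \<xi> e" using ex_chr_basis[OF conn] by blast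
 note B1 = B[unfolded chr_basis_def, THEN conjunct1, rule_format]
  and B3 = B[unfolded chr_basis_def, THEN conjunct2, THEN conjunct2, THEN conjunct1, rule_format]
  and B4 = B[unfolded chr_basis_def, THEN conjunct2, THEN conjunct2, THEN conjunct2, THEN conjunct1, rule_format]
  and B5 = B[unfolded chr_basis_def, THEN conjunct2, THEN conjunct2, THEN conjunct2, THEN conjunct2, rule_format]
 have \<xi>c: "chr (\<xi> i)" if "i < n" for i using B1[OF that] by simp
 obtain U r where U: "0 < r" "subgroup U G" "U \<subseteq> chrker" "!!x. x \<in> U ==> \<rho> x < 1" "!!x. x \<in> chrker ==> \<rho> x < r ==> x \<in> U"
  by (rule tdsubE[OF td zero_less_one], rule that)
 note Uc = subgroup.mem_carrier[OF U(2)]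
 \<comment> \<open>A product of three elements of norm at most u stays below r, so that if it lies
   in the common kernel it lies in U.\<close>
 define u where "u = r / 4"
 have u: "0 < u" "3 * u < r" using U(1) by (auto simp: u_def)
 obtain c where c: "0 < c" "!!y. y \<in> \<G> ==> \<forall>i<n. \<bar>\<xi> i y\<bar> < c ==> \<exists>b\<in>chrker. \<rho> (b \<otimes> y) < u"
  using B5[OF u(1)] by (elim exE conjE) (rule that, auto)
 define S where "S t = {x \<in> \<G>. \<rho> x < u \<and> (\<forall>i<n. \<bar>\<xi> i x\<bar> < t)}" for t
 have inU: "inv w \<otimes> v \<in> U" if "w \<in> \<G>" "v \<in> \<G>" "\<rho> w \<le> 2 * u" "\<rho> v < u" "inv w \<otimes> v \<in> chrker" for w v
  using rho_mult_inv1[OF that(1,2)] that u by (intro U(5)) auto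
 \<comment> \<open>The basis gives an element with half the character values of x, and its last
   clause moves it by the common kernel into the u-ball. The quotient of x by its square is short
   and is killed by all characters.\<close>
 have half: "\<exists>y\<in>S (c / 2). \<exists>k\<in>U. x = y \<otimes> y \<otimes> k" if x: "x \<in> S c" for x
 proof -
  have xc: "x \<in> \<G>" using x by (simp add: S_def)
  obtain a where a: "a \<in> \<G>" "!!\<eta>. chr \<eta> ==> \<eta> a = (\<Sum>i<n. (\<xi> i x / 2) * \<eta> (e i))"
   using B4[of "\<lambda>i. \<xi> i x / 2"] by blast
  have a2: "\<eta> a = \<eta> x / 2" if \<eta>: "chr \<eta>" for \<eta>
   using a(2)[OF \<eta>] B3[OF \<eta> xc] by (simp add: sum_divide_distrib)
  have "\<forall>i<n. \<bar>\<xi> i a\<bar> < c"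
  proof (intro allI impI)
   fix i assume i: "i < n"
   have "\<bar>\<xi> i x\<bar> < c" using x i by (simp add: S_def)
   then show "\<bar>\<xi> i a\<bar> < c" using a2[OF \<xi>c[OF i]] by linarith
  qed
  then obtain b where b: "b \<in> chrker" "\<rho> (b \<otimes> a) < u" using c(2)[OF a(1)] by blast
  define y where "y = b \<otimes> a"
  have bc: "b \<in> \<G>" by (rule Zc[OF b(1)])
  have y: "y \<in> \<G>" "\<rho> y < u" using b bc a by (auto simp: y_def)
  have y\<eta>: "\<eta> y = \<eta> x / 2" if \<eta>: "chr \<eta>" for \<eta>
   using a2[OF \<eta>] chr_mult[OF \<eta> bc a(1)] chrker_mem[OF b(1) \<eta>] by (simp add: y_def)
  have yi: "\<bar>\<xi> i y\<bar> < c / 2" if i: "i < n" for i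
  proof -
   have "\<bar>\<xi> i x\<bar> < c" using x i by (simp add: S_def)
   then show ?thesis using y\<eta>[OF \<xi>c[OF i]] by linarith
  qed
  have yS: "y \<in> S (c / 2)" using y yi by (simp add: S_def)
  have "\<eta> (inv (y \<otimes> y) \<otimes> x) = 0" if \<eta>: "chr \<eta>" for \<eta>
   using y\<eta>[OF \<eta>] chr_mult[OF \<eta>] chr_inv[OF \<eta>] y xc by simp
  then have k1: "inv (y \<otimes> y) \<otimes> x \<in> chrker" unfolding chrker_def using y xc by blast
  have "inv (y \<otimes> y) \<otimes> x \<in> U"
   using rho_mult[of y y] y x by (intro inU k1) (auto simp: S_def)
  moreover have "x = y \<otimes> y \<otimes> (inv (y \<otimes> y) \<otimes> x)" using y xc by (simp del: inv_mult_group)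
  ultimately show ?thesis using yS by blast
 qed
 \<comment> \<open>P M x writes x as a 2 ^ M-th power of a short element with small characters, up
   to U. Replacing the base by an approximate root raises M, so two elements can be given the same
   exponent; their product has a base with doubled characters, which one more root repairs.\<close>
 define P where "P M x \<longleftrightarrow> (\<exists>y\<in>S (c / 2). \<exists>k\<in>U. x = y [^] ((2::nat) ^ M) \<otimes> k)" for M x
 have Sc: "y \<in> \<G>" if "y \<in> S t" for y t using that by (simp add: S_def)
 have raise: "P (Suc M) (x [^] ((2::nat) ^ M) \<otimes> k)" if x: "x \<in> S c" and k: "k \<in> U" for x k M
 proof -
  obtain y l where y: "y \<in> S (c / 2)" "l \<in> U" "x = y \<otimes> y \<otimes> l" using half[OF x] by blast
  have cc: "y \<in> \<G>" "l \<in> \<G>" "k \<in> \<G>" using y k Sc Uc by auto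
  have "x [^] ((2::nat) ^ M) = (y \<otimes> y) [^] ((2::nat) ^ M) \<otimes> l [^] ((2::nat) ^ M)"
   unfolding y(3) using cc comm by (intro pow_mult_distrib) auto
  also have "(y \<otimes> y) [^] ((2::nat) ^ M) = (y [^] (2::nat)) [^] ((2::nat) ^ M)" using cc by (simp add: numeral_2_eq_2)
  also have "\<dots> = y [^] ((2::nat) ^ Suc M)" using cc by (simp add: nat_pow_pow mult.commute)
  finally have "x [^] ((2::nat) ^ M) \<otimes> k = y [^] ((2::nat) ^ Suc M) \<otimes> (l [^] ((2::nat) ^ M) \<otimes> k)" using cc by (simp add: m_assoc)
  moreover have "l [^] m \<in> U" for m :: nat
   by (induction m) (use y U(2) in \<open>auto simp: subgroup.one_closed subgroup.m_closed\<close>)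
  ultimately show ?thesis unfolding P_def using y k subgroup.m_closed[OF U(2)] by blast
 qed
 have SS: "y \<in> S c" if "y \<in> S (c / 2)" for y using that c(1) by (force simp: S_def)
 have Pmono: "P M x ==> P (M + m) x" for M m x
 proof (induction m)
  case (Suc m)
  then have "P (M + m) x" by simp
  then obtain y k where "y \<in> S (c / 2)" "k \<in> U" "x = y [^] ((2::nat) ^ (M + m)) \<otimes> k" unfolding P_def by blast
  then show ?case using raise[OF SS, of y k "M + m"] by simp
 qed simp
 let ?L = "{x. \<exists>M. P M x}"
 obtain d where d: "0 < d" "!!x. x \<in> \<G> ==> \<rho> x < d ==> \<forall>i<n. \<bar>\<xi> i x\<bar> < c / 2"
 proof -
  have "\<exists>d>0. \<forall>x\<in>\<G>. \<rho> x < d --> (\<forall>i<m. \<bar>\<xi> i x\<bar> < c / 2)" if "m \<le> n" for m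
   using that
  proof (induction m)
   case 0
   then show ?case by (intro exI[of _ 1]) auto
  next
   case (Suc m)
   then obtain d where d: "d > 0" "\<forall>x\<in>\<G>. \<rho> x < d --> (\<forall>i<m. \<bar>\<xi> i x\<bar> < c / 2)" by auto
   obtain d' where d': "d' > 0" "\<forall>x\<in>\<G>. \<rho> x < d' --> \<bar>\<xi> m x\<bar> < c / 2"
    using chr_small[OF \<xi>c, of m "c / 2"] Suc c(1) by auto
   show ?case using d d' by (intro exI[of _ "min d d'"]) (auto simp: less_Suc_eq)
  qed
  then show ?thesis using that by blast
 qed
 have "opensub ?L"
 proof (rule opensubI[where r = "min d u"])
  show "?L \<subseteq> \<G>" using Sc Uc by (auto simp: P_def)
  have zS: "x \<in> S (c / 2)" if "x \<in> \<G>" "\<rho> x < min d u" for x using d(2)[of x] that by (auto simp: S_def)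
  have sm: "x \<in> ?L" if "x \<in> \<G>" "\<rho> x < min d u" for x
  proof -
   have "x = x [^] ((2::nat) ^ 0) \<otimes> \<one>" using that by simp
   then have "P 0 x" unfolding P_def using zS[OF that] subgroup.one_closed[OF U(2)] by blast
   then show ?thesis by blast
  qed
  show du: "0 < min d u" using d u by simp
  show "x \<in> ?L" if "x \<in> \<G>" "\<rho> x < min d u" for x using sm[OF that] .
  show "\<one> \<in> ?L" by (rule sm) (use du in auto)
  show "inv a \<in> ?L" if aL: "a \<in> ?L" for a
  proof -
   obtain M y k where y: "y \<in> S (c / 2)" "k \<in> U" "a = y [^] ((2::nat) ^ M) \<otimes> k" using aL unfolding P_def by blast
   have cc: "y \<in> \<G>" "k \<in> \<G>" using y Sc Uc by auto
   have "inv a = inv (y [^] ((2::nat) ^ M)) \<otimes> inv k" using y(3) cc comm[of "inv k"] by (simp add: inv_mult_group)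
   also have "inv (y [^] ((2::nat) ^ M)) = (inv y) [^] ((2::nat) ^ M)" using cc by (simp add: nat_pow_inv)
   finally have "inv a = (inv y) [^] ((2::nat) ^ M) \<otimes> inv k" .
   moreover have "inv y \<in> S (c / 2)" using y chr_inv[OF \<xi>c] cc by (auto simp: S_def rho_inv)
   moreover have "inv k \<in> U" by (rule subgroup.m_inv_closed[OF U(2) y(2)])
   ultimately show ?thesis unfolding P_def by blast
  qed
  show "a \<otimes> b \<in> ?L" if ab: "a \<in> ?L" "b \<in> ?L" for a b
  proof -
   obtain M M' where "P M a" "P M' b" using ab by blast
   then have "P (M + M') a" "P (M + M') b" using Pmono[of M a M'] Pmono[of M' b M] by (auto simp: add.commute)
   then obtain N y k z l where y: "y \<in> S (c / 2)" "k \<in> U" "a = y [^] ((2::nat) ^ N) \<otimes> k"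
    and z: "z \<in> S (c / 2)" "l \<in> U" "b = z [^] ((2::nat) ^ N) \<otimes> l" unfolding P_def by blast
   have cc: "y \<in> \<G>" "k \<in> \<G>" "z \<in> \<G>" "l \<in> \<G>" using y z Sc Uc by auto
   have "\<forall>i<n. \<bar>\<xi> i (y \<otimes> z)\<bar> < c"
   proof (intro allI impI)
    fix i assume i: "i < n"
    have "\<bar>\<xi> i y\<bar> < c / 2" "\<bar>\<xi> i z\<bar> < c / 2" using y(1) z(1) i by (auto simp: S_def)
    then show "\<bar>\<xi> i (y \<otimes> z)\<bar> < c" using chr_mult[OF \<xi>c[OF i] cc(1,3)] by linarith
   qed
   then obtain w0 where w0: "w0 \<in> chrker" "\<rho> (w0 \<otimes> (y \<otimes> z)) < u" using c(2)[of "y \<otimes> z"] cc by auto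
   have w0c: "w0 \<in> \<G>" by (rule Zc[OF w0(1)])
   define w where "w = w0 \<otimes> (y \<otimes> z)"
   have wc: "w \<in> \<G>" using w0c cc by (simp add: w_def)
   have wS: "w \<in> S c"
    using w0(2) wc \<open>\<forall>i<n. \<bar>\<xi> i (y \<otimes> z)\<bar> < c\<close> chr_mult[OF \<xi>c w0c, of _ "y \<otimes> z"] chrker_mem[OF w0(1) \<xi>c] cc
    by (auto simp: S_def w_def)
   have "w \<otimes> inv (y \<otimes> z) = w0" using w0c cc by (simp add: w_def m_assoc)
   moreover have "inv (inv w) \<otimes> inv (y \<otimes> z) = w \<otimes> inv (y \<otimes> z)" using wc by simp
   moreover have "\<rho> w0 < r"
   proof -
    have "\<rho> w0 \<le> \<rho> w + \<rho> (inv (y \<otimes> z))" using calculation(1) rho_mult[of w "inv (y \<otimes> z)"] wc cc by simp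
    also have "\<rho> (inv (y \<otimes> z)) \<le> \<rho> y + \<rho> z" using rho_inv[of "y \<otimes> z"] rho_mult[of y z] cc by simp
    finally show ?thesis using w0(2) y(1) z(1) u by (simp add: S_def w_def)
   qed
   ultimately have w0U: "w0 \<in> U" using U(5)[OF w0(1)] by blast
   have yz: "y \<otimes> z = inv w0 \<otimes> w" using w0c cc by (simp add: w_def)
   have iU: "inv w0 \<in> U" by (rule subgroup.m_inv_closed[OF U(2) w0U])
   have ipow: "(inv w0) [^] m \<in> U" for m :: nat
    by (induction m) (use iU U(2) in \<open>auto simp: subgroup.one_closed subgroup.m_closed\<close>)
   have "a \<otimes> b = (y [^] ((2::nat) ^ N) \<otimes> z [^] ((2::nat) ^ N)) \<otimes> (k \<otimes> l)"
   proof -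
    have "a \<otimes> b = y [^] ((2::nat) ^ N) \<otimes> (k \<otimes> z [^] ((2::nat) ^ N)) \<otimes> l" using cc y z by (simp add: m_assoc)
    also have "k \<otimes> z [^] ((2::nat) ^ N) = z [^] ((2::nat) ^ N) \<otimes> k" using cc by (intro comm) auto
    finally show ?thesis using cc by (simp add: m_assoc)
   qed
   also have "y [^] ((2::nat) ^ N) \<otimes> z [^] ((2::nat) ^ N) = (inv w0 \<otimes> w) [^] ((2::nat) ^ N)"
    unfolding yz[symmetric] using cc comm by (intro pow_mult_distrib[symmetric]) auto
   also have "\<dots> = (inv w0) [^] ((2::nat) ^ N) \<otimes> w [^] ((2::nat) ^ N)"
    using w0c wc comm by (intro pow_mult_distrib) auto
   also have "\<dots> = w [^] ((2::nat) ^ N) \<otimes> (inv w0) [^] ((2::nat) ^ N)" using w0c wc by (intro comm) auto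
   finally have "a \<otimes> b = w [^] ((2::nat) ^ N) \<otimes> ((inv w0) [^] ((2::nat) ^ N) \<otimes> (k \<otimes> l))"
    using w0c wc cc by (simp add: m_assoc)
   moreover have "(inv w0) [^] ((2::nat) ^ N) \<otimes> (k \<otimes> l) \<in> U"
    using ipow y(2) z(2) by (intro subgroup.m_closed[OF U(2)])
   ultimately have "P (Suc N) (a \<otimes> b)" using raise[OF wS, of _ N] by auto
   then show ?thesis by blast
  qed
 qed
 then have L: "?L = \<G>" by (rule conn_opensub[OF conn])
 \<comment> \<open>The base y of a representation of x is killed by all characters along with x,
   since the values are multiplied by 2 ^ M. Being short, it lies in U, and so does its
   power.\<close>
 have "x \<in> U" if x: "x \<in> chrker" for x
 proof -
  have "x \<in> ?L" unfolding L by (rule Zc[OF x])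
  then obtain M y k where y: "y \<in> S (c / 2)" "k \<in> U" "x = y [^] ((2::nat) ^ M) \<otimes> k" unfolding P_def by blast
  have cc: "y \<in> \<G>" "k \<in> \<G>" using y Sc Uc by auto
  have "\<eta> y = 0" if \<eta>: "chr \<eta>" for \<eta>
  proof -
   have "\<eta> x = 2 ^ M * \<eta> y + \<eta> k" unfolding y(3) using chr_mult[OF \<eta>] chr_pow[OF \<eta>] cc by simp
   then show ?thesis using chrker_mem[OF x \<eta>] chrker_mem[of k, OF _ \<eta>] y(2) U(3) by auto
  qed
  then have "y \<in> chrker" unfolding chrker_def using cc by blast
  then have yU: "y \<in> U" using y(1) u by (intro U(5)) (auto simp: S_def)
  have "y [^] m \<in> U" for m :: nat
   by (induction m) (use yU U(2) in \<open>auto simp: subgroup.one_closed subgroup.m_closed\<close>)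
  then show ?thesis unfolding y(3) using y(2) by (intro subgroup.m_closed[OF U(2)])
 qed
 then show ?thesis using invsub_bounded[OF chrker_invsub, of 1] U(4) less_imp_le by blast
qed

lemma sub_connsub_iff:
 assumes A: "invsub A" and B: "B \<subseteq> A"
 shows "homogeneous_group.connsub (G\<lparr>carrier := A\<rparr>) \<rho> B \<longleftrightarrow> connsub B"
proof -
 interpret S: homogeneous_group "G\<lparr>carrier := A\<rparr>" \<alpha> \<rho> \<theta> by (rule sub_hg[OF A])
 have "(subgroup U (G\<lparr>carrier := A\<rparr>) \<and> U \<subseteq> B) \<longleftrightarrow> (subgroup U G \<and> U \<subseteq> B)" for U
  using sub_subgroup_iff[OF invsub_subgroup[OF A]] B by auto
 then show ?thesis unfolding S.connsub_def connsub_def by (metis (no_types, lifting))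
qed

text \<open>C is the component computed inside N. It is normal in G because conjugations restrict to
  continuous endomorphisms of N. The last clause says that N / C is totally disconnected, phrased
  without the quotient.\<close>

lemma ex_component:
 assumes N: "invsub N" and nor: "N \<lhd> G"
 shows "\<exists>C. invsub C \<and> C \<subseteq> N \<and> C \<lhd> G \<and> connsub C \<and>
   (\<forall>e>0. \<exists>U r. 0 < r \<and> subgroup U G \<and> U \<subseteq> N \<and> (\<forall>x\<in>U. \<exists>c\<in>C. \<rho> (c \<otimes> x) < e) \<and> (\<forall>x\<in>N. \<rho> x < r --> x \<in> U))"
proof -
 interpret S: homogeneous_group "G\<lparr>carrier := N\<rparr>" \<alpha> \<rho> \<theta> by (rule sub_hg[OF N])
 note iv = m_inv_consistent[OF invsub_subgroup[OF N]]
 have C: "invsub S.Comp" "S.Comp \<subseteq> N" using S.Comp_invsub sub_invsub_iff[OF N] by auto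
 have con: "connsub S.Comp" using S.Comp_conn sub_connsub_iff[OF N C(2)] by simp
 have nC: "g \<otimes> x \<otimes> inv g \<in> S.Comp" if g: "g \<in> \<G>" and x: "x \<in> S.Comp" for g x
 proof -
  have "(\<lambda>y. g \<otimes> y \<otimes> inv g) x \<in> S.Comp"
  proof (rule S.Comp_endo[OF _ _ x])
   show "(\<lambda>y. g \<otimes> y \<otimes> inv g) \<in> hom (G\<lparr>carrier := N\<rparr>) (G\<lparr>carrier := N\<rparr>)"
    using normal.inv_op_closed2[OF nor g] g invsub_mem[OF N] by (intro homI) (auto simp: gsimps)
   fix e :: real assume "0 < e"
   then obtain d where "d > 0" "\<forall>z\<in>\<G>. \<rho> z < d --> \<rho> (g \<otimes> z \<otimes> inv g) < e" using rho_conj[OF g] by blast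
   then show "\<exists>d>0. \<forall>x\<in>carrier (G\<lparr>carrier := N\<rparr>). \<rho> x < d --> \<rho> (g \<otimes> x \<otimes> inv g) < e"
    using invsub_mem[OF N] by (intro exI[of _ d]) auto
  qed
  then show ?thesis .
 qed
 have norC: "S.Comp \<lhd> G" unfolding normal_inv_iff using invsub_subgroup[OF C(1)] nC by blast
 have td: "\<exists>U r. 0 < r \<and> subgroup U G \<and> U \<subseteq> N \<and> (\<forall>x\<in>U. \<exists>c\<in>S.Comp. \<rho> (c \<otimes> x) < e) \<and> (\<forall>x\<in>N. \<rho> x < r --> x \<in> U)"
  if e: "0 < e" for e
 proof -
  obtain n where n: "\<forall>x\<in>S.On n. \<exists>c\<in>S.Comp. \<rho> (inv\<^bsub>G\<lparr>carrier := N\<rparr>\<^esub> c \<otimes>\<^bsub>G\<lparr>carrier := N\<rparr>\<^esub> x) < e" using S.On_close_Comp[OF e] by blast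
  show ?thesis
  proof (intro exI[of _ "S.On n"] exI[of _ "\<theta> ^ n"] conjI ballI impI)
   show "0 < \<theta> ^ n" using theta by simp
   show "subgroup (S.On n) G" "S.On n \<subseteq> N" using S.On_subgroup sub_subgroup_iff[OF invsub_subgroup[OF N]] by auto
   show "\<exists>c\<in>S.Comp. \<rho> (c \<otimes> x) < e" if x: "x \<in> S.On n" for x
   proof -
    obtain c where c: "c \<in> S.Comp" "\<rho> (inv\<^bsub>G\<lparr>carrier := N\<rparr>\<^esub> c \<otimes> x) < e" using n x by auto
    have "c \<in> N" using c C by blast
    then show ?thesis using c iv[of c] invsub_minv[OF C(1) c(1)] by (intro bexI[of _ "inv c"]) auto
   qed
   show "x \<in> S.On n" if "x \<in> N" "\<rho> x < \<theta> ^ n" for x unfolding S.On_def using that by (intro generate.incl) simp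
  qed
 qed
 show ?thesis using C norC con td by (intro exI[of _ S.Comp]) simp
qed

end

context homogeneous_quotient
begin

lemma quotient_image_subgroup:
 assumes "subgroup U G"
 shows "subgroup ((\<lambda>x. N #> x) ` U) (G Mod N)"
proof -
 interpret ph: group_hom G "G Mod N" "\<lambda>x. N #> x" by unfold_locales (rule pi_hom)
 show ?thesis by (rule ph.subgroup_img_is_subgroup[OF assms])
qed

lemma quotient_tdsub:
 assumes M: "N \<subseteq> M" "subgroup M G"
  and td: "!!e. 0 < e ==> \<exists>U r. 0 < r \<and> subgroup U G \<and> U \<subseteq> M \<and> (\<forall>x\<in>U. \<exists>c\<in>N. \<rho> (c \<otimes> x) < e) \<and> (\<forall>x\<in>M. \<rho> x < r --> x \<in> U)"
 shows "Q.tdsub ((\<lambda>x. N #> x) ` M)"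
 unfolding Q.tdsub_def
proof (intro allI impI)
 fix e :: real assume "0 < e"
 from td[OF this] obtain U r where U: "0 < r" "subgroup U G" "U \<subseteq> M" "\<forall>x\<in>U. \<exists>c\<in>N. \<rho> (c \<otimes> x) < e" "\<forall>x\<in>M. \<rho> x < r --> x \<in> U"
  by (elim exE conjE)
 note Mc = subgroup.mem_carrier[OF M(2)]
 show "\<exists>U r. 0 < r \<and> subgroup U (G Mod N) \<and> U \<subseteq> (\<lambda>x. N #> x) ` M \<and> (\<forall>X\<in>U. rq X < e) \<and> (\<forall>X\<in>(\<lambda>x. N #> x) ` M. rq X < r --> X \<in> U)"
 proof (intro exI[of _ "(\<lambda>x. N #> x) ` U"] exI[of _ r] conjI ballI impI U(1))
  show "subgroup ((\<lambda>x. N #> x) ` U) (G Mod N)" by (rule quotient_image_subgroup[OF U(2)])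
  show "(\<lambda>x. N #> x) ` U \<subseteq> (\<lambda>x. N #> x) ` M" using U(3) by (rule image_mono)
  fix X assume "X \<in> (\<lambda>x. N #> x) ` U"
  then obtain x where x: "X = N #> x" "x \<in> U" by (rule imageE)
  obtain c where c: "c \<in> N" "\<rho> (c \<otimes> x) < e" using U(4) x(2) by blast
  have "x \<in> \<G>" using x U(3) Mc by blast
  then have "dd N x \<le> \<rho> (c \<otimes> x)" using dd_le[OF nN.is_subgroup _ c(1)] by blast
  then show "rq X < e" using c unfolding x(1) rq_coset by linarith
 next
  fix X assume X: "X \<in> (\<lambda>x. N #> x) ` M" "rq X < r"
  obtain x where x: "X = N #> x" "x \<in> M" using X(1) by (rule imageE)
  have xc: "x \<in> \<G>" by (rule Mc[OF x(2)])
  obtain n where n: "n \<in> N" "\<rho> (n \<otimes> x) < r" using dd_approx[OF nN.is_subgroup xc] X(2) unfolding x(1) rq_coset by blast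
  have nM: "n \<in> M" using n M by blast
  have "n \<otimes> x \<in> U" using U(5) n(2) subgroup.m_closed[OF M(2) nM x(2)] by blast
  moreover have "X = N #> (n \<otimes> x)" unfolding x(1) using n xc Mc[OF nM] by (intro pi_eq) (auto simp: gsimps nN.m_inv_closed)
  ultimately show "X \<in> (\<lambda>x. N #> x) ` U" by blast
 qed
qed

end

context homogeneous_group
begin

text \<open>Let C be the component of the common kernel. The common kernel of G / C is the image of
  that of G and is totally disconnected, hence trivial by \<open>td_chrker_trivial\<close>; so C is
  everything.\<close>

lemma chrker_connsub:
 assumes conn: conn
 shows "connsub chrker"
proof -
 obtain C where C: "invsub C" "C \<subseteq> chrker" "C \<lhd> G" "connsub C"
   and td: "\<forall>e>0. \<exists>U r. 0 < r \<and> subgroup U G \<and> U \<subseteq> chrker \<and> (\<forall>x\<in>U. \<exists>c\<in>C. \<rho> (c \<otimes> x) < e) \<and> (\<forall>x\<in>chrker. \<rho> x < r --> x \<in> U)"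
  using ex_component[OF chrker_invsub chrker_normal] by (elim exE conjE)
 interpret K: homogeneous_quotient G \<alpha> \<rho> \<theta> C
  by (intro homogeneous_quotient.intro homogeneous_quotient_axioms.intro C homogeneous_group_axioms)
 have eq: "K.Q.chrker = (\<lambda>x. C #> x) ` chrker"
 proof (intro equalityI subsetI)
  fix X assume X: "X \<in> K.Q.chrker"
  then have "X \<in> carrier (G Mod C)" by (simp only: K.Q.chrker_def mem_Collect_eq)
  then obtain x where x: "x \<in> \<G>" "X = C #> x" using K.pi_surj by blast
  have "\<eta> x = 0" if \<eta>: "chr \<eta>" for \<eta>
  proof -
   have z: "!!n. n \<in> C ==> \<eta> n = 0" using chrker_mem[OF _ \<eta>] C(2) by blast
   have "\<exists>\<zeta>. K.Q.chr \<zeta> \<and> (\<forall>x\<in>\<G>. \<zeta> (C #> x) = \<eta> x)" by (rule K.chr_push[OF \<eta>]) (rule z)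
   then obtain \<zeta> where \<zeta>: "K.Q.chr \<zeta>" "\<forall>x\<in>\<G>. \<zeta> (C #> x) = \<eta> x" by (elim exE conjE)
   show ?thesis using K.Q.chrker_mem[OF X \<zeta>(1)] \<zeta>(2)[rule_format, OF x(1)] unfolding x(2) by simp
  qed
  then have "x \<in> chrker" unfolding chrker_def using x(1) by blast
  then show "X \<in> (\<lambda>x. C #> x) ` chrker" unfolding x(2) by (rule imageI)
 next
  fix X assume "X \<in> (\<lambda>x. C #> x) ` chrker"
  then obtain x where x: "X = C #> x" "x \<in> chrker" by (rule imageE)
  have xc: "x \<in> \<G>" using x(2) by (simp add: chrker_def)
  have "\<zeta> X = 0" if "K.Q.chr \<zeta>" for \<zeta> using chrker_mem[OF x(2) K.chr_pull[OF that]] unfolding x(1) .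
  then show "X \<in> K.Q.chrker" unfolding K.Q.chrker_def x(1) using K.pi_closed[OF xc] by blast
 qed
 have "K.Q.tdsub K.Q.chrker"
  unfolding eq by (rule K.quotient_tdsub[OF C(2) chrker_subgroup td[rule_format]])
 then have one: "K.Q.chrker = {\<one>\<^bsub>G Mod C\<^esub>}" by (rule K.Q.td_chrker_trivial[OF K.quotient_conn[OF conn]])
 have "x \<in> C" if x: "x \<in> chrker" for x
 proof -
  have "C #> x \<in> {\<one>\<^bsub>G Mod C\<^esub>}" unfolding one[symmetric] eq using x by (rule imageI)
  then show ?thesis using K.pi_eq_N[of x] x by (simp add: K.pi_one chrker_def)
 qed
 then have "C = chrker" using C(2) by blast
 then show ?thesis using C(4) by simp
qed

lemma conn_chrker_ne: "conn ==> \<G> \<noteq> {\<one>} ==> chrker \<noteq> \<G>"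
 using exists_character by (auto simp: chrker_def)

text \<open>Take a minimal closed invariant connected A containing K. Characters of A kill the
  bounded subgroup K, so the common kernel of A also contains K and is connected. By minimality it
  equals A, and a connected group without nonzero characters is trivial.\<close>

theorem conn_no_bounded_subgroup:
 assumes conn: conn and K: "subgroup K G" "!!x. x \<in> K ==> \<rho> x \<le> R"
 shows "K = {\<one>}"
proof -
 let ?F = "{A. invsub A \<and> connsub A \<and> K \<subseteq> A}"
 have "\<G> \<in> ?F" using conn invsub_carrier connsub_carrier subgroup.subset[OF K(1)] by auto
 from invsub_minimal[OF this] obtain A where A: "invsub A" "connsub A" "K \<subseteq> A" and min: "!!B. B \<in> ?F ==> \<not> B \<subset> A" by auto
 interpret S: homogeneous_group "G\<lparr>carrier := A\<rparr>" \<alpha> \<rho> \<theta> by (rule sub_hg[OF A(1)])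
 have Sc: "S.conn" using A(2) sub_conn_iff[OF A(1)] by simp
 have B: "invsub S.chrker" "S.chrker \<subseteq> A" using S.chrker_invsub sub_invsub_iff[OF A(1)] by auto
 have Bc: "connsub S.chrker" using S.chrker_connsub[OF Sc] sub_connsub_iff[OF A(1) B(2)] by simp
 have "x \<in> S.chrker" if x: "x \<in> K" for x
 proof -
  have xA: "x \<in> carrier (G\<lparr>carrier := A\<rparr>)" using x A(3) by auto
  have "\<eta> x = 0" if \<eta>: "S.chr \<eta>" for \<eta>
  proof (rule ccontr)
   assume ne: "\<eta> x \<noteq> 0"
   obtain L where L: "!!x. x \<in> carrier (G\<lparr>carrier := A\<rparr>) ==> \<rho> x \<le> R ==> \<bar>\<eta> x\<bar> \<le> L" using S.chr_bdd[OF \<eta>] by blast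
   obtain m :: nat where m: "L / \<bar>\<eta> x\<bar> < m" using reals_Archimedean2 by blast
   have pw: "x [^]\<^bsub>G\<lparr>carrier := A\<rparr>\<^esub> k \<in> K" for k :: nat
    by (induction k) (use x K(1) in \<open>auto simp: subgroup.one_closed subgroup.m_closed\<close>)
   have "\<bar>\<eta> (x [^]\<^bsub>G\<lparr>carrier := A\<rparr>\<^esub> m)\<bar> \<le> L" using pw[of m] K(2) A(3) by (intro L) auto
   then have "m * \<bar>\<eta> x\<bar> \<le> L" using S.chr_pow[OF \<eta> xA, of m] by (simp add: abs_mult)
   then show False using m ne by (simp add: field_simps)
  qed
  then show ?thesis unfolding S.chrker_def using xA by blast
 qed
 then have "S.chrker \<in> ?F" using B Bc by blast
 then have "S.chrker = A" using min B(2) by blast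
 then have "A = {\<one>}" using S.conn_chrker_ne[OF Sc] by auto
 then show ?thesis using A(3) subgroup.one_closed[OF K(1)] by blast
qed

text \<open>Modulo the component C of N, a small relatively open subgroup U of N becomes bounded,
  hence trivial, so U lies in C. Since \<alpha> contracts every element of N into U, N equals C.
  This applies in particular to kernels, where a discrete part is excluded by the
  contraction.\<close>

theorem conn_normal_connsub:
 assumes conn: conn and N: "invsub N" "N \<lhd> G"
 shows "connsub N"
proof -
 obtain C where C: "invsub C" "C \<subseteq> N" "C \<lhd> G" "connsub C"
   and td: "\<forall>e>0. \<exists>U r. 0 < r \<and> subgroup U G \<and> U \<subseteq> N \<and> (\<forall>x\<in>U. \<exists>c\<in>C. \<rho> (c \<otimes> x) < e) \<and> (\<forall>x\<in>N. \<rho> x < r --> x \<in> U)"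
  using ex_component[OF N] by (elim exE conjE)
 interpret K: homogeneous_quotient G \<alpha> \<rho> \<theta> C
  by (intro homogeneous_quotient.intro homogeneous_quotient_axioms.intro C homogeneous_group_axioms)
 obtain U r where U: "0 < r" "subgroup U G" "U \<subseteq> N" "\<forall>x\<in>U. \<exists>c\<in>C. \<rho> (c \<otimes> x) < 1" "\<forall>x\<in>N. \<rho> x < r --> x \<in> U"
  using td[rule_format, OF zero_less_one] by (elim exE conjE)
 note Nc = invsub_mem[OF N(1)]
 have "(\<lambda>x. C #> x) ` U = {\<one>\<^bsub>G Mod C\<^esub>}"
 proof (rule K.Q.conn_no_bounded_subgroup[OF K.quotient_conn[OF conn] K.quotient_image_subgroup[OF U(2)]])
  fix X assume "X \<in> (\<lambda>x. C #> x) ` U"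
  then obtain x where x: "X = C #> x" "x \<in> U" by (rule imageE)
  obtain c where c: "c \<in> C" "\<rho> (c \<otimes> x) < 1" using U(4) x(2) by blast
  have "x \<in> \<G>" using x U(3) Nc by blast
  then have "dd C x \<le> \<rho> (c \<otimes> x)" using dd_le[OF invsub_subgroup[OF C(1)] _ c(1)] by blast
  then show "rq X \<le> 1" using c unfolding x(1) rq_coset by linarith
 qed
 then have UC: "x \<in> C" if "x \<in> U" for x
  using K.pi_eq_N[of x] that U(3) Nc by (auto simp: K.pi_one)
 have "x \<in> C" if x: "x \<in> N" for x
 proof -
  obtain k where k: "\<theta> ^ k * \<rho> x < r" using theta_pow_small[OF U(1)] by blast
  have "ap (int k) x \<in> U" using U(5) invsub_ap[OF N(1) x, of "int k"] k rho_ap[OF Nc[OF x], of "int k"] by simp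
  then have "ap (- int k) (ap (int k) x) \<in> C" by (intro invsub_ap[OF C(1)] UC)
  then show ?thesis using Nc[OF x] by simp
 qed
 then have "C = N" using C(2) by blast
 then show ?thesis using C(4) by simp
qed

end

section \<open>Extending characters to equivariant cocycles\<close>

lemma finite_powi_band:
 fixes t u lo hi :: real
 assumes "0 < u" "0 < t" "t < 1" "0 < lo" "0 < hi"
 shows "finite {k::int. lo < t powi (- k) * u \<and> t powi (- k) * u < hi}"
proof (rule finite_subset)
 define s p r where "s = log t u" and "p = log t lo" and "r = log t hi"
 show "{k::int. lo < t powi (- k) * u \<and> t powi (- k) * u < hi} \<subseteq> {\<lfloor>s - p\<rfloor>..\<lceil>s - r\<rceil>}"
 proof
  fix k :: int assume k: "k \<in> {k. lo < t powi (- k) * u \<and> t powi (- k) * u < hi}"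
  have u: "u = t powr s" "lo = t powr p" "hi = t powr r" using assms by (simp_all add: s_def p_def r_def)
  have "t powi (- k) = t powr of_int (- k)" using assms by (simp add: powr_real_of_int'[symmetric])
  then have "t powi (- k) * u = t powr (of_int (- k) + s)" by (simp only: u(1) powr_add)
  then have "t powr p < t powr (of_int (- k) + s)" "t powr (of_int (- k) + s) < t powr r" using k u by auto
  then have "of_int (- k) + s < p" "r < of_int (- k) + s" using assms
   by (metis linorder_not_le powr_mono' less_eq_real_def)+
  then show "k \<in> {\<lfloor>s - p\<rfloor>..\<lceil>s - r\<rceil>}" by (simp; linarith)
 qed
qed simp

context homogeneous_group
begin

text \<open>The neighbourhood filter of \<one>. Continuity of h at x becomes convergence of h (x
  \<otimes> z) to h x along \<open>nb\<close>, so the limit calculus applies.\<close>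

definition nb :: "'a filter" where "nb = inf (filtercomap \<rho> (nhds 0)) (principal (\<G>))"

lemma eventually_nb: "eventually P nb \<longleftrightarrow> (\<exists>d>0. \<forall>z\<in>\<G>. \<rho> z < d --> P z)"
proof
 assume "eventually P nb"
 then obtain Q d where "0 < d" "\<forall>y. dist y 0 < d --> Q y" "\<forall>x. Q (\<rho> x) --> x \<in> \<G> --> P x"
  unfolding nb_def eventually_inf_principal eventually_filtercomap eventually_nhds_metric by blast
 then show "\<exists>d>0. \<forall>z\<in>\<G>. \<rho> z < d --> P z" using rho_nonneg by (intro exI[of _ d]) (auto simp: dist_real_def)
next
 assume "\<exists>d>0. \<forall>z\<in>\<G>. \<rho> z < d --> P z"
 then obtain d where d: "0 < d" "\<forall>z\<in>\<G>. \<rho> z < d --> P z" by blast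
 have "\<exists>e>0. \<forall>y. dist y 0 < e --> y < d" using d(1) by (intro exI[of _ d]) (auto simp: dist_real_def)
 then show "eventually P nb"
  unfolding nb_def eventually_inf_principal eventually_filtercomap eventually_nhds_metric
  using d(2) by (intro exI[of _ "\<lambda>t. t < d"]) auto
qed

lemma tendsto_nb: "(g \<longlongrightarrow> L) nb \<longleftrightarrow> (\<forall>e>0. \<exists>d>0. \<forall>z\<in>\<G>. \<rho> z < d --> \<bar>g z - L\<bar> < e)" for L :: real
 by (simp only: tendsto_iff eventually_nb dist_real_def)

lemma tendsto_nb_ap: "(g \<longlongrightarrow> L) nb ==> ((\<lambda>z. g (ap k z)) \<longlongrightarrow> L) nb" for L :: real
proof -
 assume g: "(g \<longlongrightarrow> L) nb"
 have p: "0 < \<theta> powi k" using theta by simp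
 show ?thesis unfolding tendsto_nb
 proof (intro allI impI)
  fix e :: real assume "0 < e"
  then obtain d where d: "0 < d" "\<forall>z\<in>\<G>. \<rho> z < d --> \<bar>g z - L\<bar> < e" using g unfolding tendsto_nb by blast
  show "\<exists>d>0. \<forall>z\<in>\<G>. \<rho> z < d --> \<bar>g (ap k z) - L\<bar> < e"
  proof (intro exI[of _ "d / \<theta> powi k"] conjI ballI impI)
   show "0 < d / \<theta> powi k" using d p by simp
   fix z assume z: "z \<in> \<G>" "\<rho> z < d / \<theta> powi k"
   have "\<rho> (ap k z) < d" unfolding rho_ap[OF z(1)] using z(2) p by (simp add: pos_less_divide_eq mult.commute)
   then show "\<bar>g (ap k z) - L\<bar> < e" using d(2) z(1) by simp
  qed
 qed
qed

end

text \<open>The \<xi> i are coordinates of A modulo its common kernel. \<open>xi_ap\<close> says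
  that powers of \<alpha> act on them by the matrices \<xi> i (ap k (e l)). The aim is a continuous
  b from G to R^n with b (x \<otimes> a) = b x + \<xi> a for a in A, transformed by the same
  matrices.\<close>

locale vector_extension = homogeneous_group G \<alpha> \<rho> \<theta>
 for G (structure) and \<alpha> :: "'a => 'a" and \<rho> \<theta> +
 fixes A :: "'a set" and n :: nat and \<xi> :: "nat => 'a => real" and e :: "nat => 'a"
 assumes A_invsub: "invsub A" and A_normal: "A \<lhd> G"
  and xi_add: "!!i a b. i < n ==> a \<in> A ==> b \<in> A ==> \<xi> i (a \<otimes> b) = \<xi> i a + \<xi> i b"
  and xi_bdd: "!!i R. i < n ==> \<exists>L. \<forall>a\<in>A. \<rho> a \<le> R --> \<bar>\<xi> i a\<bar> \<le> L"
  and xi_small: "!!i c. i < n ==> 0 < c ==> \<exists>d>0. \<forall>a\<in>A. \<rho> a < d --> \<bar>\<xi> i a\<bar> < c"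
  and xi_ap: "!!i k a. i < n ==> a \<in> A ==> \<xi> i (ap k a) = (\<Sum>l<n. \<xi> l a * \<xi> i (ap k (e l)))"
  and e_mem: "!!i. i < n ==> e i \<in> A"
begin

lemmas A_sub = invsub_subgroup[OF A_invsub]
lemmas A_carr [simp] = invsub_mem[OF A_invsub]
lemmas A_mult [simp] = subgroup.m_closed[OF A_sub]
lemmas A_inv [simp] = subgroup.m_inv_closed[OF A_sub]
lemmas A_one [simp] = subgroup.one_closed[OF A_sub]
lemmas A_ap [simp] = invsub_ap[OF A_invsub]

lemma A_conj: "g \<in> \<G> ==> a \<in> A ==> g \<otimes> a \<otimes> inv g \<in> A" "g \<in> \<G> ==> a \<in> A ==> inv g \<otimes> a \<otimes> g \<in> A"
 using normal.inv_op_closed2[OF A_normal] normal.inv_op_closed1[OF A_normal] by auto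

lemma xi_one: "i < n ==> \<xi> i \<one> = 0"
 using xi_add[of i \<one> \<one>] by simp

lemma xi_inv: "i < n ==> a \<in> A ==> \<xi> i (inv a) = - \<xi> i a"
 using xi_add[of i a "inv a"] xi_one[of i] by simp

text \<open>A positive function with F (x \<otimes> c) = exp (\<xi> c) * F x, so that its logarithm
  has the required shift property. The cutoff at 2 keeps the supremum finite and makes F positive
  exactly where its logarithm is used, at distance less than 2 from A.\<close>

definition F :: "nat => 'a => real" where
 "F i x = (SUP a\<in>A. max 0 (2 - \<rho> (x \<otimes> a)) * exp (- \<xi> i a))"

lemma F_bdd:
 assumes i: "i < n" and x: "x \<in> \<G>"
 shows "bdd_above ((\<lambda>a. max 0 (2 - \<rho> (x \<otimes> a)) * exp (- \<xi> i a)) ` A)"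
proof -
 obtain L where L: "!!a. a \<in> A ==> \<rho> a \<le> \<rho> x + 2 ==> \<bar>\<xi> i a\<bar> \<le> L" using xi_bdd[OF i] by blast
 show ?thesis
 proof (rule bdd_aboveI2)
  fix a assume a: "a \<in> A"
  show "max 0 (2 - \<rho> (x \<otimes> a)) * exp (- \<xi> i a) \<le> 2 * exp L"
  proof (cases "\<rho> a \<le> \<rho> x + 2")
   case True
   then have "exp (- \<xi> i a) \<le> exp L" using L[OF a] by (simp add: abs_le_iff)
   moreover have "max 0 (2 - \<rho> (x \<otimes> a)) \<le> 2" using rho_nonneg[of "x \<otimes> a"] x a by simp
   ultimately show ?thesis by (intro mult_mono) auto
  next
   case False
   then have "max 0 (2 - \<rho> (x \<otimes> a)) = 0" using rho_mult_inv1[of x "x \<otimes> a"] x a by simp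
   then show ?thesis by simp
  qed
 qed
qed

lemma F_ge: "i < n ==> x \<in> \<G> ==> a \<in> A ==> max 0 (2 - \<rho> (x \<otimes> a)) * exp (- \<xi> i a) \<le> F i x"
 unfolding F_def by (intro cSUP_upper F_bdd)

lemma F_least: "(!!a. a \<in> A ==> max 0 (2 - \<rho> (x \<otimes> a)) * exp (- \<xi> i a) \<le> c) ==> F i x \<le> c"
 unfolding F_def by (intro cSUP_least) (use A_one in blast)+

lemma ddr: "x \<in> \<G> ==> a \<in> A ==> dd A (x \<otimes> a) = dd A x"
proof -
 assume x: "x \<in> \<G>" and a: "a \<in> A"
 have "x \<otimes> a = (x \<otimes> a \<otimes> inv x) \<otimes> x" using x a by (simp add: m_assoc)
 then show ?thesis using dd_left[OF A_sub x A_conj(1)[OF x a]] by simp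
qed

lemma dd_lipschitz:
 assumes "x \<in> \<G>" "z \<in> \<G>"
 shows "\<bar>dd A (x \<otimes> z) - dd A x\<bar> \<le> \<rho> z"
proof -
 have "dd A (x \<otimes> z) \<le> dd A x + \<rho> z"
  using dd_mult[OF A_normal assms] dd_le_rho[OF A_sub assms(2)] by simp
 moreover have "dd A x \<le> dd A (x \<otimes> z) + \<rho> z"
  using dd_mult[OF A_normal, of "x \<otimes> z" "inv z"] dd_le_rho[OF A_sub, of "inv z"] assms by (simp add: m_assoc rho_inv)
 ultimately show ?thesis by simp
qed

lemma dd_cont: "x \<in> \<G> ==> ((\<lambda>z. dd A (x \<otimes> z)) \<longlongrightarrow> dd A x) nb"
 unfolding tendsto_nb using dd_lipschitz by (meson le_less_trans)

lemma coset_rep: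
 assumes x: "x \<in> \<G>" and d: "dd A x < r"
 obtains a where "a \<in> A" "\<rho> (x \<otimes> a) < r"
proof -
 obtain m where m: "m \<in> A" "\<rho> (m \<otimes> x) < r" using dd_approx[OF A_sub x d] by blast
 have "x \<otimes> (inv x \<otimes> m \<otimes> x) = m \<otimes> x" using x m by (simp add: m_assoc)
 then show thesis using that[of "inv x \<otimes> m \<otimes> x"] m A_conj(2)[OF x] by simp
qed

lemma F_pos:
 assumes i: "i < n" and x: "x \<in> \<G>" "dd A x < 2"
 shows "0 < F i x"
proof -
 obtain a where a: "a \<in> A" "\<rho> (x \<otimes> a) < 2" using coset_rep[OF x] .
 then have "0 < max 0 (2 - \<rho> (x \<otimes> a)) * exp (- \<xi> i a)" by simp
 also have "\<dots> \<le> F i x" by (rule F_ge[OF i x(1) a(1)])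
 finally show ?thesis .
qed

lemma F_shift:
 assumes i: "i < n" and x: "x \<in> \<G>" and c: "c \<in> A"
 shows "F i (x \<otimes> c) = exp (\<xi> i c) * F i x"
proof -
 have le: "F i (x \<otimes> c) \<le> exp (\<xi> i c) * F i x" if x: "x \<in> \<G>" and c: "c \<in> A" for x c
 proof (rule F_least)
  fix a assume a: "a \<in> A"
  have ex: "exp (- \<xi> i a) = exp (\<xi> i c) * exp (- \<xi> i (c \<otimes> a))"
   by (simp add: xi_add[OF i c a] exp_add[symmetric])
  have "max 0 (2 - \<rho> (x \<otimes> c \<otimes> a)) * exp (- \<xi> i a) = exp (\<xi> i c) * (max 0 (2 - \<rho> (x \<otimes> (c \<otimes> a))) * exp (- \<xi> i (c \<otimes> a)))"
   unfolding ex using x c a by (simp add: m_assoc)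
  also have "\<dots> \<le> exp (\<xi> i c) * F i x" using F_ge[OF i x A_mult[OF c a]] by (intro mult_left_mono) auto
  finally show "max 0 (2 - \<rho> (x \<otimes> c \<otimes> a)) * exp (- \<xi> i a) \<le> exp (\<xi> i c) * F i x" .
 qed
 have "F i (x \<otimes> c \<otimes> inv c) \<le> exp (\<xi> i (inv c)) * F i (x \<otimes> c)" using x c by (intro le) auto
 then have "exp (\<xi> i c) * F i x \<le> exp (\<xi> i c) * (exp (- \<xi> i c) * F i (x \<otimes> c))"
  using x c by (simp add: m_assoc xi_inv[OF i])
 also have "\<dots> = F i (x \<otimes> c)" by (simp add: exp_minus)
 finally show ?thesis using le[OF x c] by simp
qed

text \<open>Only boundedly many sizes of a matter, since the cutoff kills the others. On bounded a
  the weights are bounded, and the displacement z is conjugated by a uniformly.\<close>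

lemma F_cont:
 assumes i: "i < n" and x: "x \<in> \<G>"
 shows "((\<lambda>z. F i (x \<otimes> z)) \<longlongrightarrow> F i x) nb"
 unfolding tendsto_nb
proof (intro allI impI)
 fix \<epsilon> :: real assume \<epsilon>: "0 < \<epsilon>"
 \<comment> \<open>The 3 is the cutoff radius 2 plus the bound 1 on z: beyond R the cutoffs at x and
   at x \<otimes> z both vanish.\<close>
 define R where "R = \<rho> x + 3"
 obtain L where L: "!!a. a \<in> A ==> \<rho> a \<le> R ==> \<bar>\<xi> i a\<bar> \<le> L" using xi_bdd[OF i] by blast
 define \<eta> where "\<eta> = \<epsilon> / (2 * exp L)"
 have \<eta>: "0 < \<eta>" "\<eta> * exp L = \<epsilon> / 2" using \<epsilon> by (auto simp: \<eta>_def)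
 obtain d where d: "0 < d" "!!a z. a \<in> \<G> ==> z \<in> \<G> ==> \<rho> a \<le> R ==> \<rho> z < d ==> \<rho> (a \<otimes> z \<otimes> inv a) < \<eta> \<and> \<rho> (inv a \<otimes> z \<otimes> a) < \<eta>"
  using rho_conj_uniform'[OF \<eta>(1)] by blast
 show "\<exists>d>0. \<forall>z\<in>\<G>. \<rho> z < d --> \<bar>F i (x \<otimes> z) - F i x\<bar> < \<epsilon>"
 proof (intro exI[of _ "min d 1"] conjI ballI impI)
  show "0 < min d 1" using d by simp
  fix z assume z: "z \<in> \<G>" "\<rho> z < min d 1"
  have t: "\<bar>max 0 (2 - \<rho> (x \<otimes> z \<otimes> a)) * exp (- \<xi> i a) - max 0 (2 - \<rho> (x \<otimes> a)) * exp (- \<xi> i a)\<bar> \<le> \<epsilon> / 2" if a: "a \<in> A" for a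
  proof (cases "\<rho> a \<le> R")
   case True
   have ac: "a \<in> \<G>" using a by simp
   have "\<bar>\<rho> (x \<otimes> z \<otimes> a) - \<rho> (x \<otimes> a)\<bar> \<le> dst (x \<otimes> z \<otimes> a) (x \<otimes> a)" using x z ac by (intro rho_lipschitz) auto
   also have "inv (x \<otimes> z \<otimes> a) \<otimes> (x \<otimes> a) = inv a \<otimes> inv z \<otimes> a" using x z ac by (simp add: gsimps)
   also have "\<rho> \<dots> < \<eta>" using d(2)[of a "inv z"] ac z True by (simp add: rho_inv)
   finally have "\<bar>max 0 (2 - \<rho> (x \<otimes> z \<otimes> a)) - max 0 (2 - \<rho> (x \<otimes> a))\<bar> \<le> \<eta>" by linarith
   moreover have "exp (- \<xi> i a) \<le> exp L" using L[OF a True] by (simp add: abs_le_iff)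
   ultimately have "\<bar>max 0 (2 - \<rho> (x \<otimes> z \<otimes> a)) - max 0 (2 - \<rho> (x \<otimes> a))\<bar> * exp (- \<xi> i a) \<le> \<eta> * exp L"
    using \<eta> by (intro mult_mono) auto
   then show ?thesis unfolding left_diff_distrib[symmetric] abs_mult using \<eta> by simp
  next
   case False
   have ac: "a \<in> \<G>" using a by simp
   have "\<rho> a \<le> \<rho> x + \<rho> (x \<otimes> a)" using rho_mult_inv1[of x "x \<otimes> a"] x ac by simp
   moreover have "\<rho> a \<le> \<rho> (x \<otimes> z) + \<rho> (x \<otimes> z \<otimes> a)" using rho_mult_inv1[of "x \<otimes> z" "x \<otimes> z \<otimes> a"] x z ac by simp
   moreover have "\<rho> (x \<otimes> z) \<le> \<rho> x + \<rho> z" using x z by (intro rho_mult) auto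
   ultimately have "max 0 (2 - \<rho> (x \<otimes> z \<otimes> a)) = 0" "max 0 (2 - \<rho> (x \<otimes> a)) = 0" using False z by (auto simp: R_def)
   then show ?thesis using \<epsilon> by simp
  qed
  have "F i (x \<otimes> z) \<le> F i x + \<epsilon> / 2"
  proof (rule F_least)
   fix a assume a: "a \<in> A"
   show "max 0 (2 - \<rho> (x \<otimes> z \<otimes> a)) * exp (- \<xi> i a) \<le> F i x + \<epsilon> / 2" using t[OF a] F_ge[OF i x a] by linarith
  qed
  moreover have "F i x \<le> F i (x \<otimes> z) + \<epsilon> / 2"
  proof (rule F_least)
   fix a assume a: "a \<in> A"
   have "x \<otimes> z \<in> \<G>" using x z by simp
   from F_ge[OF i this a] show "max 0 (2 - \<rho> (x \<otimes> a)) * exp (- \<xi> i a) \<le> F i (x \<otimes> z) + \<epsilon> / 2" using t[OF a] by linarith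
  qed
  ultimately show "\<bar>F i (x \<otimes> z) - F i x\<bar> < \<epsilon>" using \<epsilon> by linarith
 qed
qed

text \<open>A continuous solution of \<open>b (x \<otimes> c) = b x + \<xi> c\<close> near \<open>A\<close>, not yet equivariant.\<close>
definition b0 :: "nat => 'a => real" where "b0 i x = ln (F i x)"

lemma b0_shift: "i < n ==> x \<in> \<G> ==> dd A x < 2 ==> c \<in> A ==> b0 i (x \<otimes> c) = b0 i x + \<xi> i c"
 using F_pos[of i x] by (simp add: b0_def F_shift ln_mult)

lemma b0_cont: "i < n ==> x \<in> \<G> ==> dd A x < 2 ==> ((\<lambda>z. b0 i (x \<otimes> z)) \<longlongrightarrow> b0 i x) nb"
 unfolding b0_def using F_pos[of i x] by (intro tendsto_ln F_cont) auto

text \<open>A bump in the distance to A, positive exactly when the distance of the rescaled point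
  lies strictly between \<theta> and 3/2. This contains the fundamental domain from \<theta> to 1,
  so some weight is positive off A, and stays below 2, where \<open>b0\<close> is defined.\<close>

definition W :: "int => 'a => real" where
 "W k x = max 0 ((dd A (ap (- k) x) - \<theta>) * (3 / 2 - dd A (ap (- k) x)))"

text \<open>The k-th conjugate of \<open>b0\<close>: evaluate at ap (- k) x, then apply the matrix
  of ap k.\<close>

definition T :: "nat => int => 'a => real" where
 "T i k x = (\<Sum>l<n. b0 l (ap (- k) x) * \<xi> i (ap k (e l)))"

text \<open>Averaging the conjugates of \<open>b0\<close> under the powers of \<open>\<alpha>\<close> makes it equivariant.\<close>
definition bb :: "nat => 'a => real" where
 "bb i x = (if x \<in> A then \<xi> i x else (\<Sum>k | W k x \<noteq> 0. W k x * T i k x) / (\<Sum>k | W k x \<noteq> 0. W k x))"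

lemma W_nonneg: "0 \<le> W k x"
 by (simp add: W_def)

lemma W_supp: "W k x \<noteq> 0 ==> \<theta> < dd A (ap (- k) x) \<and> dd A (ap (- k) x) < 3 / 2"
proof -
 assume W: "W k x \<noteq> 0"
 have "max 0 y \<noteq> 0 ==> 0 < y" for y :: real by auto
 from this[OF W[unfolded W_def]] have "0 < (dd A (ap (- k) x) - \<theta>) * (3 / 2 - dd A (ap (- k) x))" .
 then show ?thesis using theta unfolding zero_less_mult_iff by auto
qed

lemma dd_off: "x \<in> \<G> ==> x \<notin> A ==> 0 < dd A x"
 using dd_zero_iff[OF A_invsub, of x] dd_nonneg[OF A_sub, of x] by force

lemma ap_mem_iff: "x \<in> \<G> ==> ap k x \<in> A \<longleftrightarrow> x \<in> A"
 using A_ap[of "ap k x" "- k"] A_ap[of x k] by (auto simp: ap_cancel)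

lemma mult_mem_iff: "x \<in> \<G> ==> a \<in> A ==> x \<otimes> a \<in> A \<longleftrightarrow> x \<in> A"
 using A_mult[of "x \<otimes> a" "inv a"] A_mult[of x a] by (auto simp: m_assoc)

lemma ex_W:
 assumes x: "x \<in> \<G>" "x \<notin> A"
 shows "\<exists>k. 0 < W k x"
proof -
 obtain k where k: "\<theta> < \<theta> powi k * dd A x" "\<theta> powi k * dd A x \<le> 1"
  using scale_into_interval[OF dd_off[OF x] theta] by blast
 then have "0 < W (- k) x" unfolding W_def minus_minus dd_ap[OF A_invsub x(1)] by (simp add: less_max_iff_disj)
 then show ?thesis by blast
qed

text \<open>Any finite index set containing the support may be used, so that one set can serve a
  whole neighbourhood or a shifted range.\<close>

lemma bb_eq:
 assumes x: "x \<in> \<G>" "x \<notin> A" and J: "finite J" "!!k. W k x \<noteq> 0 ==> k \<in> J"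
 shows "bb i x = (\<Sum>k\<in>J. W k x * T i k x) / (\<Sum>k\<in>J. W k x)" "0 < (\<Sum>k\<in>J. W k x)"
proof -
 have "(\<Sum>k | W k x \<noteq> 0. W k x * T i k x) = (\<Sum>k\<in>J. W k x * T i k x)"
  "(\<Sum>k | W k x \<noteq> 0. W k x) = (\<Sum>k\<in>J. W k x)" using J by (auto intro!: sum.mono_neutral_left)
 then show "bb i x = (\<Sum>k\<in>J. W k x * T i k x) / (\<Sum>k\<in>J. W k x)" using x by (simp add: bb_def)
 obtain k where k: "0 < W k x" using ex_W[OF x] by blast
 then have "k \<in> J" using J(2) by force
 then show "0 < (\<Sum>k\<in>J. W k x)" using k J(1) W_nonneg by (intro sum_pos2[of J k]) auto
qed

lemma finite_W:
 assumes x: "x \<in> \<G>" "x \<notin> A"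
 shows "finite {k. W k x \<noteq> 0}"
proof (rule finite_subset[OF _ finite_powi_band[OF dd_off[OF x] theta theta(1), of "3 / 2"]])
 show "{k. W k x \<noteq> 0} \<subseteq> {k. \<theta> < \<theta> powi - k * dd A x \<and> \<theta> powi - k * dd A x < 3 / 2}"
  using W_supp[of _ x] by (auto simp: dd_ap[OF A_invsub x(1)])
qed simp

text \<open>The weights are constant on cosets of A, and each conjugate with positive weight shifts
  by \<xi> i of ap k (ap (- k) a), which is \<xi> i a. A weighted mean of the conjugates shifts by
  the same amount.\<close>

lemma bb_shift:
 assumes i: "i < n" and x: "x \<in> \<G>" and a: "a \<in> A"
 shows "bb i (x \<otimes> a) = bb i x + \<xi> i a"
proof (cases "x \<in> A")
 case True
 then show ?thesis using a by (simp add: bb_def xi_add[OF i])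
next
 case False
 let ?J = "{k. W k x \<noteq> 0}"
 have ac: "a \<in> \<G>" using a by simp
 have W: "W k (x \<otimes> a) = W k x" for k using x a by (simp add: W_def ap_mult ddr)
 have T: "T i k (x \<otimes> a) = T i k x + \<xi> i a" if k: "k \<in> ?J" for k
 proof -
  have d: "dd A (ap (- k) x) < 2" using W_supp[of k x] k by simp
  have "T i k (x \<otimes> a) = (\<Sum>l<n. b0 l (ap (- k) x) * \<xi> i (ap k (e l)) + \<xi> l (ap (- k) a) * \<xi> i (ap k (e l)))"
   unfolding T_def ap_mult[OF x ac]
  proof (rule sum.cong[OF refl])
   fix l assume "l \<in> {..<n}"
   then have "l < n" by simp
   from b0_shift[OF this _ d] show "b0 l (ap (- k) x \<otimes> ap (- k) a) * \<xi> i (ap k (e l)) =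
    b0 l (ap (- k) x) * \<xi> i (ap k (e l)) + \<xi> l (ap (- k) a) * \<xi> i (ap k (e l))" using x a by (simp add: algebra_simps)
  qed
  also have "\<dots> = T i k x + \<xi> i (ap k (ap (- k) a))"
   unfolding T_def sum.distrib using xi_ap[OF i, of "ap (- k) a" k] a by simp
  finally show ?thesis using ac by simp
 qed
 note f = finite_W[OF x False]
 have xa: "x \<otimes> a \<in> \<G>" "x \<otimes> a \<notin> A" using x a False mult_mem_iff[OF x a] by auto
 note b1 = bb_eq[OF x False f] and b2 = bb_eq[OF xa f, unfolded W]
 have "(\<Sum>k\<in>?J. W k x * T i k (x \<otimes> a)) = (\<Sum>k\<in>?J. W k x * T i k x) + (\<Sum>k\<in>?J. W k x) * \<xi> i a"
  unfolding sum_distrib_right sum.distrib[symmetric] by (rule sum.cong[OF refl]) (simp add: T algebra_simps)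
 then have "bb i (x \<otimes> a) = ((\<Sum>k\<in>?J. W k x * T i k x) + (\<Sum>k\<in>?J. W k x) * \<xi> i a) / (\<Sum>k\<in>?J. W k x)"
  using b2(1)[of i] by simp
 also have "\<dots> = bb i x + \<xi> i a" using b1(1)[of i] b1(2) by (simp add: add_divide_distrib)
 finally show ?thesis .
qed

text \<open>Applying ap j moves the k-th weight to index k + j, and the matrix of ap (k + j) is a
  product; the average is reindexed.\<close>

lemma bb_ap:
 assumes i: "i < n" and x: "x \<in> \<G>"
 shows "bb i (ap j x) = (\<Sum>m<n. bb m x * \<xi> i (ap j (e m)))"
proof (cases "x \<in> A")
 case True
 then show ?thesis using xi_ap[OF i True] by (simp add: bb_def)
next
 case False
 let ?J = "{k. W k x \<noteq> 0}"
 have ax: "ap j x \<in> \<G>" "ap j x \<notin> A" using x False ap_mem_iff[OF x] by auto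
 note f = finite_W[OF x False]
 have aa: "ap (- (k + j)) (ap j x) = ap (- k) x" for k using x by (simp add: ap_add[symmetric])
 have W: "W (k + j) (ap j x) = W k x" for k by (simp only: W_def aa)
 have T: "T i (k + j) (ap j x) = (\<Sum>m<n. T m k x * \<xi> i (ap j (e m)))" for k
 proof -
  have "T i (k + j) (ap j x) = (\<Sum>l<n. b0 l (ap (- k) x) * (\<Sum>m<n. \<xi> m (ap k (e l)) * \<xi> i (ap j (e m))))"
   unfolding T_def aa
  proof (rule sum.cong[OF refl])
   fix l assume "l \<in> {..<n}"
   then have el: "e l \<in> A" using e_mem by simp
   have "ap (k + j) (e l) = ap j (ap k (e l))" using el by (simp add: ap_add[symmetric] add.commute)
   then show "b0 l (ap (- k) x) * \<xi> i (ap (k + j) (e l)) = b0 l (ap (- k) x) * (\<Sum>m<n. \<xi> m (ap k (e l)) * \<xi> i (ap j (e m)))"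
    using xi_ap[OF i, of "ap k (e l)" j] el by simp
  qed
  also have "\<dots> = (\<Sum>m<n. T m k x * \<xi> i (ap j (e m)))"
   unfolding T_def sum_distrib_left sum_distrib_right by (subst sum.swap) (simp add: algebra_simps)
  finally show ?thesis .
 qed
 have J': "k \<in> (\<lambda>k. k + j) ` ?J" if "W k (ap j x) \<noteq> 0" for k
  using that W[of "k - j"] by (intro image_eqI[of _ _ "k - j"]) auto
 have inj: "inj_on (\<lambda>k. k + j) ?J" by (simp add: inj_on_def)
 note b1 = bb_eq[OF x False f] and b2 = bb_eq[OF ax finite_imageI[OF f] J', unfolded sum.reindex[OF inj] o_def W T]
 have "bb i (ap j x) = (\<Sum>k\<in>?J. W k x * (\<Sum>m<n. T m k x * \<xi> i (ap j (e m)))) / (\<Sum>k\<in>?J. W k x)"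
  using b2(1)[of i] by (simp add: T)
 also have "(\<Sum>k\<in>?J. W k x * (\<Sum>m<n. T m k x * \<xi> i (ap j (e m)))) = (\<Sum>m<n. (\<Sum>k\<in>?J. W k x * T m k x) * \<xi> i (ap j (e m)))"
  unfolding sum_distrib_left sum_distrib_right by (subst sum.swap) (simp add: algebra_simps)
 also have "\<dots> / (\<Sum>k\<in>?J. W k x) = (\<Sum>m<n. bb m x * \<xi> i (ap j (e m)))"
  unfolding sum_divide_distrib using b1(1) by simp
 finally show ?thesis .
qed

lemma ap_cont:
 fixes L :: real
 assumes "x \<in> \<G>" and "((\<lambda>z. g (ap k x \<otimes> z)) \<longlongrightarrow> L) nb"
 shows "((\<lambda>z. g (ap k (x \<otimes> z))) \<longlongrightarrow> L) nb"
proof (rule Lim_transform_eventually[OF tendsto_nb_ap[OF assms(2), of k]])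
 show "eventually (\<lambda>z. g (ap k x \<otimes> ap k z) = g (ap k (x \<otimes> z))) nb"
  unfolding eventually_nb using assms(1) by (intro exI[of _ 1]) (simp add: ap_mult)
qed

lemma W_cont: "x \<in> \<G> ==> ((\<lambda>z. W k (x \<otimes> z)) \<longlongrightarrow> W k x) nb"
 unfolding W_def by (intro tendsto_intros ap_cont dd_cont) auto

lemma WT_cont:
 assumes i: "i < n" and x: "x \<in> \<G>"
 shows "((\<lambda>z. W k (x \<otimes> z) * T i k (x \<otimes> z)) \<longlongrightarrow> W k x * T i k x) nb"
proof (cases "dd A (ap (- k) x) < 2")
 case True
 then show ?thesis unfolding T_def using x by (intro tendsto_intros W_cont ap_cont b0_cont) auto
next
 case False
 have "((\<lambda>z. dd A (ap (- k) (x \<otimes> z))) \<longlongrightarrow> dd A (ap (- k) x)) nb" using x by (intro ap_cont dd_cont) auto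
 then have "eventually (\<lambda>z. 3 / 2 < dd A (ap (- k) (x \<otimes> z))) nb" by (rule order_tendstoD) (use False in simp)
 moreover have z: "W k x = 0" using W_supp[of k x] False by force
 ultimately have "eventually (\<lambda>z. W k (x \<otimes> z) * T i k (x \<otimes> z) = W k x * T i k x) nb"
  by (elim eventually_mono) (use W_supp in force)
 then show ?thesis by (rule tendsto_eventually)
qed

lemma bb_cont_off:
 assumes i: "i < n" and x: "x \<in> \<G>" "x \<notin> A"
 shows "((\<lambda>z. bb i (x \<otimes> z)) \<longlongrightarrow> bb i x) nb"
proof -
 define u where "u = dd A x"
 have u: "0 < u" using dd_off[OF x] by (simp add: u_def)
 \<comment> \<open>Off A the distance varies by less than a factor 2 near x, so the band between
   \<theta> and 3/2 is widened to one between \<theta> / 2 and 4. Its finitely many indices serve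
   all nearby points.\<close>
 define J where "J = {k. \<theta> / 2 < \<theta> powi (- k) * u \<and> \<theta> powi (- k) * u < 4}"
 have J: "finite J" unfolding J_def using theta u by (intro finite_powi_band) auto
 have Jin: "k \<in> J" if y: "y \<in> \<G>" "u / 2 < dd A y" "dd A y < 2 * u" and k: "W k y \<noteq> 0" for y k
 proof -
  have "\<theta> < \<theta> powi (- k) * dd A y" "\<theta> powi (- k) * dd A y < 3 / 2" using W_supp[OF k] unfolding dd_ap[OF A_invsub y(1)] by auto
  moreover have "\<theta> powi (- k) * dd A y < \<theta> powi (- k) * (2 * u)" "\<theta> powi (- k) * (u / 2) < \<theta> powi (- k) * dd A y"
   using y theta by (auto intro!: mult_strict_left_mono)
  ultimately show ?thesis by (simp add: J_def)
 qed
 have "eventually (\<lambda>z. u / 2 < dd A (x \<otimes> z)) nb" "eventually (\<lambda>z. dd A (x \<otimes> z) < 2 * u) nb"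
  by (rule order_tendstoD[OF dd_cont[OF x(1)]]; use u in \<open>simp add: u_def\<close>)+
 moreover have "eventually (\<lambda>z. z \<in> \<G>) nb" unfolding eventually_nb by (intro exI[of _ 1]) simp
 ultimately have ev: "eventually (\<lambda>z. (\<Sum>k\<in>J. W k (x \<otimes> z) * T i k (x \<otimes> z)) / (\<Sum>k\<in>J. W k (x \<otimes> z)) = bb i (x \<otimes> z)) nb"
 proof eventually_elim
  case (elim z)
  have xz: "x \<otimes> z \<in> \<G>" using elim x by simp
  then have "x \<otimes> z \<notin> A" using dd_zero_iff[OF A_invsub xz] elim u by auto
  from bb_eq(1)[OF xz this J Jin[OF xz elim(1,2)]] show ?case by simp
 qed
 have e: "bb i x = (\<Sum>k\<in>J. W k x * T i k x) / (\<Sum>k\<in>J. W k x)" "0 < (\<Sum>k\<in>J. W k x)"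
  using bb_eq[OF x J Jin[OF x(1)]] u unfolding u_def by auto
 show ?thesis
 proof (rule Lim_transform_eventually[OF _ ev])
  show "((\<lambda>z. (\<Sum>k\<in>J. W k (x \<otimes> z) * T i k (x \<otimes> z)) / (\<Sum>k\<in>J. W k (x \<otimes> z))) \<longlongrightarrow> bb i x) nb"
   unfolding e(1) using e(2) x(1) i by (intro tendsto_divide tendsto_sum WT_cont W_cont) auto
 qed
qed

lemma bb_bounded:
 assumes i: "i < n"
 shows "\<exists>M. \<forall>s\<in>\<G>. \<rho> s \<le> 2 --> \<theta> \<le> dd A s --> \<bar>bb i s\<bar> \<le> M"
proof (rule ccontr)
 assume "\<not> ?thesis"
 then have "\<forall>m::nat. \<exists>s. s \<in> \<G> \<and> \<rho> s \<le> 2 \<and> \<theta> \<le> dd A s \<and> real m < \<bar>bb i s\<bar>" by (meson linorder_not_le)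
 then obtain s where s: "!!m::nat. s m \<in> \<G>" "!!m. \<rho> (s m) \<le> 2" "!!m. \<theta> \<le> dd A (s m)" "!!m. real m < \<bar>bb i (s m)\<bar>" by metis
 obtain l r where l: "l \<in> \<G>" "strict_mono (r::nat=>nat)" "(\<lambda>m. dst l (s (r m))) \<longlonglongrightarrow> 0" using rho_compact[of s 2] s by blast
 have small: "eventually (\<lambda>m. dst l (s (r m)) < d) sequentially" if "0 < d" for d by (rule order_tendstoD(2)[OF l(3) that])
 have ls: "l \<otimes> (inv l \<otimes> s m) = s m" for m using l s by simp
 have "0 < dd A l"
 proof (rule ccontr)
  assume "\<not> 0 < dd A l"
  then have z: "dd A l = 0" using dd_nonneg[OF A_sub l(1)] by simp
  obtain m where "dst l (s (r m)) < \<theta>" using eventually_happens[OF small[OF theta(1)]] by auto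
  then show False using dd_lipschitz[OF l(1), of "inv l \<otimes> s (r m)"] s(1,3)[of "r m"] l(1) z by (simp add: ls)
 qed
 then have "l \<notin> A" using dd_zero_iff[OF A_invsub l(1)] by force
 from bb_cont_off[OF i l(1) this] obtain d where d: "0 < d" "!!z. z \<in> \<G> ==> \<rho> z < d ==> \<bar>bb i (l \<otimes> z) - bb i l\<bar> < 1"
  unfolding tendsto_nb using zero_less_one by blast
 obtain K :: nat where K: "\<bar>bb i l\<bar> + 1 < K" using reals_Archimedean2 by blast
 have "eventually (\<lambda>m. K \<le> m \<and> dst l (s (r m)) < d) sequentially"
  by (intro eventually_conj eventually_ge_at_top small d)
 then obtain m where m: "K \<le> m" "dst l (s (r m)) < d" using eventually_happens by force
 have "\<bar>bb i (s (r m)) - bb i l\<bar> < 1" using d(2)[OF _ m(2)] l(1) s(1) by (simp add: ls)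
 moreover have "K \<le> r m" using m(1) seq_suble[OF l(2), of m] by simp
 ultimately show False using s(4)[of "r m"] K by linarith
qed

text \<open>Averaging degenerates near A, so continuity at \<one> comes from equivariance. Off A,
  write z as ap j s times an element of A, with s in a bounded set at distance at least \<theta>
  from A. There \<open>bb\<close> is bounded, the matrix of ap j is small because the contracted e l
  are short, and the factor from A is short as well.\<close>

lemma bb_small:
 assumes i: "i < n" and \<epsilon>: "0 < \<epsilon>"
 shows "\<exists>\<delta>>0. \<forall>z\<in>\<G>. \<rho> z < \<delta> --> \<bar>bb i z\<bar> < \<epsilon>"
proof -
 have "\<forall>l. \<exists>M. l < n --> (\<forall>s\<in>\<G>. \<rho> s \<le> 2 --> \<theta> \<le> dd A s --> \<bar>bb l s\<bar> \<le> M)" using bb_bounded by blast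
 then obtain M' where M': "!!l s. l < n ==> s \<in> \<G> ==> \<rho> s \<le> 2 ==> \<theta> \<le> dd A s ==> \<bar>bb l s\<bar> \<le> M' l" by metis
 define M where "M = 1 + (\<Sum>l<n. \<bar>M' l\<bar>)"
 have M0: "0 < M" unfolding M_def by (intro add_pos_nonneg sum_nonneg) auto
 have M: "\<bar>bb l s\<bar> \<le> M" if "l < n" "s \<in> \<G>" "\<rho> s \<le> 2" "\<theta> \<le> dd A s" for l s
 proof -
  have "\<bar>M' l\<bar> \<le> (\<Sum>l<n. \<bar>M' l\<bar>)" using that(1) by (intro member_le_sum) auto
  then show ?thesis using M'[OF that] by (simp add: M_def)
 qed
 define E where "E = 1 + (\<Sum>l<n. \<rho> (e l))"
 have E0: "0 < E" unfolding E_def using e_mem by (intro add_pos_nonneg sum_nonneg rho_nonneg) auto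
 have E: "\<rho> (e l) \<le> E" if "l < n" for l
  using member_le_sum[of l "{..<n}" "\<lambda>l. \<rho> (e l)"] that e_mem rho_nonneg by (auto simp: E_def)
 define c where "c = \<epsilon> / (2 * (n * M + 1))"
 have nM: "0 < n * M + 1" using M0 by (simp add: add_nonneg_pos)
 have c: "0 < c" "n * (M * c) < \<epsilon> / 2" using \<epsilon> nM by (auto simp: c_def field_simps)
 obtain d where d: "0 < d" "!!a. a \<in> A ==> \<rho> a < d ==> \<bar>\<xi> i a\<bar> < c" using xi_small[OF i c(1)] by blast
 obtain d2 where d2: "0 < d2" "!!a. a \<in> A ==> \<rho> a < d2 ==> \<bar>\<xi> i a\<bar> < \<epsilon> / 2" using xi_small[OF i, of "\<epsilon> / 2"] \<epsilon> by auto
 \<comment> \<open>The first entry makes ap j (e l) shorter than d, since its norm is at most E *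
   \<rho> z / \<theta>. The second makes the factor from A, of norm below 4 * \<rho> z / \<theta>,
   shorter than d2.\<close>
 define \<delta> where "\<delta> = min (d * \<theta> / E) (d2 * \<theta> / 4)"
 have \<delta>: "0 < \<delta>" using d d2 theta E0 by (simp add: \<delta>_def)
 have "\<bar>bb i z\<bar> < \<epsilon>" if z: "z \<in> \<G>" "\<rho> z < \<delta>" for z
 proof (cases "z \<in> A")
  case True
  have "\<delta> \<le> d2 * \<theta> / 4" unfolding \<delta>_def by (rule min.cobounded2)
  also have "\<dots> \<le> d2" using d2(1) theta by (simp add: field_simps)
  finally show ?thesis using d2(2)[OF True] z True \<epsilon> by (simp add: bb_def)
 next
  case False
  obtain k where k: "\<theta> < \<theta> powi k * dd A z" "\<theta> powi k * dd A z \<le> 1"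
   using scale_into_interval[OF dd_off[OF z(1) False] theta] by blast
  define w where "w = ap k z"
  have w: "w \<in> \<G>" "\<theta> < dd A w" "dd A w \<le> 1" using z k by (auto simp: w_def dd_ap[OF A_invsub])
  obtain a where a: "a \<in> A" "\<rho> (w \<otimes> a) < 2" using coset_rep[OF w(1), of 2] w(3) by auto
  define s where "s = w \<otimes> a"
  define j where "j = - k"
  have ac: "a \<in> \<G>" using a by simp
  have s: "s \<in> \<G>" "\<rho> s \<le> 2" "\<theta> \<le> dd A s" using w a ac ddr[OF w(1) a(1)] by (auto simp: s_def)
  have p: "0 < \<theta> powi j" using theta by simp
  have "\<theta> powi k = 1 / \<theta> powi j" unfolding j_def by (simp add: power_int_minus field_simps)
  then have "\<theta> * \<theta> powi j < dd A z" using k(1) p by (simp add: field_simps)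
  also have "\<dots> \<le> \<rho> z" by (rule dd_le_rho[OF A_sub z(1)])
  finally have jz: "\<theta> powi j < \<rho> z / \<theta>" using theta by (simp add: field_simps)
  have zz: "z = ap j s \<otimes> ap j (inv a)"
  proof -
   have "ap j s \<otimes> ap j (inv a) = ap j (s \<otimes> inv a)" using s ac by (simp add: ap_mult)
   also have "s \<otimes> inv a = w" using w ac by (simp add: s_def m_assoc)
   finally show ?thesis using z by (simp add: w_def j_def)
  qed
  have sj: "ap j s \<in> \<G>" "ap j (inv a) \<in> A" using s a by auto
  have "\<bar>\<xi> i (ap j (e l))\<bar> \<le> c" if l: "l < n" for l
  proof -
   have "\<rho> (ap j (e l)) = \<theta> powi j * \<rho> (e l)" using e_mem[OF l] by (intro rho_ap) simp
   also have "\<dots> \<le> \<rho> z / \<theta> * E" using jz E[OF l] p rho_nonneg[of "e l"] e_mem[OF l] by (intro mult_mono) auto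
   also have "\<dots> < \<delta> / \<theta> * E" using z theta E0 by (intro mult_strict_right_mono divide_strict_right_mono) auto
   also have "\<dots> \<le> d * \<theta> / E / \<theta> * E" using theta E0 unfolding \<delta>_def by (intro mult_right_mono divide_right_mono) auto
   also have "\<dots> = d" using theta E0 by simp
   finally show ?thesis using d(2)[of "ap j (e l)"] e_mem[OF l] by simp
  qed
  then have "(\<Sum>m<n. \<bar>bb m s * \<xi> i (ap j (e m))\<bar>) \<le> of_nat (card {..<n}) * (M * c)"
   using M[OF _ s] M0 by (intro sum_bounded_above) (auto simp: abs_mult intro!: mult_mono)
  then have b1: "\<bar>bb i (ap j s)\<bar> \<le> n * (M * c)"
   unfolding bb_ap[OF i s(1)] by (intro order_trans[OF sum_abs]) simp
  have "ap j (inv a) = inv (ap j s) \<otimes> z" using sj by (subst zz) simp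
  then have "\<rho> (ap j (inv a)) \<le> \<rho> (ap j s) + \<rho> z" using rho_mult_inv1[OF sj(1) z(1)] by simp
  also have "\<rho> (ap j s) \<le> \<theta> powi j * 2" using rho_ap[OF s(1), of j] s(2) p by simp
  also have "\<theta> powi j * 2 + \<rho> z < \<rho> z / \<theta> * 4"
  proof -
   define g where "g = \<rho> z / \<theta>"
   have "\<rho> z \<le> g"
    using theta rho_nonneg[OF z(1)] mult_left_le_one_le[of "\<rho> z" \<theta>] by (simp add: g_def pos_le_divide_eq mult.commute)
   moreover have "\<theta> powi j < g" using jz by (simp add: g_def)
   ultimately have "\<theta> powi j * 2 + \<rho> z < g * 4" using p by linarith
   then show ?thesis by (simp only: g_def)
  qed
  also have "\<rho> z / \<theta> * 4 < d2" using z(2) theta unfolding \<delta>_def by (simp add: field_simps)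
  finally have "\<bar>\<xi> i (ap j (inv a))\<bar> < \<epsilon> / 2" using d2(2)[OF sj(2)] by simp
  moreover have "bb i z = bb i (ap j s) + \<xi> i (ap j (inv a))" using bb_shift[OF i sj] zz by simp
  ultimately show ?thesis using b1 c(2) by linarith
 qed
 then show ?thesis using \<delta> by blast
qed

theorem bb_cont:
 assumes i: "i < n" and x: "x \<in> \<G>"
 shows "((\<lambda>z. bb i (x \<otimes> z)) \<longlongrightarrow> bb i x) nb"
proof (cases "x \<in> A")
 case False
 then show ?thesis by (rule bb_cont_off[OF i x])
next
 case True
 show ?thesis unfolding tendsto_nb
 proof (intro allI impI)
  fix \<epsilon> :: real assume \<epsilon>: "0 < \<epsilon>"
  then obtain d where d: "0 < d" "!!z. z \<in> \<G> ==> \<rho> z < d ==> \<bar>bb i z\<bar> < \<epsilon> / 2" using bb_small[OF i, of "\<epsilon> / 2"] by auto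
  obtain d1 where d1: "0 < d1" "!!a. a \<in> A ==> \<rho> a < d1 ==> \<bar>\<xi> i a\<bar> < \<epsilon> / 2" using xi_small[OF i, of "\<epsilon> / 2"] \<epsilon> by auto
  obtain d2 where d2: "0 < d2" "!!z. z \<in> \<G> ==> \<rho> z < d2 ==> \<rho> (inv x \<otimes> z \<otimes> inv (inv x)) < d1 / 2"
   using rho_conj[of "inv x" "d1 / 2"] x d1(1) by auto
  show "\<exists>d>0. \<forall>z\<in>\<G>. \<rho> z < d --> \<bar>bb i (x \<otimes> z) - bb i x\<bar> < \<epsilon>"
  proof (intro exI[of _ "min d (min d2 (d1 / 2))"] conjI ballI impI)
   show "0 < min d (min d2 (d1 / 2))" using d d1 d2 by simp
   fix z assume z: "z \<in> \<G>" "\<rho> z < min d (min d2 (d1 / 2))"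
   \<comment> \<open>The commutator lets x \<otimes> z be written as z \<otimes> (x \<otimes> c)
     with x \<otimes> c in A. The shift rule then reduces continuity at x to smallness of
     \<open>bb\<close> at z and of \<xi> at c.\<close>
   define c where "c = inv x \<otimes> (inv z \<otimes> x \<otimes> z)"
   have c: "c \<in> A" using True A_conj(2)[OF z(1) True] by (simp add: c_def)
   have "\<rho> c = \<rho> ((inv x \<otimes> inv z \<otimes> inv (inv x)) \<otimes> z)" using x z by (simp add: c_def m_assoc)
   also have "\<dots> \<le> \<rho> (inv x \<otimes> inv z \<otimes> inv (inv x)) + \<rho> z" using x z by (intro rho_mult) auto
   also have "\<dots> < d1" using d2(2)[of "inv z"] z by (simp add: rho_inv)
   finally have "\<bar>\<xi> i c\<bar> < \<epsilon> / 2" using d1(2)[OF c] by simp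
   moreover have "x \<otimes> z = z \<otimes> (x \<otimes> c)" using x z by (simp add: c_def m_assoc)
   then have "bb i (x \<otimes> z) = bb i z + \<xi> i x + \<xi> i c"
    using bb_shift[OF i z(1) A_mult[OF True c]] xi_add[OF i True c] by simp
   moreover have "bb i x = \<xi> i x" using True by (simp add: bb_def)
   moreover have "\<bar>bb i z\<bar> < \<epsilon> / 2" using d(2) z by simp
   ultimately show "\<bar>bb i (x \<otimes> z) - bb i x\<bar> < \<epsilon>" by linarith
  qed
 qed
qed

end

context homogeneous_group
begin

lemma sub_ap:
 assumes A: "invsub A" and a: "a \<in> A"
 shows "homogeneous_group.ap (G\<lparr>carrier := A\<rparr>) \<alpha> k a = ap k a"
proof -
 interpret S: homogeneous_group "G\<lparr>carrier := A\<rparr>" \<alpha> \<rho> \<theta> by (rule sub_hg[OF A])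
 have aS: "a \<in> carrier (G\<lparr>carrier := A\<rparr>)" using a by simp
 have ac: "a \<in> \<G>" by (rule invsub_mem[OF A a])
 show ?thesis
 proof (induction k rule: int_induct[of _ 0])
  case (step1 i)
  have "S.ap (i + 1) a = \<alpha> (S.ap i a)" by (rule S.ap_Suc[OF aS])
  moreover have "ap (i + 1) a = \<alpha> (ap i a)" by (rule ap_Suc[OF ac])
  ultimately show ?case using step1 by simp
 next
  case (step2 i)
  have c: "S.ap (i - 1) a \<in> A" "ap (i - 1) a \<in> A" using S.ap_closed[OF aS, of "i - 1"] invsub_ap[OF A a] by auto
  have "\<alpha> (S.ap (i - 1) a) = S.ap i a" using S.ap_Suc[OF aS, of "i - 1"] by simp
  moreover have "\<alpha> (ap (i - 1) a) = ap i a" using ap_Suc[OF ac, of "i - 1"] by simp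
  ultimately show ?case using step2 c invsub_mem[OF A] by (intro alpha_inj[of "S.ap (i - 1) a" "ap (i - 1) a"]) simp_all
 qed simp
qed

text \<open>Everything one descent needs from A, with the basis and the vectors e hidden. B is the
  common kernel of the characters of A, which conjugation by G preserves because it permutes
  characters. The zero set of b is preserved by \<alpha>, as \<alpha> acts linearly on values of
  b.\<close>

lemma vector_step:
 assumes A: "invsub A" "A \<lhd> G" "connsub A" "A \<noteq> {\<one>}"
 obtains B n \<xi> b where "invsub B" "B \<lhd> G" "connsub B" "B \<subset> A"
  "!!i x a. i < n ==> x \<in> \<G> ==> a \<in> A ==> b i (x \<otimes> a) = b i x + \<xi> i a"
  "\<forall>x\<in>\<G>. (\<forall>i<n. b i x = 0) --> (\<forall>i<n. b i (\<alpha> x) = 0)"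
  "!!i x. i < n ==> x \<in> \<G> ==> ((\<lambda>z. b i (x \<otimes> z)) \<longlongrightarrow> b i x) nb"
  "!!s :: nat => real. \<exists>a\<in>A. \<forall>i<n. \<xi> i a = s i"
  "\<forall>c\<in>A. (\<forall>i<n. \<xi> i c = 0) --> c \<in> B"
  "!!w. 0 < w ==> \<exists>c>0. \<forall>y\<in>A. (\<forall>i<n. \<bar>\<xi> i y :: real\<bar> < c) --> (\<exists>b\<in>B. \<rho> (b \<otimes> y) < w)"
proof -
 interpret S: homogeneous_group "G\<lparr>carrier := A\<rparr>" \<alpha> \<rho> \<theta> by (rule sub_hg[OF A(1)])
 note Ac = invsub_mem[OF A(1)]
 have Sc: "S.conn" using A(3) sub_conn_iff[OF A(1)] by simp
 define B where "B = S.chrker"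
 have B: "invsub B" "B \<subseteq> A" using S.chrker_invsub sub_invsub_iff[OF A(1)] by (auto simp: B_def)
 have Bc: "connsub B" using S.chrker_connsub[OF Sc] sub_connsub_iff[OF A(1) B(2)] by (simp add: B_def)
 have ne: "B \<noteq> A" using S.conn_chrker_ne[OF Sc] A(4) by (simp add: B_def)
 have nB: "g \<otimes> x \<otimes> inv g \<in> B" if g: "g \<in> \<G>" and x: "x \<in> B" for g x
 proof -
  have h: "(\<lambda>y. g \<otimes> y \<otimes> inv g) \<in> hom (G\<lparr>carrier := A\<rparr>) (G\<lparr>carrier := A\<rparr>)"
   using normal.inv_op_closed2[OF A(2)] g Ac by (intro homI) (auto simp: gsimps)
  have r: "\<rho> (g \<otimes> y \<otimes> inv g) \<le> 2 * \<rho> g + 1" if "y \<in> carrier (G\<lparr>carrier := A\<rparr>)" "\<rho> y \<le> 1" for y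
  proof -
   have y: "y \<in> \<G>" using that Ac by simp
   show ?thesis using rho_mult[of "g \<otimes> y" "inv g"] rho_mult[of g y] rho_inv[OF g] g y that(2) by simp
  qed
  have "\<eta> (g \<otimes> x \<otimes> inv g) = 0" if "S.chr \<eta>" for \<eta>
   using S.chrker_mem[OF x[unfolded B_def] S.chr_hom_comp[OF that h r]] .
  moreover have "g \<otimes> x \<otimes> inv g \<in> A" using normal.inv_op_closed2[OF A(2) g] x B(2) by blast
  ultimately show ?thesis unfolding B_def S.chrker_def by simp
 qed
 have norB: "B \<lhd> G" unfolding normal_inv_iff using invsub_subgroup[OF B(1)] nB by blast
 obtain n \<xi> e where bas: "S.chr_basis n \<xi> e" using S.ex_chr_basis[OF Sc] by blast
 note B1 = bas[unfolded S.chr_basis_def, THEN conjunct1, rule_format]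
  and B2 = bas[unfolded S.chr_basis_def, THEN conjunct2, THEN conjunct1, rule_format]
  and B3 = bas[unfolded S.chr_basis_def, THEN conjunct2, THEN conjunct2, THEN conjunct1, rule_format]
  and B4 = bas[unfolded S.chr_basis_def, THEN conjunct2, THEN conjunct2, THEN conjunct2, THEN conjunct1, rule_format]
  and B5 = bas[unfolded S.chr_basis_def, THEN conjunct2, THEN conjunct2, THEN conjunct2, THEN conjunct2, rule_format]
 have xc: "S.chr (\<xi> i)" and eA: "e i \<in> A" if "i < n" for i using B1[OF that] by auto
 have expand: "\<eta> a = (\<Sum>l<n. \<xi> l a * \<eta> (e l))" if "S.chr \<eta>" "a \<in> A" for \<eta> a
  using B3[OF that(1)] that(2) by simp
 interpret V: vector_extension G \<alpha> \<rho> \<theta> A n \<xi> e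
 proof (intro vector_extension.intro vector_extension_axioms.intro homogeneous_group_axioms)
  show "invsub A" "A \<lhd> G" by fact+
  fix i assume i: "i < n"
  show "\<xi> i (a \<otimes> b) = \<xi> i a + \<xi> i b" if "a \<in> A" "b \<in> A" for a b using S.chr_mult[OF xc[OF i], of a b] that by simp
  show "\<exists>L. \<forall>a\<in>A. \<rho> a \<le> R --> \<bar>\<xi> i a\<bar> \<le> L" for R using S.chr_bdd[OF xc[OF i], of R] by simp
  show "\<exists>d>0. \<forall>a\<in>A. \<rho> a < d --> \<bar>\<xi> i a\<bar> < c" if "0 < c" for c using S.chr_small[OF xc[OF i] that] by simp
  show "\<xi> i (ap k a) = (\<Sum>l<n. \<xi> l a * \<xi> i (ap k (e l)))" if a: "a \<in> A" for k a
  proof -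
   have "\<xi> i (S.ap k a) = (\<Sum>l<n. \<xi> l a * \<xi> i (S.ap k (e l)))" by (rule expand[OF S.chr_ap[OF xc[OF i]] a])
   also have "\<dots> = (\<Sum>l<n. \<xi> l a * \<xi> i (ap k (e l)))" by (rule sum.cong) (use sub_ap[OF A(1)] eA in auto)
   finally show ?thesis using sub_ap[OF A(1) a] by simp
  qed
  show "e i \<in> A" by (rule eA[OF i])
 qed
 show thesis
 proof (rule that[of B n V.bb \<xi>])
  show "invsub B" "B \<lhd> G" "connsub B" "B \<subset> A" using B norB Bc ne by auto
  show "V.bb i (x \<otimes> a) = V.bb i x + \<xi> i a" if "i < n" "x \<in> \<G>" "a \<in> A" for i x a by (rule V.bb_shift[OF that])
  show "\<forall>x\<in>\<G>. (\<forall>i<n. V.bb i x = 0) --> (\<forall>i<n. V.bb i (\<alpha> x) = 0)"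
  proof (intro ballI allI impI)
   fix x i assume "x \<in> \<G>" "\<forall>i<n. V.bb i x = 0" "i < n"
   then show "V.bb i (\<alpha> x) = 0" using V.bb_ap[of i x 1] by simp
  qed
  show "((\<lambda>z. V.bb i (x \<otimes> z)) \<longlongrightarrow> V.bb i x) nb" if "i < n" "x \<in> \<G>" for i x by (rule V.bb_cont[OF that])
  show "\<exists>a\<in>A. \<forall>i<n. \<xi> i a = s i" for s
  proof -
   obtain a where a: "a \<in> A" "\<forall>\<eta>. S.chr \<eta> --> \<eta> a = (\<Sum>i<n. s i * \<eta> (e i))" using B4[of s] by auto
   have "\<xi> j a = s j" if j: "j < n" for j
   proof -
    have "\<xi> j a = (\<Sum>i<n. s i * \<xi> j (e i))" using a(2) xc[OF j] by blast
    also have "\<dots> = (\<Sum>i<n. if i = j then s i else 0)"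
    proof (rule sum.cong[OF refl])
     fix i assume "i \<in> {..<n}"
     then show "s i * \<xi> j (e i) = (if i = j then s i else 0)" using B2[OF j, of i] by simp
    qed
    also have "\<dots> = s j" using j by (simp add: sum.delta)
    finally show ?thesis .
   qed
   then show ?thesis using a(1) by blast
  qed
  show "\<forall>c\<in>A. (\<forall>i<n. \<xi> i c = 0) --> c \<in> B"
  proof (intro ballI impI)
   fix c assume c: "c \<in> A" "\<forall>i<n. \<xi> i c = 0"
   have "\<eta> c = 0" if "S.chr \<eta>" for \<eta> using expand[OF that c(1)] c(2) by simp
   then show "c \<in> B" unfolding B_def S.chrker_def using c(1) by simp
  qed
  show "\<exists>c>0. \<forall>y\<in>A. (\<forall>i<n. \<bar>\<xi> i y\<bar> < c) --> (\<exists>b\<in>B. \<rho> (b \<otimes> y) < w)" if "0 < w" for w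
   using B5[OF that] by (simp add: B_def)
 qed
qed

end

section \<open>Sections for connected groups\<close>

context homogeneous_hom
begin

text \<open>Continuity and equivariance are required only for the induced map to G modulo A, while q
  (s y) = y holds exactly. For A = {\<one>} this is the section sought.\<close>

definition section_mod :: "'a set => ('b => 'a) => bool" where
 "section_mod A s \<longleftrightarrow> (\<forall>y\<in>carrier H. s y \<in> \<G> \<and> q (s y) = y \<and> inv (s (\<beta> y)) \<otimes> \<alpha> (s y) \<in> A) \<and>
   (\<forall>y\<in>carrier H. \<forall>\<epsilon>>0. \<exists>\<delta>>0. \<forall>y'\<in>carrier H. H.dst y y' < \<delta> --> (\<exists>a\<in>A. \<rho> (inv (s y) \<otimes> s y' \<otimes> a) < \<epsilon>))"

text \<open>Any choice of preimages works: equivariance modulo the kernel is automatic, and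
  continuity modulo the kernel is openness of q.\<close>

lemma section_mod_qker:
 assumes surj: "q ` \<G> = carrier H"
 shows "\<exists>s. section_mod qker s"
proof -
 have "\<forall>y\<in>carrier H. \<exists>x. x \<in> \<G> \<and> q x = y" unfolding surj[symmetric] by auto
 from bchoice[OF this] obtain s where s: "!!y. y \<in> carrier H ==> s y \<in> \<G>" "!!y. y \<in> carrier H ==> q (s y) = y" by blast
 show ?thesis
 proof (intro exI[of _ s] section_mod_def[THEN iffD2] conjI ballI allI impI)
  fix y assume y: "y \<in> carrier H"
  show "s y \<in> \<G>" "q (s y) = y" using s[OF y] by auto
  show "inv (s (\<beta> y)) \<otimes> \<alpha> (s y) \<in> qker"
   using s[OF y] s[of "\<beta> y"] y q_equiv[of "s y"] by (simp add: qker_def qh.hom_mult qh.hom_inv)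
  fix \<epsilon> :: real assume \<epsilon>: "0 < \<epsilon>"
  obtain d where d: "d > 0" "\<forall>y\<in>carrier H. \<rho>' y < d --> (\<exists>x\<in>\<G>. q x = y \<and> \<rho> x < \<epsilon>)" using q_lift[OF surj \<epsilon>] by blast
  show "\<exists>\<delta>>0. \<forall>y'\<in>carrier H. H.dst y y' < \<delta> --> (\<exists>a\<in>qker. \<rho> (inv (s y) \<otimes> s y' \<otimes> a) < \<epsilon>)"
  proof (intro exI[of _ d] conjI ballI impI d(1))
   fix y' assume y': "y' \<in> carrier H" "H.dst y y' < d"
   have "ivH y \<star> y' \<in> carrier H" using y y' by simp
   then obtain x where x: "x \<in> \<G>" "q x = ivH y \<star> y'" "\<rho> x < \<epsilon>" using d(2) y'(2) by blast
   note sy = s[OF y] s[OF y'(1)]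
   have "inv (s y') \<otimes> s y \<otimes> x \<in> qker"
    using sy x y y' by (simp add: qker_def qh.hom_mult qh.hom_inv H.m_assoc)
   moreover have "inv (s y) \<otimes> s y' \<otimes> (inv (s y') \<otimes> s y \<otimes> x) = x" using sy x by (simp add: m_assoc)
   ultimately show "\<exists>a\<in>qker. \<rho> (inv (s y) \<otimes> s y' \<otimes> a) < \<epsilon>" using x(3) by (intro bexI) auto
  qed
 qed
qed

text \<open>Move s y along A to a zero of b. Two zeros in one coset of A differ by an element killed
  by all \<xi> i, hence by an element of B. Since \<alpha> preserves zeros, equivariance modulo A
  improves to equivariance modulo B; continuity improves in the same way, approximately.\<close>

lemma section_mod_step:
 assumes A: "invsub A" "A \<lhd> G" "connsub A" "A \<noteq> {\<one>}" "A \<subseteq> qker" and s: "section_mod A s"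
 shows "\<exists>B s'. invsub B \<and> B \<lhd> G \<and> connsub B \<and> B \<subset> A \<and> section_mod B s'"
proof -
 note Ac = invsub_mem[OF A(1)] and Am = subgroup.m_closed[OF invsub_subgroup[OF A(1)]]
  and Ai = subgroup.m_inv_closed[OF invsub_subgroup[OF A(1)]]
 obtain B n \<xi> b where B: "invsub B" "B \<lhd> G" "connsub B" "B \<subset> A"
  and b1: "!!i x a. i < n ==> x \<in> \<G> ==> a \<in> A ==> b i (x \<otimes> a) = b i x + \<xi> i a"
  and b2: "\<forall>x\<in>\<G>. (\<forall>i<n. b i x = 0) --> (\<forall>i<n. b i (\<alpha> x) = 0)"
  and b3: "!!i x. i < n ==> x \<in> \<G> ==> ((\<lambda>z. b i (x \<otimes> z)) \<longlongrightarrow> b i x) nb"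
  and x1: "!!s :: nat => real. \<exists>a\<in>A. \<forall>i<n. \<xi> i a = s i"
  and x2: "\<forall>c\<in>A. (\<forall>i<n. \<xi> i c = 0) --> c \<in> B"
  and x3: "!!w. 0 < w ==> \<exists>c>0. \<forall>y\<in>A. (\<forall>i<n. \<bar>\<xi> i y :: real\<bar> < c) --> (\<exists>b\<in>B. \<rho> (b \<otimes> y) < w)"
  by (rule vector_step[OF A(1-4)], rule that)
 have "\<forall>y. \<exists>a. a \<in> A \<and> (\<forall>i<n. \<xi> i a = - b i (s y))"
 proof
  fix y show "\<exists>a. a \<in> A \<and> (\<forall>i<n. \<xi> i a = - b i (s y))" using x1[of "\<lambda>i. - b i (s y)"] by blast
 qed
 from choice[OF this] obtain t where t: "!!y. t y \<in> A" "!!y i. i < n ==> \<xi> i (t y) = - b i (s y)" by blast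
 have tc: "t y \<in> \<G>" for y by (rule Ac[OF t(1)])
 have s1: "s y \<in> \<G>" "q (s y) = y" "inv (s (\<beta> y)) \<otimes> \<alpha> (s y) \<in> A" if "y \<in> carrier H" for y
  using s that unfolding section_mod_def by auto
 define s' where "s' y = s y \<otimes> t y" for y
 have s'c: "s' y \<in> \<G>" if "y \<in> carrier H" for y using s1[OF that] tc by (simp add: s'_def)
 have bs: "b i (s' y) = 0" if "i < n" "y \<in> carrier H" for i y
  using b1[OF that(1) s1(1)[OF that(2)] t(1)] t(2)[OF that(1)] by (simp add: s'_def)
 have "section_mod B s'"
  unfolding section_mod_def
 proof (intro conjI ballI allI impI)
  fix y assume y: "y \<in> carrier H"
  have \<beta>y: "\<beta> y \<in> carrier H" using y by simp
  note sy = s1[OF y] and s\<beta> = s1[OF \<beta>y]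
  show "s' y \<in> \<G>" by (rule s'c[OF y])
  have "q (t y) = \<one>\<^bsub>H\<^esub>" using t(1) A(5) by (auto simp: qker_def)
  then show "q (s' y) = y" using sy tc y by (simp add: s'_def qh.hom_mult)
  define c where "c = inv (s' (\<beta> y)) \<otimes> \<alpha> (s' y)"
  have "c = inv (t (\<beta> y)) \<otimes> (inv (s (\<beta> y)) \<otimes> \<alpha> (s y)) \<otimes> \<alpha> (t y)"
   using sy s\<beta> tc by (simp add: c_def s'_def gsimps)
  moreover have "\<alpha> (t y) \<in> A" using invsub_ap[OF A(1) t(1)[of y], of 1] by simp
  ultimately have cA: "c \<in> A" using Am Ai t(1) sy(3) by simp
  have e: "\<alpha> (s' y) = s' (\<beta> y) \<otimes> c" using s'c[OF y] s'c[OF \<beta>y] by (simp add: c_def)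
  have "\<xi> i c = 0" if i: "i < n" for i
  proof -
   have "b i (\<alpha> (s' y)) = 0" using b2 s'c[OF y] bs[OF _ y] i by blast
   then show ?thesis using b1[OF i s'c[OF \<beta>y] cA] bs[OF i \<beta>y] unfolding e by simp
  qed
  then show "inv (s' (\<beta> y)) \<otimes> \<alpha> (s' y) \<in> B" using x2 cA unfolding c_def by blast
 next
  fix y and \<epsilon> :: real assume y: "y \<in> carrier H" and \<epsilon>: "0 < \<epsilon>"
  note sy = s1[OF y] and xc = s'c[OF y]
  obtain c where c: "c > 0" "\<forall>a\<in>A. (\<forall>i<n. \<bar>\<xi> i a\<bar> < c) --> (\<exists>b\<in>B. \<rho> (b \<otimes> a) < \<epsilon> / 2)" using x3[of "\<epsilon> / 2"] \<epsilon> by auto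
  have "eventually (\<lambda>z. \<forall>i\<in>{..<n}. \<bar>b i (s' y \<otimes> z)\<bar> < c) nb"
  proof (rule eventually_ball_finite[OF finite_lessThan], rule ballI)
   fix i assume "i \<in> {..<n}"
   then have i: "i < n" by simp
   show "eventually (\<lambda>z. \<bar>b i (s' y \<otimes> z)\<bar> < c) nb"
    using b3[OF i xc] c(1) unfolding bs[OF i y] tendsto_nb eventually_nb by simp
  qed
  then obtain d1 where d1: "d1 > 0" "\<forall>z\<in>\<G>. \<rho> z < d1 --> (\<forall>i\<in>{..<n}. \<bar>b i (s' y \<otimes> z)\<bar> < c)"
   unfolding eventually_nb by blast
  obtain d2 where d2: "d2 > 0" "\<forall>z\<in>\<G>. \<rho> z < d2 --> \<rho> (inv (t y) \<otimes> z \<otimes> inv (inv (t y))) < min d1 (\<epsilon> / 2)"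
   using rho_conj[of "inv (t y)" "min d1 (\<epsilon> / 2)"] tc d1 \<epsilon> by auto
  obtain \<delta> where \<delta>: "\<delta> > 0" "\<forall>y'\<in>carrier H. H.dst y y' < \<delta> --> (\<exists>a\<in>A. \<rho> (inv (s y) \<otimes> s y' \<otimes> a) < d2)"
   using s y d2(1) unfolding section_mod_def by blast
  show "\<exists>\<delta>>0. \<forall>y'\<in>carrier H. H.dst y y' < \<delta> --> (\<exists>a\<in>B. \<rho> (inv (s' y) \<otimes> s' y' \<otimes> a) < \<epsilon>)"
  proof (intro exI[of _ \<delta>] conjI ballI impI \<delta>(1))
   fix y' assume y': "y' \<in> carrier H" "H.dst y y' < \<delta>"
   note sy' = s1[OF y'(1)]
   obtain a where a: "a \<in> A" "\<rho> (inv (s y) \<otimes> s y' \<otimes> a) < d2" using \<delta>(2) y' by blast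
   have ac: "a \<in> \<G>" by (rule Ac[OF a(1)])
   \<comment> \<open>Chosen so that s' y' \<otimes> a' and s' y differ by z, a conjugate of the
     short element supplied by s. Both s' y and s' y' are zeros of b, so \<xi> i a' equals b i (s' y
     \<otimes> z), which is small.\<close>
   define a' where "a' = inv (t y') \<otimes> a \<otimes> t y"
   define z where "z = inv (s' y) \<otimes> s' y' \<otimes> a'"
   have a'A: "a' \<in> A" using a(1) t(1) Am Ai by (simp add: a'_def)
   have a'c: "a' \<in> \<G>" by (rule Ac[OF a'A])
   have zc: "z \<in> \<G>" using xc s'c[OF y'(1)] a'c by (simp add: z_def)
   have "z = inv (t y) \<otimes> (inv (s y) \<otimes> s y' \<otimes> a) \<otimes> inv (inv (t y))"
    using sy sy' ac tc by (simp add: z_def a'_def s'_def gsimps)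
   then have z: "\<rho> z < min d1 (\<epsilon> / 2)" using d2(2) a(2) sy sy' ac by simp
   have "\<bar>\<xi> i a'\<bar> < c" if i: "i < n" for i
   proof -
    have "s' y' \<otimes> a' = s' y \<otimes> z" using xc s'c[OF y'(1)] a'c by (simp add: z_def m_assoc)
    then have "\<xi> i a' = b i (s' y \<otimes> z)" using b1[OF i s'c[OF y'(1)] a'A] bs[OF i y'(1)] by simp
    then show ?thesis using d1(2) zc z i by simp
   qed
   \<comment> \<open>Small coordinates put a' close to B. Its inverse approximant inv k corrects by
     an element of B where a' corrected by an element of A.\<close>
   then obtain k where k: "k \<in> B" "\<rho> (k \<otimes> a') < \<epsilon> / 2" using c(2) a'A by blast
   have kc: "k \<in> \<G>" using k B(4) Ac by blast
   have "inv (s' y) \<otimes> s' y' \<otimes> inv k = z \<otimes> inv (k \<otimes> a')"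
    using xc s'c[OF y'(1)] a'c kc by (simp add: z_def gsimps)
   then have "\<rho> (inv (s' y) \<otimes> s' y' \<otimes> inv k) \<le> \<rho> z + \<rho> (k \<otimes> a')"
    using rho_mult[of z "inv (k \<otimes> a')"] rho_inv[of "k \<otimes> a'"] zc a'c kc by simp
   then show "\<exists>a\<in>B. \<rho> (inv (s' y) \<otimes> s' y' \<otimes> a) < \<epsilon>"
    using z k invsub_minv[OF B(1) k(1)] by (intro bexI[of _ "inv k"]) auto
  qed
 qed
 then show ?thesis using B by blast
qed

text \<open>The kernel itself is connected by \<open>conn_normal_connsub\<close>, so it is a member
  of the family from which a minimal A is taken.\<close>

theorem conn_section:
 assumes conn: conn and surj: "q ` \<G> = carrier H"
 shows "\<exists>s. (\<forall>y\<in>carrier H. s y \<in> \<G> \<and> q (s y) = y \<and> \<alpha> (s y) = s (\<beta> y)) \<and>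
   (\<forall>y\<in>carrier H. \<forall>\<epsilon>>0. \<exists>\<delta>>0. \<forall>y'\<in>carrier H. H.dst y y' < \<delta> --> dst (s y) (s y') < \<epsilon>)"
proof -
 let ?F = "{A. invsub A \<and> A \<lhd> G \<and> connsub A \<and> A \<subseteq> qker \<and> (\<exists>s. section_mod A s)}"
 have "qker \<in> ?F" using qker_invsub qker_normal conn_normal_connsub[OF conn qker_invsub qker_normal] section_mod_qker[OF surj] by simp
 from invsub_minimal[OF this] have "\<exists>A\<in>?F. \<forall>B\<in>?F. \<not> B \<subset> A" by simp
 then obtain A s where A: "invsub A" "A \<lhd> G" "connsub A" "A \<subseteq> qker" "section_mod A s" and m: "\<forall>B\<in>?F. \<not> B \<subset> A" by auto
 have "A = {\<one>}"
 proof (rule ccontr)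
  assume "A \<noteq> {\<one>}"
  from section_mod_step[OF A(1-3) this A(4,5)] obtain B s' where "invsub B" "B \<lhd> G" "connsub B" "B \<subset> A" "section_mod B s'" by (elim exE conjE)
  then have "B \<in> ?F" "B \<subset> A" using A(4) by auto
  then show False using m by blast
 qed
 then have s: "section_mod {\<one>} s" using A(5) by simp
 have s1: "s y \<in> \<G>" "q (s y) = y" "inv (s (\<beta> y)) \<otimes> \<alpha> (s y) = \<one>" if "y \<in> carrier H" for y
  using s that unfolding section_mod_def by auto
 show ?thesis
 proof (intro exI[of _ s] conjI ballI allI impI)
  fix y assume y: "y \<in> carrier H"
  show "s y \<in> \<G>" "q (s y) = y" using s1[OF y] by auto
  have "\<beta> y \<in> carrier H" using y by simp
  then have c: "s (\<beta> y) \<in> \<G>" by (rule s1)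
  have "\<alpha> (s y) = s (\<beta> y) \<otimes> (inv (s (\<beta> y)) \<otimes> \<alpha> (s y))" using c s1(1)[OF y] by simp
  also have "\<dots> = s (\<beta> y)" unfolding s1(3)[OF y] using c by simp
  finally show "\<alpha> (s y) = s (\<beta> y)" .
  fix \<epsilon> :: real assume \<epsilon>: "0 < \<epsilon>"
  have "\<exists>\<delta>>0. \<forall>y'\<in>carrier H. H.dst y y' < \<delta> --> (\<exists>a\<in>{\<one>}. \<rho> (inv (s y) \<otimes> s y' \<otimes> a) < \<epsilon>)"
   using s y \<epsilon> unfolding section_mod_def by blast
  then obtain \<delta> where \<delta>: "\<delta> > 0" "\<forall>y'\<in>carrier H. H.dst y y' < \<delta> --> (\<exists>a\<in>{\<one>}. \<rho> (inv (s y) \<otimes> s y' \<otimes> a) < \<epsilon>)" by (elim exE conjE)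
  show "\<exists>\<delta>>0. \<forall>y'\<in>carrier H. H.dst y y' < \<delta> --> dst (s y) (s y') < \<epsilon>"
  proof (intro exI[of _ \<delta>] conjI ballI impI \<delta>(1))
   fix y' assume "y' \<in> carrier H" "H.dst y y' < \<delta>"
   then show "dst (s y) (s y') < \<epsilon>" using \<delta>(2) s1[OF y] s1[of y'] by force
  qed
 qed
qed

end

section \<open>Digit expansions modulo identity components\<close>

context homogeneous_group
begin

lemma On_mult: "x \<in> On m ==> y \<in> On m ==> x \<otimes> y \<in> On m"
 by (rule subgroup.m_closed[OF On_subgroup])

lemma On_inv: "x \<in> On m ==> inv x \<in> On m"
 by (rule subgroup.m_inv_closed[OF On_subgroup])

lemma On_one: "\<one> \<in> On m"
 by (rule subgroup.one_closed[OF On_subgroup])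

lemma On_ball: "x \<in> \<G> ==> \<rho> x < \<theta> ^ m ==> x \<in> On m"
 unfolding On_def by (rule generate.incl) simp

lemma On_alpha_mem: "x \<in> On m ==> \<alpha> x \<in> On (Suc m)"
 unfolding On_alpha[symmetric] by (rule imageI)

lemma On_alpha':
 assumes "x \<in> On (Suc m)"
 shows "alpha' x \<in> On m"
proof -
 have "x \<in> \<alpha> ` On m" using assms by (simp only: On_alpha)
 then obtain y where y: "x = \<alpha> y" "y \<in> On m" by (rule imageE)
 then show ?thesis using On_closed[OF y(2)] by simp
qed

lemma Comp_opensub: "opensub U ==> x \<in> Comp ==> x \<in> U"
 using On_least Comp_On by blast

lemma Comp_conj:
 assumes g: "g \<in> \<G>" and x: "x \<in> Comp"
 shows "g \<otimes> x \<otimes> inv g \<in> Comp"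
proof -
 have "(\<lambda>y. g \<otimes> y \<otimes> inv g) x \<in> Comp"
 proof (rule Comp_endo[OF _ _ x])
  show "(\<lambda>y. g \<otimes> y \<otimes> inv g) \<in> hom G G" using g by (intro homI) (auto simp: gsimps)
 qed (rule rho_conj[OF g])
 then show ?thesis .
qed

end

context homogeneous_hom
begin

lemma q_ap: "x \<in> \<G> ==> q (ap (int N) x) = H.ap (int N) (q x)"
 by (simp add: ap_of_nat H.ap_of_nat q_funpow)

text \<open>\<open>q_lift\<close> lifts only sufficiently small elements. A unit-ball element is
  contracted until it is small, lifted, and the lift is expanded by the same power.\<close>

lemma lift_bounded:
 assumes surj: "q ` \<G> = carrier H"
 shows "\<exists>R. \<forall>y\<in>carrier H. \<rho>' y < 1 --> (\<exists>x\<in>\<G>. q x = y \<and> \<rho> x \<le> R)"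
proof -
 obtain d where d: "d > 0" "\<forall>y\<in>carrier H. \<rho>' y < d --> (\<exists>x\<in>\<G>. q x = y \<and> \<rho> x < 1)" using q_lift[OF surj zero_less_one] by blast
 obtain N where N: "\<theta>' ^ N * 1 < d" using H.theta_pow_small[OF d(1)] by blast
 show ?thesis
 proof (intro exI[of _ "\<theta> powi (- int N)"] ballI impI)
  fix y assume y: "y \<in> carrier H" "\<rho>' y < 1"
  have "\<rho>' (H.ap (int N) y) \<le> \<theta>' ^ N * 1" using y H.theta by (simp add: H.rho_ap)
  then have "\<rho>' (H.ap (int N) y) < d" using N by linarith
  moreover have "H.ap (int N) y \<in> carrier H" using y by simp
  ultimately obtain x where x: "x \<in> \<G>" "q x = H.ap (int N) y" "\<rho> x < 1" using d(2) by blast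
  have "q (ap (int N) (ap (- int N) x)) = H.ap (int N) (q (ap (- int N) x))" using x by (intro q_ap) simp
  then have "H.ap (int N) y = H.ap (int N) (q (ap (- int N) x))" using x by simp
  then have "H.ap (- int N) (H.ap (int N) y) = H.ap (- int N) (H.ap (int N) (q (ap (- int N) x)))" by simp
  then have "q (ap (- int N) x) = y" using x y by simp
  moreover have "\<rho> (ap (- int N) x) \<le> \<theta> powi (- int N)" using x(3) theta by (simp add: rho_ap[OF x(1)] mult_left_le)
  ultimately show "\<exists>x\<in>\<G>. q x = y \<and> \<rho> x \<le> \<theta> powi (- int N)" using x(1) by (intro bexI[of _ "ap (- int N) x"]) auto
 qed
qed

lemma q_Comp:
 assumes surj: "q ` \<G> = carrier H"
 shows "q ` Comp = H.Comp"
proof (intro equalityI subsetI)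
 fix y assume "y \<in> q ` Comp"
 then obtain x where x: "x \<in> Comp" "y = q x" by blast
 have "q x \<in> H.On n" for n
 proof -
  have "opensub {g \<in> \<G>. q g \<in> H.On n}"
  proof -
   obtain d where d: "d > 0" "\<forall>x\<in>\<G>. \<rho> x < d --> \<rho>' (q x) < \<theta>' ^ n" using q_cont[of "\<theta>' ^ n"] H.theta by auto
   show ?thesis
    by (rule opensubI[of _ d]) (use d H.On_one H.On_inv H.On_mult H.On_ball in auto)
  qed
  then show ?thesis using Comp_opensub[OF _ x(1)] by blast
 qed
 then show "y \<in> H.Comp" unfolding x(2) H.Comp_def by blast
next
 fix y assume y: "y \<in> H.Comp"
 have yc: "y \<in> carrier H" by (rule H.invsub_mem[OF H.Comp_invsub y])
 interpret C: homogeneous_group "G\<lparr>carrier := Comp\<rparr>" \<alpha> \<rho> \<theta> by (rule sub_hg[OF Comp_invsub])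
 note Cc = invsub_mem[OF Comp_invsub]
 interpret K: homogeneous_hom "G\<lparr>carrier := Comp\<rparr>" \<alpha> \<rho> \<theta> H \<beta> \<rho>' \<theta>' q
 proof (intro homogeneous_hom.intro homogeneous_hom_axioms.intro C.homogeneous_group_axioms H.homogeneous_group_axioms)
  show "q \<in> hom (G\<lparr>carrier := Comp\<rparr>) H" using Cc by (intro homI) auto
  show "\<beta> (q x) = q (\<alpha> x)" if "x \<in> carrier (G\<lparr>carrier := Comp\<rparr>)" for x using that Cc q_equiv by simp
  show "\<exists>d>0. \<forall>x\<in>carrier (G\<lparr>carrier := Comp\<rparr>). \<rho> x < d --> \<rho>' (q x) < e" if e: "0 < e" for e
  proof -
   obtain d where "d > 0" "\<forall>x\<in>\<G>. \<rho> x < d --> \<rho>' (q x) < e" using q_cont[OF e] by blast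
   then show ?thesis using Cc by (intro exI[of _ d]) auto
  qed
 qed
 have im: "H.invsub (q ` Comp)" using K.q_image_invsub by simp
 show "y \<in> q ` Comp"
 proof (rule H.seqclosedD[OF H.invsub_closed[OF im] yc])
  fix \<epsilon> :: real assume \<epsilon>: "0 < \<epsilon>"
  obtain d where d: "d > 0" "\<forall>x\<in>\<G>. \<rho> x < d --> \<rho>' (q x) < \<epsilon>" using q_cont[OF \<epsilon>] by blast
  obtain n where n: "\<forall>x\<in>On n. \<exists>c\<in>Comp. dst c x < d" using On_close_Comp[OF d(1)] by blast
  obtain d' where d': "d' > 0" "\<forall>y\<in>carrier H. \<rho>' y < d' --> (\<exists>x\<in>\<G>. q x = y \<and> \<rho> x < \<theta> ^ n)"
   using q_lift[OF surj, of "\<theta> ^ n"] theta by auto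
  have "H.opensub (q ` On n)"
   unfolding H.opensub_def
  proof (intro conjI exI[of _ d'] ballI impI d'(1))
   show "subgroup (q ` On n) H" by (rule qh.subgroup_img_is_subgroup[OF On_subgroup])
   fix y assume "y \<in> carrier H" "\<rho>' y < d'"
   then obtain x where "x \<in> \<G>" "q x = y" "\<rho> x < \<theta> ^ n" using d'(2) by blast
   then show "y \<in> q ` On n" using On_ball by blast
  qed
  then have "y \<in> q ` On n" using H.Comp_opensub[OF _ y] by blast
  then obtain x where x: "y = q x" "x \<in> On n" by (rule imageE)
  obtain c where c: "c \<in> Comp" "dst c x < d" using n x(2) by blast
  have cc: "c \<in> \<G>" "x \<in> \<G>" using c Cc On_closed[OF x(2)] by auto
  have "\<rho>' (q (inv c \<otimes> x)) < \<epsilon>" by (rule d(2)[rule_format, OF _ c(2)]) (use cc in simp)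
  then have "H.dst y (q c) < \<epsilon>" using cc H.dist_sym[of y "q c"] by (simp add: x(1))
  then show "\<exists>a\<in>q ` Comp. H.dst y a < \<epsilon>" using c(1) by blast
 qed
qed

end

text \<open>g x lifts the leading digit of x, that is, its class modulo H.On (Suc m), with bounded
  norm and depending only on that class. \<open>g_one\<close> gives deeper elements the leading
  digit \<one>, which makes the expansion commute with \<beta>.\<close>

locale digit_system = homogeneous_hom G \<alpha> \<rho> \<theta> H \<beta> \<rho>' \<theta>' q
 for G (structure) and \<alpha> :: "'a => 'a" and \<rho> \<theta> and H (structure) and \<beta> :: "'b => 'b" and \<rho>' \<theta>' q +
 fixes m :: nat and R :: real and g :: "'b => 'a"
 assumes g_closed [simp]: "!!x. x \<in> H.On m ==> g x \<in> \<G>"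
  and g_rho: "!!x. x \<in> H.On m ==> \<rho> (g x) \<le> R"
  and g_q: "!!x. x \<in> H.On m ==> ivH (q (g x)) \<star> x \<in> H.On (Suc m)"
  and g_const: "!!x x'. x \<in> H.On m ==> x' \<in> H.On m ==> ivH x \<star> x' \<in> H.On (Suc m) ==> g x = g x'"
  and g_one: "!!x. x \<in> H.On (Suc m) ==> g x = \<one>"
begin

text \<open>The remainder after removing the leading digit, expanded back to the level of H.On m;
  iterating it reads off the further digits.\<close>

definition stp :: "'b => 'b" where
 "stp x = H.alpha' (ivH (q (g x)) \<star> x)"

lemma stp_closed [simp]: "x \<in> H.On m ==> stp x \<in> H.On m"
 unfolding stp_def by (rule H.On_alpha'[OF g_q])

text \<open>The product of the first k lifted digits, the i-th one contracted by the i-th power of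
  \<alpha>.\<close>

primrec pp :: "nat => 'b => 'a" where
 "pp 0 x = \<one>"
| "pp (Suc k) x = g x \<otimes> \<alpha> (pp k (stp x))"

lemma pp_closed [simp]: "x \<in> H.On m ==> pp k x \<in> \<G>"
 by (induction k arbitrary: x) auto

definition R2 :: real where "R2 = R / (1 - \<theta>)"

lemma R2: "R + \<theta> * R2 = R2" "0 \<le> R2"
proof -
 have "0 \<le> R" using g_rho[OF H.On_one] rho_nonneg[OF g_closed[OF H.On_one]] by linarith
 then show "0 \<le> R2" using theta by (simp add: R2_def)
 show "R + \<theta> * R2 = R2" using theta by (simp add: R2_def field_simps)
qed

lemma pp_rho: "x \<in> H.On m ==> \<rho> (pp k x) \<le> R2"
proof (induction k arbitrary: x)
 case (Suc k)
 have "\<rho> (pp (Suc k) x) \<le> \<rho> (g x) + \<theta> * \<rho> (pp k (stp x))"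
  using rho_mult[of "g x" "\<alpha> (pp k (stp x))"] Suc.prems by (simp add: rho_alpha)
 also have "\<dots> \<le> R + \<theta> * R2" using g_rho[OF Suc.prems] Suc.IH[OF stp_closed[OF Suc.prems]] theta by (intro add_mono mult_left_mono) auto
 finally show ?case unfolding R2(1) .
qed (use R2 in simp)

lemma pp_cauchy: "x \<in> H.On m ==> dst (pp k x) (pp (k + j) x) \<le> \<theta> ^ k * R2"
proof (induction k arbitrary: x)
 case 0
 then show ?case using pp_rho by simp
next
 case (Suc k)
 have c: "pp k (stp x) \<in> \<G>" "pp (k + j) (stp x) \<in> \<G>" "g x \<in> \<G>" using Suc.prems by auto
 have e: "inv (pp (Suc k) x) \<otimes> pp (Suc k + j) x = \<alpha> (inv (pp k (stp x)) \<otimes> pp (k + j) (stp x))"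
  using c by (simp add: gsimps)
 have "dst (pp (Suc k) x) (pp (Suc k + j) x) = \<theta> * dst (pp k (stp x)) (pp (k + j) (stp x))"
  unfolding e by (rule rho_alpha) (use c in simp)
 also have "\<dots> \<le> \<theta> * (\<theta> ^ k * R2)" using Suc.IH[OF stp_closed[OF Suc.prems]] theta by (intro mult_left_mono) auto
 finally show ?case by simp
qed

lemma ex_digit_limit:
 assumes x: "x \<in> H.On m"
 shows "\<exists>l\<in>\<G>. \<forall>k. dst (pp k x) l \<le> \<theta> ^ k * R2"
proof -
 obtain l r where l: "l \<in> \<G>" "strict_mono (r :: nat => nat)" "(\<lambda>n. dst l (pp (r n) x)) \<longlonglongrightarrow> 0"
  using rho_compact[of "\<lambda>n. pp n x" R2] pp_rho[OF x] x by auto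
 have "dst (pp k x) l \<le> \<theta> ^ k * R2" for k
 proof (rule field_le_epsilon)
  fix e :: real assume "0 < e"
  then have "eventually (\<lambda>n. dst l (pp (r n) x) < e) sequentially" by (rule order_tendstoD(2)[OF l(3)])
  then have "eventually (\<lambda>n. k \<le> n \<and> dst l (pp (r n) x) < e) sequentially" by (intro eventually_conj eventually_ge_at_top)
  then obtain n where n: "k \<le> n" "dst l (pp (r n) x) < e" using eventually_happens by force
  have "k \<le> r n" using n(1) seq_suble[OF l(2), of n] by simp
  then have "dst (pp k x) (pp (r n) x) \<le> \<theta> ^ k * R2" using pp_cauchy[OF x, of k "r n - k"] by simp
  moreover have "dst (pp k x) l \<le> dst (pp k x) (pp (r n) x) + dst (pp (r n) x) l"
   using x l(1) by (intro dist_tri) auto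
  ultimately show "dst (pp k x) l \<le> \<theta> ^ k * R2 + e" using n(2) dist_sym[of l "pp (r n) x"] x l(1) by simp
 qed
 then show ?thesis using l(1) by blast
qed

definition sg :: "'b => 'a" where
 "sg x = (SOME l. l \<in> \<G> \<and> (\<forall>k. dst (pp k x) l \<le> \<theta> ^ k * R2))"

lemma sg: "x \<in> H.On m ==> sg x \<in> \<G>" "x \<in> H.On m ==> dst (pp k x) (sg x) \<le> \<theta> ^ k * R2"
proof -
 assume "x \<in> H.On m"
 then have "\<exists>l. l \<in> \<G> \<and> (\<forall>k. dst (pp k x) l \<le> \<theta> ^ k * R2)" using ex_digit_limit by blast
 from someI_ex[OF this] show "sg x \<in> \<G>" "dst (pp k x) (sg x) \<le> \<theta> ^ k * R2" unfolding sg_def by auto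
qed

lemma pp_q: "x \<in> H.On m ==> ivH (q (pp k x)) \<star> x \<in> H.On (m + k)"
proof (induction k arbitrary: x)
 case 0
 then show ?case using H.On_closed by simp
next
 case (Suc k)
 have c: "pp k (stp x) \<in> \<G>" "g x \<in> \<G>" "x \<in> carrier H" "stp x \<in> carrier H"
  using Suc.prems H.On_closed[OF Suc.prems] H.On_closed[OF stp_closed[OF Suc.prems]] by auto
 have s: "\<beta> (stp x) = ivH (q (g x)) \<star> x" unfolding stp_def using c by simp
 have "ivH (q (pp (Suc k) x)) \<star> x = ivH (\<beta> (q (pp k (stp x)))) \<star> (ivH (q (g x)) \<star> x)"
  using c by (simp add: q_equiv H.gsimps)
 also have "\<dots> = \<beta> (ivH (q (pp k (stp x))) \<star> stp x)" unfolding s[symmetric] using c by simp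
 also have "\<dots> \<in> H.On (Suc (m + k))" by (rule H.On_alpha_mem[OF Suc.IH[OF stp_closed[OF Suc.prems]]])
 finally show ?case by simp
qed

text \<open>The partial products reproduce x modulo H.On (m + k), and these subgroups decrease to
  the component of H, so the limit is exact only modulo the component.\<close>

lemma sg_q:
 assumes x: "x \<in> H.On m"
 shows "ivH x \<star> q (sg x) \<in> H.Comp"
proof -
 have xc: "x \<in> carrier H" by (rule H.On_closed[OF x])
 have "ivH x \<star> q (sg x) \<in> H.On n" for n
 proof -
  have "0 < \<theta>' ^ n" using H.theta by simp
  from q_cont[OF this] obtain d where d: "d > 0" "\<forall>x\<in>\<G>. \<rho> x < d --> \<rho>' (q x) < \<theta>' ^ n" by blast
  obtain k where k: "\<theta> ^ k * R2 < d" using theta_pow_small[OF d(1)] by blast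
  have "\<theta> ^ (k + n) * R2 \<le> \<theta> ^ k * R2" using theta R2 by (intro mult_right_mono power_decreasing) auto
  then have "dst (pp (k + n) x) (sg x) < d" using sg(2)[OF x, of "k + n"] k by linarith
  then have a: "q (inv (pp (k + n) x) \<otimes> sg x) \<in> H.On n" using d(2) sg(1)[OF x] x by (intro H.On_ball) auto
  have b: "ivH (q (pp (k + n) x)) \<star> x \<in> H.On n" using pp_q[OF x, of "k + n"] H.On_antimono[of n "m + (k + n)"] by auto
  have "ivH (ivH (q (pp (k + n) x)) \<star> x) \<star> q (inv (pp (k + n) x) \<otimes> sg x) \<in> H.On n"
   by (rule H.On_mult[OF H.On_inv[OF b] a])
  then show ?thesis using xc x sg(1)[OF x] by (simp add: H.gsimps)
 qed
 then show ?thesis unfolding H.Comp_def by blast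
qed

text \<open>The leading digit of \<beta> x is \<one> and its remainder is x, so its expansion is
  that of x shifted by one place.\<close>

lemma sg_beta:
 assumes x: "x \<in> H.On m"
 shows "\<beta> x \<in> H.On m" "sg (\<beta> x) = \<alpha> (sg x)"
proof -
 have xc: "x \<in> carrier H" by (rule H.On_closed[OF x])
 have b: "\<beta> x \<in> H.On (Suc m)" by (rule H.On_alpha_mem[OF x])
 then show bx: "\<beta> x \<in> H.On m" using H.On_antimono[of m "Suc m"] by auto
 have s: "stp (\<beta> x) = x" unfolding stp_def g_one[OF b] using xc by simp
 have p: "\<rho> (inv (pp k (\<beta> x)) \<otimes> \<alpha> (sg x)) \<le> \<theta> ^ k * R2" for k
 proof (cases k)
  case 0
  have "\<theta> * \<rho> (sg x) \<le> 1 * \<rho> (sg x)" using theta rho_nonneg[OF sg(1)[OF x]] by (intro mult_right_mono) auto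
  then show ?thesis using 0 sg(1)[OF x] sg(2)[OF x, of 0] by (simp add: rho_alpha)
 next
  case (Suc j)
  have e: "inv (pp k (\<beta> x)) \<otimes> \<alpha> (sg x) = \<alpha> (inv (pp j x) \<otimes> sg x)" using sg(1)[OF x] x by (simp add: Suc g_one[OF b] s)
  have "\<rho> (inv (pp k (\<beta> x)) \<otimes> \<alpha> (sg x)) = \<theta> * dst (pp j x) (sg x)"
   unfolding e by (rule rho_alpha) (use sg(1)[OF x] x in simp)
  then show ?thesis using sg(2)[OF x, of j] theta by (simp add: Suc)
 qed
 have "\<rho> (inv (sg (\<beta> x)) \<otimes> \<alpha> (sg x)) < e" if e: "0 < e" for e
 proof -
  obtain k where k: "\<theta> ^ k * (2 * R2) < e" using theta_pow_small[OF e] by blast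
  have "\<rho> (inv (sg (\<beta> x)) \<otimes> \<alpha> (sg x)) \<le> dst (sg (\<beta> x)) (pp k (\<beta> x)) + \<rho> (inv (pp k (\<beta> x)) \<otimes> \<alpha> (sg x))"
   using sg(1)[OF bx] sg(1)[OF x] bx by (intro dist_tri) auto
  then show ?thesis using p[of k] sg(2)[OF bx, of k] dist_sym[of "sg (\<beta> x)" "pp k (\<beta> x)"] sg(1)[OF bx] bx k by simp
 qed
 then have "inv (sg (\<beta> x)) \<otimes> \<alpha> (sg x) = \<one>" using sg(1)[OF bx] sg(1)[OF x] by (intro small_eq_one) auto
 then have "sg (\<beta> x) \<otimes> (inv (sg (\<beta> x)) \<otimes> \<alpha> (sg x)) = sg (\<beta> x) \<otimes> \<one>" by (rule arg_cong)
 then show "sg (\<beta> x) = \<alpha> (sg x)" using sg(1)[OF bx] sg(1)[OF x] by simp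
qed

lemma pp_const: "x \<in> H.On m ==> x' \<in> H.On m ==> ivH x \<star> x' \<in> H.On (m + k) ==> pp k x = pp k x'"
proof (induction k arbitrary: x x')
 case (Suc k)
 have xc: "x \<in> carrier H" "x' \<in> carrier H" using Suc.prems H.On_closed by auto
 have "ivH x \<star> x' \<in> H.On (Suc m)" using Suc.prems(3) H.On_antimono[of "Suc m" "m + Suc k"] by auto
 then have g: "g x = g x'" using g_const Suc.prems by blast
 have gc: "g x' \<in> \<G>" using Suc.prems by simp
 have "ivH (stp x) \<star> stp x' = H.alpha' (ivH x \<star> x')"
 proof (rule H.alpha_inj)
  show "\<beta> (ivH (stp x) \<star> stp x') = \<beta> (H.alpha' (ivH x \<star> x'))"
   using xc gc unfolding stp_def g by (simp add: H.gsimps del: H.alpha'_mult)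
 qed (use xc gc in \<open>auto simp: stp_def g\<close>)
 also have "\<dots> \<in> H.On (m + k)" using H.On_alpha'[of _ "m + k"] Suc.prems(3) by simp
 finally have "pp k (stp x) = pp k (stp x')" using Suc.IH Suc.prems by simp
 then show ?case using g by simp
qed simp

text \<open>Elements congruent modulo H.On (m + k) have the same first k digits; each limit is
  within \<theta> ^ k * R2 of the common partial product.\<close>

lemma sg_close:
 assumes x: "x \<in> H.On m" "x' \<in> H.On m" and k: "ivH x \<star> x' \<in> H.On (m + k)"
 shows "dst (sg x) (sg x') \<le> \<theta> ^ k * (2 * R2)"
proof -
 have "dst (sg x) (sg x') \<le> dst (sg x) (pp k x) + dst (pp k x) (sg x')"
  using sg(1) x by (intro dist_tri) auto
 then show ?thesis
  using sg(2)[OF x(1), of k] sg(2)[OF x(2), of k] dist_sym[of "sg x" "pp k x"] sg(1)[OF x(1)] x pp_const[OF x k] by simp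
qed

lemma sg_ap: "x \<in> H.On m ==> H.ap (int j) x \<in> H.On m \<and> sg (H.ap (int j) x) = ap (int j) (sg x)"
proof (induction j)
 case (Suc j)
 have xc: "x \<in> carrier H" by (rule H.On_closed[OF Suc.prems])
 have e: "int (Suc j) = int j + 1" by simp
 show ?case unfolding e H.ap_Suc[OF xc] ap_Suc[OF sg(1)[OF Suc.prems]] using Suc.IH[OF Suc.prems] sg_beta by metis
qed simp

lemma ex_scale: "y \<in> carrier H ==> \<exists>N. H.ap (int N) y \<in> H.On m"
proof -
 assume y: "y \<in> carrier H"
 have "0 < \<theta>' ^ m" using H.theta by simp
 from H.theta_pow_small[OF this, of "\<rho>' y"] obtain N where "\<theta>' ^ N * \<rho>' y < \<theta>' ^ m" by blast
 then show ?thesis using y by (intro exI[of _ N] H.On_ball) (auto simp: H.rho_ap)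
qed

text \<open>Every y is contracted into H.On m by some power of \<beta>, and the section is expanded
  back by the same power of \<alpha>. The result does not depend on the power because
  \<open>sg\<close> commutes with the contractions.\<close>

lemma ex_extend:
 assumes y: "y \<in> carrier H"
 shows "\<exists>z\<in>\<G>. \<forall>N. H.ap (int N) y \<in> H.On m --> ap (int N) z = sg (H.ap (int N) y)"
proof -
 obtain N where N: "H.ap (int N) y \<in> H.On m" using ex_scale[OF y] by blast
 define z where "z = ap (- int N) (sg (H.ap (int N) y))"
 have zc: "z \<in> \<G>" using sg(1)[OF N] by (simp add: z_def)
 have zN: "ap (int N) z = sg (H.ap (int N) y)" using sg(1)[OF N] by (simp add: z_def)
 have "ap (int M) z = sg (H.ap (int M) y)" if M: "H.ap (int M) y \<in> H.On m" for M
 proof (cases "N \<le> M")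
  case True
  then have e: "int M = int (M - N) + int N" by simp
  show ?thesis unfolding e H.ap_add[OF y] ap_add[OF zc] zN using sg_ap[OF N, of "M - N"] by simp
 next
  case False
  then have e: "int N = int (N - M) + int M" by simp
  have "ap (int (N - M)) (ap (int M) z) = ap (int (N - M)) (sg (H.ap (int M) y))"
   using zN sg_ap[OF M, of "N - M"] unfolding e H.ap_add[OF y] ap_add[OF zc] by simp
  then have "ap (- int (N - M)) (ap (int (N - M)) (ap (int M) z)) = ap (- int (N - M)) (ap (int (N - M)) (sg (H.ap (int M) y)))" by simp
  then show ?thesis using zc sg(1)[OF M] by simp
 qed
 then show ?thesis using zc by blast
qed

lemma digit_section:
 "\<exists>s. (\<forall>y\<in>carrier H. s y \<in> \<G> \<and> ivH y \<star> q (s y) \<in> H.Comp \<and> \<alpha> (s y) = s (\<beta> y)) \<and>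
   (\<forall>y\<in>carrier H. \<forall>\<epsilon>>0. \<exists>\<delta>>0. \<forall>y'\<in>carrier H. H.dst y y' < \<delta> --> dst (s y) (s y') < \<epsilon>)"
proof -
 have "\<forall>y\<in>carrier H. \<exists>z. z \<in> \<G> \<and> (\<forall>N. H.ap (int N) y \<in> H.On m --> ap (int N) z = sg (H.ap (int N) y))"
  using ex_extend by blast
 from bchoice[OF this] obtain s where s0: "\<forall>y\<in>carrier H. s y \<in> \<G> \<and> (\<forall>N. H.ap (int N) y \<in> H.On m --> ap (int N) (s y) = sg (H.ap (int N) y))" ..
 have sc: "s y \<in> \<G>" if "y \<in> carrier H" for y using s0 that by blast
 have s: "ap (int N) (s y) = sg (H.ap (int N) y)" if "y \<in> carrier H" "H.ap (int N) y \<in> H.On m" for y N using s0 that by blast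
 show ?thesis
 proof (intro exI[of _ s] conjI ballI allI impI)
  fix y assume y: "y \<in> carrier H"
  obtain N where N: "H.ap (int N) y \<in> H.On m" using ex_scale[OF y] by blast
  have \<beta>y: "\<beta> y \<in> carrier H" using y by simp
  show "s y \<in> \<G>" by (rule sc[OF y])
  have "H.ap (- int N) (ivH (H.ap (int N) y) \<star> q (sg (H.ap (int N) y))) \<in> H.Comp"
   by (rule H.invsub_ap[OF H.Comp_invsub sg_q[OF N]])
  then show "ivH y \<star> q (s y) \<in> H.Comp" unfolding s[OF y N, symmetric] q_ap[OF sc[OF y]] using y sc[OF y] by simp
  have e: "H.ap (int N) (\<beta> y) = \<beta> (H.ap (int N) y)" using H.ap_add[OF y, of "int N" 1] H.ap_Suc[OF y, of "int N"] by simp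
  have N': "H.ap (int N) (\<beta> y) \<in> H.On m" unfolding e by (rule sg_beta(1)[OF N])
  have "ap (int N) (s (\<beta> y)) = \<alpha> (ap (int N) (s y))" unfolding s[OF \<beta>y N'] s[OF y N] e by (rule sg_beta(2)[OF N])
  also have "\<dots> = ap (int N) (\<alpha> (s y))" using ap_add[OF sc[OF y], of "int N" 1] ap_Suc[OF sc[OF y], of "int N"] by simp
  finally have "ap (- int N) (ap (int N) (s (\<beta> y))) = ap (- int N) (ap (int N) (\<alpha> (s y)))" by simp
  then show "\<alpha> (s y) = s (\<beta> y)" using sc[OF y] sc[OF \<beta>y] by simp
  fix \<epsilon> :: real assume \<epsilon>: "0 < \<epsilon>"
  have pN: "0 < \<theta> ^ N" "0 < \<theta>' ^ N" using theta H.theta by auto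
  have "0 < \<theta> ^ N * \<epsilon>" using pN \<epsilon> by simp
  from theta_pow_small[OF this] obtain k where k: "\<theta> ^ k * (2 * R2) < \<theta> ^ N * \<epsilon>" by blast
  show "\<exists>\<delta>>0. \<forall>y'\<in>carrier H. H.dst y y' < \<delta> --> dst (s y) (s y') < \<epsilon>"
  \<comment> \<open>After N contractions the difference lies in H.On (m + k), so k digits agree. The
    N expansions back are paid for by the choice of k.\<close>
  proof (intro exI[of _ "\<theta>' ^ (m + k) / \<theta>' ^ N"] conjI ballI impI)
   show "0 < \<theta>' ^ (m + k) / \<theta>' ^ N" using H.theta by simp
   fix y' assume y': "y' \<in> carrier H" "H.dst y y' < \<theta>' ^ (m + k) / \<theta>' ^ N"
   have "\<rho>' (H.ap (int N) (ivH y \<star> y')) = \<theta>' ^ N * H.dst y y'" using H.rho_ap[of "ivH y \<star> y'" "int N"] y y' by simp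
   also have "\<dots> < \<theta>' ^ (m + k)" using y'(2) pN by (simp add: pos_less_divide_eq mult.commute)
   finally have d: "ivH (H.ap (int N) y) \<star> H.ap (int N) y' \<in> H.On (m + k)" using y y' H.On_ball[of "H.ap (int N) (ivH y \<star> y')" "m + k"] by simp
   then have "ivH (H.ap (int N) y) \<star> H.ap (int N) y' \<in> H.On m" using H.On_antimono[of m "m + k"] by auto
   from H.On_mult[OF N this] have N': "H.ap (int N) y' \<in> H.On m" using y y' by simp
   have "\<theta> ^ N * dst (s y) (s y') = \<rho> (ap (int N) (inv (s y) \<otimes> s y'))" using rho_ap[of "inv (s y) \<otimes> s y'" "int N"] sc[OF y] sc[OF y'(1)] by simp
   also have "\<dots> = dst (sg (H.ap (int N) y)) (sg (H.ap (int N) y'))" using sc[OF y] sc[OF y'(1)] by (simp add: s[OF y N] s[OF y'(1) N'])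
   also have "\<dots> < \<theta> ^ N * \<epsilon>" using sg_close[OF N N' d] k by linarith
   finally show "dst (s y) (s y') < \<epsilon>" using pN by simp
  qed
 qed
qed

end

context homogeneous_hom
begin

text \<open>Choose m so that every x in H.On m is within 1 of some c in H.Comp. The short element y
  = inv c \<star> x has a bounded lift, and inv y \<star> x is a conjugate of c, hence in H.Comp and
  so in H.On (Suc m).\<close>

lemma ex_digit_system:
 assumes surj: "q ` \<G> = carrier H"
 shows "\<exists>m R g. digit_system G \<alpha> \<rho> \<theta> H \<beta> \<rho>' \<theta>' q m R g"
proof -
 obtain m where m: "\<forall>x\<in>H.On m. \<exists>c\<in>H.Comp. H.dst c x < 1" using H.On_close_Comp[OF zero_less_one] by blast
 obtain R where R: "\<forall>y\<in>carrier H. \<rho>' y < 1 --> (\<exists>x\<in>\<G>. q x = y \<and> \<rho> x \<le> R)" using lift_bounded[OF surj] by blast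
 note Cc = H.invsub_mem[OF H.Comp_invsub]
 define C where "C x = {y \<in> carrier H. ivH y \<star> x \<in> H.On (Suc m)}" for x
 \<comment> \<open>The choice depends on x only through the set C x, which is constant on classes
   modulo H.On (Suc m); so SOME picks the same digit throughout a class.\<close>
 define g where "g x = (if x \<in> H.On (Suc m) then \<one> else SOME z. z \<in> \<G> \<and> q z \<in> C x \<and> \<rho> z \<le> max 0 R)" for x
 have g: "g x \<in> \<G> \<and> q (g x) \<in> C x \<and> \<rho> (g x) \<le> max 0 R" if x: "x \<in> H.On m" for x
 proof (cases "x \<in> H.On (Suc m)")
  case True
  then show ?thesis using H.On_closed[OF x] by (simp add: g_def C_def)
 next
  case False
  have xc: "x \<in> carrier H" by (rule H.On_closed[OF x])
  obtain c where c: "c \<in> H.Comp" "H.dst c x < 1" using m x by blast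
  have cc: "c \<in> carrier H" by (rule Cc[OF c(1)])
  define y where "y = ivH c \<star> x"
  have y: "y \<in> carrier H" "\<rho>' y < 1" using c cc xc by (auto simp: y_def)
  obtain z where z: "z \<in> \<G>" "q z = y" "\<rho> z \<le> R" using R y by blast
  have "ivH y \<star> x = ivH x \<star> c \<star> ivH (ivH x)" using xc cc by (simp add: y_def H.gsimps)
  moreover have "ivH x \<star> c \<star> ivH (ivH x) \<in> H.Comp" using xc c(1) by (intro H.Comp_conj) auto
  ultimately have "y \<in> C x" using y(1) H.Comp_On by (simp add: C_def)
  then have "\<exists>z. z \<in> \<G> \<and> q z \<in> C x \<and> \<rho> z \<le> max 0 R" using z by (intro exI[of _ z]) auto
  from someI_ex[OF this] show ?thesis using False by (simp add: g_def)
 qed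
 have "digit_system G \<alpha> \<rho> \<theta> H \<beta> \<rho>' \<theta>' q m (max 0 R) g"
 proof (intro digit_system.intro digit_system_axioms.intro homogeneous_hom_axioms)
  fix x assume x: "x \<in> H.On m"
  show "g x \<in> \<G>" "\<rho> (g x) \<le> max 0 R" "ivH (q (g x)) \<star> x \<in> H.On (Suc m)" using g[OF x] by (auto simp: C_def)
  fix x' assume x': "x' \<in> H.On m" and d: "ivH x \<star> x' \<in> H.On (Suc m)"
  have c: "x \<in> carrier H" "x' \<in> carrier H" using H.On_closed x x' by auto
  have t: "ivH y \<star> x \<in> H.On (Suc m) \<longleftrightarrow> ivH y \<star> x' \<in> H.On (Suc m)" if y: "y \<in> carrier H" for y
  proof
   assume "ivH y \<star> x \<in> H.On (Suc m)"
   from H.On_mult[OF this d] show "ivH y \<star> x' \<in> H.On (Suc m)" using c y by (simp add: H.m_assoc)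
  next
   assume "ivH y \<star> x' \<in> H.On (Suc m)"
   from H.On_mult[OF this H.On_inv[OF d]] show "ivH y \<star> x \<in> H.On (Suc m)" using c y by (simp add: H.gsimps)
  qed
  have "C x = C x'" using t by (auto simp: C_def)
  moreover have "x \<in> H.On (Suc m) \<longleftrightarrow> x' \<in> H.On (Suc m)" using t[OF H.one_closed] c by simp
  ultimately show "g x = g x'" by (simp add: g_def)
 qed (simp add: g_def)
 then show ?thesis by blast
qed

text \<open>The digit section s misses y by c y = ivH (q (s y)) \<star> y in H.Comp. An equivariant
  section t between the components supplies the missing factor, and s y \<otimes> t (c y) is exact.
  The factor c inherits continuity and equivariance from s.\<close>

theorem equivariant_section:
 assumes surj: "q ` \<G> = carrier H"
 shows "\<exists>s. (\<forall>y\<in>carrier H. s y \<in> \<G> \<and> q (s y) = y \<and> \<alpha> (s y) = s (\<beta> y)) \<and>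
   (\<forall>y\<in>carrier H. \<forall>\<epsilon>>0. \<exists>\<delta>>0. \<forall>y'\<in>carrier H. H.dst y y' < \<delta> --> dst (s y) (s y') < \<epsilon>)"
proof -
 obtain m R g where "digit_system G \<alpha> \<rho> \<theta> H \<beta> \<rho>' \<theta>' q m R g" using ex_digit_system[OF surj] by blast
 from digit_system.digit_section[OF this]
 obtain s where s: "\<forall>y\<in>carrier H. s y \<in> \<G> \<and> ivH y \<star> q (s y) \<in> H.Comp \<and> \<alpha> (s y) = s (\<beta> y)"
  and sk: "\<forall>y\<in>carrier H. \<forall>\<epsilon>>0. \<exists>\<delta>>0. \<forall>y'\<in>carrier H. H.dst y y' < \<delta> --> dst (s y) (s y') < \<epsilon>"
  by (elim exE conjE)
 note Gc = invsub_mem[OF Comp_invsub] and Hc = H.invsub_mem[OF H.Comp_invsub]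
 interpret CG: homogeneous_group "G\<lparr>carrier := Comp\<rparr>" \<alpha> \<rho> \<theta> by (rule sub_hg[OF Comp_invsub])
 interpret CH: homogeneous_group "H\<lparr>carrier := H.Comp\<rparr>" \<beta> \<rho>' \<theta>' by (rule H.sub_hg[OF H.Comp_invsub])
 interpret K: homogeneous_hom "G\<lparr>carrier := Comp\<rparr>" \<alpha> \<rho> \<theta> "H\<lparr>carrier := H.Comp\<rparr>" \<beta> \<rho>' \<theta>' q
 proof (intro homogeneous_hom.intro homogeneous_hom_axioms.intro CG.homogeneous_group_axioms CH.homogeneous_group_axioms)
  show "q \<in> hom (G\<lparr>carrier := Comp\<rparr>) (H\<lparr>carrier := H.Comp\<rparr>)" using Gc q_Comp[OF surj] by (intro homI) auto
  show "\<beta> (q x) = q (\<alpha> x)" if "x \<in> carrier (G\<lparr>carrier := Comp\<rparr>)" for x using that Gc q_equiv by simp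
  show "\<exists>d>0. \<forall>x\<in>carrier (G\<lparr>carrier := Comp\<rparr>). \<rho> x < d --> \<rho>' (q x) < e" if e: "0 < e" for e
  proof -
   obtain d where "d > 0" "\<forall>x\<in>\<G>. \<rho> x < d --> \<rho>' (q x) < e" using q_cont[OF e] by blast
   then show ?thesis using Gc by (intro exI[of _ d]) auto
  qed
 qed
 have conn: "CG.conn" using Comp_conn sub_conn_iff[OF Comp_invsub] by simp
 have sj: "q ` carrier (G\<lparr>carrier := Comp\<rparr>) = carrier (H\<lparr>carrier := H.Comp\<rparr>)" using q_Comp[OF surj] by simp
 note iG = m_inv_consistent[OF invsub_subgroup[OF Comp_invsub]] and iH = H.m_inv_consistent[OF H.invsub_subgroup[OF H.Comp_invsub]]
 obtain t where t: "\<forall>y\<in>H.Comp. t y \<in> Comp \<and> q (t y) = y \<and> \<alpha> (t y) = t (\<beta> y)"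
  and tk: "\<forall>y\<in>H.Comp. \<forall>\<epsilon>>0. \<exists>\<delta>>0. \<forall>y'\<in>H.Comp. H.dst y y' < \<delta> --> dst (t y) (t y') < \<epsilon>"
 proof -
  have "\<exists>t. (\<forall>y\<in>H.Comp. t y \<in> Comp \<and> q (t y) = y \<and> \<alpha> (t y) = t (\<beta> y)) \<and>
    (\<forall>y\<in>H.Comp. \<forall>\<epsilon>>0. \<exists>\<delta>>0. \<forall>y'\<in>H.Comp. \<rho>' (inv\<^bsub>H\<lparr>carrier := H.Comp\<rparr>\<^esub> y \<star> y') < \<delta> --> \<rho> (inv\<^bsub>G\<lparr>carrier := Comp\<rparr>\<^esub> (t y) \<otimes> t y') < \<epsilon>)"
   using K.conn_section[OF conn sj] by simp
  then obtain t where t: "\<forall>y\<in>H.Comp. t y \<in> Comp \<and> q (t y) = y \<and> \<alpha> (t y) = t (\<beta> y)" and tk: "\<forall>y\<in>H.Comp. \<forall>\<epsilon>>0. \<exists>\<delta>>0. \<forall>y'\<in>H.Comp. \<rho>' (inv\<^bsub>H\<lparr>carrier := H.Comp\<rparr>\<^esub> y \<star> y') < \<delta> --> \<rho> (inv\<^bsub>G\<lparr>carrier := Comp\<rparr>\<^esub> (t y) \<otimes> t y') < \<epsilon>" by (elim exE conjE)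
  have "\<forall>y\<in>H.Comp. \<forall>\<epsilon>>0. \<exists>\<delta>>0. \<forall>y'\<in>H.Comp. H.dst y y' < \<delta> --> dst (t y) (t y') < \<epsilon>"
  proof
   fix y assume y: "y \<in> H.Comp"
   have "t y \<in> Comp" using t y by blast
   with bspec[OF tk y] show "\<forall>\<epsilon>>0. \<exists>\<delta>>0. \<forall>y'\<in>H.Comp. H.dst y y' < \<delta> --> dst (t y) (t y') < \<epsilon>"
    by (simp only: iG iH[OF y])
  qed
  with t show thesis by (rule that)
 qed
 define c where "c y = ivH (q (s y)) \<star> y" for y
 have s1: "s y \<in> \<G>" "\<alpha> (s y) = s (\<beta> y)" if "y \<in> carrier H" for y using s that by auto
 have cC: "c y \<in> H.Comp" if y: "y \<in> carrier H" for y
 proof -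
  have "ivH (ivH y \<star> q (s y)) \<in> H.Comp" using s y by (intro H.invsub_minv[OF H.Comp_invsub]) blast
  then show ?thesis using s1[OF y] y by (simp add: c_def H.gsimps)
 qed
 have cc: "c y \<in> carrier H" if "y \<in> carrier H" for y using Hc cC that by blast
 have t1: "t y \<in> Comp" "q (t y) = y" "\<alpha> (t y) = t (\<beta> y)" if "y \<in> H.Comp" for y using t that by auto
 have tc: "t (c y) \<in> \<G>" if "y \<in> carrier H" for y using t1(1)[OF cC[OF that]] Gc by blast
 show ?thesis
 proof (intro exI[of _ "\<lambda>y. s y \<otimes> t (c y)"] conjI ballI allI impI)
  fix y assume y: "y \<in> carrier H"
  note sy = s1[OF y] and ty = tc[OF y] and cy = cc[OF y]
  have \<beta>y: "\<beta> y \<in> carrier H" using y by simp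
  show "s y \<otimes> t (c y) \<in> \<G>" using sy ty by simp
  show "q (s y \<otimes> t (c y)) = y" using sy ty t1(2)[OF cC[OF y]] y by (simp add: c_def)
  have "\<beta> (c y) = c (\<beta> y)" using sy y by (simp add: c_def q_equiv)
  then show "\<alpha> (s y \<otimes> t (c y)) = s (\<beta> y) \<otimes> t (c (\<beta> y))" using sy ty t1(3)[OF cC[OF y]] by simp
  fix \<epsilon> :: real assume \<epsilon>: "0 < \<epsilon>"
  have e2: "0 < \<epsilon> / 2" using \<epsilon> by simp
  obtain d1 where d1: "d1 > 0" "\<forall>z\<in>\<G>. \<rho> z < d1 --> \<rho> (inv (t (c y)) \<otimes> z \<otimes> inv (inv (t (c y)))) < \<epsilon> / 2"
   using rho_conj[of "inv (t (c y))" "\<epsilon> / 2"] ty e2 by auto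
  obtain d2 where d2: "d2 > 0" "\<forall>y'\<in>H.Comp. H.dst (c y) y' < d2 --> dst (t (c y)) (t y') < \<epsilon> / 2"
   using tk cC[OF y] e2 by blast
  obtain d3 where d3: "d3 > 0" "\<forall>z\<in>carrier H. \<rho>' z < d3 --> \<rho>' (ivH (c y) \<star> z \<star> ivH (ivH (c y))) < d2 / 2"
   using H.rho_conj[of "ivH (c y)" "d2 / 2"] cy d2(1) by auto
  obtain d4 where d4: "d4 > 0" "\<forall>x\<in>\<G>. \<rho> x < d4 --> \<rho>' (q x) < d3" using q_cont[OF d3(1)] by blast
  have m0: "0 < min d1 d4" using d1 d4 by simp
  obtain d5 where d5: "d5 > 0" "\<forall>y'\<in>carrier H. H.dst y y' < d5 --> dst (s y) (s y') < min d1 d4"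
   using sk y m0 by blast
  show "\<exists>\<delta>>0. \<forall>y'\<in>carrier H. H.dst y y' < \<delta> --> dst (s y \<otimes> t (c y)) (s y' \<otimes> t (c y')) < \<epsilon>"
  proof (intro exI[of _ "min d5 (d2 / 2)"] conjI ballI impI)
   show "0 < min d5 (d2 / 2)" using d5 d2 by simp
   fix y' assume y': "y' \<in> carrier H" "H.dst y y' < min d5 (d2 / 2)"
   note sy' = s1[OF y'(1)] and ty' = tc[OF y'(1)] and cy' = cc[OF y'(1)]
   have v: "dst (s y) (s y') < min d1 d4" using d5(2) y' by simp
   define u where "u = inv (s y') \<otimes> s y"
   have uc: "u \<in> \<G>" using sy sy' by (simp add: u_def)
   have "\<rho> u < d4" using v sy sy' dist_sym[of "s y" "s y'"] by (simp add: u_def)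
   then have qu: "\<rho>' (ivH (c y) \<star> q u \<star> ivH (ivH (c y))) < d2 / 2" using d4(2) d3(2) uc by simp
   \<comment> \<open>The displacement of c splits into a fixed conjugate of q u, small by continuity
     of s and q, and the displacement of y; the two halves of d2 are for these.\<close>
   have "ivH (c y) \<star> c y' = (ivH (c y) \<star> q u \<star> ivH (ivH (c y))) \<star> (ivH y \<star> y')"
    using sy sy' y y'(1) by (simp add: u_def c_def H.gsimps)
   then have "H.dst (c y) (c y') \<le> \<rho>' (ivH (c y) \<star> q u \<star> ivH (ivH (c y))) + H.dst y y'"
    using H.rho_mult[of "ivH (c y) \<star> q u \<star> ivH (ivH (c y))" "ivH y \<star> y'"] cy uc y y'(1) by simp
   then have "H.dst (c y) (c y') < d2" using qu y'(2) by linarith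
   then have a: "dst (t (c y)) (t (c y')) < \<epsilon> / 2" using d2(2) cC[OF y'(1)] by blast
   have b: "\<rho> (inv (t (c y)) \<otimes> (inv (s y) \<otimes> s y') \<otimes> inv (inv (t (c y)))) < \<epsilon> / 2" using d1(2) v sy sy' by simp
   have "inv (s y \<otimes> t (c y)) \<otimes> (s y' \<otimes> t (c y')) = (inv (t (c y)) \<otimes> (inv (s y) \<otimes> s y') \<otimes> inv (inv (t (c y)))) \<otimes> (inv (t (c y)) \<otimes> t (c y'))"
    using sy sy' ty ty' by (simp add: gsimps)
   then have "dst (s y \<otimes> t (c y)) (s y' \<otimes> t (c y')) \<le> \<rho> (inv (t (c y)) \<otimes> (inv (s y) \<otimes> s y') \<otimes> inv (inv (t (c y)))) + dst (t (c y)) (t (c y'))"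
    using rho_mult[of "inv (t (c y)) \<otimes> (inv (s y) \<otimes> s y') \<otimes> inv (inv (t (c y)))" "inv (t (c y)) \<otimes> t (c y')"] sy sy' ty ty' by simp
   then show "dst (s y \<otimes> t (c y)) (s y' \<otimes> t (c y')) < \<epsilon>" using a b by linarith
  qed
 qed
qed

end

section \<open>Frink's chain construction\<close>

text \<open>The entry z at which the partial sums cross t is split off, so that neither remaining
  part exceeds its share.\<close>

lemma split_sum_list:
 fixes w :: "'a => real"
 assumes "xs \<noteq> []" "!!x. x \<in> set xs ==> 0 \<le> w x" "0 \<le> t" "t \<le> sum_list (map w xs)"
 shows "\<exists>ys z zs. xs = ys @ z # zs \<and> sum_list (map w ys) \<le> t \<and> sum_list (map w zs) \<le> sum_list (map w xs) - t"
 using assms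
proof (induction xs arbitrary: t)
 case (Cons x xs)
 show ?case
 proof (cases "xs = [] \<or> t \<le> w x")
  case True
  then show ?thesis using Cons.prems by (intro exI[of _ "[]"] exI[of _ x] exI[of _ xs]) auto
 next
  case False
  have "\<exists>ys z zs. xs = ys @ z # zs \<and> sum_list (map w ys) \<le> t - w x \<and>
    sum_list (map w zs) \<le> sum_list (map w xs) - (t - w x)"
   by (rule Cons.IH) (use Cons.prems False in auto)
  then obtain ys z zs where h: "xs = ys @ z # zs" "sum_list (map w ys) \<le> t - w x"
    "sum_list (map w zs) \<le> sum_list (map w xs) - (t - w x)"
   by (elim exE conjE)
  then show ?thesis by (intro exI[of _ "x # ys"] exI[of _ z] exI[of _ zs]) auto
 qed
qed simp

text \<open>The hypothesis of Frink's metrization lemma in group form: the triple product inequality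
  with factor 2 is what lets the two halves of a chain and its middle entry be recombined.\<close>

locale quasi_norm = group G for G (structure) +
 fixes f :: "'a => real"
 assumes f_nonneg: "!!x. x \<in> carrier G ==> 0 \<le> f x"
  and f_one: "f \<one> = 0"
  and f_inv: "!!x. x \<in> carrier G ==> f (inv x) = f x"
  and f_tri: "!!x y z. x \<in> carrier G ==> y \<in> carrier G ==> z \<in> carrier G ==>
    f (x \<otimes> y \<otimes> z) \<le> 2 * max (f x) (max (f y) (f z))"
begin

definition lprod :: "'a list => 'a" where "lprod xs = foldr (\<otimes>) xs \<one>"

lemma lprod_simps [simp]: "lprod [] = \<one>" "lprod (x # xs) = x \<otimes> lprod xs"
 by (simp_all add: lprod_def)

lemma lprod_closed [simp]: "set xs \<subseteq> carrier G ==> lprod xs \<in> carrier G"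
 by (induction xs) auto

lemma lprod_append: "set xs \<subseteq> carrier G ==> set ys \<subseteq> carrier G ==> lprod (xs @ ys) = lprod xs \<otimes> lprod ys"
 by (induction xs) (auto simp: m_assoc)

lemma lprod_inv: "set xs \<subseteq> carrier G ==> lprod (rev (map (\<lambda>x. inv x) xs)) = inv (lprod xs)"
proof (induction xs)
 case (Cons x xs)
 have "set (rev (map (\<lambda>x. inv x) xs)) \<subseteq> carrier G" using Cons.prems by auto
 then show ?case using Cons by (simp add: lprod_append inv_mult_group)
qed simp

lemma sum_f_nonneg: "set xs \<subseteq> carrier G ==> 0 \<le> sum_list (map f xs)"
 using f_nonneg by (intro sum_list_nonneg) auto

text \<open>Frink's chain lemma: the list is cut in the middle of its total weight.\<close>
lemma frink: "set xs \<subseteq> carrier G ==> f (lprod xs) \<le> 2 * sum_list (map f xs)"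
proof (induction "length xs" arbitrary: xs rule: less_induct)
 case less
 show ?case
 proof (cases "xs = []")
  case True
  then show ?thesis by (simp add: f_one)
 next
  case False
  define s where "s = sum_list (map f xs)"
  have s: "0 \<le> s" unfolding s_def by (rule sum_f_nonneg[OF less.prems])
  have "\<exists>ys z zs. xs = ys @ z # zs \<and> sum_list (map f ys) \<le> s / 2 \<and> sum_list (map f zs) \<le> sum_list (map f xs) - s / 2"
   by (rule split_sum_list[OF False]) (use less.prems f_nonneg s in \<open>auto simp: s_def\<close>)
  then obtain ys z zs where h: "xs = ys @ z # zs" "sum_list (map f ys) \<le> s / 2" "sum_list (map f zs) \<le> s / 2"
   by (auto simp: s_def[symmetric])
  have c: "set ys \<subseteq> carrier G" "z \<in> carrier G" "set zs \<subseteq> carrier G" using less.prems h(1) by auto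
  have "f (lprod ys) \<le> s" using less.hyps[of ys] c h by simp
  moreover have "f (lprod zs) \<le> s" using less.hyps[of zs] c h by simp
  moreover have "f z \<le> s" using sum_f_nonneg[OF c(1)] sum_f_nonneg[OF c(3)] by (simp add: s_def h(1))
  moreover have "lprod xs = lprod ys \<otimes> z \<otimes> lprod zs" using c by (simp add: h(1) lprod_append m_assoc)
  ultimately have "f (lprod xs) \<le> 2 * s" using f_tri[of "lprod ys" z "lprod zs"] c by simp
  then show ?thesis by (simp add: s_def)
 qed
qed

text \<open>The chain infimum, the largest subadditive function below f. Frink's lemma keeps it
  above f / 2, so it is a genuine norm equivalent to f.\<close>

definition nrm :: "'a => real" where
 "nrm x = Inf {sum_list (map f xs) | xs. set xs \<subseteq> carrier G \<and> lprod xs = x}"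

lemma nrm_le: "set xs \<subseteq> carrier G ==> nrm (lprod xs) \<le> sum_list (map f xs)"
 unfolding nrm_def using sum_f_nonneg by (intro cInf_lower bdd_belowI[of _ 0]) auto

lemma nrm_ge:
 assumes "x \<in> carrier G" "!!xs. set xs \<subseteq> carrier G ==> lprod xs = x ==> c \<le> sum_list (map f xs)"
 shows "c \<le> nrm x"
 unfolding nrm_def
proof (rule cInf_greatest)
 have "set [x] \<subseteq> carrier G \<and> lprod [x] = x" using assms(1) by simp
 then show "{sum_list (map f xs) | xs. set xs \<subseteq> carrier G \<and> lprod xs = x} \<noteq> {}" by blast
qed (use assms(2) in auto)

lemma nrm_approx:
 assumes "x \<in> carrier G" "nrm x < c"
 shows "\<exists>xs. set xs \<subseteq> carrier G \<and> lprod xs = x \<and> sum_list (map f xs) < c"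
 using nrm_ge[OF assms(1), of c] assms(2) by (meson linorder_not_le)

lemma nrm_le_f: "x \<in> carrier G ==> nrm x \<le> f x"
 using nrm_le[of "[x]"] by simp

lemma f_le_nrm: "x \<in> carrier G ==> f x \<le> 2 * nrm x"
 using nrm_ge[of x "f x / 2"] frink by force

lemma nrm_nonneg: "x \<in> carrier G ==> 0 \<le> nrm x"
 using f_le_nrm[of x] f_nonneg[of x] by linarith

lemma nrm_one: "nrm \<one> = 0"
 using nrm_le_f[of \<one>] nrm_nonneg[of \<one>] f_one by simp

lemma nrm_mult:
 assumes x: "x \<in> carrier G" and y: "y \<in> carrier G"
 shows "nrm (x \<otimes> y) \<le> nrm x + nrm y"
proof (rule field_le_epsilon)
 fix e :: real assume e: "0 < e"
 obtain xs where xs: "set xs \<subseteq> carrier G" "lprod xs = x" "sum_list (map f xs) < nrm x + e / 2" using nrm_approx[OF x, of "nrm x + e / 2"] e by auto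
 obtain ys where ys: "set ys \<subseteq> carrier G" "lprod ys = y" "sum_list (map f ys) < nrm y + e / 2" using nrm_approx[OF y, of "nrm y + e / 2"] e by auto
 have "nrm (lprod (xs @ ys)) \<le> sum_list (map f (xs @ ys))" using xs ys by (intro nrm_le) auto
 then show "nrm (x \<otimes> y) \<le> nrm x + nrm y + e" using xs ys by (simp add: lprod_append)
qed

lemma nrm_inv:
 assumes x: "x \<in> carrier G"
 shows "nrm (inv x) = nrm x"
proof -
 have le: "nrm (inv x) \<le> nrm x" if x: "x \<in> carrier G" for x
 proof (rule nrm_ge[OF x])
  fix xs assume xs: "set xs \<subseteq> carrier G" "lprod xs = x"
  have "nrm (lprod (rev (map (\<lambda>x. inv x) xs))) \<le> sum_list (map f (rev (map (\<lambda>x. inv x) xs)))" using xs by (intro nrm_le) auto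
  moreover have "map f (rev (map (\<lambda>x. inv x) xs)) = rev (map f xs)" using xs f_inv by (auto simp: rev_map[symmetric])
  ultimately show "nrm (inv x) \<le> sum_list (map f xs)" using lprod_inv[OF xs(1)] xs(2) by (simp add: sum_list_rev)
 qed
 show ?thesis using le[OF x] le[of "inv x"] x by simp
qed

lemma lprod_hom: "h \<in> hom G G ==> set xs \<subseteq> carrier G ==> lprod (map h xs) = h (lprod xs)"
proof (induction xs)
 case Nil
 then show ?case using hom_one[of h G G] is_group by simp
next
 case (Cons x xs)
 then show ?case by (simp add: hom_mult)
qed

text \<open>Such an automorphism carries chains for x bijectively to chains for h x and halves their
  weight, so the scaling of f passes exactly to the norm.\<close>

lemma nrm_halving:
 assumes h: "h \<in> hom G G" "bij_betw h (carrier G) (carrier G)" and f: "!!x. x \<in> carrier G ==> f (h x) = f x / 2" and x: "x \<in> carrier G"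
 shows "nrm (h x) = nrm x / 2"
proof (rule antisym)
 have hc: "h y \<in> carrier G" if "y \<in> carrier G" for y using h(1) that by (auto simp: hom_def)
 have sf: "sum_list (map f (map h xs)) = sum_list (map f xs) / 2" if "set xs \<subseteq> carrier G" for xs
  using that by (induction xs) (auto simp: f add_divide_distrib)
 have "2 * nrm (h x) \<le> nrm x"
 proof (rule nrm_ge[OF x])
  fix xs assume xs: "set xs \<subseteq> carrier G" "lprod xs = x"
  have "nrm (lprod (map h xs)) \<le> sum_list (map f (map h xs))" using xs hc by (intro nrm_le) auto
  then show "2 * nrm (h x) \<le> sum_list (map f xs)" using xs sf[OF xs(1)] by (simp add: lprod_hom[OF h(1)])
 qed
 then show "nrm (h x) \<le> nrm x / 2" by simp
 show "nrm x / 2 \<le> nrm (h x)"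
 proof (rule nrm_ge[OF hc[OF x]])
  fix ys assume ys: "set ys \<subseteq> carrier G" "lprod ys = h x"
  define xs where "xs = map (inv_into (carrier G) h) ys"
  have im: "h ` carrier G = carrier G" using h(2) by (rule bij_betw_imp_surj_on)
  have xs: "set xs \<subseteq> carrier G" using ys(1) inv_into_into[of _ h "carrier G"] by (auto simp: xs_def im)
  have m: "map h xs = ys" using ys(1) by (auto simp: xs_def im f_inv_into_f intro!: map_idI)
  have "h (lprod xs) = h x" using lprod_hom[OF h(1) xs] ys(2) m by simp
  then have "lprod xs = x" using bij_betw_imp_inj_on[OF h(2)] x xs by (auto dest: inj_onD)
  then show "nrm x / 2 \<le> sum_list (map f ys)" using nrm_le[OF xs] sf[OF xs] m by simp
 qed
qed

end

section \<open>Uniform contraction and the homogeneous norm of a contraction group\<close>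

context locally_compact_contraction_group
begin

lemma nbhd_mult:
 assumes W: "openin T W" and x: "x \<in> carrier G" "y \<in> carrier G" "x \<otimes> y \<in> W"
 shows "\<exists>U V. openin T U \<and> openin T V \<and> x \<in> U \<and> y \<in> V \<and> (\<forall>u\<in>U. \<forall>v\<in>V. u \<otimes> v \<in> W)"
proof -
 define Z where "Z = {p \<in> topspace (prod_topology T T). (\<lambda>(x, y). x \<otimes> y) p \<in> W}"
 have "openin (prod_topology T T) Z" unfolding Z_def by (rule openin_continuous_map_preimage[OF continuous_mult W])
 moreover have "(x, y) \<in> Z" using x by (simp add: Z_def topspace_eq_carrier)
 ultimately have "\<exists>U V. openin T U \<and> openin T V \<and> x \<in> U \<and> y \<in> V \<and> U \<times> V \<subseteq> Z"
  by (simp only: openin_prod_topology_alt)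
 then obtain U V where "openin T U" "openin T V" "x \<in> U" "y \<in> V" "U \<times> V \<subseteq> Z" by (elim exE conjE)
 moreover have "u \<otimes> v \<in> W" if "u \<in> U" "v \<in> V" "U \<times> V \<subseteq> Z" for u v
 proof -
  have "(u, v) \<in> Z" using that by blast
  then show ?thesis by (simp add: Z_def)
 qed
 ultimately show ?thesis by (intro exI[of _ U] exI[of _ V]) simp
qed

lemma open_carrier: "openin T U ==> x \<in> U ==> x \<in> carrier G"
 using openin_subset[of T U] topspace_eq_carrier by auto

lemma open_translate:
 assumes U: "openin T U" and g: "g \<in> carrier G"
 shows "openin T {x \<in> carrier G. g \<otimes> x \<in> U}"
proof -
 have "continuous_map T (prod_topology T T) (\<lambda>x. (g, x))"
  using g by (intro continuous_map_pairedI) (auto simp: topspace_eq_carrier)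
 then have "continuous_map T T ((\<lambda>(x, y). x \<otimes> y) \<circ> (\<lambda>x. (g, x)))" using continuous_mult by (rule continuous_map_compose)
 from openin_continuous_map_preimage[OF this U] show ?thesis by (simp add: topspace_eq_carrier)
qed

lemma open_inv: "openin T U ==> openin T {x \<in> carrier G. inv x \<in> U}"
 using openin_continuous_map_preimage[OF continuous_inv] by (simp add: topspace_eq_carrier)

lemma nbhd_square:
 assumes W: "openin T W" "\<one> \<in> W"
 shows "\<exists>U. openin T U \<and> \<one> \<in> U \<and> (\<forall>u\<in>U. \<forall>v\<in>U. u \<otimes> v \<in> W)"
proof -
 obtain U V where "openin T U" "openin T V" "\<one> \<in> U" "\<one> \<in> V" "\<forall>u\<in>U. \<forall>v\<in>V. u \<otimes> v \<in> W"
  using nbhd_mult[OF W(1), of \<one> \<one>] W(2) by auto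
 then show ?thesis by (intro exI[of _ "U \<inter> V"]) auto
qed

lemma al_hom: "\<alpha> \<in> hom G G" and al_bij: "bij_betw \<alpha> (carrier G) (carrier G)"
 using automorphism by (auto simp: iso_def)

lemma al_pow_closed [simp]: "x \<in> carrier G ==> (\<alpha> ^^ n) x \<in> carrier G"
 using al_hom by (induction n) (auto simp: hom_def)

lemma al_pow_mult: "x \<in> carrier G ==> y \<in> carrier G ==> (\<alpha> ^^ n) (x \<otimes> y) = (\<alpha> ^^ n) x \<otimes> (\<alpha> ^^ n) y"
 by (induction n) (simp_all add: hom_mult[OF al_hom])

lemma al_pow_hom: "\<alpha> ^^ n \<in> hom G G"
 by (rule homI) (simp_all add: al_pow_mult)

lemma al_pow_one [simp]: "(\<alpha> ^^ n) \<one> = \<one>"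
 using hom_one[OF al_pow_hom is_group is_group] .

lemma al_pow_inv: "x \<in> carrier G ==> (\<alpha> ^^ n) (inv x) = inv ((\<alpha> ^^ n) x)"
 using group_hom.hom_inv[of G G "\<alpha> ^^ n" x] al_pow_hom is_group by (simp add: group_hom_def group_hom_axioms_def)

lemma al_pow_bij: "bij_betw (\<alpha> ^^ n) (carrier G) (carrier G)"
 by (rule bij_betw_funpow[OF al_bij])

lemma al_pow_inj: "x \<in> carrier G ==> y \<in> carrier G ==> (\<alpha> ^^ n) x = (\<alpha> ^^ n) y ==> x = y"
 using bij_betw_imp_inj_on[OF al_pow_bij] unfolding inj_on_def by blast

lemma al_pow_homeo: "homeomorphic_map T T (\<alpha> ^^ n)"
proof (induction n)
 case 0
 then show ?case by (simp add: id_def[symmetric] homeomorphic_map_id)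
next
 case (Suc n)
 then show ?case unfolding funpow.simps(2) by (rule homeomorphic_map_compose[OF _ bicontinuous])
qed

lemma al_pow_cont: "continuous_map T T (\<alpha> ^^ n)"
 by (rule homeomorphic_imp_continuous_map[OF al_pow_homeo])

lemma al_pow_add: "(\<alpha> ^^ (m + n)) x = (\<alpha> ^^ m) ((\<alpha> ^^ n) x)"
 by (simp add: funpow_add)

lemma regular: "regular_space T"
 using Hausdorff locally_compact by (simp add: locally_compact_Hausdorff_imp_regular_space)

text \<open>The sets \<open>{x. \<forall>m\<ge>n. \<alpha>\<^sup>m x \<in> C}\<close> with \<open>C\<close> a closed neighbourhood exhaust the group, so by
 Baire's theorem one of them has interior.\<close>
lemma uniform_near_one:
 assumes W: "openin T W" "\<one> \<in> W"
 shows "\<exists>P N. openin T P \<and> \<one> \<in> P \<and> (\<forall>m\<ge>N. \<forall>x\<in>P. (\<alpha> ^^ m) x \<in> W)"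
proof -
 obtain U0 where U0: "openin T U0" "\<one> \<in> U0" "\<forall>u\<in>U0. \<forall>v\<in>U0. u \<otimes> v \<in> W" using nbhd_square[OF W] by blast
 define U where "U = U0 \<inter> {x \<in> carrier G. inv x \<in> U0}"
 have U: "openin T U" "\<one> \<in> U" using U0 open_inv[OF U0(1)] by (auto simp: U_def)
 have "neighbourhood_base_of (closedin T) T" using regular neighbourhood_base_of_closedin by blast
 then obtain U' C where C: "openin T U'" "closedin T C" "\<one> \<in> U'" "U' \<subseteq> C" "C \<subseteq> U"
  using U unfolding neighbourhood_base_of by metis
 define A where "A n = (\<Inter>m\<in>{n..}. {x \<in> topspace T. (\<alpha> ^^ m) x \<in> C})" for n
 have cl: "closedin T (A n)" for n
  unfolding A_def by (intro closedin_INT closedin_continuous_map_preimage[OF al_pow_cont C(2)]) auto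
 have un: "\<Union>(range A) = topspace T"
 proof (intro equalityI subsetI)
  fix x assume "x \<in> topspace T"
  then have x: "x \<in> carrier G" by (simp add: topspace_eq_carrier)
  have "eventually (\<lambda>n. (\<alpha> ^^ n) x \<in> U') sequentially" using contractive[OF x] C(1,3) by (simp add: limitin_def)
  then obtain n where "\<forall>m\<ge>n. (\<alpha> ^^ m) x \<in> U'" by (auto simp: eventually_sequentially)
  then have "x \<in> A n" using x C(4) by (auto simp: A_def topspace_eq_carrier)
  then show "x \<in> \<Union>(range A)" by blast
 qed (auto simp: A_def)
 have "\<exists>n. T interior_of A n \<noteq> {}"
 proof (rule ccontr)
  assume ne: "\<not> ?thesis"
  have "T interior_of \<Union>(range A) = {}"
  proof (rule Baire_category_alt)
   show "completely_metrizable_space T \<or> locally_compact_space T \<and> regular_space T"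
    using locally_compact regular by simp
   show "countable (range A)" by simp
   fix X assume "X \<in> range A"
   then obtain n where "X = A n" by (rule rangeE)
   then show "closedin T X \<and> T interior_of X = {}" using cl[of n] ne by simp
  qed
  then have "topspace T = {}" unfolding un interior_of_topspace .
  then show False using one_closed by (simp add: topspace_eq_carrier)
 qed
 then obtain n z where z: "z \<in> T interior_of A n" by blast
 define O' where "O' = T interior_of A n"
 have O': "openin T O'" "z \<in> O'" "O' \<subseteq> A n" using z by (auto simp: O'_def interior_of_subset)
 have zc: "z \<in> carrier G" by (rule open_carrier[OF O'(1,2)])
 have AU: "(\<alpha> ^^ m) y \<in> U" if "y \<in> A n" "n \<le> m" for m y
 proof -
  have "(\<alpha> ^^ m) y \<in> C" using that by (simp add: A_def)
  then show ?thesis using C(5) by (rule subsetD[rotated])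
 qed
 show ?thesis
 \<comment> \<open>The interior of A n, translated from its point z to \<one>. For x in it, both z
   and z \<otimes> x are carried into U, and U was arranged so that the quotient of two of its
   elements lies in W.\<close>
 proof (intro exI[of _ "{x \<in> carrier G. z \<otimes> x \<in> O'}"] exI[of _ n] conjI allI impI ballI)
  show "openin T {x \<in> carrier G. z \<otimes> x \<in> O'}" by (rule open_translate[OF O'(1) zc])
  show "\<one> \<in> {x \<in> carrier G. z \<otimes> x \<in> O'}" using zc O' by simp
  fix m x assume m: "n \<le> m" and "x \<in> {x \<in> carrier G. z \<otimes> x \<in> O'}"
  then have x: "x \<in> carrier G" "z \<otimes> x \<in> A n" using O'(3) by auto
  have "z \<in> A n" using O'(2,3) by (rule subsetD[rotated])
  then have "(\<alpha> ^^ m) z \<in> U" "(\<alpha> ^^ m) (z \<otimes> x) \<in> U" using AU[OF _ m] x(2) by simp_all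
  then have "inv ((\<alpha> ^^ m) z) \<in> U0" "(\<alpha> ^^ m) (z \<otimes> x) \<in> U0" by (auto simp: U_def)
  then have "inv ((\<alpha> ^^ m) z) \<otimes> (\<alpha> ^^ m) (z \<otimes> x) \<in> W" using U0(3) by blast
  then show "(\<alpha> ^^ m) x \<in> W" using x zc by (simp add: al_pow_mult m_assoc[symmetric])
 qed
qed

text \<open>Cover K by finitely many translates of the neighbourhood on which contraction is
  uniform. The centres contract by pointwise convergence, the remainders uniformly.\<close>

lemma uniform_on_compact:
 assumes K: "compactin T K" and W: "openin T W" "\<one> \<in> W"
 shows "\<exists>N. \<forall>m\<ge>N. \<forall>x\<in>K. (\<alpha> ^^ m) x \<in> W"
proof -
 have Kc: "x \<in> carrier G" if "x \<in> K" for x using compactin_subset_topspace[OF K] that topspace_eq_carrier by auto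
 obtain U where U: "openin T U" "\<one> \<in> U" "\<forall>u\<in>U. \<forall>v\<in>U. u \<otimes> v \<in> W" using nbhd_square[OF W] by blast
 obtain P N0 where P: "openin T P" "\<one> \<in> P" "\<forall>m\<ge>N0. \<forall>x\<in>P. (\<alpha> ^^ m) x \<in> U" using uniform_near_one[OF U(1,2)] by blast
 define D where "D k = {x \<in> carrier G. inv k \<otimes> x \<in> P}" for k
 have "\<forall>k\<in>K. \<exists>N. \<forall>m\<ge>N. (\<alpha> ^^ m) k \<in> U"
 proof
  fix k assume "k \<in> K"
  then have "eventually (\<lambda>n. (\<alpha> ^^ n) k \<in> U) sequentially" using contractive[OF Kc] U(1,2) by (simp add: limitin_def)
  then show "\<exists>N. \<forall>m\<ge>N. (\<alpha> ^^ m) k \<in> U" by (simp add: eventually_sequentially)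
 qed
 from bchoice[OF this] obtain N where N: "\<forall>k\<in>K. \<forall>m\<ge>N k. (\<alpha> ^^ m) k \<in> U" by blast
 have "\<exists>F. finite F \<and> F \<subseteq> D ` K \<and> K \<subseteq> \<Union>F"
 proof (rule compactinD[OF K])
  show "openin T X" if "X \<in> D ` K" for X using that Kc open_translate[OF P(1)] by (auto simp: D_def)
  show "K \<subseteq> \<Union>(D ` K)" using Kc P(2) by (auto simp: D_def)
 qed
 then obtain F0 where F0: "finite F0" "F0 \<subseteq> D ` K" "K \<subseteq> \<Union>F0" by blast
 from finite_subset_image[OF F0(1,2)] obtain F where F: "F \<subseteq> K" "finite F" "F0 = D ` F" by blast
 define M where "M = Max (insert N0 (N ` F))"
 have M: "N0 \<le> M" "!!k. k \<in> F ==> N k \<le> M" using F(2) by (auto simp: M_def)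
 show ?thesis
 proof (intro exI[of _ M] allI impI ballI)
  fix m x assume m: "M \<le> m" and x: "x \<in> K"
  obtain k where k: "k \<in> F" "x \<in> D k" using F0(3) x F(3) by blast
  have kc: "k \<in> carrier G" "x \<in> carrier G" using k F(1) Kc x by auto
  have "N k \<le> m" using M(2)[OF k(1)] m by simp
  then have "(\<alpha> ^^ m) k \<in> U" using N k(1) F(1) by blast
  moreover have "(\<alpha> ^^ m) (inv k \<otimes> x) \<in> U" using P(3) M(1) m k(2) by (simp add: D_def)
  ultimately have "(\<alpha> ^^ m) k \<otimes> (\<alpha> ^^ m) (inv k \<otimes> x) \<in> W" using U(3) by blast
  then show "(\<alpha> ^^ m) x \<in> W" using kc by (simp add: al_pow_mult al_pow_inv m_assoc[symmetric])
 qed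
qed

text \<open>A power \<alpha> ^^ a carries the compact symmetric neighbourhood V so close to \<one>
  that triple products return to V. This is the triple product inequality of Frink's lemma at the
  level of neighbourhoods.\<close>

lemma ex_contracted_nbhd:
 "\<exists>V U0 a. compactin T V \<and> openin T U0 \<and> \<one> \<in> U0 \<and> U0 \<subseteq> V \<and> (\<forall>x\<in>V. inv x \<in> V) \<and> 0 < a \<and>
   (\<forall>x\<in>V. \<forall>y\<in>V. \<forall>z\<in>V. (\<alpha> ^^ a) x \<otimes> (\<alpha> ^^ a) y \<otimes> (\<alpha> ^^ a) z \<in> V)"
proof -
 obtain U0 K where K: "openin T U0" "compactin T K" "\<one> \<in> U0" "U0 \<subseteq> K"
  using locally_compact one_closed unfolding locally_compact_space_def topspace_eq_carrier by blast
 have Kc: "x \<in> carrier G" if "x \<in> K" for x using compactin_subset_topspace[OF K(2)] that topspace_eq_carrier by auto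
 define V where "V = K \<union> (\<lambda>x. inv x) ` K"
 have V: "compactin T V" unfolding V_def by (intro compactin_Un K(2) image_compactin[OF K(2) continuous_inv])
 have Vi: "\<forall>x\<in>V. inv x \<in> V" using Kc by (auto simp: V_def)
 obtain U1 where U1: "openin T U1" "\<one> \<in> U1" "\<forall>u\<in>U1. \<forall>v\<in>U1. u \<otimes> v \<in> U0" using nbhd_square[OF K(1,3)] by blast
 obtain U2 where U2: "openin T U2" "\<one> \<in> U2" "\<forall>u\<in>U2. \<forall>v\<in>U2. u \<otimes> v \<in> U1" using nbhd_square[OF U1(1,2)] by blast
 have i: "openin T (U1 \<inter> U2)" "\<one> \<in> U1 \<inter> U2" using U1 U2 by auto
 obtain N where N: "\<forall>m\<ge>N. \<forall>x\<in>V. (\<alpha> ^^ m) x \<in> U1 \<inter> U2" using uniform_on_compact[OF V i] by blast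
 \<comment> \<open>The successor makes a positive, as needed for its later use as a number of
   summands and as a divisor.\<close>
 define a where "a = Suc N"
 have a: "(\<alpha> ^^ a) x \<in> U1 \<inter> U2" if "x \<in> V" for x using N that by (simp add: a_def del: funpow.simps)
 have "(\<alpha> ^^ a) x \<otimes> (\<alpha> ^^ a) y \<otimes> (\<alpha> ^^ a) z \<in> V" if "x \<in> V" "y \<in> V" "z \<in> V" for x y z
 proof -
  have "(\<alpha> ^^ a) x \<otimes> (\<alpha> ^^ a) y \<in> U1" using a[OF that(1)] a[OF that(2)] U2(3) by blast
  then have "(\<alpha> ^^ a) x \<otimes> (\<alpha> ^^ a) y \<otimes> (\<alpha> ^^ a) z \<in> U0" using a[OF that(3)] U1(3) by blast
  then show ?thesis using K(4) by (auto simp: V_def)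
 qed
 then show ?thesis using V Vi K by (intro exI[of _ V] exI[of _ U0] exI[of _ a]) (auto simp: V_def a_def)
qed

end

locale contracted_nbhd = locally_compact_contraction_group G T \<alpha>
 for G (structure) and T :: "'a topology" and \<alpha> :: "'a => 'a" +
 fixes V U0 :: "'a set" and a :: nat
 assumes V_compact: "compactin T V" and U0: "openin T U0" "\<one> \<in> U0" "U0 \<subseteq> V"
  and V_inv: "!!x. x \<in> V ==> inv x \<in> V" and a_pos: "0 < a"
  and V_cube: "!!x y z. x \<in> V ==> y \<in> V ==> z \<in> V ==> (\<alpha> ^^ a) x \<otimes> (\<alpha> ^^ a) y \<otimes> (\<alpha> ^^ a) z \<in> V"
begin

lemma V_closed [simp]: "x \<in> V ==> x \<in> carrier G"
 using compactin_subset_topspace[OF V_compact] topspace_eq_carrier by auto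

lemma V_one [simp]: "\<one> \<in> V"
 using U0 by blast

text \<open>Powers of the iterate for which V has the triple product property; unrelated to the word
  sets of homogeneous groups.\<close>

definition pw :: "nat => 'a => 'a" where "pw i = \<alpha> ^^ (a * i)"

lemma pw_closed [simp]: "x \<in> carrier G ==> pw i x \<in> carrier G" by (simp add: pw_def)
lemma pw_mult: "x \<in> carrier G ==> y \<in> carrier G ==> pw i (x \<otimes> y) = pw i x \<otimes> pw i y" by (simp add: pw_def al_pow_mult)
lemma pw_inv: "x \<in> carrier G ==> pw i (inv x) = inv (pw i x)" by (simp add: pw_def al_pow_inv)
lemma pw_one [simp]: "pw i \<one> = \<one>" by (simp add: pw_def)
lemma pw_0 [simp]: "pw 0 x = x" by (simp add: pw_def)
lemma pw_1: "pw 1 = \<alpha> ^^ a" by (simp add: pw_def)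
lemma pw_add: "pw (i + j) x = pw i (pw j x)" by (simp only: pw_def distrib_left al_pow_add)
lemma pw_inj: "x \<in> carrier G ==> y \<in> carrier G ==> pw i x = pw i y ==> x = y" unfolding pw_def by (rule al_pow_inj)

lemma pw_V: "x \<in> V ==> pw j x \<in> V"
proof (induction j)
 case (Suc j)
 have "pw 1 (pw j x) \<otimes> pw 1 \<one> \<otimes> pw 1 \<one> \<in> V" unfolding pw_1 by (intro V_cube Suc V_one)
 then have "pw 1 (pw j x) \<in> V" using Suc.prems by simp
 then show ?case using pw_add[of 1 j x] by simp
qed simp

text \<open>\<open>lev i j x\<close> says that \<open>x\<close> lies in \<open>\<alpha>\<^sup>a\<^sup>(\<^sup>j\<^sup>-\<^sup>i\<^sup>) V\<close>; two indices avoid negative powers of \<open>\<alpha>\<close>.\<close>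
definition lev :: "nat => nat => 'a => bool" where
 "lev i j x \<longleftrightarrow> x \<in> carrier G \<and> (\<exists>v\<in>V. pw i x = pw j v)"

lemma lev_shift: "lev i j x ==> lev (i + k) (j + k) x"
 unfolding lev_def using pw_add[of k] by (metis add.commute)

lemma lev_weaken: "lev i (j + k) x ==> lev i j x"
 unfolding lev_def using pw_add[of j k] pw_V by metis

text \<open>The dyadic gauge of the sets \<alpha>^(a k) V with k = j - i: the value attached to
  level k is 2 to the power - k.\<close>

definition f :: "'a => real" where "f x = Inf {2 ^ i / 2 ^ j | i j. lev i j x}"

lemma ex_lev: "x \<in> carrier G ==> \<exists>i. lev i 0 x"
proof -
 assume x: "x \<in> carrier G"
 have "eventually (\<lambda>n. (\<alpha> ^^ n) x \<in> U0) sequentially" using contractive[OF x] U0(1,2) by (simp add: limitin_def)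
 then obtain n where "\<forall>m\<ge>n. (\<alpha> ^^ m) x \<in> U0" by (auto simp: eventually_sequentially)
 then have "pw n x \<in> V" unfolding pw_def using a_pos U0(3) by (simp add: subset_iff)
 then show ?thesis using x by (auto simp: lev_def)
qed

lemma f_le: "lev i j x ==> f x \<le> 2 ^ i / 2 ^ j"
 unfolding f_def by (intro cInf_lower bdd_belowI[of _ 0]) auto

lemma f_ge: "x \<in> carrier G ==> (!!i j. lev i j x ==> c \<le> 2 ^ i / 2 ^ j) ==> c \<le> f x"
 unfolding f_def using ex_lev[of x] by (intro cInf_greatest) blast+

lemma f_less: "x \<in> carrier G ==> f x < r ==> \<exists>i j. lev i j x \<and> 2 ^ i / 2 ^ j < r"
 using f_ge[of x r] by (meson linorder_not_le)

lemma f_nonneg': "x \<in> carrier G ==> 0 \<le> f x"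
 by (intro f_ge) auto

lemma lev_inv: "lev i j x ==> lev i j (inv x)"
proof -
 assume "lev i j x"
 then obtain v where v: "x \<in> carrier G" "v \<in> V" "pw i x = pw j v" by (auto simp: lev_def)
 then have "pw i (inv x) = pw j (inv v)" by (simp add: pw_inv)
 then show ?thesis using v V_inv by (auto simp: lev_def)
qed

lemma lev_mult3:
 assumes "lev i j x" "lev i j y" "lev i j z"
 shows "lev (Suc i) j (x \<otimes> y \<otimes> z)"
proof -
 obtain u v w where u: "x \<in> carrier G" "u \<in> V" "pw i x = pw j u" and v: "y \<in> carrier G" "v \<in> V" "pw i y = pw j v"
  and w: "z \<in> carrier G" "w \<in> V" "pw i z = pw j w" using assms by (auto simp: lev_def)
 have "pw (Suc i) (x \<otimes> y \<otimes> z) = pw 1 (pw j u \<otimes> pw j v \<otimes> pw j w)"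
  using u v w pw_add[of 1 i] by (simp add: pw_mult)
 also have "\<dots> = pw (1 + j) (u \<otimes> v \<otimes> w)" using u v w by (simp only: pw_add pw_mult V_closed m_closed)
 also have "\<dots> = pw (j + 1) (u \<otimes> v \<otimes> w)" by (simp add: add.commute)
 also have "\<dots> = pw j (pw 1 u \<otimes> pw 1 v \<otimes> pw 1 w)" using u v w by (simp only: pw_add pw_mult V_closed m_closed)
 finally have e: "pw (Suc i) (x \<otimes> y \<otimes> z) = pw j (pw 1 u \<otimes> pw 1 v \<otimes> pw 1 w)" .
 have "pw 1 u \<otimes> pw 1 v \<otimes> pw 1 w \<in> V" unfolding pw_1 by (rule V_cube[OF u(2) v(2) w(2)])
 with e show ?thesis using u v w by (auto simp: lev_def)
qed

lemma lev_common:
 assumes "lev i j x" "2 ^ i / 2 ^ j < (r :: real)"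
 shows "\<exists>K. \<forall>k\<ge>K. \<exists>l. lev k l x \<and> 2 ^ k / 2 ^ l < r"
proof (rule exI[of _ i], intro allI impI)
 fix k assume "i \<le> k"
 then obtain d where d: "k = i + d" using le_Suc_ex by blast
 show "\<exists>l. lev k l x \<and> 2 ^ k / 2 ^ l < r"
  using lev_shift[OF assms(1), of d] assms(2) by (intro exI[of _ "j + d"]) (simp add: d power_add)
qed

text \<open>Shifting makes the first indices of the three levels equal, weakening makes the second
  ones equal. Then \<open>lev_mult3\<close> raises the first index by one, which is the factor
  2.\<close>

lemma f_tri':
 assumes c: "x \<in> carrier G" "y \<in> carrier G" "z \<in> carrier G"
 shows "f (x \<otimes> y \<otimes> z) \<le> 2 * max (f x) (max (f y) (f z))"
proof (rule dense_ge)
 fix r :: real assume r: "2 * max (f x) (max (f y) (f z)) < r"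
 have ex: "\<exists>K. \<forall>k\<ge>K. \<exists>l. lev k l w \<and> 2 ^ k / 2 ^ l < r / 2" if w: "w \<in> carrier G" "f w < r / 2" for w
  using f_less[OF w] lev_common by blast
 have fr: "f x < r / 2" "f y < r / 2" "f z < r / 2" using r by auto
 obtain K1 where K1: "\<forall>k\<ge>K1. \<exists>l. lev k l x \<and> 2 ^ k / 2 ^ l < r / 2" using ex[OF c(1) fr(1)] ..
 obtain K2 where K2: "\<forall>k\<ge>K2. \<exists>l. lev k l y \<and> 2 ^ k / 2 ^ l < r / 2" using ex[OF c(2) fr(2)] ..
 obtain K3 where K3: "\<forall>k\<ge>K3. \<exists>l. lev k l z \<and> 2 ^ k / 2 ^ l < r / 2" using ex[OF c(3) fr(3)] ..
 define k where "k = K1 + K2 + K3"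
 obtain l1 where l1: "lev k l1 x" "2 ^ k / 2 ^ l1 < r / 2" using K1[rule_format, of k] by (auto simp: k_def)
 obtain l2 where l2: "lev k l2 y" "2 ^ k / 2 ^ l2 < r / 2" using K2[rule_format, of k] by (auto simp: k_def)
 obtain l3 where l3: "lev k l3 z" "2 ^ k / 2 ^ l3 < r / 2" using K3[rule_format, of k] by (auto simp: k_def)
 define l where "l = min l1 (min l2 l3)"
 have "lev k l x" "lev k l y" "lev k l z"
  using lev_weaken[of k l "l1 - l" x] lev_weaken[of k l "l2 - l" y] lev_weaken[of k l "l3 - l" z] l1 l2 l3 by (auto simp: l_def)
 from f_le[OF lev_mult3[OF this]] have "f (x \<otimes> y \<otimes> z) \<le> 2 * (2 ^ k / 2 ^ l)" by simp
 also have "2 ^ k / 2 ^ l < r / 2" using l1(2) l2(2) l3(2) by (auto simp: l_def min_def)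
 finally show "f (x \<otimes> y \<otimes> z) \<le> r" by simp
qed

lemma f_inv': "x \<in> carrier G ==> f (inv x) = f x"
proof -
 have le: "f (inv x) \<le> f x" if "x \<in> carrier G" for x using that by (intro f_ge f_le lev_inv)
 assume x: "x \<in> carrier G"
 then show ?thesis using le[OF x] le[of "inv x"] by simp
qed

lemma f_one': "f \<one> = 0"
proof -
 have "f \<one> \<le> 0"
 proof (rule field_le_epsilon)
  fix e :: real assume e: "0 < e"
  obtain j where "(1 / 2) ^ j < e" using real_arch_pow_inv[OF e, of "1 / 2"] by auto
  moreover have "lev 0 j \<one>" unfolding lev_def by (intro conjI bexI[of _ \<one>]) auto
  ultimately show "f \<one> \<le> 0 + e" using f_le[of 0 j \<one>] by (simp add: power_one_over)
 qed
 then show ?thesis using f_nonneg'[of \<one>] by simp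
qed

lemma f_half:
 assumes x: "x \<in> carrier G"
 shows "f ((\<alpha> ^^ a) x) = f x / 2"
proof (rule antisym)
 have "2 * f (pw 1 x) \<le> f x"
 proof (rule f_ge[OF x])
  fix i j assume "lev i j x"
  then obtain v where v: "v \<in> V" "pw i x = pw j v" by (auto simp: lev_def)
  have "pw i (pw 1 x) = pw (1 + i) x" by (simp only: pw_add[symmetric] add.commute)
  also have "\<dots> = pw (1 + j) v" by (simp only: pw_add v(2))
  finally have "lev i (Suc j) (pw 1 x)" using v(1) x by (auto simp: lev_def)
  from f_le[OF this] show "2 * f (pw 1 x) \<le> 2 ^ i / 2 ^ j" by (simp add: field_simps)
 qed
 then show "f ((\<alpha> ^^ a) x) \<le> f x / 2" unfolding pw_1 by simp
 show "f x / 2 \<le> f ((\<alpha> ^^ a) x)" unfolding pw_1[symmetric]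
 proof (rule f_ge)
  fix i j assume "lev i j (pw 1 x)"
  then obtain v where v: "v \<in> V" "pw i (pw 1 x) = pw j v" by (auto simp: lev_def)
  have "lev (Suc i) j x" using v x pw_add[of i 1 x] by (auto simp: lev_def)
  from f_le[OF this] show "f x / 2 \<le> 2 ^ i / 2 ^ j" by (simp add: mult.commute)
 qed (use x in simp)
qed

sublocale Q: quasi_norm G f
 by unfold_locales (use f_nonneg' f_one' f_inv' f_tri' in auto)

text \<open>A small gauge places x in the image of V under a high power of \<alpha>, and high powers
  carry the compact set V into W uniformly.\<close>

lemma f_nbhd:
 assumes W: "openin T W" "\<one> \<in> W"
 shows "\<exists>r>0. \<forall>x\<in>carrier G. f x < r --> x \<in> W"
proof -
 obtain N where N: "\<forall>m\<ge>N. \<forall>x\<in>V. (\<alpha> ^^ m) x \<in> W" using uniform_on_compact[OF V_compact W] by blast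
 show ?thesis
 proof (intro exI[of _ "1 / 2 ^ N"] conjI ballI impI)
  fix x assume x: "x \<in> carrier G" "f x < 1 / 2 ^ N"
  obtain i j where h: "lev i j x" "2 ^ i / 2 ^ j < (1 / 2 ^ N :: real)" using f_less[OF x] by blast
  have "(2::real) ^ (i + N) < 2 ^ j" using h(2) by (simp add: field_simps power_add)
  then have "i + N < j" by simp
  then obtain d where d: "j = i + (N + d)" by (metis add.assoc less_imp_add_positive)
  obtain v where v: "v \<in> V" "pw i x = pw j v" using h(1) by (auto simp: lev_def)
  have "x = pw (N + d) v" by (rule pw_inj[of _ _ i]) (use x v d pw_add[of i "N + d" v] in auto)
  moreover have "N \<le> a * (N + d)" using a_pos by (cases a) auto
  ultimately show "x \<in> W" using N v(1) by (simp add: pw_def)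
 qed simp
qed

lemma nbhd_f:
 assumes r: "0 < r"
 shows "\<exists>U. openin T U \<and> \<one> \<in> U \<and> (\<forall>x\<in>U. f x < r)"
proof -
 obtain j where j: "(1 / 2) ^ j < r" using real_arch_pow_inv[OF r, of "1 / 2"] by auto
 have "openin T (pw j ` U0)" using homeomorphic_imp_open_map[OF al_pow_homeo] U0(1) by (simp add: pw_def open_map_def)
 moreover have "f x < r" if "x \<in> pw j ` U0" for x
 proof -
  have "lev 0 j x" using that U0(3) by (auto simp: lev_def)
  from f_le[OF this] j show ?thesis by (simp add: power_one_over)
 qed
 moreover have "\<one> \<in> pw j ` U0" using U0(2) by (intro image_eqI[of _ _ \<one>]) auto
 ultimately show ?thesis by blast
qed

lemma f_bounded: "\<exists>k. \<forall>x\<in>carrier G. f x < R --> pw k x \<in> V"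
proof -
 obtain k where k: "R < 2 ^ k" using real_arch_pow[of 2 R] by auto
 show ?thesis
 proof (intro exI[of _ k] ballI impI)
  fix x assume x: "x \<in> carrier G" "f x < R"
  then have "f x < 2 ^ k" using k by simp
  from f_less[OF x(1) this] obtain i j where h: "lev i j x" "2 ^ i / 2 ^ j < (2 ^ k :: real)" by blast
  have "(2::real) ^ i < 2 ^ (k + j)" using h(2) by (simp add: field_simps power_add)
  then have "i < k + j" by simp
  then obtain d where d: "k + j = i + d" using less_imp_add_positive by metis
  obtain v where v: "v \<in> V" "pw i x = pw j v" using h(1) by (auto simp: lev_def)
  have "pw j (pw k x) = pw d (pw i x)" using d by (simp only: pw_add[symmetric] add.commute)
  also have "\<dots> = pw j (pw d v)" unfolding v(2) by (simp only: pw_add[symmetric] add.commute)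
  finally have "pw k x = pw d v" by (rule pw_inj[rotated 2]) (use x v in auto)
  then show "pw k x \<in> V" using pw_V[OF v(1)] by simp
 qed
qed

definition s :: real where "s = 2 powr (1 / a)"
text \<open>Frink's norm is halved by \<alpha> ^^ a only. Weighting the first a iterates by powers
  of s, where s ^ a = 2, makes the sum scale exactly under \<alpha> itself, by the factor 1 /
  s.\<close>

definition rho :: "'a => real" where "rho x = (\<Sum>i<a. s ^ i * Q.nrm ((\<alpha> ^^ i) x))"

lemma s: "1 < s" "s ^ a = 2"
proof -
 show "1 < s" unfolding s_def using a_pos by (intro gr_one_powr) auto
 have "s ^ a = s powr a" using \<open>1 < s\<close> by (simp add: powr_realpow)
 also have "\<dots> = 2" unfolding s_def using a_pos by (simp add: powr_powr)
 finally show "s ^ a = 2" .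
qed

lemma rho_alpha:
 assumes x: "x \<in> carrier G"
 shows "rho (\<alpha> x) = (1 / s) * rho x"
proof -
 define g where "g i = s ^ i * Q.nrm ((\<alpha> ^^ i) x)" for i
 have "s * rho (\<alpha> x) = (\<Sum>i<a. g (Suc i))"
  unfolding rho_def sum_distrib_left by (rule sum.cong) (auto simp: g_def funpow_swap1)
 also have "\<dots> = (\<Sum>i<Suc a. g i) - g 0" by (simp only: sum.lessThan_Suc_shift)
 also have "\<dots> = rho x + g a - g 0" by (simp add: rho_def g_def)
 \<comment> \<open>The sum wraps around: the factor s ^ a = 2 cancels the halving of the norm by
   \<alpha> ^^ a.\<close>
 also have "g a = g 0"
  using Q.nrm_halving[OF al_pow_hom al_pow_bij f_half x] by (simp add: g_def s(2))
 finally show ?thesis using s(1) by (simp add: field_simps)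
qed

lemma nrm_le_rho: "x \<in> carrier G ==> Q.nrm x \<le> rho x"
 using member_le_sum[of 0 "{..<a}" "\<lambda>i. s ^ i * Q.nrm ((\<alpha> ^^ i) x)"] a_pos s(1) Q.nrm_nonneg by (simp add: rho_def)

lemma rho_nbhd:
 assumes W: "openin T W" "\<one> \<in> W"
 shows "\<exists>r>0. \<forall>x\<in>carrier G. rho x < r --> x \<in> W"
proof -
 obtain r where r: "r > 0" "\<forall>x\<in>carrier G. f x < r --> x \<in> W" using f_nbhd[OF W] by blast
 show ?thesis
 proof (intro exI[of _ "r / 2"] conjI ballI impI)
  fix x assume x: "x \<in> carrier G" "rho x < r / 2"
  then have "f x < r" using Q.f_le_nrm[OF x(1)] nrm_le_rho[OF x(1)] by linarith
  then show "x \<in> W" using r(2) x(1) by blast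
 qed (use r in simp)
qed

lemma nbhd_rho:
 assumes r: "0 < r"
 shows "\<exists>U. openin T U \<and> \<one> \<in> U \<and> (\<forall>x\<in>U. rho x < r)"
proof -
 have "0 < r / (2 * a)" using r a_pos by simp
 from nbhd_f[OF this] obtain U where U: "openin T U" "\<one> \<in> U" "\<forall>x\<in>U. f x < r / (2 * a)" by blast
 define U' where "U' = (\<Inter>i\<in>{..<a}. {x \<in> carrier G. (\<alpha> ^^ i) x \<in> U})"
 have o: "openin T {x \<in> carrier G. (\<alpha> ^^ i) x \<in> U}" for i
  using openin_continuous_map_preimage[OF al_pow_cont U(1)] by (simp add: topspace_eq_carrier)
 have "openin T U'" unfolding U'_def using a_pos o by (intro openin_Inter) auto
 moreover have "\<one> \<in> U'" using U(2) by (simp add: U'_def)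
 moreover have "rho x < r" if x: "x \<in> U'" for x
 proof -
  have "rho x < (\<Sum>i<a. r / a)" unfolding rho_def
  proof (rule sum_strict_mono)
   fix i assume i: "i \<in> {..<a}"
   have xi: "(\<alpha> ^^ i) x \<in> U" "x \<in> carrier G" using x i by (auto simp: U'_def)
   have "s ^ i \<le> 2" using power_increasing[of i a s] i s by simp
   moreover have "Q.nrm ((\<alpha> ^^ i) x) < r / (2 * a)" using Q.nrm_le_f[of "(\<alpha> ^^ i) x"] U(3) xi by force
   ultimately have "s ^ i * Q.nrm ((\<alpha> ^^ i) x) \<le> 2 * Q.nrm ((\<alpha> ^^ i) x)" "2 * Q.nrm ((\<alpha> ^^ i) x) < r / a"
    using Q.nrm_nonneg[of "(\<alpha> ^^ i) x"] xi by (auto intro: mult_right_mono simp: field_simps)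
   then show "s ^ i * Q.nrm ((\<alpha> ^^ i) x) < r / a" by linarith
  qed (use a_pos in auto)
  then show ?thesis using a_pos by simp
 qed
 ultimately show ?thesis by blast
qed

lemma open_iff: "openin T U \<longleftrightarrow> U \<subseteq> carrier G \<and> (\<forall>x\<in>U. \<exists>r>0. \<forall>y\<in>carrier G. rho (inv x \<otimes> y) < r --> y \<in> U)"
proof (intro iffI conjI ballI)
 assume U: "openin T U"
 then show "U \<subseteq> carrier G" using open_carrier by blast
 fix x assume x: "x \<in> U"
 have xc: "x \<in> carrier G" by (rule open_carrier[OF U x])
 have "\<one> \<in> {z \<in> carrier G. x \<otimes> z \<in> U}" using x xc by simp
 from rho_nbhd[OF open_translate[OF U xc] this]
 obtain r where r: "r > 0" "\<forall>z\<in>carrier G. rho z < r --> z \<in> {z \<in> carrier G. x \<otimes> z \<in> U}" by blast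
 have "y \<in> U" if y: "y \<in> carrier G" "rho (inv x \<otimes> y) < r" for y
 proof -
  have "x \<otimes> (inv x \<otimes> y) \<in> U" using r(2) y xc by simp
  then show ?thesis using xc y(1) by (simp add: m_assoc[symmetric])
 qed
 then show "\<exists>r>0. \<forall>y\<in>carrier G. rho (inv x \<otimes> y) < r --> y \<in> U" using r(1) by blast
next
 assume h: "U \<subseteq> carrier G \<and> (\<forall>x\<in>U. \<exists>r>0. \<forall>y\<in>carrier G. rho (inv x \<otimes> y) < r --> y \<in> U)"
 have "\<exists>O'. openin T O' \<and> x \<in> O' \<and> O' \<subseteq> U" if x: "x \<in> U" for x
 proof -
  have xc: "x \<in> carrier G" using h x by blast
  obtain r where r: "r > 0" "\<forall>y\<in>carrier G. rho (inv x \<otimes> y) < r --> y \<in> U" using h x by blast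
  obtain O' where O': "openin T O'" "\<one> \<in> O'" "\<forall>x\<in>O'. rho x < r" using nbhd_rho[OF r(1)] by blast
  show ?thesis
   by (intro exI[of _ "{y \<in> carrier G. inv x \<otimes> y \<in> O'}"] conjI open_translate[OF O'(1)]) (use xc O' r in auto)
 qed
 then show "openin T U" using openin_subopen by blast
qed

lemma rho_nonneg': "x \<in> carrier G ==> 0 \<le> rho x"
 using nrm_le_rho[of x] Q.nrm_nonneg[of x] by linarith

lemma rho_mult': "x \<in> carrier G ==> y \<in> carrier G ==> rho (x \<otimes> y) \<le> rho x + rho y"
 unfolding rho_def sum.distrib[symmetric] distrib_left[symmetric] using s(1) Q.nrm_mult
 by (intro sum_mono mult_left_mono) (auto simp: al_pow_mult)

lemma rho_inv': "x \<in> carrier G ==> rho (inv x) = rho x"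
 by (simp add: rho_def al_pow_inv Q.nrm_inv)

lemma rho_zero':
 assumes x: "x \<in> carrier G"
 shows "rho x = 0 \<longleftrightarrow> x = \<one>"
proof
 assume z: "rho x = 0"
 show "x = \<one>"
 proof (rule ccontr)
  assume ne: "x \<noteq> \<one>"
  then obtain W W' where W: "openin T W" "openin T W'" "\<one> \<in> W" "x \<in> W'" "disjnt W W'"
   using Hausdorff x unfolding Hausdorff_space_def topspace_eq_carrier by (metis one_closed)
  obtain r where "r > 0" "\<forall>x\<in>carrier G. rho x < r --> x \<in> W" using rho_nbhd[OF W(1,3)] by blast
  then have "x \<in> W" using x z by simp
  then show False using W by (auto simp: disjnt_iff)
 qed
qed (simp add: rho_def Q.nrm_one)

text \<open>One power of \<alpha> moves the bounded sequence into the compact set V. A cluster point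
  exists there, since otherwise finitely many balls, each met for finitely many indices only, would
  cover V. The subsequence is carried back by the inverse power, which multiplies distances by a
  constant.\<close>

lemma rho_compact':
 fixes u :: "nat => 'a"
 assumes u: "!!n. u n \<in> carrier G" "!!n. rho (u n) \<le> R"
 shows "\<exists>l\<in>carrier G. \<exists>r::nat => nat. strict_mono r \<and> (\<lambda>n. rho (inv l \<otimes> u (r n))) \<longlonglongrightarrow> 0"
proof -
 obtain k where k: "\<forall>x\<in>carrier G. f x < 2 * R + 1 --> pw k x \<in> V" using f_bounded by blast
 define w where "w n = pw k (u n)" for n
 have w: "w n \<in> V" for n
 proof -
  have "f (u n) < 2 * R + 1" using Q.f_le_nrm[OF u(1)[of n]] nrm_le_rho[OF u(1)[of n]] u(2)[of n] by linarith
  then show ?thesis using k u(1) by (simp add: w_def)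
 qed
 have "\<exists>l\<in>V. \<forall>e>0. infinite {n. rho (inv l \<otimes> w n) < e}"
 proof (rule ccontr)
  assume "\<not> ?thesis"
  then have "\<forall>l\<in>V. \<exists>e>0. finite {n. rho (inv l \<otimes> w n) < e}" by blast
  from bchoice[OF this] obtain e where e: "\<forall>l\<in>V. 0 < e l \<and> finite {n. rho (inv l \<otimes> w n) < e l}" by blast
  define D where "D l = {y \<in> carrier G. rho (inv l \<otimes> y) < e l}" for l
  have op: "openin T (D l)" if l: "l \<in> V" for l
   unfolding open_iff
  proof (intro conjI ballI)
   show "D l \<subseteq> carrier G" by (auto simp: D_def)
   fix x assume x: "x \<in> D l"
   have "y \<in> D l" if y: "y \<in> carrier G" "rho (inv x \<otimes> y) < e l - rho (inv l \<otimes> x)" for y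
   proof -
    have c: "l \<in> carrier G" "x \<in> carrier G" using l x by (auto simp: D_def)
    have "inv l \<otimes> y = (inv l \<otimes> x) \<otimes> (inv x \<otimes> y)" using c y(1) by (simp add: m_assoc) (simp add: m_assoc[symmetric])
    then have "rho (inv l \<otimes> y) \<le> rho (inv l \<otimes> x) + rho (inv x \<otimes> y)" using rho_mult'[of "inv l \<otimes> x" "inv x \<otimes> y"] c y(1) by simp
    then show ?thesis using y by (simp add: D_def)
   qed
   then show "\<exists>r>0. \<forall>y\<in>carrier G. rho (inv x \<otimes> y) < r --> y \<in> D l"
    using x by (intro exI[of _ "e l - rho (inv l \<otimes> x)"]) (auto simp: D_def)
  qed
  have self: "rho \<one> = 0" using rho_zero'[of \<one>] by simp
  have "\<exists>F. finite F \<and> F \<subseteq> D ` V \<and> V \<subseteq> \<Union>F"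
  proof (rule compactinD[OF V_compact])
   show "openin T X" if "X \<in> D ` V" for X using that op by blast
   show "V \<subseteq> \<Union>(D ` V)" using e self by (auto simp: D_def)
  qed
  then obtain F0 where F0: "finite F0" "F0 \<subseteq> D ` V" "V \<subseteq> \<Union>F0" by blast
  from finite_subset_image[OF F0(1,2)] obtain F where F: "F \<subseteq> V" "finite F" "F0 = D ` F" by blast
  have "UNIV = (\<Union>l\<in>F. {n. rho (inv l \<otimes> w n) < e l})"
  proof (intro equalityI subsetI)
   fix n :: nat
   obtain l where "l \<in> F" "w n \<in> D l" using F0(3) F(3) w[of n] by blast
   then show "n \<in> (\<Union>l\<in>F. {n. rho (inv l \<otimes> w n) < e l})" by (auto simp: D_def)
  qed simp
  moreover have "finite (\<Union>l\<in>F. {n. rho (inv l \<otimes> w n) < e l})" using F e by blast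
  ultimately show False using infinite_UNIV_nat by metis
 qed
 then obtain l where l: "l \<in> V" "\<forall>e>0. infinite {n. rho (inv l \<otimes> w n) < e}" by blast
 have "\<exists>r :: nat => nat. \<forall>n. rho (inv l \<otimes> w (r n)) < 1 / real (Suc n) \<and> r n < r (Suc n)"
 proof (rule dependent_nat_choice)
  have "infinite {n. rho (inv l \<otimes> w n) < 1 / real (Suc 0)}" using l(2) by simp
  then show "\<exists>x. rho (inv l \<otimes> w x) < 1 / real (Suc 0)" using not_finite_existsD by blast
  fix x n :: nat
  have "infinite {m. rho (inv l \<otimes> w m) < 1 / real (Suc (Suc n))}" using l(2) by simp
  then show "\<exists>y. rho (inv l \<otimes> w y) < 1 / real (Suc (Suc n)) \<and> x < y" unfolding infinite_nat_iff_unbounded by blast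
 qed
 then obtain r :: "nat => nat" where r: "!!n. rho (inv l \<otimes> w (r n)) < 1 / real (Suc n)" "!!n. r n < r (Suc n)" by blast
 obtain l' where l': "l' \<in> carrier G" "l = pw k l'"
  using al_pow_bij[of "a * k"] l(1) unfolding pw_def by (metis V_closed bij_betw_imp_surj_on imageE)
 have sc: "rho ((\<alpha> ^^ i) x) = (1 / s) ^ i * rho x" if "x \<in> carrier G" for x i
  using that by (induction i) (simp_all add: rho_alpha)
 have e: "rho (inv l' \<otimes> u (r n)) = s ^ (a * k) * rho (inv l \<otimes> w (r n))" for n
 proof -
  have "inv l \<otimes> w (r n) = (\<alpha> ^^ (a * k)) (inv l' \<otimes> u (r n))"
   using l' u(1) by (simp add: w_def pw_def al_pow_mult al_pow_inv)
  then show ?thesis using sc[of "inv l' \<otimes> u (r n)" "a * k"] l'(1) u(1) s(1) by (simp add: power_one_over)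
 qed
 have "(\<lambda>n. rho (inv l \<otimes> w (r n))) \<longlonglongrightarrow> 0"
 proof (rule tendsto_sandwich[OF _ _ tendsto_const LIMSEQ_inverse_real_of_nat])
  show "eventually (\<lambda>n. 0 \<le> rho (inv l \<otimes> w (r n))) sequentially" using l(1) w by (intro always_eventually allI rho_nonneg') auto
  show "eventually (\<lambda>n. rho (inv l \<otimes> w (r n)) \<le> inverse (real (Suc n))) sequentially"
   using less_imp_le[OF r(1)] by (intro always_eventually allI) (simp add: inverse_eq_divide)
 qed
 then have "(\<lambda>n. s ^ (a * k) * rho (inv l \<otimes> w (r n))) \<longlonglongrightarrow> s ^ (a * k) * 0" by (intro tendsto_mult_left)
 then have "(\<lambda>n. rho (inv l' \<otimes> u (r n))) \<longlonglongrightarrow> 0" unfolding e by simp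
 moreover have "strict_mono r" using r(2) by (simp add: strict_mono_Suc_iff)
 ultimately show ?thesis using l'(1) by blast
qed

lemma homogeneous: "homogeneous_group G \<alpha> rho (1 / s)"
proof (intro homogeneous_group.intro homogeneous_group_axioms.intro is_group)
 show "0 < 1 / s" "1 / s < 1" using s(1) by auto
 show "\<alpha> \<in> iso G G" by (rule automorphism)
 show "\<exists>d>0. \<forall>z\<in>carrier G. rho z < d --> rho (x \<otimes> z \<otimes> inv x) < e" if x: "x \<in> carrier G" and e: "0 < e" for x e
 proof -
  obtain U where U: "openin T U" "\<one> \<in> U" "\<forall>x\<in>U. rho x < e" using nbhd_rho[OF e] by blast
  have "x \<otimes> inv x \<in> U" using x U(2) by simp
  with nbhd_mult[OF U(1) x _ this] obtain A B where AB: "openin T A" "openin T B" "x \<in> A" "inv x \<in> B" "\<forall>u\<in>A. \<forall>v\<in>B. u \<otimes> v \<in> U"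
   using x by auto
  have "\<one> \<in> {z \<in> carrier G. x \<otimes> z \<in> A}" using x AB by simp
  from rho_nbhd[OF open_translate[OF AB(1) x] this] obtain d where d: "d > 0" "\<forall>z\<in>carrier G. rho z < d --> z \<in> {z \<in> carrier G. x \<otimes> z \<in> A}" by blast
  have "rho (x \<otimes> z \<otimes> inv x) < e" if "z \<in> carrier G" "rho z < d" for z
   using d(2) that AB(4,5) U(3) by blast
  then show ?thesis using d(1) by blast
 qed
 show "\<exists>l\<in>carrier G. \<exists>r::nat => nat. strict_mono r \<and> (\<lambda>n. rho (inv l \<otimes> u (r n))) \<longlonglongrightarrow> 0"
  if "!!n. u n \<in> carrier G" "!!n. rho (u n) \<le> R" for u :: "nat => 'a" and R
  by (rule rho_compact'[OF that])
qed (simp_all add: rho_zero' rho_inv' rho_mult' rho_alpha)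

end

section \<open>Passage between topologies and norms\<close>

theorem (in locally_compact_contraction_group) ex_homogeneous_norm:
 "\<exists>\<rho> \<theta>. homogeneous_group G \<alpha> \<rho> \<theta> \<and>
   (\<forall>U. openin T U \<longleftrightarrow> U \<subseteq> carrier G \<and> (\<forall>x\<in>U. \<exists>r>0. \<forall>y\<in>carrier G. \<rho> (inv x \<otimes> y) < r --> y \<in> U))"
proof -
 obtain V U0 a where V: "compactin T V \<and> openin T U0 \<and> \<one> \<in> U0 \<and> U0 \<subseteq> V \<and> (\<forall>x\<in>V. inv x \<in> V) \<and> 0 < a \<and>
   (\<forall>x\<in>V. \<forall>y\<in>V. \<forall>z\<in>V. (\<alpha> ^^ a) x \<otimes> (\<alpha> ^^ a) y \<otimes> (\<alpha> ^^ a) z \<in> V)" using ex_contracted_nbhd by (elim exE)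
 interpret C: contracted_nbhd G T \<alpha> V U0 a
  by (intro contracted_nbhd.intro contracted_nbhd_axioms.intro locally_compact_contraction_group_axioms) (use V in auto)
 show ?thesis using C.homogeneous C.open_iff by blast
qed

theorem theoremC:
 fixes G :: "('a, 'm) monoid_scheme" and S :: "'a topology" and \<alpha> :: "'a \<Rightarrow> 'a"
  and H :: "('b, 'n) monoid_scheme" and T :: "'b topology" and \<beta> :: "'b \<Rightarrow> 'b"
  and q :: "'a \<Rightarrow> 'b"
 assumes "locally_compact_contraction_group G S \<alpha>"
  and "locally_compact_contraction_group H T \<beta>"
  and "q \<in> hom G H"
  and "continuous_map S T q"
  and "q ` carrier G = carrier H"
  and "\<And>x. x \<in> carrier G \<Longrightarrow> \<beta> (q x) = q (\<alpha> x)"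
 shows "\<exists>\<sigma> :: 'b \<Rightarrow> 'a.
      continuous_map T S \<sigma> \<and>
      \<sigma> \<one>\<^bsub>H\<^esub> = \<one>\<^bsub>G\<^esub> \<and>
      (\<forall>y \<in> carrier H. q (\<sigma> y) = y) \<and>
      (\<forall>y \<in> carrier H. \<alpha> (\<sigma> y) = \<sigma> (\<beta> y))"
proof -
 interpret CG: locally_compact_contraction_group G S \<alpha> by (rule assms(1))
 interpret CH: locally_compact_contraction_group H T \<beta> by (rule assms(2))
 obtain \<rho> \<theta> where h1: "homogeneous_group G \<alpha> \<rho> \<theta>"
  and o1: "\<And>U. openin S U \<longleftrightarrow> U \<subseteq> carrier G \<and> (\<forall>x\<in>U. \<exists>r>0. \<forall>y\<in>carrier G. \<rho> (inv\<^bsub>G\<^esub> x \<otimes>\<^bsub>G\<^esub> y) < r \<longrightarrow> y \<in> U)"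
  using CG.ex_homogeneous_norm by blast
 obtain \<rho>' \<theta>' where h2: "homogeneous_group H \<beta> \<rho>' \<theta>'"
  and o2: "\<And>U. openin T U \<longleftrightarrow> U \<subseteq> carrier H \<and> (\<forall>x\<in>U. \<exists>r>0. \<forall>y\<in>carrier H. \<rho>' (inv\<^bsub>H\<^esub> x \<otimes>\<^bsub>H\<^esub> y) < r \<longrightarrow> y \<in> U)"
  using CH.ex_homogeneous_norm by blast
 interpret HG: homogeneous_group G \<alpha> \<rho> \<theta> by (rule h1)
 interpret HH: homogeneous_group H \<beta> \<rho>' \<theta>' by (rule h2)
 interpret K: homogeneous_hom G \<alpha> \<rho> \<theta> H \<beta> \<rho>' \<theta>' q
 proof (intro homogeneous_hom.intro homogeneous_hom_axioms.intro h1 h2 assms(3))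
  show "\<beta> (q x) = q (\<alpha> x)" if "x \<in> carrier G" for x by (rule assms(6)[OF that])
  fix e :: real assume e: "0 < e"
  \<comment> \<open>The norm ball of H is open by the triangle inequality; its preimage contains a
    norm ball of G, which is continuity of q at the identity in the form of the locale.\<close>
  let ?B = "{y \<in> carrier H. \<rho>' y < e}"
  have "openin T ?B"
   unfolding o2
  proof (intro conjI ballI)
   fix x assume x: "x \<in> ?B"
   have "\<rho>' y < e" if "y \<in> carrier H" "\<rho>' (inv\<^bsub>H\<^esub> x \<otimes>\<^bsub>H\<^esub> y) < e - \<rho>' x" for y
    using HH.rho_diff[of x y] x that by simp
   then show "\<exists>r>0. \<forall>y\<in>carrier H. \<rho>' (inv\<^bsub>H\<^esub> x \<otimes>\<^bsub>H\<^esub> y) < r \<longrightarrow> y \<in> ?B" using x by (intro exI[of _ "e - \<rho>' x"]) auto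
  qed auto
  from openin_continuous_map_preimage[OF assms(4) this]
  have op: "openin S {x \<in> carrier G. q x \<in> ?B}" by (simp only: CG.topspace_eq_carrier)
  have "\<one>\<^bsub>G\<^esub> \<in> {x \<in> carrier G. q x \<in> ?B}" using hom_one[OF assms(3) CG.is_group CH.is_group] e by simp
  then obtain r where r: "r > 0" "\<forall>y\<in>carrier G. \<rho> (inv\<^bsub>G\<^esub> \<one>\<^bsub>G\<^esub> \<otimes>\<^bsub>G\<^esub> y) < r \<longrightarrow> y \<in> {x \<in> carrier G. q x \<in> ?B}"
   using op[unfolded o1] by blast
  then show "\<exists>d>0. \<forall>x\<in>carrier G. \<rho> x < d \<longrightarrow> \<rho>' (q x) < e" by (intro exI[of _ r]) auto
 qed
 obtain s where s: "\<forall>y\<in>carrier H. s y \<in> carrier G \<and> q (s y) = y \<and> \<alpha> (s y) = s (\<beta> y)"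
  and c: "\<forall>y\<in>carrier H. \<forall>\<epsilon>>0. \<exists>\<delta>>0. \<forall>y'\<in>carrier H. \<rho>' (inv\<^bsub>H\<^esub> y \<otimes>\<^bsub>H\<^esub> y') < \<delta> \<longrightarrow> \<rho> (inv\<^bsub>G\<^esub> (s y) \<otimes>\<^bsub>G\<^esub> s y') < \<epsilon>"
  using K.equivariant_section[OF assms(5)] by (elim exE conjE)
 have s1: "s \<one>\<^bsub>H\<^esub> \<in> carrier G" "\<alpha> (s \<one>\<^bsub>H\<^esub>) = s \<one>\<^bsub>H\<^esub>" using s by auto
 \<comment> \<open>Equivariance makes the image of the identity a fixed point of \<alpha>, and a
   fixed point has norm 0 because \<theta> is less than 1.\<close>
 have "\<rho> (s \<one>\<^bsub>H\<^esub>) = \<theta> * \<rho> (s \<one>\<^bsub>H\<^esub>)" using HG.rho_alpha[OF s1(1)] unfolding s1(2) .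
 then have "\<rho> (s \<one>\<^bsub>H\<^esub>) = 0" using HG.theta by simp
 then have one: "s \<one>\<^bsub>H\<^esub> = \<one>\<^bsub>G\<^esub>" using HG.rho_zero_iff[OF s1(1)] by simp
 have "continuous_map T S s"
  unfolding continuous_map_def CG.topspace_eq_carrier CH.topspace_eq_carrier
 proof (intro conjI allI impI)
  show "s \<in> carrier H \<rightarrow> carrier G" using s by blast
  fix U assume "openin S U"
  note U = this[unfolded o1]
  show "openin T {x \<in> carrier H. s x \<in> U}"
   unfolding o2
  proof (intro conjI ballI)
   fix x assume x: "x \<in> {x \<in> carrier H. s x \<in> U}"
   then obtain r where r: "r > 0" "\<forall>y\<in>carrier G. \<rho> (inv\<^bsub>G\<^esub> (s x) \<otimes>\<^bsub>G\<^esub> y) < r \<longrightarrow> y \<in> U" using U by blast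
   obtain d where d: "d > 0" "\<forall>y\<in>carrier H. \<rho>' (inv\<^bsub>H\<^esub> x \<otimes>\<^bsub>H\<^esub> y) < d \<longrightarrow> \<rho> (inv\<^bsub>G\<^esub> (s x) \<otimes>\<^bsub>G\<^esub> s y) < r" using c x r(1) by blast
   show "\<exists>r>0. \<forall>y\<in>carrier H. \<rho>' (inv\<^bsub>H\<^esub> x \<otimes>\<^bsub>H\<^esub> y) < r \<longrightarrow> y \<in> {x \<in> carrier H. s x \<in> U}"
    using d r(2) s by (intro exI[of _ d]) blast
  qed auto
 qed
 then show ?thesis using one s by blast
qed

end
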